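(* Let $N\ge 3$ be odd, $1\le q\le N$, let $\Omega\subset\mathbb{R}^N$ be an exterior domain possessing the SMP, and let $\varepsilon$ (acting on $q$-forms) and $\mu$ (acting on $(q+1)$-forms) be $\tau$-$C^1$-admissible with $\tau>(N+1)/2$ and $\varepsilon_0=\mu_0=1$. Let $s\in(1/2,N/2)$, $t:=s-(N+1)/2$ and let $\hat\omega>0$ be an admissible frequency bound for $s$ (as defined in the context). Let $(\omega_n)_{n\in\mathbb{N}}\subset\mathbb{C}_{+,\hat\omega}\setminus\{0\}$ be a sequence tending to $0$ and let $\big((F_n,G_n)\big)_{n\in\mathbb{N}}\subset\mathbf{D}^q_s(\Omega)\times\mathring{\mathbf{R}}^{q+1}_s(\Omega)$ be such that, as $n\to\infty$, $$(F_n,G_n)\to(F,G)\ \text{ in } L^{2,q}_s(\Omega)\times L^{2,q+1}_s(\Omega),$$ $$-i\omega_n^{-1}(\operatorname{div}F_n,\operatorname{rot}G_n)\to(f,g)\ \text{ in } L^{2,q-1}_s(\Omega)\times L^{2,q+2}_s(\Omega),$$ $$-i\omega_n^{-1}\langle F_n,\mathring b^q_\ell\rangle_{L^{2,q}(\Omega)}\to\zeta_\ell\ \text{ in }\mathbb{C},\quad \ell=1,\dots,d^q,$$ $$-i\omega_n^{-1}\langle G_n,b^{q+1}_k\rangle_{L^{2,q+1}(\Omega)}\to\xi_k\ \text{ in }\mathbb{C},\quad k=1,\dots,d^{q+1}.$$ Then $\big((E_n,H_n)\big)_{n\in\mathbb{N}}:=\big(\mathcal{L}_{\omega_n}(F_n,G_n)\big)_{n\in\mathbb{N}}$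 converges for all $\tilde t<t$ in $$\big(\mathring{\mathbf{R}}^q_{\tilde t}(\Omega)\cap\varepsilon^{-1}\mathbf{D}^q_{\tilde t}(\Omega)\big)\times\big(\mu^{-1}\mathring{\mathbf{R}}^{q+1}_{\tilde t}(\Omega)\cap\mathbf{D}^{q+1}_{\tilde t}(\Omega)\big)$$ to $(E,H)$, the unique solution of the static problem $\mathrm{Max}(\Lambda,0,f,F,G,g,\zeta,\xi)$.
   Context: **General notation.** An exterior domain $\Omega\subset\mathbb{R}^N$ is a connected open set with compact complement. $r(x)=|x|$, $\rho=(1+r^2)^{1/2}$, $U_\varrho$ is the open ball of radius $\varrho$ about $0$, $A_\varrho=\mathbb{R}^N\setminus\overline{U_\varrho}$; $r_0>0$ is fixed with $\mathbb{R}^N\setminus\Omega\subset U_{r_0}$. Forms of rank $q$ ($q$-forms) are complex valued alternating differential forms $u=\sum_I u_I\,dx^I$ ($I$ ordered multi-indices of length $q$); forms of rank outside $\{0,\dots,N\}$ are zero. $\langle f,g\rangle_{L^{2,q}(\Omega)}=\int_\Omega\sum_I f_I\overline{g_I}\,dx$ (the same symbol is used for pairs of forms for which the integral exists). $\operatorname{rot}$ is the exterior derivative $d$; $\operatorname{div}=\delta=(-1)^{qN}*d*$ on $(q+1)$-forms is the codifferential, with sign such that $\langle\operatorname{rot}\Phi,\Psi\rangle=-\langle\Phi,\operatorname{div}\Psi\rangle$ for test forms; both are understood weakly. **Spaces.** For $s\in\mathbb{R}$: $L^{2,q}_s(\Omega)$ is the space of $q$-forms $u$ with $\rho^su\in L^{2,q}(\Omega)$.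 $\mathbf{R}^q_s(\Omega)=\{E\in L^{2,q}_s(\Omega):\operatorname{rot}E\in L^{2,q+1}_s(\Omega)\}$, $\mathbf{D}^q_s(\Omega)=\{H\in L^{2,q}_s(\Omega):\operatorname{div}H\in L^{2,q-1}_s(\Omega)\}$, with graph norms; $\mathring{\mathbf{R}}^q_s(\Omega)$ is the closure of the smooth compactly supported $q$-forms in $\Omega$ in $\mathbf{R}^q_s(\Omega)$. $\mathrm{R}^q_s(\Omega)$, $\mathring{\mathrm{R}}^q_s(\Omega)$, $\mathrm{D}^q_s(\Omega)$ are defined in the same way, but with $\operatorname{rot}E\in L^{2,q+1}_{s+1}(\Omega)$ resp. $\operatorname{div}H\in L^{2,q-1}_{s+1}(\Omega)$. A lower left index $0$ means vanishing rotation resp. divergence, e.g. ${}_0\mathring{\mathrm{R}}^q_s(\Omega)$, ${}_0\mathrm{D}^q_s(\Omega)$. The weight index is omitted if $s=0$ (e.g. $\mathring{\mathbf{R}}^q(\Omega)=\mathring{\mathbf{R}}^q_0(\Omega)$, ${}_0\mathrm{D}^q(\Omega)=\{H\in L^{2,q}(\Omega):\operatorname{div}H=0\}$). $V_{<s}=\bigcap_{t<s}V_t$, $V_{>s}=\bigcup_{t>s}V_t$. Index $\mathrm{loc}$: square-integrability (of the form and its rot resp. div) required on $\Omega\cap U_\varrho$ for every $\varrho$; $E\in\mathring{\mathrm{R}}^q_{\mathrm{loc}}(\Omega)$ means $\chi E\in\mathring{\mathbf{R}}^q(\Omega)$ for all $\chi\in C_0^\infty(\mathbb{R}^N)$. Index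 $\mathrm{vox}$: forms with bounded support. $\nu^{-1}V=\{E:\nu E\in V\}$ for a transformation $\nu$. **Transformations.** $\varepsilon$ is $\tau$-admissible if $\varepsilon(x)$ is linear on $q$-forms for each $x\in\Omega$, has $L^\infty(\Omega)$ matrix entries, is symmetric and uniformly positive definite with respect to $\langle\cdot,\cdot\rangle_{L^{2,q}(\Omega)}$, and $\varepsilon=\varepsilon_0\mathrm{Id}+\hat\varepsilon$ with $\varepsilon_0>0$, $\hat\varepsilon=O(r^{-\tau})$ as $r\to\infty$. It is $\tau$-$C^1$-admissible if moreover $\hat\varepsilon$ has $C^1(A_{r_0})$ entries with $\partial_n\hat\varepsilon=O(r^{-1-\tau})$, $n=1,\dots,N$. Same for $\mu$ on $(q+1)$-forms. Set $\Lambda(E,H)=(\varepsilon E,\mu H)$, $M(E,H)=(\operatorname{div}H,\operatorname{rot}E)$. **SMP.** $\Omega$ has the MLCP if $\mathring{\mathbf{R}}^q(\Omega)\cap\mathbf{D}^q(\Omega)\hookrightarrow L^{2,q}_{\mathrm{loc}}(\overline\Omega)$ is compact for all $q$. Let $\mathcal{H}^q(\Omega)={}_0\mathring{\mathrm{R}}^q(\Omega)\cap{}_0\mathrm{D}^q(\Omega)$ (square-integrable harmonic Dirichlet forms), $d^q=\dim\mathcal{H}^q(\Omega)<\infty$. $\Omega$ has the SMP (static Maxwell property) if it has the MLCP and there are finite sets $\mathring{B}^q(\Omega)=\{\mathring b^q_1,\dots,\mathring b^q_{d^q}\}\subset{}_0\mathring{\mathrm{R}}^q_{\mathrm{vox}}(\Omega)$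 and, for $q\ne1$, $B^q(\Omega)=\{b^q_1,\dots,b^q_{d^q}\}\subset{}_0\mathrm{D}^q_{\mathrm{vox}}(\Omega)$ with $\mathcal{H}^q(\Omega)\cap\mathring{B}^q(\Omega)^\perp=\{0\}$ and $\mathcal{H}^q(\Omega)\cap B^q(\Omega)^\perp=\{0\}$ ($\perp$ with respect to the $L^{2,q}(\Omega)$ pairing); such sets are fixed. **Time-harmonic problem.** $\mathbb{C}_+=\{z\in\mathbb{C}:\operatorname{Im}z\ge0\}$, $\mathbb{C}_{+,\gamma}=\{\omega\in\mathbb{C}_+:|\omega|\le\gamma\}$. Let $R=\sum_n x_n\,dx^n\wedge\cdot$ on $q$-forms, $T=(-1)^{qN}*R*$ on $(q+1)$-forms (the pointwise adjoint of $R$), $S(E,H)=(TH,RE)$. For $\omega\in\mathbb{C}\setminus\mathbb{R}$ and $(F,G)\in L^{2,q}(\Omega)\times L^{2,q+1}(\Omega)$, $(E,H)$ solves $\mathrm{Max}(\Lambda,\omega,F,G)$ iff $(E,H)\in\mathring{\mathbf{R}}^q(\Omega)\times\mathbf{D}^{q+1}(\Omega)$ and $(M+i\omega\Lambda)(E,H)=(F,G)$. For $\omega\in\mathbb{R}\setminus\{0\}$ and $(F,G)\in L^{2,q}_{\mathrm{loc}}(\Omega)\times L^{2,q+1}_{\mathrm{loc}}(\Omega)$, $(E,H)$ solves $\mathrm{Max}(\Lambda,\omega,F,G)$ iff $(E,H)\in\mathring{\mathbf{R}}^q_{<-1/2}(\Omega)\times\mathbf{D}^{q+1}_{<-1/2}(\Omega)$,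 $(M+i\omega\Lambda)(E,H)=(F,G)$ and $(r^{-1}S+\mathrm{Id})(E,H)\in L^{2,q}_{>-1/2}(\Omega)\times L^{2,q+1}_{>-1/2}(\Omega)$. $\mathbb{P}$ is the set of $\omega\in\mathbb{C}\setminus\{0\}$ for which $\mathrm{Max}(\Lambda,\omega,0,0)$ has a nontrivial solution. For $\omega\in\mathbb{C}_+\setminus(\{0\}\cup\mathbb{P})$ and $(F,G)\in L^{2,q}_{>1/2}(\Omega)\times L^{2,q+1}_{>1/2}(\Omega)$, $\mathcal{L}_\omega(F,G)$ denotes the unique solution of $\mathrm{Max}(\Lambda,\omega,F,G)$. **Admissible frequency bound.** $\hat\omega>0$ is an admissible frequency bound for $s\in(1/2,N/2)$ if $\mathbb{P}\cap\mathbb{C}_{+,\hat\omega}=\emptyset$ and there is $c>0$ such that, with $t=s-(N+1)/2$, for all $\omega\in\mathbb{C}_{+,\hat\omega}\setminus\{0\}$ and $(F,G)\in\mathbf{D}^q_s(\Omega)\times\mathring{\mathbf{R}}^{q+1}_s(\Omega)$ the norm of $\mathcal{L}_\omega(F,G)$ in $(\mathring{\mathbf{R}}^q_t(\Omega)\cap\varepsilon^{-1}\mathbf{D}^q_t(\Omega))\times(\mu^{-1}\mathring{\mathbf{R}}^{q+1}_t(\Omega)\cap\mathbf{D}^{q+1}_t(\Omega))$ is at most $c\big(\|(F,G)\|_{L^{2,q}_s\times L^{2,q+1}_s}+|\omega|^{-1}\|(\operatorname{div}F,\operatorname{rot}G)\|_{L^{2,q-1}_s\times L^{2,q+2}_s}+|\omega|^{-1}\sum_\ell|\langle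 F,\mathring b^q_\ell\rangle|+|\omega|^{-1}\sum_\ell|\langle G,b^{q+1}_\ell\rangle|\big)$. Such $\hat\omega$ exists for every $s\in(1/2,N/2)$. **Static problem.** $(E,H)$ solves $\mathrm{Max}(\Lambda,0,f,F,G,g,\zeta,\xi)$ with $(f,F,G,g)$ locally square-integrable forms of rank $q-1,q,q+1,q+2$ and $(\zeta,\xi)\in\mathbb{C}^{d^q}\times\mathbb{C}^{d^{q+1}}$ iff $E\in L^{2,q}_{>-N/2}(\Omega)\cap\mathring{\mathrm{R}}^q_{\mathrm{loc}}(\Omega)\cap\varepsilon^{-1}\mathrm{D}^q_{\mathrm{loc}}(\Omega)$, $H\in L^{2,q+1}_{>-N/2}(\Omega)\cap\mu^{-1}\mathring{\mathrm{R}}^{q+1}_{\mathrm{loc}}(\Omega)\cap\mathrm{D}^{q+1}_{\mathrm{loc}}(\Omega)$ and $\operatorname{rot}E=G$, $\operatorname{div}\varepsilon E=f$, $\langle\varepsilon E,\mathring b^q_\ell\rangle_{L^{2,q}(\Omega)}=\zeta_\ell$ ($\ell=1,\dots,d^q$), $\operatorname{div}H=F$, $\operatorname{rot}\mu H=g$, $\langle\mu H,b^{q+1}_k\rangle_{L^{2,q+1}(\Omega)}=\xi_k$ ($k=1,\dots,d^{q+1}$). *)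

theory Defs
  imports "HOL-Analysis.Analysis"
begin

section \<open>Alternating forms\<close>

text \<open>
  The complexified exterior algebra of \<open>\<real>\<^sup>N\<close>, \<open>N = CARD('n)\<close>, is \<open>complex ^ ('n set)\<close>: the component
  \<open>v $ I\<close> is the coefficient of \<open>dx\<^sup>I\<close>, where \<open>I\<close> is listed in the increasing order given by the
  linear order on \<open>'n\<close>. Ranks are integers, so that forms of rank outside \<open>{0..N}\<close> vanish.
  A form on \<open>\<Omega>\<close> is a function of which only the values on \<open>\<Omega>\<close> matter; as usual for
  Lebesgue spaces, two forms are identified if they agree almost everywhere on \<open>\<Omega>\<close>. We work with
  representatives and spell the identification out wherever equality of forms is asserted.
\<close>

type_synonym 'n alg = "complex ^ ('n set)"
type_synonym 'n form = "real ^ 'n \<Rightarrow> 'n alg"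
type_synonym 'n transf = "real ^ 'n \<Rightarrow> complex ^ ('n set) ^ ('n set)"

definition alt :: "int \<Rightarrow> ('n::finite) alg set" where
  "alt q = {v. \<forall>I. int (card I) \<noteq> q \<longrightarrow> v $ I = 0}"

definition hinner :: "('n::finite) alg \<Rightarrow> 'n alg \<Rightarrow> complex" where
  "hinner u v = (\<Sum>I\<in>UNIV. u $ I * cnj (v $ I))"

text \<open>\<open>dx\<^sup>n \<and> v\<close>\<close>

definition wedge1 :: "'n \<Rightarrow> ('n::{finite,linorder}) alg \<Rightarrow> 'n alg" where
  "wedge1 n v = (\<chi> K. if n \<in> K then (-1) ^ card {m \<in> K. m < n} * v $ (K - {n}) else 0)"

text \<open>
  Hodge star: \<open>* dx\<^sup>I = \<sigma>(I) dx\<close> with upper index the complement of \<open>I\<close>, where \<open>\<sigma>(I)\<close> is the sign of the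
  permutation listing first \<open>I\<close> and then its complement, each in increasing order. It is extended
  complex linearly.
\<close>

definition star_sign :: "('n::{finite,linorder}) set \<Rightarrow> complex" where
  "star_sign I = (-1) ^ card {(i, j). i \<in> I \<and> j \<notin> I \<and> j < i}"

definition hodge :: "('n::{finite,linorder}) alg \<Rightarrow> 'n alg" where
  "hodge v = (\<chi> K. star_sign (- K) * v $ (- K))"

definition codiff_sign :: "'n::finite itself \<Rightarrow> int \<Rightarrow> complex" where
  "codiff_sign _ q = (-1) powi (q * int CARD('n))"

text \<open>\<open>R\<close> on forms of any rank, and \<open>T = (-1)\<^sup>q\<^sup>N * R *\<close> on \<open>(q+1)\<close>-forms, at the point \<open>x\<close>\<close>

definition R_op :: "real ^ 'n::{finite,linorder} \<Rightarrow> 'n alg \<Rightarrow> 'n alg" where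
  "R_op x v = (\<Sum>n\<in>UNIV. (x $ n) *\<^sub>R wedge1 n v)"

definition T_op :: "int \<Rightarrow> real ^ 'n::{finite,linorder} \<Rightarrow> 'n alg \<Rightarrow> 'n alg" where
  "T_op q x v = codiff_sign TYPE('n) q *s hodge (R_op x (hodge v))"


section \<open>Smooth forms and classical derivatives\<close>

definition partial_deriv :: "'n \<Rightarrow> (real ^ 'n::finite \<Rightarrow> 'b::real_normed_vector) \<Rightarrow> real ^ 'n \<Rightarrow> 'b" where
  "partial_deriv n f x = frechet_derivative f (at x) (axis n 1)"

text \<open>\<open>Ck_on k S f\<close> is meant for open \<open>S\<close>.\<close>

primrec Ck_on :: "nat \<Rightarrow> (real ^ 'n::finite) set \<Rightarrow> (real ^ 'n \<Rightarrow> 'b::real_normed_vector) \<Rightarrow> bool" where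
  "Ck_on 0 S f = continuous_on S f"
| "Ck_on (Suc k) S f =
     ((\<forall>x\<in>S. f differentiable (at x)) \<and> (\<forall>n. Ck_on k S (partial_deriv n f)))"

text \<open>Functions in \<open>C\<^sub>0\<^sup>\<infinity>(\<Omega>)\<close>, extended by zero\<close>

definition C0_inf :: "(real ^ 'n::finite) set \<Rightarrow> (real ^ 'n \<Rightarrow> 'b::real_normed_vector) set" where
  "C0_inf \<Omega> = {f. (\<forall>k. Ck_on k UNIV f) \<and>
                  (\<exists>K. compact K \<and> K \<subseteq> \<Omega> \<and> (\<forall>x. x \<notin> K \<longrightarrow> f x = 0))}"

definition test_forms :: "(real ^ 'n) set \<Rightarrow> int \<Rightarrow> ('n::finite) form set" where
  "test_forms \<Omega> q = {\<Phi> \<in> C0_inf \<Omega>. \<forall>x. \<Phi> x \<in> alt q}"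

definition ext_d :: "('n::{finite,linorder}) form \<Rightarrow> 'n form" where
  "ext_d \<Phi> x = (\<Sum>n\<in>UNIV. wedge1 n (partial_deriv n \<Phi> x))"

text \<open>\<open>co_d q = (-1)\<^sup>q\<^sup>N * d *\<close> acts on \<open>(q+1)\<close>-forms.\<close>

definition co_d :: "int \<Rightarrow> ('n::{finite,linorder}) form \<Rightarrow> 'n form" where
  "co_d q \<Psi> x = codiff_sign TYPE('n) q *s hodge (ext_d (\<lambda>y. hodge (\<Psi> y)) x)"


section \<open>Weighted Lebesgue spaces\<close>

definition rho :: "real ^ 'n::finite \<Rightarrow> real" where
  "rho x = sqrt (1 + (norm x)\<^sup>2)"

definition L2 :: "(real ^ 'n) set \<Rightarrow> int \<Rightarrow> ('n::finite) form set" where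
  "L2 \<Omega> q = {u. u \<in> borel_measurable (lebesgue_on \<Omega>) \<and> (\<forall>x\<in>\<Omega>. u x \<in> alt q) \<and>
                integrable (lebesgue_on \<Omega>) (\<lambda>x. (norm (u x))\<^sup>2)}"

definition L2_norm :: "(real ^ 'n) set \<Rightarrow> ('n::finite) form \<Rightarrow> real" where
  "L2_norm \<Omega> u = sqrt (integral\<^sup>L (lebesgue_on \<Omega>) (\<lambda>x. (norm (u x))\<^sup>2))"

definition L2_pair :: "(real ^ 'n) set \<Rightarrow> ('n::finite) form \<Rightarrow> 'n form \<Rightarrow> complex" where
  "L2_pair \<Omega> u v = integral\<^sup>L (lebesgue_on \<Omega>) (\<lambda>x. hinner (u x) (v x))"

definition L2w :: "(real ^ 'n) set \<Rightarrow> int \<Rightarrow> real \<Rightarrow> ('n::finite) form set" where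
  "L2w \<Omega> q s = {u. (\<lambda>x. (rho x powr s) *\<^sub>R u x) \<in> L2 \<Omega> q}"

definition L2w_norm :: "(real ^ 'n) set \<Rightarrow> real \<Rightarrow> ('n::finite) form \<Rightarrow> real" where
  "L2w_norm \<Omega> s u = L2_norm \<Omega> (\<lambda>x. (rho x powr s) *\<^sub>R u x)"

text \<open>Square integrable up to the boundary of \<open>\<Omega>\<close>, but not at infinity\<close>

definition L2loc :: "(real ^ 'n) set \<Rightarrow> int \<Rightarrow> ('n::finite) form set" where
  "L2loc \<Omega> q = {u. \<forall>R>0. u \<in> L2 (\<Omega> \<inter> ball 0 R) q}"

definition ae_eq :: "(real ^ 'n) set \<Rightarrow> ('n::finite) form \<Rightarrow> 'n form \<Rightarrow> bool" where
  "ae_eq \<Omega> u v \<longleftrightarrow> (AE x in lebesgue_on \<Omega>. u x = v x)"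

definition bounded_support :: "(real ^ 'n) set \<Rightarrow> ('n::finite) form \<Rightarrow> bool" where
  "bounded_support \<Omega> u \<longleftrightarrow> (\<exists>R. AE x in lebesgue_on \<Omega>. norm x > R \<longrightarrow> u x = 0)"


section \<open>Weak rotation and divergence\<close>

text \<open>For a \<open>q\<close>-form \<open>E\<close> and a \<open>(q+1)\<close>-form \<open>G\<close>: \<open>rot E = G\<close> weakly in \<open>\<Omega>\<close>\<close>

definition has_rot :: "(real ^ 'n::{finite,linorder}) set \<Rightarrow> int \<Rightarrow> 'n form \<Rightarrow> 'n form \<Rightarrow> bool" where
  "has_rot \<Omega> q E G \<longleftrightarrow> E \<in> L2loc \<Omega> q \<and> G \<in> L2loc \<Omega> (q + 1) \<and>
     (\<forall>\<Psi>\<in>test_forms \<Omega> (q + 1). L2_pair \<Omega> E (co_d q \<Psi>) = - L2_pair \<Omega> G \<Psi>)"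

text \<open>For a \<open>q\<close>-form \<open>H\<close> and a \<open>(q-1)\<close>-form \<open>F\<close>: \<open>div H = F\<close> weakly in \<open>\<Omega>\<close>\<close>

definition has_div :: "(real ^ 'n::{finite,linorder}) set \<Rightarrow> int \<Rightarrow> 'n form \<Rightarrow> 'n form \<Rightarrow> bool" where
  "has_div \<Omega> q H F \<longleftrightarrow> H \<in> L2loc \<Omega> q \<and> F \<in> L2loc \<Omega> (q - 1) \<and>
     (\<forall>\<Phi>\<in>test_forms \<Omega> (q - 1). L2_pair \<Omega> H (ext_d \<Phi>) = - L2_pair \<Omega> F \<Phi>)"

text \<open>
  Weak derivatives are unique up to null sets; \<open>wrot\<close> and \<open>wdiv\<close> choose a representative and are
  used only for forms that possess a weak derivative.
\<close>

definition wrot :: "(real ^ 'n::{finite,linorder}) set \<Rightarrow> int \<Rightarrow> 'n form \<Rightarrow> 'n form" where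
  "wrot \<Omega> q E = (SOME G. has_rot \<Omega> q E G)"

definition wdiv :: "(real ^ 'n::{finite,linorder}) set \<Rightarrow> int \<Rightarrow> 'n form \<Rightarrow> 'n form" where
  "wdiv \<Omega> q H = (SOME F. has_div \<Omega> q H F)"

text \<open>
  The weight \<open>s\<close> is imposed on the form and the weight \<open>s'\<close> on its derivative: the spaces with bold
  letters are those with \<open>s' = s\<close>, the ones with roman letters those with \<open>s' = s + 1\<close>.
\<close>

definition rot_space ::
  "(real ^ 'n::{finite,linorder}) set \<Rightarrow> int \<Rightarrow> real \<Rightarrow> real \<Rightarrow> 'n form set" where
  "rot_space \<Omega> q s s' = {E \<in> L2w \<Omega> q s. \<exists>G\<in>L2w \<Omega> (q + 1) s'. has_rot \<Omega> q E G}"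

definition rot_norm ::
  "(real ^ 'n::{finite,linorder}) set \<Rightarrow> int \<Rightarrow> real \<Rightarrow> real \<Rightarrow> 'n form \<Rightarrow> real" where
  "rot_norm \<Omega> q s s' E = sqrt ((L2w_norm \<Omega> s E)\<^sup>2 + (L2w_norm \<Omega> s' (wrot \<Omega> q E))\<^sup>2)"

definition div_space ::
  "(real ^ 'n::{finite,linorder}) set \<Rightarrow> int \<Rightarrow> real \<Rightarrow> real \<Rightarrow> 'n form set" where
  "div_space \<Omega> q s s' = {H \<in> L2w \<Omega> q s. \<exists>F\<in>L2w \<Omega> (q - 1) s'. has_div \<Omega> q H F}"

definition div_norm ::
  "(real ^ 'n::{finite,linorder}) set \<Rightarrow> int \<Rightarrow> real \<Rightarrow> real \<Rightarrow> 'n form \<Rightarrow> real" where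
  "div_norm \<Omega> q s s' H = sqrt ((L2w_norm \<Omega> s H)\<^sup>2 + (L2w_norm \<Omega> s' (wdiv \<Omega> q H))\<^sup>2)"

definition rot0_space ::
  "(real ^ 'n::{finite,linorder}) set \<Rightarrow> int \<Rightarrow> real \<Rightarrow> real \<Rightarrow> 'n form set" where
  "rot0_space \<Omega> q s s' =
     {E \<in> rot_space \<Omega> q s s'. \<forall>e>0. \<exists>\<Phi>\<in>test_forms \<Omega> q. rot_norm \<Omega> q s s' (\<lambda>x. E x - \<Phi> x) < e}"

abbreviation bold_R0 ::
  "(real ^ 'n::{finite,linorder}) set \<Rightarrow> int \<Rightarrow> real \<Rightarrow> 'n form set" where
  "bold_R0 \<Omega> q s \<equiv> rot0_space \<Omega> q s s"

abbreviation bold_D ::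
  "(real ^ 'n::{finite,linorder}) set \<Rightarrow> int \<Rightarrow> real \<Rightarrow> 'n form set" where
  "bold_D \<Omega> q s \<equiv> div_space \<Omega> q s s"

abbreviation roman_R0 ::
  "(real ^ 'n::{finite,linorder}) set \<Rightarrow> int \<Rightarrow> real \<Rightarrow> 'n form set" where
  "roman_R0 \<Omega> q s \<equiv> rot0_space \<Omega> q s (s + 1)"

abbreviation roman_D ::
  "(real ^ 'n::{finite,linorder}) set \<Rightarrow> int \<Rightarrow> real \<Rightarrow> 'n form set" where
  "roman_D \<Omega> q s \<equiv> div_space \<Omega> q s (s + 1)"

definition ker_R0 :: "(real ^ 'n::{finite,linorder}) set \<Rightarrow> int \<Rightarrow> 'n form set" where
  "ker_R0 \<Omega> q = {E \<in> roman_R0 \<Omega> q 0. has_rot \<Omega> q E (\<lambda>_. 0)}"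

definition ker_D :: "(real ^ 'n::{finite,linorder}) set \<Rightarrow> int \<Rightarrow> 'n form set" where
  "ker_D \<Omega> q = {H \<in> roman_D \<Omega> q 0. has_div \<Omega> q H (\<lambda>_. 0)}"

definition R0_loc :: "(real ^ 'n::{finite,linorder}) set \<Rightarrow> int \<Rightarrow> 'n form set" where
  "R0_loc \<Omega> q =
     {E. \<forall>\<phi>::real ^ ('n::{finite,linorder}) \<Rightarrow> real. \<phi> \<in> C0_inf UNIV \<longrightarrow>
       (\<lambda>x. \<phi> x *\<^sub>R E x) \<in> bold_R0 \<Omega> q 0}"

definition D_loc :: "(real ^ 'n::{finite,linorder}) set \<Rightarrow> int \<Rightarrow> 'n form set" where
  "D_loc \<Omega> q = {H. \<exists>F. has_div \<Omega> q H F}"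


section \<open>Exterior domains and the static Maxwell property\<close>

definition exterior_domain :: "(real ^ 'n::finite) set \<Rightarrow> bool" where
  "exterior_domain \<Omega> \<longleftrightarrow> open \<Omega> \<and> connected \<Omega> \<and> compact (- \<Omega>)"

text \<open>
  Compactness of the embedding into the metrizable space \<open>L2loc\<close>: every bounded sequence has a
  subsequence converging in \<open>L2 (\<Omega> \<inter> ball 0 R)\<close> for all \<open>R\<close>.
\<close>

definition MLCP :: "(real ^ 'n::{finite,linorder}) set \<Rightarrow> bool" where
  "MLCP \<Omega> \<longleftrightarrow> (\<forall>q. \<forall>u :: nat \<Rightarrow> 'n form.
     (\<forall>n. u n \<in> bold_R0 \<Omega> q 0 \<inter> bold_D \<Omega> q 0) \<and>
     (\<exists>C. \<forall>n. rot_norm \<Omega> q 0 0 (u n) \<le> C \<and> div_norm \<Omega> q 0 0 (u n) \<le> C) \<longrightarrow>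
     (\<exists>r v. strict_mono r \<and> v \<in> L2loc \<Omega> q \<and>
        (\<forall>R>0. (\<lambda>k. L2_norm (\<Omega> \<inter> ball 0 R) (\<lambda>x. u (r k) x - v x)) \<longlonglongrightarrow> 0)))"

definition harmonic :: "(real ^ 'n::{finite,linorder}) set \<Rightarrow> int \<Rightarrow> 'n form set" where
  "harmonic \<Omega> q = ker_R0 \<Omega> q \<inter> ker_D \<Omega> q"

text \<open>
  Complex dimension of a space of forms, after identification of forms agreeing almost everywhere:
  \<open>h 0, \<dots>, h (d - 1)\<close> is a basis.
\<close>

definition has_dim :: "(real ^ 'n) set \<Rightarrow> ('n::finite) form set \<Rightarrow> nat \<Rightarrow> bool" where
  "has_dim \<Omega> V d \<longleftrightarrow> (\<exists>h :: nat \<Rightarrow> 'n form.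
     (\<forall>l<d. h l \<in> V) \<and>
     (\<forall>c. ae_eq \<Omega> (\<lambda>x. \<Sum>l<d. c l *s h l x) (\<lambda>_. 0) \<longrightarrow> (\<forall>l<d. c l = 0)) \<and>
     (\<forall>u\<in>V. \<exists>c. ae_eq \<Omega> u (\<lambda>x. \<Sum>l<d. c l *s h l x)))"

text \<open>
  The static Maxwell property, with the fixed choices of the sets as data: \<open>d q\<close> is the dimension of
  the harmonic Dirichlet forms, and \<open>b0 q l\<close> and \<open>b q l\<close>, \<open>l < d q\<close>, enumerate the two sets of forms
  with bounded support.
\<close>

definition SMP_data ::
  "(real ^ 'n::{finite,linorder}) set \<Rightarrow> (int \<Rightarrow> nat) \<Rightarrow> (int \<Rightarrow> nat \<Rightarrow> 'n form) \<Rightarrow>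
    (int \<Rightarrow> nat \<Rightarrow> 'n form) \<Rightarrow> bool" where
  "SMP_data \<Omega> d b0 b \<longleftrightarrow> MLCP \<Omega> \<and>
     (\<forall>q. has_dim \<Omega> (harmonic \<Omega> q) (d q)) \<and>
     (\<forall>q. (\<forall>l<d q. b0 q l \<in> ker_R0 \<Omega> q \<and> bounded_support \<Omega> (b0 q l)) \<and>
        (\<forall>u\<in>harmonic \<Omega> q. (\<forall>l<d q. L2_pair \<Omega> u (b0 q l) = 0) \<longrightarrow> ae_eq \<Omega> u (\<lambda>_. 0))) \<and>
     (\<forall>q. q \<noteq> 1 \<longrightarrow> (\<forall>l<d q. b q l \<in> ker_D \<Omega> q \<and> bounded_support \<Omega> (b q l)) \<and>
        (\<forall>u\<in>harmonic \<Omega> q. (\<forall>l<d q. L2_pair \<Omega> u (b q l) = 0) \<longrightarrow> ae_eq \<Omega> u (\<lambda>_. 0)))"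


section \<open>Admissible transformations\<close>

definition app :: "('n::finite) transf \<Rightarrow> 'n form \<Rightarrow> 'n form" where
  "app \<epsilon> u = (\<lambda>x. \<epsilon> x *v u x)"

definition pert :: "('n::finite) transf \<Rightarrow> real \<Rightarrow> 'n transf" where
  "pert \<epsilon> e0 x = \<epsilon> x - mat (complex_of_real e0)"

text \<open>
  A transformation is given by full matrices on the exterior algebra; a transformation on \<open>q\<close>-forms
  preserves \<open>alt q\<close>, and only its entries with indices of length \<open>q\<close> are relevant.
\<close>

definition admissible ::
  "(real ^ 'n) set \<Rightarrow> int \<Rightarrow> real \<Rightarrow> real \<Rightarrow> ('n::finite) transf \<Rightarrow> bool" where
  "admissible \<Omega> q \<tau> e0 \<epsilon> \<longleftrightarrow>
     (\<forall>x\<in>\<Omega>. \<forall>v\<in>alt q. \<epsilon> x *v v \<in> alt q) \<and>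
     (\<forall>I J. int (card I) = q \<and> int (card J) = q \<longrightarrow>
        (\<lambda>x. \<epsilon> x $ I $ J) \<in> borel_measurable (lebesgue_on \<Omega>) \<and>
        (\<exists>C. AE x in lebesgue_on \<Omega>. cmod (\<epsilon> x $ I $ J) \<le> C)) \<and>
     (\<forall>u\<in>L2 \<Omega> q. \<forall>v\<in>L2 \<Omega> q. L2_pair \<Omega> (app \<epsilon> u) v = L2_pair \<Omega> u (app \<epsilon> v)) \<and>
     (\<exists>c>0. \<forall>u\<in>L2 \<Omega> q. Re (L2_pair \<Omega> (app \<epsilon> u) u) \<ge> c * (L2_norm \<Omega> u)\<^sup>2) \<and>
     e0 > 0 \<and>
     (\<forall>I J. int (card I) = q \<and> int (card J) = q \<longrightarrow>
        (\<exists>C R. AE x in lebesgue_on \<Omega>. norm x \<ge> R \<longrightarrow>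
           cmod (pert \<epsilon> e0 x $ I $ J) \<le> C * norm x powr (- \<tau>)))"

definition C1_admissible ::
  "(real ^ 'n) set \<Rightarrow> real \<Rightarrow> int \<Rightarrow> real \<Rightarrow> real \<Rightarrow> ('n::finite) transf \<Rightarrow> bool" where
  "C1_admissible \<Omega> r0 q \<tau> e0 \<epsilon> \<longleftrightarrow> admissible \<Omega> q \<tau> e0 \<epsilon> \<and>
     (\<forall>I J. int (card I) = q \<and> int (card J) = q \<longrightarrow>
        Ck_on 1 (- closure (ball 0 r0)) (\<lambda>x. pert \<epsilon> e0 x $ I $ J) \<and>
        (\<forall>n. \<exists>C R. \<forall>x\<in>- closure (ball 0 r0). norm x \<ge> R \<longrightarrow>
           cmod (partial_deriv n (\<lambda>y. pert \<epsilon> e0 y $ I $ J) x) \<le> C * norm x powr (- 1 - \<tau>)))"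


section \<open>The time-harmonic problem\<close>

definition maxwell ::
  "(real ^ 'n::{finite,linorder}) set \<Rightarrow> int \<Rightarrow> 'n transf \<Rightarrow> 'n transf \<Rightarrow> complex \<Rightarrow> 'n form \<Rightarrow> 'n form \<Rightarrow>
    'n form \<Rightarrow> 'n form \<Rightarrow> bool" where
  "maxwell \<Omega> q \<epsilon> \<mu> \<omega> F G E H \<longleftrightarrow>
     (if \<omega> \<notin> \<real>
      then F \<in> L2 \<Omega> q \<and> G \<in> L2 \<Omega> (q + 1) \<and> E \<in> bold_R0 \<Omega> q 0 \<and> H \<in> bold_D \<Omega> (q + 1) 0
      else \<omega> \<noteq> 0 \<and> F \<in> L2loc \<Omega> q \<and> G \<in> L2loc \<Omega> (q + 1) \<and>
        (\<forall>t < - 1/2. E \<in> bold_R0 \<Omega> q t \<and> H \<in> bold_D \<Omega> (q + 1) t) \<and>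
        (\<exists>t > - 1/2. (\<lambda>x. (1 / norm x) *\<^sub>R T_op q x (H x) + E x) \<in> L2w \<Omega> q t \<and>
                     (\<lambda>x. (1 / norm x) *\<^sub>R R_op x (E x) + H x) \<in> L2w \<Omega> (q + 1) t)) \<and>
     ae_eq \<Omega> (\<lambda>x. wdiv \<Omega> (q + 1) H x + (\<i> * \<omega>) *s app \<epsilon> E x) F \<and>
     ae_eq \<Omega> (\<lambda>x. wrot \<Omega> q E x + (\<i> * \<omega>) *s app \<mu> H x) G"

definition sing_freqs ::
  "(real ^ 'n::{finite,linorder}) set \<Rightarrow> int \<Rightarrow> 'n transf \<Rightarrow> 'n transf \<Rightarrow> complex set" where
  "sing_freqs \<Omega> q \<epsilon> \<mu> = {\<omega>. \<omega> \<noteq> 0 \<and>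
     (\<exists>E H. maxwell \<Omega> q \<epsilon> \<mu> \<omega> (\<lambda>_. 0) (\<lambda>_. 0) E H \<and>
            \<not> (ae_eq \<Omega> E (\<lambda>_. 0) \<and> ae_eq \<Omega> H (\<lambda>_. 0)))}"

text \<open>
  \<open>(E, H)\<close> is the unique solution (up to null sets) of the time-harmonic problem, that is, it
  represents \<open>\<L>\<^sub>\<omega>(F, G)\<close>. The solution operator is rendered as a relation because forms are
  identified almost everywhere.
\<close>

definition is_sol_op ::
  "(real ^ 'n::{finite,linorder}) set \<Rightarrow> int \<Rightarrow> 'n transf \<Rightarrow> 'n transf \<Rightarrow> complex \<Rightarrow> 'n form \<Rightarrow> 'n form \<Rightarrow>
    'n form \<Rightarrow> 'n form \<Rightarrow> bool" where
  "is_sol_op \<Omega> q \<epsilon> \<mu> \<omega> F G E H \<longleftrightarrow> maxwell \<Omega> q \<epsilon> \<mu> \<omega> F G E H \<and>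
     (\<forall>E' H'. maxwell \<Omega> q \<epsilon> \<mu> \<omega> F G E' H' \<longrightarrow> ae_eq \<Omega> E' E \<and> ae_eq \<Omega> H' H)"

definition upper_disc :: "real \<Rightarrow> complex set" where
  "upper_disc \<gamma> = {\<omega>. Im \<omega> \<ge> 0 \<and> cmod \<omega> \<le> \<gamma>}"

text \<open>
  The spaces in which solutions are measured, with graph norms. Norms of intersections and of
  products are taken as sums.
\<close>

definition sol_space ::
  "(real ^ 'n::{finite,linorder}) set \<Rightarrow> int \<Rightarrow> 'n transf \<Rightarrow> 'n transf \<Rightarrow> real \<Rightarrow>
    ('n form \<times> 'n form) set" where
  "sol_space \<Omega> q \<epsilon> \<mu> t = {(E, H).
     E \<in> bold_R0 \<Omega> q t \<and> app \<epsilon> E \<in> bold_D \<Omega> q t \<and>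
     app \<mu> H \<in> bold_R0 \<Omega> (q + 1) t \<and> H \<in> bold_D \<Omega> (q + 1) t}"

definition sol_norm ::
  "(real ^ 'n::{finite,linorder}) set \<Rightarrow> int \<Rightarrow> 'n transf \<Rightarrow> 'n transf \<Rightarrow> real \<Rightarrow>
    'n form \<Rightarrow> 'n form \<Rightarrow> real" where
  "sol_norm \<Omega> q \<epsilon> \<mu> t E H =
     rot_norm \<Omega> q t t E + div_norm \<Omega> q t t (app \<epsilon> E) +
     rot_norm \<Omega> (q + 1) t t (app \<mu> H) + div_norm \<Omega> (q + 1) t t H"

definition admissible_frequency_bound ::
  "(real ^ 'n::{finite,linorder}) set \<Rightarrow> int \<Rightarrow> 'n transf \<Rightarrow> 'n transf \<Rightarrow> (int \<Rightarrow> nat) \<Rightarrow>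
    (int \<Rightarrow> nat \<Rightarrow> 'n form) \<Rightarrow> (int \<Rightarrow> nat \<Rightarrow> 'n form) \<Rightarrow>
    real \<Rightarrow> real \<Rightarrow> bool" where
  "admissible_frequency_bound \<Omega> q \<epsilon> \<mu> d b0 b s \<gamma> \<longleftrightarrow> \<gamma> > 0 \<and>
     sing_freqs \<Omega> q \<epsilon> \<mu> \<inter> upper_disc \<gamma> = {} \<and>
     (\<exists>c>0. \<forall>\<omega>\<in>upper_disc \<gamma> - {0}. \<forall>F\<in>bold_D \<Omega> q s. \<forall>G\<in>bold_R0 \<Omega> (q + 1) s.
        \<forall>E H. is_sol_op \<Omega> q \<epsilon> \<mu> \<omega> F G E H \<longrightarrow>
          (E, H) \<in> sol_space \<Omega> q \<epsilon> \<mu> (s - (real CARD('n) + 1) / 2) \<and>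
          sol_norm \<Omega> q \<epsilon> \<mu> (s - (real CARD('n) + 1) / 2) E H \<le>
            c * (L2w_norm \<Omega> s F + L2w_norm \<Omega> s G
               + (L2w_norm \<Omega> s (wdiv \<Omega> q F) + L2w_norm \<Omega> s (wrot \<Omega> (q + 1) G)) / cmod \<omega>
               + (\<Sum>l<d q. cmod (L2_pair \<Omega> F (b0 q l))) / cmod \<omega>
               + (\<Sum>k<d (q + 1). cmod (L2_pair \<Omega> G (b (q + 1) k))) / cmod \<omega>))"


section \<open>The static problem\<close>

definition static_maxwell ::
  "(real ^ 'n::{finite,linorder}) set \<Rightarrow> int \<Rightarrow> 'n transf \<Rightarrow> 'n transf \<Rightarrow> (int \<Rightarrow> nat) \<Rightarrow>
    (int \<Rightarrow> nat \<Rightarrow> 'n form) \<Rightarrow> (int \<Rightarrow> nat \<Rightarrow> 'n form) \<Rightarrow>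
    'n form \<Rightarrow> 'n form \<Rightarrow> 'n form \<Rightarrow> 'n form \<Rightarrow> (nat \<Rightarrow> complex) \<Rightarrow> (nat \<Rightarrow> complex) \<Rightarrow>
    'n form \<Rightarrow> 'n form \<Rightarrow> bool" where
  "static_maxwell \<Omega> q \<epsilon> \<mu> d b0 b f F G g \<zeta> \<xi> E H \<longleftrightarrow>
     (\<exists>t > - real CARD('n) / 2. E \<in> L2w \<Omega> q t) \<and> E \<in> R0_loc \<Omega> q \<and> app \<epsilon> E \<in> D_loc \<Omega> q \<and>
     (\<exists>t > - real CARD('n) / 2. H \<in> L2w \<Omega> (q + 1) t) \<and>
     app \<mu> H \<in> R0_loc \<Omega> (q + 1) \<and> H \<in> D_loc \<Omega> (q + 1) \<and>
     has_rot \<Omega> q E G \<and> has_div \<Omega> q (app \<epsilon> E) f \<and>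
     (\<forall>l<d q. L2_pair \<Omega> (app \<epsilon> E) (b0 q l) = \<zeta> l) \<and>
     has_div \<Omega> (q + 1) H F \<and> has_rot \<Omega> (q + 1) (app \<mu> H) g \<and>
     (\<forall>k<d (q + 1). L2_pair \<Omega> (app \<mu> H) (b (q + 1) k) = \<xi> k)"

end

theory Submission
 imports Defs
begin

text \<open>
 The a priori estimate of an admissible frequency bound makes \<open>(E\<^sub>n, H\<^sub>n)\<close> bounded in the weighted
 space of order \<open>t > - N / 2\<close>, and Maxwell's equations give
 \<open>rot E\<^sub>n = G\<^sub>n - i\<omega>\<^sub>n \<mu> H\<^sub>n\<close> and \<open>div \<epsilon> E\<^sub>n = - i\<omega>\<^sub>n\<^sup>-\<^sup>1 div F\<^sub>n\<close>, together with their counterparts for \<open>H\<^sub>n\<close>.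
 A div-rot lemma, obtained from the MLCP by splitting off rotations, makes
 \<open>\<langle>E\<^sub>n - E\<^sub>m, \<epsilon> (E\<^sub>n - E\<^sub>m)\<rangle>\<close> small on bounded sets along a subsequence, so that positivity of \<open>\<epsilon>\<close> yields local
 convergence, and the bound turns it into convergence with any smaller weight. The limit solves the static problem.
 A difference of two static solutions is square integrable: outside a ball it is, up to square integrable
 data, a harmonic field on \<open>\<real>\<^sup>N\<close> in a weighted space that contains no harmonic functions but \<open>0\<close>. Modulo limits
 of rotations of test forms it is then a harmonic Dirichlet form orthogonal to the forms of the SMP, hence \<open>0\<close>.
 Uniqueness makes the whole sequence converge.
\<close>

section \<open>Exterior multiplication and contraction\<close>

text \<open>The MLCP speaks of forms whose rotation and divergence are both controlled, whereas here
  \<open>rot\<close> is controlled for \<open>E\<close> and \<open>div\<close> for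
  \<open>\<epsilon> E\<close>, and near the boundary \<open>\<epsilon>\<close> is merely bounded.
  Hence compactness is extracted from the product of \<open>E\<close> with
  \<open>\<epsilon> E\<close>, in which a rotation can be moved to the other factor. The boundary
  condition is approximability by test forms, so no traces occur: approximating test forms are
  carried through the constructions (\<open>has_rot0\<close>), and this is why the Riesz argument
  returns its minimising sequence. The number - N / 2 has two sources that match: s > 1 / 2 gives t
  > - N / 2, and a field of weight \<sigma> has means over balls of radius r bounded by r^(-
  \<sigma> - N / 2), which tends to 0 exactly for \<sigma> > - N / 2. As \<tau> > N / 2, the term
  \<open>\<epsilon> E - E\<close> of such a field is square integrable and acts as a harmless
  source. N \<ge> 3 enters through Hardy's inequality, which makes sources of weight 1 bounded
  functionals for the Dirichlet norm. Complex pairings are split into real ones, and the Hodge star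
  is eliminated in favour of contractions.\<close>

definition contr :: "'n => ('n::{finite,linorder}) alg => 'n alg" where
 "contr n v = (\<chi> K. if n \<in> K then 0 else (-1) ^ card {m \<in> K. m < n} * v $ (insert n K))"

lemma wedge1_add: "wedge1 n (u + v) = wedge1 n u + wedge1 n v"
 and wedge1_scaleR: "wedge1 n (r *\<^sub>R u) = r *\<^sub>R wedge1 n u"
 and wedge1_smult: "wedge1 n (c *s u) = c *s wedge1 n u"
 by (auto simp: wedge1_def vec_eq_iff algebra_simps)

lemma contr_add: "contr n (u + v) = contr n u + contr n v"
 and contr_scaleR: "contr n (r *\<^sub>R u) = r *\<^sub>R contr n u"
 and contr_smult: "contr n (c *s u) = c *s contr n u"
 by (auto simp: contr_def vec_eq_iff algebra_simps)

lemma linear_wedge1: "linear (wedge1 n)" and linear_contr: "linear (contr n)"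
 by (auto intro!: linearI simp: wedge1_add wedge1_scaleR contr_add contr_scaleR)

lemma bounded_linear_wedge1: "bounded_linear (wedge1 n)"
 and bounded_linear_contr: "bounded_linear (contr n)"
 by (simp_all add: linear_wedge1 linear_contr linear_conv_bounded_linear[symmetric])

text \<open>\<open>contr n\<close> is the interior product with the n-th unit vector. Sets
  containing \<open>n\<close> correspond to sets avoiding it by inserting \<open>n\<close>; the sign
  counts elements strictly below \<open>n\<close> and is therefore the same on both sides.\<close>

lemma wedge1_adjoint: "wedge1 n u \<bullet> v = u \<bullet> contr n (v :: ('n::{finite,linorder}) alg)"
proof -
 have s: "(((-1)::complex) ^ k * a) \<bullet> b = a \<bullet> ((-1) ^ k * b)" for k a b
  by (cases "even k") auto
 have 1: "wedge1 n u \<bullet> v = (\<Sum>K | n \<in> K. ((-1) ^ card {m \<in> K. m < n} * u $ (K - {n})) \<bullet> (v $ K))"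
  unfolding inner_vec_def wedge1_def by (intro sum.mono_neutral_cong_right) auto
 have 2: "u \<bullet> contr n v = (\<Sum>K | n \<notin> K. (u $ K) \<bullet> ((-1) ^ card {m \<in> K. m < n} * v $ insert n K))"
  unfolding inner_vec_def contr_def by (intro sum.mono_neutral_cong_right) auto
 have c: "n \<notin> K ==> {m. (m = n \<or> m \<in> K) \<and> m < n} = {m \<in> K. m < n}" for K by auto
 show ?thesis unfolding 1 2
  by (rule sum.reindex_bij_witness[of _ "insert n" "%K. K - {n}"])
   (auto simp: insert_absorb c s intro!: arg_cong2[where f=inner] arg_cong2[where f="(*)"]
    arg_cong[where f=card] arg_cong2[where f="power"])
qed

lemma contr_adjoint: "contr n u \<bullet> v = u \<bullet> wedge1 n (v :: ('n::{finite,linorder}) alg)"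
 using wedge1_adjoint[of n v u] by (simp add: inner_commute)

lemma card_less_insert:
 fixes K :: "('n::{finite,linorder}) set"
 assumes "n \<notin> K"
 shows "card {m \<in> insert n K. m < k} = card {m \<in> K. m < k} + (if n < k then 1 else 0)"
proof (cases "n < k")
 case True
 then have "{m \<in> insert n K. m < k} = insert n {m \<in> K. m < k}" by auto
 then show ?thesis using True assms by simp
next
 case False
 then have "{m \<in> insert n K. m < k} = {m \<in> K. m < k}" by auto
 then show ?thesis using False by simp
qed

text \<open>The two orders of insertion differ in one count only: the smaller index, once present,
  is counted below the larger one.\<close>

lemma contr_contr: "contr n (contr m v) = - contr m (contr n v)"
proof (intro vec_eq_iff[THEN iffD2] allI)
 fix K
 show "contr n (contr m v) $ K = (- contr m (contr n v)) $ K"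
 proof (cases "n \<in> K \<or> m \<in> K \<or> n = m")
  case True then show ?thesis by (auto simp: contr_def)
 next
  case False
  then have "n < m \<or> m < n" by auto
  then show ?thesis using False
   by (auto simp: contr_def card_less_insert insert_commute simp del: insert_iff)
 qed
qed

lemma inner_eq_all: "(\<And>w. u \<bullet> w = v \<bullet> w) ==> u = v"
 by (metis vector_eq_rdot)

lemma wedge1_wedge1: "wedge1 n (wedge1 m v) = - wedge1 m (wedge1 n v)"
 by (rule inner_eq_all) (simp add: wedge1_adjoint inner_minus_left, subst contr_contr, simp)

text \<open>The canonical anticommutation relation; it is what reduces the Hodge Laplacian to the
  pure second derivatives. For \<open>n \<noteq> m\<close> only sets with \<open>n\<close> inside
  and \<open>m\<close> outside give nonzero terms, and there one of the two orders picks up an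
  additional sign.\<close>

lemma wedge1_contr:
 "wedge1 n (contr m v) + contr m (wedge1 n v) = (if n = m then v else 0)"
proof (intro vec_eq_iff[THEN iffD2] allI)
 fix K :: "'a set"
 show "(wedge1 n (contr m v) + contr m (wedge1 n v)) $ K = (if n = m then v else 0) $ K"
 proof (cases "n = m")
  case True
  have c: "{k. (k = m \<or> k \<in> K) \<and> k < m} = {k \<in> K. k < m}"
   "{k \<in> K. k \<noteq> m \<and> k < m} = {k \<in> K. k < m}" by auto
  show ?thesis using True
   by (auto simp: wedge1_def contr_def insert_absorb c mult.assoc[symmetric]
     power_mult_distrib[symmetric])
 next
  case False
  show ?thesis
  proof (cases "n \<in> K \<and> m \<notin> K")
   case True
   define L where "L = K - {n}"
   have L: "K = insert n L" "n \<notin> L" "m \<notin> L" using True by (auto simp: L_def)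
   have e: "insert m K - {n} = insert m L" using L False by auto
   have *: "wedge1 n (contr m v) $ K = (-1) ^ card {k \<in> L. k < n} * ((-1) ^ card {k \<in> L. k < m} * v $ insert m L)"
   proof -
    have "{k \<in> insert n L. k < n} = {k \<in> L. k < n}" by auto
    moreover have "insert n L - {n} = L" using L by auto
    ultimately show ?thesis unfolding L(1) wedge1_def contr_def using L(3) by simp
   qed
   have "contr m (wedge1 n v) $ K = (-1) ^ card {k \<in> insert n L. k < m} *
    ((-1) ^ card {k \<in> insert m (insert n L). k < n} * v $ insert m L)"
    using L e False by (simp add: contr_def wedge1_def)
   also have "card {k \<in> insert m (insert n L). k < n} = card {k \<in> L. k < n} + (if m < n then 1 else 0)"
    using L False by (subst card_less_insert) (simp_all add: card_less_insert del: insert_iff, auto)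
   finally have **: "contr m (wedge1 n v) $ K = (-1) ^ (card {k \<in> L. k < m} + (if n < m then 1 else 0)) *
    ((-1) ^ (card {k \<in> L. k < n} + (if m < n then 1 else 0)) * v $ insert m L)"
    using L by (simp add: card_less_insert del: insert_iff)
   have "n < m \<or> m < n" using False by auto
   then show ?thesis using False by (auto simp: * **)
  next
   case F: False
   then show ?thesis using False by (auto simp: wedge1_def contr_def)
  qed
 qed
qed

text \<open>By the anticommutation relation for equal indices, the squares of the two norms add up
  to that of \<open>v\<close>.\<close>

lemma norm_wedge1: "norm (wedge1 n v) \<le> norm v" and norm_contr: "norm (contr n v) \<le> norm v"
proof -
 have "(norm (wedge1 n v))\<^sup>2 + (norm (contr n v))\<^sup>2 = v \<bullet> (contr n (wedge1 n v)) + v \<bullet> wedge1 n (contr n v)"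
  by (simp add: power2_norm_eq_inner wedge1_adjoint contr_adjoint)
 also have "\<dots> = (norm v)\<^sup>2"
  using wedge1_contr[of n n v] by (simp add: inner_add_right[symmetric] add.commute power2_norm_eq_inner)
 finally have "(norm (wedge1 n v))\<^sup>2 \<le> (norm v)\<^sup>2" "(norm (contr n v))\<^sup>2 \<le> (norm v)\<^sup>2"
  by (smt (verit) zero_le_power2)+
 then show "norm (wedge1 n v) \<le> norm v" "norm (contr n v) \<le> norm v"
  by (simp_all add: power2_le_iff_abs_le)
qed

lemma wedge1_alt:
 assumes "v \<in> alt q" shows "wedge1 n v \<in> alt (q + 1)"
proof -
 have "v $ (K - {n}) = 0" if "n \<in> K" "int (card K) \<noteq> q + 1" for K
 proof -
  have "Suc (card (K - {n})) = card K" using that by (intro card_Suc_Diff1) auto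
  then have "int (card (K - {n})) \<noteq> q" using that by linarith
  then show ?thesis using assms by (simp add: alt_def)
 qed
 then show ?thesis by (simp add: alt_def wedge1_def)
qed

lemma contr_alt: "v \<in> alt q ==> contr n v \<in> alt (q - 1)"
 by (auto simp: alt_def contr_def)

lemma alt_zero [simp]: "0 \<in> alt q" by (auto simp: alt_def)
lemma alt_add: "u \<in> alt q ==> v \<in> alt q ==> u + v \<in> alt q" by (auto simp: alt_def)
lemma alt_diff: "u \<in> alt q ==> v \<in> alt q ==> u - v \<in> alt q" by (auto simp: alt_def)
lemma alt_scaleR: "u \<in> alt q ==> r *\<^sub>R u \<in> alt q" by (auto simp: alt_def)
lemma alt_smult: "u \<in> alt q ==> c *s u \<in> alt q" by (auto simp: alt_def)
lemma alt_sum: "(\<And>i. i \<in> S ==> f i \<in> alt q) ==> sum f S \<in> alt q"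
 by (induction S rule: infinite_finite_induct) (auto intro: alt_add)

lemma closed_alt: "closed (alt q :: ('n::finite) alg set)"
proof -
 have "(alt q :: 'n alg set) = (\<Inter>I \<in> {I. int (card I) \<noteq> q}. {v. v $ I = 0})" by (auto simp: alt_def)
 moreover have "closed {v :: 'n alg. v $ I = 0}" for I
  by (intro closed_Collect_eq continuous_intros)
 ultimately show ?thesis by auto
qed

text \<open>The parity count behind the identity of codifferential and contraction. Passing from
  \<open>K\<close> to \<open>insert n K\<close> changes the inversions only through pairs containing
  \<open>n\<close>, and the inversions of \<open>K\<close> together with the reversed ones of
  \<open>- K\<close> exhaust the pairs in \<open>K\<close> times \<open>- K\<close>.\<close>

lemma star_sign_insert:
 fixes K :: "('n::{finite,linorder}) set"
 assumes n: "n \<notin> K"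
 shows "star_sign (- K) * star_sign (insert n K) * (-1) ^ card {m \<in> - K. m < n} =
  (-1) ^ (card K * CARD('n)) * (-1) ^ card {m \<in> K. m < n}"
proof -
 let ?a = "{(i, j). i \<in> insert n K \<and> j \<notin> insert n K \<and> j < i}"
 let ?b = "{(i, j). i \<in> - K \<and> j \<notin> - K \<and> j < i}"
 let ?L = "card {m \<in> K. m < n}" and ?G = "card {m \<in> K. n < m}" and ?M = "card {m \<in> - K. m < n}"
 let ?I = "{(i, j). i \<in> K \<and> j \<notin> K \<and> j < i}"
 have fin: "finite (X :: ('n \<times> 'n) set)" for X by (rule finite)
 have K: "card K = ?L + ?G"
 proof -
  have "K = {m \<in> K. m < n} \<union> {m \<in> K. n < m}" using n by (auto, metis linorder_neqE)
  then have k: "{m \<in> K. m < n} \<union> {m \<in> K. n < m} = K" by simp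
  have "card ({m \<in> K. m < n} \<union> {m \<in> K. n < m}) = ?L + ?G" by (rule card_Un_disjoint) auto
  then show ?thesis by (simp only: k)
 qed
 \<comment> \<open>Lost are the pairs (m, n) with m in \<open>K\<close> above \<open>n\<close>,
   gained the pairs (n, m) with m outside \<open>K\<close> below \<open>n\<close>; the equation is
   written additively to stay within the natural numbers.\<close>
 have 1: "card ?a + ?G = card ?I + ?M"
 proof -
  have "?a \<union> (%m. (m, n)) ` {m \<in> K. n < m} = ?I \<union> (%m. (n, m)) ` {m \<in> - K. m < n}" using n by auto
  moreover have "card (?a \<union> (%m. (m, n)) ` {m \<in> K. n < m}) = card ?a + ?G"
   by (subst card_Un_disjoint) (auto simp: card_image inj_on_def fin)
  moreover have "card (?I \<union> (%m. (n, m)) ` {m \<in> - K. m < n}) = card ?I + ?M"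
   using n by (subst card_Un_disjoint) (auto simp: card_image inj_on_def fin)
  ultimately show ?thesis by simp
 qed
 have 2: "card ?I + card ?b = card K * (CARD('n) - card K)"
 proof -
  have "?I \<union> (%(i, j). (j, i)) ` ?b = K \<times> (- K)"
   by (auto simp: image_iff) (metis linorder_neqE)
  moreover have "card (?I \<union> (%(i, j). (j, i)) ` ?b) = card ?I + card ?b"
   by (subst card_Un_disjoint) (auto simp: card_image inj_on_def fin)
  ultimately have "card ?I + card ?b = card (K \<times> (- K))" by simp
  then show ?thesis by (simp add: card_cartesian_product Compl_eq_Diff_UNIV card_Diff_subset)
 qed
 \<comment> \<open>Adding \<open>2 * ?G\<close> completes \<open>?L\<close> to the cardinality of
   \<open>K\<close>; what remains is a multiple of 2 plus |K| (|K| + 1), which is even.\<close>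
 have e: "even (card ?b + card ?a + ?M + (card K * CARD('n) + ?L))"
 proof -
  have N: "CARD('n) = card K + card (- K)" by (simp add: Compl_eq_Diff_UNIV card_Diff_subset card_mono)
  have N2: "card ?I + card ?b = card K * card (- K)" using 2 N by simp
  have "card ?b + card ?a + ?M + (card K * CARD('n) + ?L) + 2 * ?G =
   card ?b + (card ?a + ?G) + ?M + (card K * (card K + card (- K)) + (?L + ?G))"
   unfolding N by simp
  also have "\<dots> = (card ?I + card ?b) + 2 * ?M + (card K * card K + card K * card (- K) + card K)"
   unfolding 1 K[symmetric] by (simp add: distrib_left)
  also have "\<dots> = 2 * (card K * card (- K) + ?M) + card K * (card K + 1)"
   unfolding N2 by simp
  finally have "even (card ?b + card ?a + ?M + (card K * CARD('n) + ?L) + 2 * ?G)"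
   by (simp only: even_add even_mult_iff) simp
  then show ?thesis by (simp only: even_add even_mult_iff) simp
 qed
 have sgn: "even (i + j) ==> (-1::complex) ^ i = (-1) ^ j" for i j :: nat
  by (cases "even i") auto
 have "(-1::complex) ^ (card ?b + card ?a + ?M) = (-1) ^ (card K * CARD('n) + ?L)"
  by (rule sgn) (rule e)
 then show ?thesis by (simp add: star_sign_def power_add)
qed

text \<open>On rank \<open>q + 1\<close> the contributing index sets \<open>K\<close> have
  \<open>q\<close> elements, so \<open>codiff_sign\<close> cancels the global sign produced by the
  two stars. From here on the divergence is a contraction, and no orientation signs remain.\<close>

lemma codiff_contr:
 fixes v :: "('n::{finite,linorder}) alg"
 assumes "v \<in> alt (q + 1)"
 shows "codiff_sign TYPE('n) q *s hodge (wedge1 n (hodge v)) = contr n v"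
proof (intro vec_eq_iff[THEN iffD2] allI)
 fix K :: "'n set"
 show "(codiff_sign TYPE('n) q *s hodge (wedge1 n (hodge v))) $ K = contr n v $ K"
 proof (cases "n \<in> K \<or> v $ insert n K = 0")
  case True
  have e: "- (- K - {n}) = insert n K" by auto
  show ?thesis using True by (auto simp: hodge_def wedge1_def contr_def e)
 next
  case False
  then have "int (card (insert n K)) = q + 1" using assms unfolding alt_def by blast
  then have q: "q = int (card K)" using False by simp
  have "codiff_sign TYPE('n) q = (-1) ^ (card K * CARD('n))"
   unfolding codiff_sign_def q by (metis of_nat_mult power_int_of_nat)
  have e: "- (- K - {n}) = insert n K" by auto
  have c: "codiff_sign TYPE('n) q = (-1) ^ (card K * CARD('n))" by fact
  have sq: "((-1::complex) ^ k) * ((-1) ^ k * z) = z" for k z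
   by (simp add: mult.assoc[symmetric] power_mult_distrib[symmetric])
  let ?x = "v $ insert n K" and ?M = "(-1::complex) ^ card {m \<in> - K. m < n}"
   and ?P = "(-1::complex) ^ (card K * CARD('n))" and ?L = "(-1::complex) ^ card {m \<in> K. m < n}"
  have "(codiff_sign TYPE('n) q *s hodge (wedge1 n (hodge v))) $ K =
    ?P * (star_sign (- K) * (?M * (star_sign (insert n K) * ?x)))"
   using False by (simp add: hodge_def wedge1_def c e)
  also have "\<dots> = ?P * ((star_sign (- K) * star_sign (insert n K) * ?M) * ?x)"
   by (simp only: mult_ac)
  also have "\<dots> = ?P * (?P * (?L * ?x))"
   using star_sign_insert[of n K] False by (simp only: mult.assoc de_Morgan_disj) simp
  also have "\<dots> = ?L * ?x" by (rule sq)
  also have "\<dots> = contr n v $ K" using False by (simp add: contr_def)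
  finally show ?thesis .
 qed
qed

text \<open>The orthogonal projection to rank \<open>q\<close>. It turns an arbitrary constant
  vector into an admissible coefficient of a test form, so that forms can be tested component by
  component.\<close>

definition altproj :: "int => ('n::finite) alg => 'n alg" where
 "altproj q v = (\<chi> I. if int (card I) = q then v $ I else 0)"

text \<open>The real part of the Hermitian product is the Euclidean inner product of
  \<open>alg\<close>, and the imaginary part is the same with \<open>v\<close> multiplied by i. Weak
  identities are therefore handled with the real inner product.\<close>

lemma hinner_Re: "Re (hinner u v) = u \<bullet> v"
 by (simp add: hinner_def inner_vec_def inner_complex_def cmod_def)

lemma hinner_Im: "Im (hinner u v) = u \<bullet> (\<i> *s v)"
 by (simp add: hinner_def inner_vec_def inner_complex_def)

lemma norm_smult: "norm (c *s u) = cmod c * norm u" for u :: "('n::finite) alg"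
 by (simp add: norm_vec_def norm_mult L2_set_left_distrib L2_set_right_distrib)

section \<open>Smooth functions\<close>

abbreviation smooth :: "(real ^ 'n::finite => 'b::real_normed_vector) => bool" where
 "smooth f \<equiv> (\<forall>k. Ck_on k UNIV f)"

lemma partial_deriv_eq:
 "(f has_derivative f') (at x) ==> partial_deriv n f x = f' (axis n 1)"
 by (simp add: partial_deriv_def frechet_derivative_at[symmetric])

lemma Ck_imp_cont: "Ck_on k UNIV f ==> continuous_on UNIV f"
proof (cases k)
 case (Suc j)
 assume "Ck_on k UNIV f"
 with Suc have "\<forall>x. f differentiable (at x)" by simp
 then show ?thesis
  using differentiable_imp_continuous_on differentiable_on_def differentiable_at_withinI by blast
qed simp

lemma Ck_SucD: "Ck_on (Suc k) UNIV f ==> Ck_on k UNIV f"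
proof (induction k arbitrary: f)
 case 0
 then show ?case using Ck_imp_cont by fastforce
qed auto

text \<open>\<open>Ck_on\<close> is phrased with \<open>frechet_derivative\<close>; this rule lets
  an explicitly known derivative be used instead.\<close>

lemma Ck_SucI:
 assumes "\<And>x. (f has_derivative f' x) (at x)" "\<And>n. Ck_on k UNIV (%x. f' x (axis n 1))"
 shows "Ck_on (Suc k) UNIV f"
proof -
 have "partial_deriv n f = (%x. f' x (axis n 1))" for n
  using partial_deriv_eq[OF assms(1)] by (intro ext) auto
 then show ?thesis using assms by (auto simp: differentiable_def)
qed

lemma Ck_has_derivative:
 "Ck_on (Suc k) UNIV f ==> (f has_derivative frechet_derivative f (at x)) (at x)"
 by (simp add: frechet_derivative_works)

lemma smooth_has_derivative: "smooth f ==> (f has_derivative frechet_derivative f (at x)) (at x)"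
 using Ck_has_derivative by blast

lemma smooth_continuous: "smooth f ==> continuous_on UNIV f"
 using Ck_imp_cont by blast

lemma smooth_partial: "smooth f ==> smooth (partial_deriv n f)"
 by (metis Ck_on.simps(2))

lemma Ck_linear:
 assumes "bounded_linear L" shows "Ck_on k UNIV f ==> Ck_on k UNIV (%x. L (f x))"
proof (induction k arbitrary: f)
 case 0
 then show ?case using assms by (auto intro: bounded_linear.continuous_on)
next
 case (Suc k)
 then show ?case
  by (intro Ck_SucI[where f'="%x h. L (frechet_derivative f (at x) h)"])
   (auto intro!: bounded_linear.has_derivative[OF assms] Ck_has_derivative Suc.IH
    simp: partial_deriv_def[abs_def])
qed

lemma Ck_const [simp]: "Ck_on k UNIV (%x. c)"
proof (induction k arbitrary: c)
 case (Suc k)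
 then show ?case by (intro Ck_SucI[where f'="%x h. 0"]) auto
qed auto

text \<open>Sums are settled inside the same proof, since the Leibniz rule turns one product into a
  sum of two.\<close>

lemma Ck_bilinear:
 assumes "bounded_bilinear B"
 shows "Ck_on k UNIV f ==> Ck_on k UNIV g ==> Ck_on k UNIV (%x. B (f x) (g x))"
 and "Ck_on k UNIV f0 ==> Ck_on k UNIV g0 ==> Ck_on k UNIV (%x. (f0 x :: 'z::real_normed_vector) + g0 x)"
proof -
 have add: "Ck_on k UNIV f0 ==> Ck_on k UNIV g0 ==> Ck_on k UNIV (%x. f0 x + g0 x)"
  for f0 g0 :: "real ^ 'n => 'y::real_normed_vector" and k
 proof (induction k arbitrary: f0 g0)
  case (Suc k)
  then show ?case
   by (intro Ck_SucI[where f'="%x h. frechet_derivative f0 (at x) h + frechet_derivative g0 (at x) h"])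
    (auto intro!: has_derivative_add Ck_has_derivative Suc.IH simp: partial_deriv_def[abs_def])
 qed (auto intro: continuous_intros)
 then show "Ck_on k UNIV f0 ==> Ck_on k UNIV g0 ==> Ck_on k UNIV (%x. f0 x + g0 x)" by blast
 show "Ck_on k UNIV f ==> Ck_on k UNIV g ==> Ck_on k UNIV (%x. B (f x) (g x))"
 proof (induction k arbitrary: f g)
  case 0
  then show ?case using assms by (auto intro: bounded_bilinear.continuous_on)
 next
  case (Suc k)
  then show ?case using Ck_SucD[OF Suc.prems(1)] Ck_SucD[OF Suc.prems(2)]
   by (intro Ck_SucI[where f'="%x h. B (f x) (frechet_derivative g (at x) h) + B (frechet_derivative f (at x) h) (g x)"])
    (auto intro!: bounded_bilinear.FDERIV[OF assms] Ck_has_derivative add Suc.IH simp: partial_deriv_def[abs_def])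
 qed
qed

lemma Ck_add: "Ck_on k UNIV f ==> Ck_on k UNIV g ==> Ck_on k UNIV (%x. f x + g x)"
 using Ck_bilinear(2)[OF bounded_bilinear_mult] by blast

lemma Ck_minus: "Ck_on k UNIV f ==> Ck_on k UNIV (%x. - f x)"
 using Ck_linear[OF bounded_linear_minus[OF bounded_linear_ident]] by blast

lemma Ck_diff: "Ck_on k UNIV f ==> Ck_on k UNIV g ==> Ck_on k UNIV (%x. f x - g x)"
 using Ck_add[OF _ Ck_minus] by fastforce

lemma Ck_scaleR: "Ck_on k UNIV f ==> Ck_on k UNIV g ==> Ck_on k UNIV (%x. f x *\<^sub>R g x)"
 using Ck_bilinear(1)[OF bounded_bilinear_scaleR] by blast

lemma Ck_mult: "Ck_on k UNIV f ==> Ck_on k UNIV g ==> Ck_on k UNIV (%x. f x * (g x :: real))"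
 using Ck_bilinear(1)[OF bounded_bilinear_mult] by blast

lemma Ck_inner: "Ck_on k UNIV f ==> Ck_on k UNIV g ==> Ck_on k UNIV (%x. f x \<bullet> g x)"
 using Ck_bilinear(1)[OF bounded_bilinear_inner] by blast

lemma Ck_sum: "(\<And>i. i \<in> S ==> Ck_on k UNIV (f i)) ==> Ck_on k UNIV (%x. \<Sum>i\<in>S. f i x)"
 by (induction S rule: infinite_finite_induct) (auto intro: Ck_add)

lemma Ck_ident: "Ck_on k UNIV (%x::real^'n. x)"
proof (cases k)
 case (Suc j)
 then show ?thesis by (auto intro!: Ck_SucI[where f'="%x h. h"] simp del: Ck_on.simps)
qed auto

lemma partial_deriv_linear:
 assumes "bounded_linear L" "smooth f"
 shows "partial_deriv n (%x. L (f x)) x = L (partial_deriv n f x)"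
 unfolding partial_deriv_eq[OF bounded_linear.has_derivative[OF assms(1) smooth_has_derivative[OF assms(2)]]]
 by (simp add: partial_deriv_def)

lemma partial_deriv_bilinear:
 assumes "bounded_bilinear B" "smooth f" "smooth g"
 shows "partial_deriv n (%x. B (f x) (g x)) x = B (f x) (partial_deriv n g x) + B (partial_deriv n f x) (g x)"
 unfolding partial_deriv_eq[OF bounded_bilinear.FDERIV[OF assms(1) smooth_has_derivative[OF assms(2)] smooth_has_derivative[OF assms(3)]]]
 by (simp add: partial_deriv_def)

lemma partial_deriv_add:
 assumes "smooth f" "smooth g"
 shows "partial_deriv n (%x. f x + g x) x = partial_deriv n f x + partial_deriv n g x"
 unfolding partial_deriv_eq[OF has_derivative_add[OF smooth_has_derivative[OF assms(1)] smooth_has_derivative[OF assms(2)]]]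
 by (simp add: partial_deriv_def)

lemma partial_deriv_sum:
 assumes "\<And>i. i \<in> S ==> smooth (f i)"
 shows "partial_deriv n (%x. \<Sum>i\<in>S. f i x) x = (\<Sum>i\<in>S. partial_deriv n (f i) x)"
proof -
 have "((%x. \<Sum>i\<in>S. f i x) has_derivative (%h. \<Sum>i\<in>S. frechet_derivative (f i) (at x) h)) (at x)"
  using assms by (intro has_derivative_sum smooth_has_derivative) auto
 then show ?thesis by (simp add: partial_deriv_eq) (simp add: partial_deriv_def)
qed

lemma partial_deriv_const [simp]: "partial_deriv n (%x. c) = (%x. 0)"
 by (intro ext, rule partial_deriv_eq[of _ "%x. 0", simplified]) auto

lemma partial_deriv_diff:
 assumes "smooth f" "smooth g"
 shows "partial_deriv n (%x. f x - g x) x = partial_deriv n f x - partial_deriv n g x"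
 unfolding partial_deriv_eq[OF has_derivative_diff[OF smooth_has_derivative[OF assms(1)] smooth_has_derivative[OF assms(2)]]]
 by (simp add: partial_deriv_def)

lemma partial_deriv_outside_support:
 assumes "closed K" "\<And>x. x \<notin> K ==> f x = 0" "x \<notin> K"
 shows "partial_deriv n f x = 0"
proof -
 have "(f has_derivative (%h. 0)) (at x)"
  by (rule has_derivative_transform_within_open[of "%x. 0" _ _ UNIV "- K"])
   (use assms in \<open>auto simp: open_Compl\<close>)
 then show ?thesis by (rule partial_deriv_eq[of f "%h. 0", simplified])
qed

lemma has_derivative_compose_affine:
 assumes "smooth f"
 shows "((%x. f (a *\<^sub>R x + c)) has_derivative (%h. frechet_derivative f (at (a *\<^sub>R x + c)) (a *\<^sub>R h))) (at x)"
proof -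
 have "((%x. a *\<^sub>R x + c) has_derivative (%h. a *\<^sub>R h)) (at x)" by (auto intro!: derivative_eq_intros)
 from has_derivative_compose[OF this smooth_has_derivative[OF assms]] show ?thesis .
qed

lemma partial_deriv_affine:
 assumes "smooth f"
 shows "partial_deriv n (%x. f (a *\<^sub>R x + c)) x = a *\<^sub>R partial_deriv n f (a *\<^sub>R x + c)"
 using partial_deriv_eq[OF has_derivative_compose_affine[OF assms]]
  linear_scale[OF has_derivative_linear[OF smooth_has_derivative[OF assms]]]
 by (simp add: partial_deriv_def)

lemma Ck_affine: "smooth f ==> Ck_on k UNIV (%x. f (a *\<^sub>R x + c))"
proof (induction k arbitrary: f)
 case 0
 then show ?case
  by (auto intro!: continuous_on_compose2[OF smooth_continuous[OF 0]] continuous_intros)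
next
 case (Suc k)
 have "(%x. f (a *\<^sub>R x + c)) differentiable (at x)" for x
  using has_derivative_compose_affine[OF Suc.prems] by (auto simp: differentiable_def)
 moreover have "Ck_on k UNIV (%x. a *\<^sub>R partial_deriv n f (a *\<^sub>R x + c))" for n
  by (intro Ck_scaleR Ck_const Suc.IH smooth_partial Suc.prems)
 moreover have "partial_deriv n (%x. f (a *\<^sub>R x + c)) = (%x. a *\<^sub>R partial_deriv n f (a *\<^sub>R x + c))" for n
  using partial_deriv_affine[OF Suc.prems] by blast
 ultimately show ?case by simp
qed

text \<open>The family is closed under differentiation up to linear combinations, hence all its members are smooth.\<close>

definition flat_exp :: "nat => real => real" where
 "flat_exp m x = (if x \<le> 0 then 0 else exp (- 1 / x) / x ^ m)"

lemma flat_exp_limit: "((%x. exp (- 1 / x) / x ^ m) \<longlongrightarrow> 0) (at_right (0::real))"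
proof -
 have "((%y. y ^ m / exp y) \<longlongrightarrow> 0) (at_top :: real filter)" by (rule tendsto_power_div_exp_0)
 then have "((%x. (inverse x) ^ m / exp (inverse x)) \<longlongrightarrow> 0) (at_right (0::real))"
  by (rule filterlim_compose[OF _ filterlim_inverse_at_top_right])
 then show ?thesis
  by (rule Lim_transform_eventually)
   (simp add: eventually_at_filter exp_minus divide_inverse power_inverse mult.commute)
qed

lemma flat_exp_deriv:
 "(flat_exp m has_real_derivative flat_exp (m + 2) x - real m * flat_exp (m + 1) x) (at x)"
proof -
 consider "x < 0" | "x = 0" | "x > 0" by linarith
 then show ?thesis
 proof cases
  case 1
  have "((%x. 0) has_real_derivative 0) (at x)" by simp
  then have "(flat_exp m has_real_derivative 0) (at x)"
   by (rule has_field_derivative_transform_within_open[where S="{..<0}"]) (use 1 in \<open>auto simp: flat_exp_def\<close>)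
  then show ?thesis using 1 by (simp add: flat_exp_def)
 next
  case 3
  have "((%x. exp (- 1 / x) * inverse x ^ m) has_real_derivative
    exp (- 1 / x) * inverse x ^ (m + 2) - real m * (exp (- 1 / x) * inverse x ^ (m + 1))) (at x)"
  proof (cases m)
   case 0
   then show ?thesis using 3
    by (auto intro!: derivative_eq_intros simp: power2_eq_square divide_simps)
  next
   case (Suc j)
   have "((%x. exp (- 1 / x)) has_real_derivative exp (- 1 / x) * inverse x ^ 2) (at x)"
    using 3 by (auto intro!: derivative_eq_intros simp: power2_eq_square divide_simps)
   from DERIV_mult[OF this DERIV_power_Suc[OF DERIV_inverse, of x j]] 3
   have "((%x. exp (- 1 / x) * inverse x ^ Suc j) has_real_derivative
     exp (- 1 / x) * inverse x ^ 2 * inverse x ^ Suc j +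
     (1 + real j) * (- (inverse x ^ Suc (Suc 0)) * inverse x ^ j) * exp (- 1 / x)) (at x)"
    by blast
   then show ?thesis unfolding Suc by (rule DERIV_cong) (simp add: power2_eq_square algebra_simps)
  qed
  then have "((%x. exp (- 1 / x) / x ^ m) has_real_derivative
    flat_exp (m + 2) x - real m * flat_exp (m + 1) x) (at x)"
   using 3 by (simp add: flat_exp_def divide_inverse power_inverse)
  then show ?thesis
   by (rule has_field_derivative_transform_within_open[where S="{0<..}"]) (use 3 in \<open>auto simp: flat_exp_def\<close>)
 next
  case 2
  have "((%h. (flat_exp m h - flat_exp m 0) / (h - 0)) \<longlongrightarrow> 0) (at 0)"
  proof -
   have "((%h. (flat_exp m h - flat_exp m 0) / (h - 0)) \<longlongrightarrow> 0) (at_left 0)"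
    by (rule Lim_transform_eventually[of "%h. 0"]) (auto simp: eventually_at_filter flat_exp_def)
   \<comment> \<open>For positive \<open>h\<close> the difference quotient at 0 is the next member
     of the family, hence the limit for \<open>Suc m\<close>.\<close>
   moreover have "((%h. (flat_exp m h - flat_exp m 0) / (h - 0)) \<longlongrightarrow> 0) (at_right 0)"
    by (rule Lim_transform_eventually[OF flat_exp_limit[of "Suc m"]])
     (auto simp: eventually_at_filter flat_exp_def mult.commute)
   ultimately show ?thesis by (simp add: filterlim_split_at)
  qed
  then have "(flat_exp m has_real_derivative 0) (at 0)" by (simp add: has_field_derivative_iff)
  then show ?thesis using 2 by (simp add: flat_exp_def)
 qed
qed

text \<open>All members of the family are treated in one induction, because differentiating a member
  leads to other members.\<close>

lemma Ck_comp_deriv: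
 assumes "\<And>i t. (h i has_real_derivative (\<Sum>j\<in>J i. c i j * h j t)) (at t)"
  and "Ck_on k UNIV p"
 shows "Ck_on k UNIV (%x. h i (p x))"
 using assms(2)
proof (induction k arbitrary: i)
 case 0
 have "continuous_on UNIV (h i)"
  by (rule DERIV_continuous_on) (rule has_field_derivative_at_within[OF assms(1)])
 then have "continuous_on UNIV (%x. h i (p x))"
  using 0 by (intro continuous_on_compose2[of UNIV "h i" UNIV p]) simp_all
 then show ?case by simp
next
 case (Suc k)
 have p: "Ck_on (Suc k) UNIV p" by (rule Suc.prems)
 have "((%x. h i (p x)) has_derivative
  (%v. (\<Sum>j\<in>J i. c i j * h j (p x)) * frechet_derivative p (at x) v)) (at x)" for x
  by (rule has_derivative_compose[OF Ck_has_derivative[OF p] assms(1)[unfolded has_field_derivative_def]])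
 moreover have "Ck_on k UNIV (%x. (\<Sum>j\<in>J i. c i j * h j (p x)) * frechet_derivative p (at x) (axis n 1))" for n
  using p by (intro Ck_mult Ck_sum Ck_const Suc.IH[OF Ck_SucD[OF p]]) (simp add: partial_deriv_def[abs_def])
 ultimately show ?case by (rule Ck_SucI)
qed

lemma Ck_flat_exp: "Ck_on k UNIV p ==> Ck_on k UNIV (%x. flat_exp m (p x))"
proof (rule Ck_comp_deriv[where h=flat_exp and J="%m. {m + 1, m + 2}" and c="%m j. if j = m + 1 then - real m else 1"])
 show "(flat_exp i has_real_derivative (\<Sum>j\<in>{i + 1, i + 2}. (if j = i + 1 then - real i else 1) * flat_exp j t)) (at t)" for i t
  using flat_exp_deriv[of i t] by simp
qed

lemma Ck_inverse:
 assumes "\<And>x. p x \<noteq> (0::real)"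
 shows "Ck_on k UNIV p ==> Ck_on k UNIV (%x. inverse (p x))"
proof (induction k)
 case 0
 then show ?case using assms by (auto intro: continuous_intros)
next
 case (Suc k)
 have "((%x. inverse (p x)) has_derivative (%v. - (inverse (p x) * frechet_derivative p (at x) v * inverse (p x)))) (at x)" for x
  using Deriv.has_derivative_inverse[OF assms Ck_has_derivative[OF Suc.prems]] by simp
 moreover have "Ck_on k UNIV (%x. - (inverse (p x) * frechet_derivative p (at x) (axis n 1) * inverse (p x)))" for n
  using Suc.prems Suc.IH[OF Ck_SucD[OF Suc.prems]]
  by (intro Ck_minus Ck_mult) (auto simp: partial_deriv_def[abs_def])
 ultimately show ?case by (rule Ck_SucI)
qed

lemma Ck_powr:
 assumes "\<And>x. p x > (0::real)"
 shows "Ck_on k UNIV p ==> Ck_on k UNIV (%x. p x powr a)"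
proof (induction k arbitrary: a)
 case 0
 then show ?case
  using less_imp_neq[OF assms, symmetric] by (simp add: continuous_on_powr)
next
 case (Suc k)
 have "((%x. p x powr a) has_derivative (%v. (a * p x powr (a - 1)) * frechet_derivative p (at x) v)) (at x)" for x
  by (rule has_derivative_compose[OF Ck_has_derivative[OF Suc.prems]
   has_real_derivative_powr[OF assms, unfolded has_field_derivative_def]])
 moreover have "Ck_on k UNIV (%x. (a * p x powr (a - 1)) * frechet_derivative p (at x) (axis n 1))" for n
  using Suc.prems Suc.IH[OF Ck_SucD[OF Suc.prems]]
  by (intro Ck_mult Ck_const) (auto simp: partial_deriv_def[abs_def])
 ultimately show ?case by (rule Ck_SucI)
qed

section \<open>Integration by parts and the Hodge Laplacian\<close>

lemma DERIV_line:
 fixes f :: "real ^ 'n::finite => real"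
 assumes "smooth f"
 shows "((%s. f (c + s *\<^sub>R axis n 1)) has_real_derivative partial_deriv n f (c + s *\<^sub>R axis n 1)) (at s)"
proof -
 have "((%s. c + s *\<^sub>R axis n 1) has_derivative (%h. h *\<^sub>R axis n 1)) (at s)"
  by (auto intro!: derivative_eq_intros)
 from has_derivative_compose[OF this smooth_has_derivative[OF assms]]
 have "((%s. f (c + s *\<^sub>R axis n 1)) has_derivative
   (%h. h * partial_deriv n f (c + s *\<^sub>R axis n 1))) (at s)"
  using linear_scale[OF has_derivative_linear[OF smooth_has_derivative[OF assms]]]
  by (simp add: partial_deriv_def)
 then show ?thesis unfolding has_field_derivative_def
  by (rule has_derivative_eq_rhs) (simp add: fun_eq_iff mult.commute)
qed

text \<open>Two applications of the mean value theorem. The second difference on the left is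
  symmetric in \<open>i\<close> and \<open>j\<close>, so comparing its two expressions as
  \<open>h\<close> tends to 0 gives the symmetry of mixed derivatives.\<close>

lemma second_difference:
 fixes f :: "real ^ 'n::finite => real"
 assumes f: "smooth f" and h: "h > 0"
 shows "\<exists>y. norm (y - x) \<le> 2 * h \<and>
  f (x + h *\<^sub>R axis j 1 + h *\<^sub>R axis i 1) - f (x + h *\<^sub>R axis i 1) - (f (x + h *\<^sub>R axis j 1) - f x)
   = h * (h * partial_deriv j (partial_deriv i f) y)"
proof -
 let ?g = "%s. f (x + h *\<^sub>R axis j 1 + s *\<^sub>R axis i 1) - f (x + s *\<^sub>R axis i 1)"
 let ?G = "%s. partial_deriv i f (x + h *\<^sub>R axis j 1 + s *\<^sub>R axis i 1) - partial_deriv i f (x + s *\<^sub>R axis i 1)"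
 have "(?g has_real_derivative ?G s) (at s)" for s
  by (intro DERIV_diff DERIV_line f)
 then obtain s where s: "0 < s" "s < h" "?g h - ?g 0 = (h - 0) * ?G s"
  using MVT2[OF h, of ?g ?G] by blast
 let ?p = "%t. partial_deriv i f (x + s *\<^sub>R axis i 1 + t *\<^sub>R axis j 1)"
 have "(?p has_real_derivative partial_deriv j (partial_deriv i f) (x + s *\<^sub>R axis i 1 + t *\<^sub>R axis j 1)) (at t)" for t
  by (intro DERIV_line smooth_partial f)
 then obtain t where t: "0 < t" "t < h"
  "?p h - ?p 0 = (h - 0) * partial_deriv j (partial_deriv i f) (x + s *\<^sub>R axis i 1 + t *\<^sub>R axis j 1)"
  using MVT2[OF h, of ?p "%t. partial_deriv j (partial_deriv i f) (x + s *\<^sub>R axis i 1 + t *\<^sub>R axis j 1)"] by blast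
 let ?y = "x + s *\<^sub>R axis i 1 + t *\<^sub>R axis j (1::real)"
 have "norm (?y - x) \<le> norm (s *\<^sub>R axis i (1::real) :: real^'n) + norm (t *\<^sub>R axis j (1::real) :: real^'n)"
  using norm_triangle_ineq[of "s *\<^sub>R axis i (1::real) :: real^'n" "t *\<^sub>R axis j (1::real)"] by (simp add: add.assoc)
 also have "\<dots> \<le> 2 * h" using s t by simp
 finally show ?thesis using s(3) t(3) by (intro exI[of _ ?y]) (simp add: add_ac)
qed

lemma mixed_partials_real:
 fixes f :: "real ^ 'n::finite => real"
 assumes f: "smooth f"
 shows "partial_deriv i (partial_deriv j f) x = partial_deriv j (partial_deriv i f) x"
proof -
 let ?a = "partial_deriv i (partial_deriv j f)" and ?b = "partial_deriv j (partial_deriv i f)"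
 have "dist (?a x) (?b x) < e" if e: "e > 0" for e
 proof -
  have "continuous_on UNIV ?a" "continuous_on UNIV ?b"
   by (intro smooth_continuous smooth_partial f)+
  then obtain d1 d2 where d: "d1 > 0" "\<And>y. dist y x < d1 ==> dist (?a y) (?a x) < e / 2"
   "d2 > 0" "\<And>y. dist y x < d2 ==> dist (?b y) (?b x) < e / 2"
   using e half_gt_zero[OF e] unfolding continuous_on_iff by (metis UNIV_I)
  \<comment> \<open>The intermediate points lie within \<open>2 * h\<close> of \<open>x\<close>; the
    divisor 4 keeps this strictly below both radii.\<close>
  define h where "h = min d1 d2 / 4"
  have h: "h > 0" "2 * h < d1" "2 * h < d2" using d by (auto simp: h_def min_def)
  obtain y where y: "norm (y - x) \<le> 2 * h" "f (x + h *\<^sub>R axis j 1 + h *\<^sub>R axis i 1) - f (x + h *\<^sub>R axis i 1) - (f (x + h *\<^sub>R axis j 1) - f x)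
   = h * (h * ?b y)" using second_difference[OF f h(1)] by blast
  obtain z where z: "norm (z - x) \<le> 2 * h" "f (x + h *\<^sub>R axis i 1 + h *\<^sub>R axis j 1) - f (x + h *\<^sub>R axis j 1) - (f (x + h *\<^sub>R axis i 1) - f x)
   = h * (h * ?a z)" using second_difference[OF f h(1)] by blast
  have c: "x + h *\<^sub>R axis i 1 + h *\<^sub>R axis j 1 = x + h *\<^sub>R axis j 1 + h *\<^sub>R axis i (1::real)"
   by (simp add: add_ac)
  have "h * (h * ?a z) = h * (h * ?b y)" using y(2) z(2) unfolding c by linarith
  then have "?a z = ?b y" using h by simp
  moreover have "dist (?a z) (?a x) < e / 2" "dist (?b y) (?b x) < e / 2"
   by (rule d(2), use z h in \<open>simp add: dist_norm\<close>) (rule d(4), use y h in \<open>simp add: dist_norm\<close>)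
  ultimately show ?thesis by (smt (verit) dist_commute dist_triangle field_sum_of_halves)
 qed
 then show ?thesis using zero_less_dist_iff[of "?a x" "?b x"] less_irrefl by blast
qed

lemma mixed_partials:
 fixes f :: "real ^ 'n::finite => 'b::real_inner"
 assumes f: "smooth f"
 shows "partial_deriv i (partial_deriv j f) x = partial_deriv j (partial_deriv i f) x"
proof (rule vector_eq_rdot[THEN iffD1, rule_format])
 fix w
 have p: "partial_deriv j (%x. f x \<bullet> w) = (%x. partial_deriv j f x \<bullet> w)" for j
  using partial_deriv_linear[OF bounded_linear_inner_left f] by blast
 have q: "partial_deriv i (%x. partial_deriv j f x \<bullet> w) x = partial_deriv i (partial_deriv j f) x \<bullet> w" for i j
  using partial_deriv_linear[OF bounded_linear_inner_left smooth_partial[OF f]] by blast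
 have "smooth (%x. f x \<bullet> w)" using Ck_linear[OF bounded_linear_inner_left] f by blast
 from mixed_partials_real[OF this, of i j x] show "partial_deriv i (partial_deriv j f) x \<bullet> w = partial_deriv j (partial_deriv i f) x \<bullet> w"
  unfolding p q .
qed

section \<open>Compact support and integration by parts\<close>

definition csupp :: "(real ^ 'n::finite => 'b::real_normed_vector) => bool" where
 "csupp f \<longleftrightarrow> (\<exists>K. compact K \<and> (\<forall>x. x \<notin> K \<longrightarrow> f x = 0))"

lemma csupp_cball: "csupp f \<longleftrightarrow> (\<exists>R>0. \<forall>x. norm x > R \<longrightarrow> f x = 0)"
proof
 assume "csupp f"
 then obtain K where K: "compact K" "\<And>x. x \<notin> K ==> f x = 0" by (auto simp: csupp_def)
 then obtain R where "R > 0" "\<forall>x\<in>K. norm x \<le> R" using bounded_pos compact_imp_bounded by metis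
 then show "\<exists>R>0. \<forall>x. norm x > R \<longrightarrow> f x = 0" using K(2) by (metis not_le)
next
 assume "\<exists>R>0. \<forall>x. norm x > R \<longrightarrow> f x = 0"
 then obtain R where "\<forall>x. norm x > R \<longrightarrow> f x = 0" by blast
 then show "csupp f" unfolding csupp_def by (intro exI[of _ "cball 0 R"]) auto
qed

lemma csupp_partial:
 assumes "csupp f" shows "csupp (partial_deriv n f)"
proof -
 obtain K where K: "compact K" "\<And>x. x \<notin> K ==> f x = 0" using assms by (auto simp: csupp_def)
 then show ?thesis unfolding csupp_def
  using partial_deriv_outside_support[OF compact_imp_closed[OF K(1)]] by (intro exI[of _ K]) auto
qed

lemma csupp_mono: "csupp f ==> (\<And>x. f x = 0 ==> g x = 0) ==> csupp g"
 by (fastforce simp: csupp_def)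

lemma csupp_inner1: "csupp f ==> csupp (%x. f x \<bullet> g x)"
 and csupp_inner2: "csupp g ==> csupp (%x. f x \<bullet> g x)"
 by (erule csupp_mono, simp)+

lemma csupp_bounded:
 assumes "csupp f" "continuous_on UNIV f"
 shows "\<exists>B>0. \<forall>x. norm (f x) \<le> B"
proof -
 obtain K where K: "compact K" "\<And>x. x \<notin> K ==> f x = 0" using assms by (auto simp: csupp_def)
 have "compact (f ` K)" by (intro compact_continuous_image K continuous_on_subset[OF assms(2)]) auto
 then obtain B where "B > 0" "\<forall>y\<in>f ` K. norm y \<le> B" using bounded_pos compact_imp_bounded by metis
 then show ?thesis using K(2) by (intro exI[of _ B]) (metis image_eqI less_eq_real_def norm_zero)
qed

lemma integrable_csupp_lborel:
 fixes f :: "real ^ 'n::finite => 'b::euclidean_space"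
 assumes "csupp f" "continuous_on UNIV f" shows "integrable lborel f"
proof -
 obtain K where K: "compact K" "\<And>x. x \<notin> K ==> f x = 0" using assms by (auto simp: csupp_def)
 have "integrable lborel (%x. indicator K x *\<^sub>R f x)"
  by (intro borel_integrable_compact K continuous_on_subset[OF assms(2)]) auto
 also have "(%x. indicator K x *\<^sub>R f x) = f" using K(2) by (auto simp: indicator_def)
 finally show ?thesis .
qed

lemma integrable_csupp:
 fixes f :: "real ^ 'n::finite => 'b::euclidean_space"
 assumes "csupp f" "continuous_on UNIV f" shows "integrable lebesgue f"
 using integrable_csupp_lborel[OF assms] by (simp add: integrable_completion assms(2) borel_measurable_continuous_onI)

text \<open>Difference quotients integrate to zero by translation invariance of Lebesgue measure,
  and they converge dominatedly to the derivative. Iterated integrals are thereby avoided.\<close>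

lemma integral_partial_zero:
 fixes f :: "real ^ 'n::finite => real"
 assumes f: "smooth f" "csupp f"
 shows "integral\<^sup>L lebesgue (partial_deriv n f) = 0"
proof -
 let ?e = "axis n (1::real) :: real ^ 'n" and ?D = "partial_deriv n f"
 have cf: "continuous_on UNIV f" and cD: "continuous_on UNIV ?D"
  using smooth_continuous[OF f(1)] smooth_continuous[OF smooth_partial[OF f(1)]] .
 obtain R where R: "R > 0" "\<And>x. norm x > R ==> f x = 0" using f(2) by (auto simp: csupp_cball)
 obtain B where B: "B > 0" "\<And>x. norm (?D x) \<le> B"
  using csupp_bounded[OF csupp_partial[OF f(2)] cD] by blast
 define h where "h k = 1 / real (Suc k)" for k
 have h: "h k > 0" "h k \<le> 1" for k by (auto simp: h_def)
 have h0: "h \<longlonglongrightarrow> 0" unfolding h_def by (rule LIMSEQ_Suc[OF lim_1_over_n])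
 let ?q = "%k x. (f (x + h k *\<^sub>R ?e) - f x) / h k"
 \<comment> \<open>Since \<open>h k \<le> 1\<close>, all difference quotients vanish outside the
   ball of radius \<open>R + 1\<close>; inside, the mean value theorem bounds them by the
   derivative.\<close>
 have q: "norm (?q k x) \<le> B * indicator (cball 0 (R + 1)) x" for k x
 proof (cases "norm x \<le> R + 1")
  case True
  obtain s where "f (x + h k *\<^sub>R ?e) - f (x + 0 *\<^sub>R ?e) = (h k - 0) * ?D (x + s *\<^sub>R ?e)"
   using MVT2[OF h(1)[of k], of "%s. f (x + s *\<^sub>R ?e)" "%s. ?D (x + s *\<^sub>R ?e)"] DERIV_line[OF f(1)] by blast
  then have "?q k x = ?D (x + s *\<^sub>R ?e)" using h(1)[of k] by simp
  then show ?thesis using B(2) True by simp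
 next
  case False
  then have "norm x - norm (h k *\<^sub>R ?e) > R" using h[of k] by simp
  then have "norm (x + h k *\<^sub>R ?e) > R" by (smt (verit) norm_diff_ineq)
  then show ?thesis using R False by simp
 qed
 have lim: "(%k. integral\<^sup>L lborel (?q k)) \<longlonglongrightarrow> integral\<^sup>L lborel ?D"
 proof (rule integral_dominated_convergence[where w="%x. B * indicator (cball 0 (R + 1)) x"])
  show "integrable lborel (%x. B * indicator (cball (0::real^'n) (R + 1)) x)"
   by (intro integrable_mult_right integrable_real_indicator) (use emeasure_compact_finite[OF compact_cball, of "0::real^'n" "R + 1"] in \<open>auto simp: top.not_eq_extremum\<close>)
  show "AE x in lborel. (%k. ?q k x) \<longlonglongrightarrow> ?D x"
  proof (intro AE_I2)
   fix x
   have "((%t. (f (x + (0 + t) *\<^sub>R ?e) - f (x + 0 *\<^sub>R ?e)) / t) \<longlongrightarrow> ?D (x + 0 *\<^sub>R ?e)) (at 0)"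
    using DERIV_line[OF f(1), of x n 0] unfolding has_field_derivative_iff by (simp add: )
   then have "((%t. (f (x + t *\<^sub>R ?e) - f x) / t) \<longlongrightarrow> ?D x) (at 0)" by simp
   moreover have "filterlim h (at 0) sequentially"
    using h0 h(1) by (auto simp: filterlim_at less_imp_neq[symmetric] intro!: always_eventually)
   ultimately show "(%k. ?q k x) \<longlonglongrightarrow> ?D x" by (rule filterlim_compose)
  qed
  show "?D \<in> borel_measurable lborel" using cD by (simp add: borel_measurable_continuous_onI)
  show "?q k \<in> borel_measurable lborel" for k
  proof -
   have "continuous_on UNIV (%x. f (x + h k *\<^sub>R ?e))"
    by (rule continuous_on_compose2[OF cf]) (auto intro!: continuous_intros)
   then have "continuous_on UNIV (?q k)" using cf h(1)[of k]
    by (intro continuous_on_divide continuous_on_diff continuous_on_const) auto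
   then show ?thesis by (simp add: borel_measurable_continuous_onI)
  qed
  show "AE x in lborel. norm (?q k x) \<le> B * indicator (cball 0 (R + 1)) x" for k
   using q by (intro AE_I2) blast
 qed
 have i: "integrable lborel f" by (rule integrable_csupp_lborel[OF f(2) cf])
 have tr: "integrable lborel (%x. f (x + h k *\<^sub>R ?e))" "integral\<^sup>L lborel (%x. f (x + h k *\<^sub>R ?e)) = integral\<^sup>L lborel f" for k
 proof -
  have d: "distr lborel borel ((+) (h k *\<^sub>R ?e)) = lborel" by (rule lborel_distr_plus)
  show "integrable lborel (%x. f (x + h k *\<^sub>R ?e))"
   using i integrable_distr[of "(+) (h k *\<^sub>R ?e)" lborel borel f] d by (simp add: add.commute)
  show "integral\<^sup>L lborel (%x. f (x + h k *\<^sub>R ?e)) = integral\<^sup>L lborel f"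
   using integral_distr[of "(+) (h k *\<^sub>R ?e)" lborel borel f] d cf
   by (simp add: add.commute borel_measurable_continuous_onI)
 qed
 have "integral\<^sup>L lborel (?q k) = 0" for k using tr[of k] i by simp
 then have "(%k. 0) \<longlonglongrightarrow> integral\<^sup>L lborel ?D" using lim by (simp only:)
 then have "integral\<^sup>L lborel ?D = 0" by (simp add: LIMSEQ_const_iff)
 then show ?thesis using cD by (simp add: integral_completion borel_measurable_continuous_onI)
qed

lemma integral_by_parts:
 fixes f g :: "real ^ 'n::finite => 'b::euclidean_space"
 assumes f: "smooth f" and g: "smooth g" and s: "csupp f \<or> csupp g"
 shows "integral\<^sup>L lebesgue (%x. partial_deriv n f x \<bullet> g x) = - integral\<^sup>L lebesgue (%x. f x \<bullet> partial_deriv n g x)"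
proof -
 have 1: "csupp (%x. f x \<bullet> g x)" "csupp (%x. f x \<bullet> partial_deriv n g x)" "csupp (%x. partial_deriv n f x \<bullet> g x)"
  using s csupp_partial[of f n] csupp_partial[of g n] by (auto intro: csupp_inner1 csupp_inner2)
 have c: "integrable lebesgue (%x. f x \<bullet> partial_deriv n g x)" "integrable lebesgue (%x. partial_deriv n f x \<bullet> g x)"
  by (intro integrable_csupp 1 continuous_intros smooth_continuous smooth_partial f g)+
 have "integral\<^sup>L lebesgue (partial_deriv n (%x. f x \<bullet> g x)) = 0"
  by (rule integral_partial_zero) (use f g 1 in \<open>auto intro: Ck_inner\<close>)
 moreover have "partial_deriv n (%x. f x \<bullet> g x) = (%x. f x \<bullet> partial_deriv n g x + partial_deriv n f x \<bullet> g x)"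
  using partial_deriv_bilinear[OF bounded_bilinear_inner f g] by blast
 ultimately show ?thesis using c by simp
qed

section \<open>Rotation, divergence and Laplacian of smooth forms\<close>

definition grad :: "(real ^ 'n::finite => real) => real ^ 'n => real ^ 'n" where
 "grad \<phi> x = (\<chi> n. partial_deriv n \<phi> x)"

text \<open>Contraction with the vector \<open>p\<close>, the adjoint of \<open>R_op p\<close>. For
  \<open>p = grad \<phi> x\<close> these two operators are the commutators of a cut-off
  \<open>\<phi>\<close> with divergence and rotation.\<close>

definition ctr :: "real ^ 'n::{finite,linorder} => 'n alg => 'n alg" where
 "ctr p v = (\<Sum>n\<in>UNIV. (p $ n) *\<^sub>R contr n v)"

text \<open>The divergence with the Hodge stars eliminated; unlike \<open>co_d\<close> it does not
  depend on a rank.\<close>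

definition codd :: "('n::{finite,linorder}) form => 'n form" where
 "codd \<Psi> x = (\<Sum>n\<in>UNIV. contr n (partial_deriv n \<Psi> x))"

definition lap :: "(real ^ 'n::finite => 'b::real_normed_vector) => real ^ 'n => 'b" where
 "lap \<Psi> x = (\<Sum>n\<in>UNIV. partial_deriv n (partial_deriv n \<Psi>) x)"

lemma R_op_adjoint: "R_op p u \<bullet> v = u \<bullet> ctr p v"
 by (simp add: R_op_def ctr_def inner_sum_left inner_sum_right wedge1_adjoint)

lemma linear_R_op: "linear (R_op p)" and linear_ctr: "linear (ctr p)"
 by (auto intro!: linearI simp: R_op_def ctr_def wedge1_add contr_add wedge1_scaleR contr_scaleR
   scaleR_sum_right sum.distrib scaleR_add_right algebra_simps)

lemma R_op_alt: "v \<in> alt q ==> R_op p v \<in> alt (q + 1)"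
 and ctr_alt: "v \<in> alt q ==> ctr p v \<in> alt (q - 1)"
 by (auto simp: R_op_def ctr_def intro!: alt_sum alt_scaleR wedge1_alt contr_alt)

lemma norm_R_op: "norm (R_op p v) \<le> (\<Sum>n\<in>UNIV. \<bar>p $ n\<bar>) * norm v"
 and norm_ctr: "norm (ctr p v) \<le> (\<Sum>n\<in>UNIV. \<bar>p $ n\<bar>) * norm v"
 unfolding R_op_def ctr_def sum_distrib_right
 by (auto intro!: order_trans[OF norm_sum] sum_mono mult_left_mono norm_wedge1 norm_contr)

lemma smooth_ext_d: "smooth \<Phi> ==> smooth (ext_d \<Phi>)" and smooth_codd: "smooth \<Phi> ==> smooth (codd \<Phi>)"
proof -
 assume "smooth \<Phi>"
 then have p: "Ck_on k UNIV (partial_deriv n \<Phi>)" for n k using smooth_partial by blast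
 show "smooth (ext_d \<Phi>)" "smooth (codd \<Phi>)" unfolding ext_d_def[abs_def] codd_def[abs_def]
  by (intro allI Ck_sum Ck_linear[OF bounded_linear_wedge1] Ck_linear[OF bounded_linear_contr] p)+
qed

lemma smooth_lap: "smooth \<Phi> ==> smooth (lap \<Phi>)"
 unfolding lap_def[abs_def] by (intro allI Ck_sum) (metis smooth_partial)

lemma ext_d_scaleR:
 assumes "smooth \<phi>" "smooth \<Phi>"
 shows "ext_d (%x. \<phi> x *\<^sub>R \<Phi> x) x = \<phi> x *\<^sub>R ext_d \<Phi> x + R_op (grad \<phi> x) (\<Phi> x)"
 and "codd (%x. \<phi> x *\<^sub>R \<Phi> x) x = \<phi> x *\<^sub>R codd \<Phi> x + ctr (grad \<phi> x) (\<Phi> x)"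
 unfolding ext_d_def codd_def partial_deriv_bilinear[OF bounded_bilinear_scaleR assms]
 by (auto simp: R_op_def ctr_def grad_def wedge1_add wedge1_scaleR contr_add contr_scaleR sum.distrib scaleR_sum_right)

lemma ext_d_lincomb: "smooth \<Phi> ==> smooth \<Psi> ==> ext_d (%x. a *\<^sub>R \<Phi> x + \<Psi> x) x = a *\<^sub>R ext_d \<Phi> x + ext_d \<Psi> x"
 by (subst ext_d_def, subst partial_deriv_add)
  (auto simp: partial_deriv_linear[OF bounded_linear_scaleR_right] ext_d_def wedge1_add wedge1_scaleR
   sum.distrib scaleR_sum_right intro: Ck_linear[OF bounded_linear_scaleR_right])

lemma codd_lincomb: "smooth \<Phi> ==> smooth \<Psi> ==> codd (%x. a *\<^sub>R \<Phi> x + \<Psi> x) x = a *\<^sub>R codd \<Phi> x + codd \<Psi> x"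
 by (subst codd_def, subst partial_deriv_add)
  (auto simp: partial_deriv_linear[OF bounded_linear_scaleR_right] codd_def contr_add contr_scaleR
   sum.distrib scaleR_sum_right intro: Ck_linear[OF bounded_linear_scaleR_right])

lemma antisym_sum_zero:
 fixes T :: "'i::finite => 'i => 'v::real_vector"
 assumes "\<And>n m. T n m = - T m n"
 shows "(\<Sum>n\<in>UNIV. \<Sum>m\<in>UNIV. T n m) = 0"
proof -
 have "(\<Sum>n\<in>UNIV. \<Sum>m\<in>UNIV. T n m) = (\<Sum>n\<in>UNIV. \<Sum>m\<in>UNIV. - T m n)"
  by (intro sum.cong refl assms)
 also have "\<dots> = - (\<Sum>n\<in>UNIV. \<Sum>m\<in>UNIV. T n m)"
  by (subst sum.swap) (simp add: sum_negf)
 finally show ?thesis by (metis equation_minus_iff neg_equal_zero scaleR_half_double scaleR_zero_right add_eq_0_iff)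
qed

lemma partial_deriv_ext_d:
 assumes "smooth \<Phi>"
 shows "partial_deriv n (ext_d \<Phi>) x = (\<Sum>m\<in>UNIV. wedge1 m (partial_deriv n (partial_deriv m \<Phi>) x))"
  and "partial_deriv n (codd \<Phi>) x = (\<Sum>m\<in>UNIV. contr m (partial_deriv n (partial_deriv m \<Phi>) x))"
 unfolding ext_d_def[abs_def] codd_def[abs_def]
 by (subst partial_deriv_sum,
   use smooth_partial[OF assms] in \<open>auto intro: Ck_linear[OF bounded_linear_wedge1] Ck_linear[OF bounded_linear_contr]
    simp: partial_deriv_linear[OF bounded_linear_wedge1] partial_deriv_linear[OF bounded_linear_contr]\<close>)+

text \<open>Second derivatives are symmetric while the algebraic factors anticommute, so the double
  sums cancel in pairs.\<close>

lemma ext_d_ext_d: "smooth \<Phi> ==> ext_d (ext_d \<Phi>) x = 0"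
 and codd_codd: "smooth \<Phi> ==> codd (codd \<Phi>) x = 0"
proof -
 assume s: "smooth \<Phi>"
 have "ext_d (ext_d \<Phi>) x = (\<Sum>n\<in>UNIV. \<Sum>m\<in>UNIV. wedge1 n (wedge1 m (partial_deriv n (partial_deriv m \<Phi>) x)))"
  by (simp add: ext_d_def[of "ext_d \<Phi>"] partial_deriv_ext_d[OF s] linear_sum[OF linear_wedge1])
 also have "\<dots> = 0"
  by (rule antisym_sum_zero, subst wedge1_wedge1, subst mixed_partials[OF s]) (rule refl)
 finally show "ext_d (ext_d \<Phi>) x = 0" .
 have "codd (codd \<Phi>) x = (\<Sum>n\<in>UNIV. \<Sum>m\<in>UNIV. contr n (contr m (partial_deriv n (partial_deriv m \<Phi>) x)))"
  by (simp add: codd_def[of "codd \<Phi>"] partial_deriv_ext_d[OF s] linear_sum[OF linear_contr])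
 also have "\<dots> = 0"
  by (rule antisym_sum_zero, subst contr_contr, subst mixed_partials[OF s]) (rule refl)
 finally show "codd (codd \<Phi>) x = 0" .
qed

text \<open>By the anticommutation relation all mixed terms cancel. Since \<open>codd\<close> is
  minus the formal adjoint of \<open>ext_d\<close>, the result is the usual Laplacian without a
  sign.\<close>

lemma hodge_laplacian:
 assumes s: "smooth \<Phi>"
 shows "ext_d (codd \<Phi>) x + codd (ext_d \<Phi>) x = lap \<Phi> x"
proof -
 have 1: "ext_d (codd \<Phi>) x = (\<Sum>n\<in>UNIV. \<Sum>m\<in>UNIV. wedge1 n (contr m (partial_deriv n (partial_deriv m \<Phi>) x)))"
  by (simp add: ext_d_def[of "codd \<Phi>"] partial_deriv_ext_d[OF s] linear_sum[OF linear_wedge1])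
 have "codd (ext_d \<Phi>) x = (\<Sum>n\<in>UNIV. \<Sum>m\<in>UNIV. contr n (wedge1 m (partial_deriv n (partial_deriv m \<Phi>) x)))"
  by (simp add: codd_def[of "ext_d \<Phi>"] partial_deriv_ext_d[OF s] linear_sum[OF linear_contr])
 also have "\<dots> = (\<Sum>n\<in>UNIV. \<Sum>m\<in>UNIV. contr m (wedge1 n (partial_deriv n (partial_deriv m \<Phi>) x)))"
  by (subst sum.swap, subst mixed_partials[OF s]) (rule refl)
 finally have "ext_d (codd \<Phi>) x + codd (ext_d \<Phi>) x =
   (\<Sum>n\<in>UNIV. \<Sum>m\<in>UNIV. if n = m then partial_deriv n (partial_deriv m \<Phi>) x else 0)"
  by (simp add: 1 sum.distrib[symmetric] wedge1_contr)
 then show ?thesis by (simp add: lap_def)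
qed

lemma ext_d_by_parts:
 assumes s: "smooth \<Phi>" "smooth \<Psi>" and c: "csupp \<Phi> \<or> csupp \<Psi>"
 shows "integral\<^sup>L lebesgue (%x. ext_d \<Phi> x \<bullet> \<Psi> x) = - integral\<^sup>L lebesgue (%x. \<Phi> x \<bullet> codd \<Psi> x)"
proof -
 have sc: "smooth (%x. contr n (\<Psi> x))" for n using s(2) Ck_linear[OF bounded_linear_contr] by blast
 have cc: "csupp \<Psi> ==> csupp (%x. contr n (\<Psi> x))" for n
  by (erule csupp_mono) (simp add: linear_0[OF linear_contr])
 have pd: "partial_deriv n (%x. contr n (\<Psi> x)) x = contr n (partial_deriv n \<Psi> x)" for n x
  by (rule partial_deriv_linear[OF bounded_linear_contr s(2)])
 have i1: "integrable lebesgue (%x. partial_deriv n \<Phi> x \<bullet> contr n (\<Psi> x))" for n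
  using c cc[of n] csupp_partial[of \<Phi> n]
  by (intro integrable_csupp continuous_intros smooth_continuous smooth_partial s sc) (auto intro: csupp_inner1 csupp_inner2)
 have i2: "integrable lebesgue (%x. \<Phi> x \<bullet> contr n (partial_deriv n \<Psi> x))" for n
  unfolding pd[symmetric] using c cc[of n] csupp_partial[of "%x. contr n (\<Psi> x)" n]
  by (intro integrable_csupp continuous_intros smooth_continuous smooth_partial s sc) (auto intro: csupp_inner1 csupp_inner2)
 have "integral\<^sup>L lebesgue (%x. ext_d \<Phi> x \<bullet> \<Psi> x) = (\<Sum>n\<in>UNIV. integral\<^sup>L lebesgue (%x. partial_deriv n \<Phi> x \<bullet> contr n (\<Psi> x)))"
  using i1 by (simp add: ext_d_def inner_sum_left wedge1_adjoint)
 also have "\<dots> = (\<Sum>n\<in>UNIV. - integral\<^sup>L lebesgue (%x. \<Phi> x \<bullet> contr n (partial_deriv n \<Psi> x)))"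
  using integral_by_parts[OF s(1) sc] c cc pd by (intro sum.cong refl) auto
 also have "\<dots> = - integral\<^sup>L lebesgue (%x. \<Phi> x \<bullet> codd \<Psi> x)"
  using i2 by (simp add: codd_def inner_sum_right sum_negf)
 finally show ?thesis .
qed

lemma lap_by_parts:
 fixes f g :: "real ^ 'n::finite => 'b::euclidean_space"
 assumes s: "smooth f" "smooth g" and c: "csupp f"
 shows "integral\<^sup>L lebesgue (%x. f x \<bullet> lap g x) = - (\<Sum>n\<in>UNIV. integral\<^sup>L lebesgue (%x. partial_deriv n f x \<bullet> partial_deriv n g x))"
proof -
 have i: "integrable lebesgue (%x. f x \<bullet> partial_deriv n (partial_deriv n g) x)" for n
  by (intro integrable_csupp continuous_intros smooth_continuous smooth_partial s csupp_mono[OF c]) auto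
 have "integral\<^sup>L lebesgue (%x. f x \<bullet> lap g x) = (\<Sum>n\<in>UNIV. integral\<^sup>L lebesgue (%x. f x \<bullet> partial_deriv n (partial_deriv n g) x))"
  using i by (simp add: lap_def inner_sum_right)
 also have "\<dots> = (\<Sum>n\<in>UNIV. - integral\<^sup>L lebesgue (%x. partial_deriv n f x \<bullet> partial_deriv n g x))"
  using integral_by_parts[OF s(1) smooth_partial[OF s(2)]] c by (intro sum.cong refl) simp
 finally show ?thesis by (simp add: sum_negf)
qed

section \<open>Completeness and the Riesz theorem for square integrable functions\<close>

text \<open>Measure and Euclidean target are left general: the same Hilbert space facts are used for
  forms, for gradient fields and for pairs of forms.\<close>

definition sq :: "'a measure => ('a => 'b::euclidean_space) => bool" where
 "sq M u \<longleftrightarrow> u \<in> borel_measurable M \<and> integrable M (%x. (norm (u x))\<^sup>2)"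

definition nrm :: "'a measure => ('a => 'b::euclidean_space) => real" where
 "nrm M u = sqrt (integral\<^sup>L M (%x. (norm (u x))\<^sup>2))"

definition ip :: "'a measure => ('a => 'b::euclidean_space) => ('a => 'b) => real" where
 "ip M u v = integral\<^sup>L M (%x. u x \<bullet> v x)"

lemma sq_measurable: "sq M u ==> u \<in> borel_measurable M" by (simp add: sq_def)
lemma sq_integrable: "sq M u ==> integrable M (%x. (norm (u x))\<^sup>2)" by (simp add: sq_def)

lemma nrm_nonneg [simp]: "0 \<le> nrm M u" by (simp add: nrm_def)

lemma nrm_sq: "(nrm M u)\<^sup>2 = integral\<^sup>L M (%x. (norm (u x))\<^sup>2)" by (simp add: nrm_def)

lemma nrm_ip: "(nrm M u)\<^sup>2 = ip M u u" by (simp add: nrm_sq ip_def power2_norm_eq_inner)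

lemma sq_dom:
 assumes "sq M v" "u \<in> borel_measurable M" "AE x in M. norm (u x) \<le> C * norm (v x)"
 shows "sq M u" "C \<ge> 0 ==> nrm M u \<le> C * nrm M v"
proof -
 have le: "AE x in M. (norm (u x))\<^sup>2 \<le> C\<^sup>2 * (norm (v x))\<^sup>2"
  using assms(3) by eventually_elim (metis norm_ge_zero power_mono power_mult_distrib)
 have "integrable M (%x. (norm (u x))\<^sup>2)"
 proof (rule Bochner_Integration.integrable_bound[of M "%x. C\<^sup>2 * (norm (v x))\<^sup>2"])
  show "integrable M (%x. C\<^sup>2 * (norm (v x))\<^sup>2)" using assms(1) by (simp add: sq_def)
  show "(%x. (norm (u x))\<^sup>2) \<in> borel_measurable M" using assms(2) by measurable
  show "AE x in M. norm ((norm (u x))\<^sup>2) \<le> norm (C\<^sup>2 * (norm (v x))\<^sup>2)" using le by eventually_elim simp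
 qed
 then show s: "sq M u" using assms(2) by (simp add: sq_def)
 assume C: "C \<ge> 0"
 have "(nrm M u)\<^sup>2 \<le> integral\<^sup>L M (%x. C\<^sup>2 * (norm (v x))\<^sup>2)"
  unfolding nrm_sq using le s assms(1) by (intro integral_mono_AE) (auto simp: sq_def)
 also have "\<dots> = (C * nrm M v)\<^sup>2" by (simp add: nrm_sq power_mult_distrib)
 finally show "nrm M u \<le> C * nrm M v" by (rule power2_le_imp_le) (simp add: C)
qed

lemma sq_cong_AE:
 assumes "sq M u" "v \<in> borel_measurable M" "AE x in M. u x = v x" shows "sq M v"
 by (rule sq_dom(1)[OF assms(1,2), of 1]) (use assms(3) in \<open>eventually_elim, simp\<close>)

lemma nrm_cong_AE:
 assumes "sq M u" "v \<in> borel_measurable M" "AE x in M. u x = v x" shows "nrm M u = nrm M v"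
 unfolding nrm_def using assms
 by (intro arg_cong[where f=sqrt] integral_cong_AE) (auto simp: sq_def elim: AE_mp)

lemma sq_zero [simp]: "sq M (%x. 0)" and nrm_zero [simp]: "nrm M (%x. 0) = 0"
 by (auto simp: sq_def nrm_def)

lemma sq_scaleR: "sq M u ==> sq M (%x. c *\<^sub>R u x)"
 by (auto simp: sq_def power_mult_distrib)

lemma nrm_scaleR: "nrm M (%x. c *\<^sub>R u x) = \<bar>c\<bar> * nrm M u"
 by (simp add: nrm_def power_mult_distrib real_sqrt_mult)

lemma sq_minus: "sq M u ==> sq M (%x. - u x)"
 by (auto simp: sq_def)

lemma sq_add: assumes "sq M u" "sq M v" shows "sq M (%x. u x + v x)"
proof -
 have "integrable M (%x. (norm (u x + v x))\<^sup>2)"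
 proof (rule Bochner_Integration.integrable_bound[of M "%x. 2 * (norm (u x))\<^sup>2 + 2 * (norm (v x))\<^sup>2"])
  show "integrable M (%x. 2 * (norm (u x))\<^sup>2 + 2 * (norm (v x))\<^sup>2)" using assms by (simp add: sq_def)
  show "(%x. (norm (u x + v x))\<^sup>2) \<in> borel_measurable M" using assms by (auto simp: sq_def)
  have "(norm (u x + v x))\<^sup>2 \<le> 2 * (norm (u x))\<^sup>2 + 2 * (norm (v x))\<^sup>2" for x
  proof -
   have "(norm (u x + v x))\<^sup>2 \<le> (norm (u x) + norm (v x))\<^sup>2" by (intro power_mono norm_triangle_ineq) auto
   also have "\<dots> \<le> 2 * (norm (u x))\<^sup>2 + 2 * (norm (v x))\<^sup>2"
    using sum_squares_bound[of "norm (u x)" "norm (v x)"] by (simp add: power2_sum)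
   finally show ?thesis .
  qed
  then show "AE x in M. norm ((norm (u x + v x))\<^sup>2) \<le> norm (2 * (norm (u x))\<^sup>2 + 2 * (norm (v x))\<^sup>2)" by simp
 qed
 then show ?thesis using assms by (auto simp: sq_def)
qed

lemma sq_diff: "sq M u ==> sq M v ==> sq M (%x. u x - v x)"
 using sq_add[OF _ sq_minus, of M u v] by simp

lemma sq_inner: assumes "sq M u" "sq M v" shows "integrable M (%x. u x \<bullet> v x)"
proof (rule Bochner_Integration.integrable_bound[of M "%x. (norm (u x))\<^sup>2 + (norm (v x))\<^sup>2"])
 show "integrable M (%x. (norm (u x))\<^sup>2 + (norm (v x))\<^sup>2)" using assms by (simp add: sq_def)
 show "(%x. u x \<bullet> v x) \<in> borel_measurable M" using assms by (auto simp: sq_def)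
 have "\<bar>u x \<bullet> v x\<bar> \<le> (norm (u x))\<^sup>2 + (norm (v x))\<^sup>2" for x
  using Cauchy_Schwarz_ineq2[of "u x" "v x"] sum_squares_bound[of "norm (u x)" "norm (v x)"]
   mult_nonneg_nonneg[OF norm_ge_zero[of "u x"] norm_ge_zero[of "v x"]] by linarith
 then show "AE x in M. norm (u x \<bullet> v x) \<le> norm ((norm (u x))\<^sup>2 + (norm (v x))\<^sup>2)" by simp
qed

lemma ip_commute: "ip M u v = ip M v u" by (simp add: ip_def inner_commute)
lemma ip_add_left: "sq M u ==> sq M v ==> sq M w ==> ip M (%x. u x + v x) w = ip M u w + ip M v w"
 by (simp add: ip_def inner_add_left sq_inner)
lemma ip_diff_left: "sq M u ==> sq M v ==> sq M w ==> ip M (%x. u x - v x) w = ip M u w - ip M v w"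
 by (simp add: ip_def inner_diff_left sq_inner)
lemma ip_scaleR_left: "ip M (%x. c *\<^sub>R u x) w = c * ip M u w" by (simp add: ip_def)
lemma ip_add_right: "sq M u ==> sq M v ==> sq M w ==> ip M w (%x. u x + v x) = ip M w u + ip M w v"
 by (simp add: ip_def inner_add_right sq_inner)
lemma ip_diff_right: "sq M u ==> sq M v ==> sq M w ==> ip M w (%x. u x - v x) = ip M w u - ip M w v"
 by (simp add: ip_def inner_diff_right sq_inner)
lemma ip_scaleR_right: "ip M w (%x. c *\<^sub>R u x) = c * ip M w u" by (simp add: ip_def)

lemma nrm_add_sq: "sq M u ==> sq M v ==> (nrm M (%x. u x + v x))\<^sup>2 = (nrm M u)\<^sup>2 + 2 * ip M u v + (nrm M v)\<^sup>2"
 by (simp add: nrm_ip ip_add_left ip_add_right sq_add ip_commute[of M v u])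
lemma nrm_diff_sq: "sq M u ==> sq M v ==> (nrm M (%x. u x - v x))\<^sup>2 = (nrm M u)\<^sup>2 - 2 * ip M u v + (nrm M v)\<^sup>2"
 by (simp add: nrm_ip ip_diff_left ip_diff_right sq_diff ip_commute[of M v u])

lemma nrm_eq_0:
 assumes "sq M u" "nrm M u = 0" shows "AE x in M. u x = 0"
proof -
 have "integral\<^sup>L M (%x. (norm (u x))\<^sup>2) = 0" using assms(2) nrm_sq[of M u] by simp
 then have "AE x in M. (norm (u x))\<^sup>2 = 0"
  using integral_nonneg_eq_0_iff_AE[OF sq_integrable[OF assms(1)]] by simp
 then show ?thesis by eventually_elim simp
qed

lemma ip_CS: assumes "sq M u" "sq M v" shows "\<bar>ip M u v\<bar> \<le> nrm M u * nrm M v"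
proof (cases "nrm M u = 0 \<or> nrm M v = 0")
 case True
 then have "AE x in M. u x \<bullet> v x = 0"
  using nrm_eq_0[OF assms(1)] nrm_eq_0[OF assms(2)] by (auto elim: AE_mp)
 then have "ip M u v = 0" unfolding ip_def by (rule integral_eq_zero_AE)
 then show ?thesis by simp
next
 case False
 let ?a = "nrm M u" and ?b = "nrm M v"
 have pos: "?a > 0" "?b > 0" using False by (auto simp: less_le)
 have sb: "sq M (%x. ?b *\<^sub>R u x)" and sa: "sq M (%x. ?a *\<^sub>R v x)" by (intro sq_scaleR assms)+
 \<comment> \<open>Scaling each function by the norm of the other gives both the same norm; the
   square of the difference bounds the product from above, that of the sum from below.\<close>
 have "0 \<le> (nrm M (%x. ?b *\<^sub>R u x - ?a *\<^sub>R v x))\<^sup>2" "0 \<le> (nrm M (%x. ?b *\<^sub>R u x + ?a *\<^sub>R v x))\<^sup>2" by auto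
 then have "0 \<le> (?b * ?a)\<^sup>2 - 2 * (?b * (?a * ip M u v)) + (?a * ?b)\<^sup>2" "0 \<le> (?b * ?a)\<^sup>2 + 2 * (?b * (?a * ip M u v)) + (?a * ?b)\<^sup>2"
  unfolding nrm_diff_sq[OF sb sa] nrm_add_sq[OF sb sa] by (simp_all add: nrm_scaleR ip_scaleR_left ip_scaleR_right)
 then have "0 \<le> (?a * ?b) * (?a * ?b - ip M u v)" "0 \<le> (?a * ?b) * (?a * ?b + ip M u v)"
  by (simp_all add: power2_eq_square algebra_simps)
 moreover have "?a * ?b > 0" using pos by simp
 ultimately have "0 \<le> ?a * ?b - ip M u v" "0 \<le> ?a * ?b + ip M u v"
  using zero_le_mult_iff[of "?a * ?b"] by (smt (verit))+
 then show ?thesis by simp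
qed

lemma nrm_triangle: assumes "sq M u" "sq M v" shows "nrm M (%x. u x + v x) \<le> nrm M u + nrm M v"
proof (rule power2_le_imp_le)
 show "(nrm M (%x. u x + v x))\<^sup>2 \<le> (nrm M u + nrm M v)\<^sup>2"
  using ip_CS[OF assms] by (simp add: nrm_add_sq assms power2_sum)
qed auto

lemma nrm_minus: "nrm M (%x. - u x) = nrm M u" by (simp add: nrm_def)

lemma nrm_minus_commute: "nrm M (%x. u x - v x) = nrm M (%x. v x - u x)"
 by (simp add: nrm_def norm_minus_commute)

lemma nrm_triangle_diff: "sq M u ==> sq M v ==> nrm M (%x. u x - v x) \<le> nrm M u + nrm M v"
 using nrm_triangle[OF _ sq_minus, of M u v] by (simp add: nrm_minus)

lemma nrm_triangle3:
 assumes "sq M u" "sq M v" "sq M w"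
 shows "nrm M (%x. u x - w x) \<le> nrm M (%x. u x - v x) + nrm M (%x. v x - w x)"
 using nrm_triangle[OF sq_diff[OF assms(1,2)] sq_diff[OF assms(2,3)]] by simp

lemma ip_tendsto:
 assumes "\<And>k. sq M (u k)" "sq M p" "sq M v" "(%k. nrm M (%x. u k x - p x)) \<longlonglongrightarrow> 0"
 shows "(%k. ip M (u k) v) \<longlonglongrightarrow> ip M p v"
proof -
 have "(%k. ip M (u k) v - ip M p v) \<longlonglongrightarrow> 0"
 proof (rule Lim_null_comparison)
  show "\<forall>\<^sub>F k in sequentially. norm (ip M (u k) v - ip M p v) \<le> nrm M (%x. u k x - p x) * nrm M v"
   using ip_CS[OF sq_diff[OF assms(1,2)] assms(3)] assms by (simp add: ip_diff_left)
  show "(%k. nrm M (%x. u k x - p x) * nrm M v) \<longlonglongrightarrow> 0"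
   using tendsto_mult_left_zero[OF assms(4)] by simp
 qed
 then show ?thesis by (simp add: LIM_zero_iff)
qed

lemma sq_limit_unique:
 assumes "\<And>k. sq M (u k)" "sq M p" "sq M p'"
  "(%k. nrm M (%x. u k x - p x)) \<longlonglongrightarrow> 0" "(%k. nrm M (%x. u k x - p' x)) \<longlonglongrightarrow> 0"
 shows "AE x in M. p x = p' x"
proof -
 have "nrm M (%x. p x - p' x) \<le> nrm M (%x. u k x - p x) + nrm M (%x. u k x - p' x)" for k
  using nrm_triangle3[OF assms(2) assms(1)[of k] assms(3)] by (simp add: nrm_minus_commute[of M p])
 then have "nrm M (%x. p x - p' x) \<le> 0"
  using LIMSEQ_le_const[OF tendsto_add[OF assms(4,5)]] by simp
 then have "nrm M (%x. p x - p' x) = 0" by (simp add: antisym)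
 from nrm_eq_0[OF sq_diff[OF assms(2,3)] this] show ?thesis by eventually_elim simp
qed

text \<open>Fatou's lemma: the bound on the norms survives a pointwise limit even without a
  dominating function.\<close>

lemma fatou_sq:
 assumes v: "\<And>k. sq M (v k)" "\<And>k. nrm M (v k) \<le> e" and w: "w \<in> borel_measurable M"
  and l: "AE x in M. (%k. v k x) \<longlonglongrightarrow> w x"
 shows "sq M w \<and> nrm M w \<le> e"
proof -
 have e: "e \<ge> 0" using v(2)[of 0] nrm_nonneg order_trans by blast
 have nn: "(\<integral>\<^sup>+x. ennreal ((norm (v k x))\<^sup>2) \<partial>M) \<le> ennreal (e\<^sup>2)" for k
  using v power_mono[OF v(2), of k 2] by (simp add: nn_integral_eq_integral sq_def nrm_sq ennreal_leI)
 have "(\<integral>\<^sup>+x. ennreal ((norm (w x))\<^sup>2) \<partial>M) = (\<integral>\<^sup>+x. liminf (%k. ennreal ((norm (v k x))\<^sup>2)) \<partial>M)"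
 proof (rule nn_integral_cong_AE)
  show "AE x in M. ennreal ((norm (w x))\<^sup>2) = liminf (%k. ennreal ((norm (v k x))\<^sup>2))"
   using l
  proof eventually_elim
   case (elim x)
   then have "(%k. ennreal ((norm (v k x))\<^sup>2)) \<longlonglongrightarrow> ennreal ((norm (w x))\<^sup>2)"
    by (intro tendsto_ennrealI tendsto_intros)
   then show ?case using lim_imp_Liminf[OF sequentially_bot] by metis
  qed
 qed
 also have "\<dots> \<le> liminf (%k. \<integral>\<^sup>+x. ennreal ((norm (v k x))\<^sup>2) \<partial>M)"
  using v by (intro nn_integral_liminf) (auto simp: sq_def)
 also have "\<dots> \<le> limsup (%k. \<integral>\<^sup>+x. ennreal ((norm (v k x))\<^sup>2) \<partial>M)" by (intro Liminf_le_Limsup) auto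
 also have "\<dots> \<le> ennreal (e\<^sup>2)" by (intro Limsup_bounded) (auto intro: nn always_eventually)
 finally have fin: "(\<integral>\<^sup>+x. ennreal ((norm (w x))\<^sup>2) \<partial>M) \<le> ennreal (e\<^sup>2)" .
 have "integrable M (%x. (norm (w x))\<^sup>2)"
  using w fin by (intro integrableI_nonneg) (auto intro: le_less_trans)
 then have s: "sq M w" using w by (simp add: sq_def)
 then have "(nrm M w)\<^sup>2 \<le> e\<^sup>2" using fin e
  by (simp add: nn_integral_eq_integral sq_def nrm_sq ennreal_le_iff)
 then show ?thesis using s e power2_le_imp_le by blast
qed

text \<open>Riesz-Fischer with a pointwise constraint. In the applications \<open>W\<close> fixes
  the rank of a form: membership in the spaces asks for the rank at every point, so an almost
  everywhere statement would not do.\<close>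

lemma L2_complete:
 assumes f: "\<And>k. sq M (f k)" and C: "\<And>e. e > 0 ==> \<exists>K. \<forall>m\<ge>K. \<forall>n\<ge>K. nrm M (%x. f m x - f n x) < e"
  and W: "closed W" "0 \<in> W" "\<And>k x. x \<in> space M ==> f k x \<in> W"
 shows "\<exists>p. sq M p \<and> (\<forall>x\<in>space M. p x \<in> W) \<and> (%k. nrm M (%x. f k x - p x)) \<longlonglongrightarrow> 0"
proof -
 have "\<exists>r. \<forall>k. (\<forall>m\<ge>r k. \<forall>n\<ge>r k. nrm M (%x. f m x - f n x) < (1/2)^k) \<and> r k < r (Suc k)"
 proof (rule dependent_nat_choice)
  show "\<exists>x. \<forall>m\<ge>x. \<forall>n\<ge>x. nrm M (%x. f m x - f n x) < (1/2)^0" using C[of 1] by simp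
  fix x k
  obtain K where "\<forall>m\<ge>K. \<forall>n\<ge>K. nrm M (%x. f m x - f n x) < (1/2)^(Suc k)" using C[of "(1/2)^(Suc k)"] by auto
  then show "\<exists>y. (\<forall>m\<ge>y. \<forall>n\<ge>y. nrm M (%x. f m x - f n x) < (1/2)^(Suc k)) \<and> x < y"
   by (intro exI[of _ "max K (Suc x)"]) auto
 qed
 then obtain r where r: "\<And>k m n. m \<ge> r k ==> n \<ge> r k ==> nrm M (%x. f m x - f n x) < (1/2)^k"
  and rs: "\<And>k. r k < r (Suc k)" by blast
 have sm: "strict_mono r" using rs by (simp add: strict_mono_Suc_iff)
 define d where "d k x = f (r (Suc k)) x - f (r k) x" for k x
 have dsq: "sq M (d k)" for k unfolding d_def by (intro sq_diff f)
 have dn: "(nrm M (d k))\<^sup>2 \<le> (1/4)^k" for k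
 proof -
  have "nrm M (d k) \<le> (1/2)^k" unfolding d_def using r[of k "r (Suc k)" "r k"] rs[of k] by simp
  then have "(nrm M (d k))\<^sup>2 \<le> ((1/2)^k)\<^sup>2" by (intro power_mono) auto
  also have "\<dots> = (1/4)^k" by (simp add: power2_eq_square power_mult_distrib[symmetric])
  finally show ?thesis .
 qed
 have dm [measurable]: "d k \<in> borel_measurable M" for k using dsq by (simp add: sq_def)
 \<comment> \<open>The factor \<open>2^k\<close> still leaves a convergent sum of integrals, since
   the squared norms are at most \<open>(1/4)^k\<close>. Finiteness of the sum at a point gives
   increments of order 2^(- k / 2) there, hence convergence.\<close>
 let ?h = "%x. \<Sum>k. ennreal (2^k * (norm (d k x))\<^sup>2)"
 have "(\<integral>\<^sup>+x. ?h x \<partial>M) = (\<Sum>k. \<integral>\<^sup>+x. ennreal (2^k * (norm (d k x))\<^sup>2) \<partial>M)"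
  using dm by (intro nn_integral_suminf) simp
 also have "\<dots> = (\<Sum>k. ennreal (2^k * (nrm M (d k))\<^sup>2))"
  using dsq by (simp add: nn_integral_eq_integral sq_def nrm_sq)
 also have "\<dots> \<le> (\<Sum>k. ennreal ((1/2)^k))"
 proof (intro suminf_le summableI ennreal_leI)
  fix k
  have "2^k * (nrm M (d k))\<^sup>2 \<le> 2^k * (1/4)^k" using dn by (intro mult_left_mono) auto
  also have "\<dots> = (1/2::real)^k" by (simp add: power_mult_distrib[symmetric])
  finally show "2^k * (nrm M (d k))\<^sup>2 \<le> (1/2)^k" .
 qed
 also have "\<dots> = ennreal (\<Sum>k. (1/2)^k)" by (intro suminf_ennreal2) (auto intro: summable_geometric)
 finally have "(\<integral>\<^sup>+x. ?h x \<partial>M) \<noteq> \<infinity>" by (auto simp: top_unique)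
 then have fin: "AE x in M. ?h x \<noteq> \<infinity>"
  by (intro nn_integral_PInf_AE) simp_all
 have conv: "AE x in M. convergent (%k. f (r k) x)"
  using fin
 proof eventually_elim
  case (elim x)
  then have "summable (%k. 2^k * (norm (d k x))\<^sup>2)"
   by (intro summable_suminf_not_top) auto
  then have "(%k. 2^k * (norm (d k x))\<^sup>2) \<longlonglongrightarrow> 0" by (rule summable_LIMSEQ_zero)
  then have "Bseq (%k. 2^k * (norm (d k x))\<^sup>2)" by (meson convergentI convergent_imp_Bseq)
  then obtain c where c: "c > 0" "\<And>k. norm (2^k * (norm (d k x))\<^sup>2) \<le> c" by (auto elim: BseqE)
  have dk: "norm (d k x) \<le> sqrt c * (sqrt (1/2))^k" for k
  proof (rule power2_le_imp_le)
   have "(norm (d k x))\<^sup>2 = (2^k * (norm (d k x))\<^sup>2) * (1/2)^k" by (simp add: power_one_over)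
   also have "\<dots> \<le> c * (1/2)^k" using c(2)[of k] by (intro mult_right_mono) auto
   also have "\<dots> = (sqrt c * (sqrt (1/2))^k)\<^sup>2"
    using c(1) by (simp add: power_mult_distrib power_mult[symmetric] mult.commute[of k 2])
     (simp add: power_mult real_sqrt_divide power_divide)
   finally show "(norm (d k x))\<^sup>2 \<le> (sqrt c * (sqrt (1/2))^k)\<^sup>2" .
  qed (use c in auto)
  have su: "summable (%k. sqrt c * (sqrt (1/2))^k)"
   by (intro summable_mult summable_geometric) (auto simp: real_sqrt_divide)
  have "summable (%k. d k x)" by (rule summable_comparison_test'[OF su, of 0]) (rule dk)
  then have "convergent (%n. \<Sum>k<n. d k x)" by (simp add: summable_iff_convergent)
  moreover have "(\<Sum>k<n. d k x) = f (r n) x - f (r 0) x" for n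
   unfolding d_def by (rule sum_lessThan_telescope)
  ultimately have "convergent (%n. f (r n) x - f (r 0) x)" by simp
  from convergent_add[OF this convergent_const[of "f (r 0) x"]] show ?case by simp
 qed
 \<comment> \<open>The value 0 off the set of convergence keeps \<open>p\<close> measurable and with
   values in \<open>W\<close>.\<close>
 define p where "p x = (if convergent (%k. f (r k) x) then lim (%k. f (r k) x) else 0)" for x
 have fm: "f k \<in> borel_measurable M" for k using f by (simp add: sq_def)
 have pm: "p \<in> borel_measurable M"
 proof -
  have "(%x. if Cauchy (%k. f (r k) x) then lim (%k. f (r k) x) else 0) \<in> borel_measurable M"
   using fm by (intro measurable_If borel_measurable_lim_metric sets_Collect_Cauchy) auto
  then show ?thesis unfolding p_def[abs_def] by (simp add: Cauchy_convergent_iff)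
 qed
 have pl: "AE x in M. (%k. f (r k) x) \<longlonglongrightarrow> p x"
  using conv by eventually_elim (simp add: p_def convergent_LIMSEQ_iff)
 have est: "sq M (%x. f n x - p x) \<and> nrm M (%x. f n x - p x) \<le> (1/2)^j" if "n \<ge> r j" for n j
 proof (rule fatou_sq[of M "%k x. f n x - f (r (k + j)) x"])
  show "sq M (%x. f n x - f (r (k + j)) x)" for k by (intro sq_diff f)
  show "nrm M (%x. f n x - f (r (k + j)) x) \<le> (1/2)^j" for k
   using r[of j n "r (k + j)"] that strict_mono_less_eq[OF sm, of j "k + j"] by simp
  show "(%x. f n x - p x) \<in> borel_measurable M" using fm pm by simp
  show "AE x in M. (%k. f n x - f (r (k + j)) x) \<longlonglongrightarrow> f n x - p x"
   using pl by eventually_elim (intro tendsto_diff tendsto_const LIMSEQ_ignore_initial_segment)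
 qed
 have ps: "sq M p" using sq_diff[OF f[of "r 0"] conjunct1[OF est[of 0 "r 0"]]] by simp
 have lim: "(%k. nrm M (%x. f k x - p x)) \<longlonglongrightarrow> 0"
 proof (rule LIMSEQ_I)
  fix e :: real assume "e > 0"
  then obtain j where j: "(1/2)^j < e" using real_arch_pow_inv[of e "1/2"] by auto
  have "norm (nrm M (%x. f n x - p x) - 0) < e" if "n \<ge> r j" for n
   using est[OF that] j by simp
  then show "\<exists>no. \<forall>n\<ge>no. norm (nrm M (%x. f n x - p x) - 0) < e" by blast
 qed
 have "p x \<in> W" if "x \<in> space M" for x
 proof (cases "convergent (%k. f (r k) x)")
  case True
  then have "(%k. f (r k) x) \<longlonglongrightarrow> p x" by (simp add: p_def convergent_LIMSEQ_iff)
  from closed_sequentially[OF W(1) _ this] W(3)[OF that] show ?thesis by blast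
 qed (use W(2) in \<open>simp add: p_def\<close>)
 with ps lim show ?thesis by blast
qed

text \<open>Vanishing of a first variation: a small multiple of \<open>- b\<close> would make the
  expression negative.\<close>

lemma quadratic_zero:
 fixes b c :: real assumes "\<And>a. 2 * a * b + a\<^sup>2 * c \<ge> 0" shows "b = 0"
proof (rule ccontr)
 assume b: "b \<noteq> 0"
 define a where "a = - b / (\<bar>c\<bar> + 1)"
 have p: "\<bar>c\<bar> + 1 > 0" by simp
 have e: "a * (\<bar>c\<bar> + 1) = - b" using p by (simp add: a_def)
 have "2 * a * b + a\<^sup>2 * c \<le> 2 * a * b + a\<^sup>2 * (\<bar>c\<bar> + 1)" by (intro add_left_mono mult_left_mono) auto
 also have "a\<^sup>2 * (\<bar>c\<bar> + 1) = a * (a * (\<bar>c\<bar> + 1))" by (simp add: power2_eq_square)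
 also have "2 * a * b + a * (a * (\<bar>c\<bar> + 1)) = a * b" unfolding e by simp
 also have "a * b = - (b\<^sup>2 / (\<bar>c\<bar> + 1))" by (simp add: a_def power2_eq_square)
 also have "\<dots> < 0" using b p by (simp add: zero_less_divide_iff)
 finally show False using assms[of a] by simp
qed

text \<open>The functional is given by its graph \<open>S\<close>, because in the applications its
  value is computed from a test form and not from the element \<open>u\<close> built from it.
  Minimising |u|^2 - 2 l over \<open>S\<close> requires no closedness of \<open>S\<close>: a
  minimising sequence is Cauchy, its limit represents the functional, and the sequence itself is
  part of the result.\<close>

theorem L2_riesz:
 fixes S :: "(('a => 'b::euclidean_space) \<times> real) set"
 assumes S: "\<And>u l. (u, l) \<in> S ==> sq M u \<and> \<bar>l\<bar> \<le> C * nrm M u"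
  and lin: "\<And>u l v m a. (u, l) \<in> S ==> (v, m) \<in> S ==> (%x. a *\<^sub>R u x + v x, a * l + m) \<in> S"
  and ne: "S \<noteq> {}"
  and W: "closed W" "0 \<in> W" "\<And>u l x. (u, l) \<in> S ==> x \<in> space M ==> u x \<in> W"
 obtains p s l where "sq M p" "\<And>x. x \<in> space M ==> p x \<in> W" "\<And>k. (s k, l k) \<in> S"
  "(%k. nrm M (%x. s k x - p x)) \<longlonglongrightarrow> 0" "\<And>u l. (u, l) \<in> S ==> ip M p u = l"
proof -
 define J where "J z = (nrm M (fst z))\<^sup>2 - 2 * snd z" for z :: "('a => 'b) \<times> real"
 have low: "J z \<ge> - C\<^sup>2" if "z \<in> S" for z
 proof -
  have "\<bar>snd z\<bar> \<le> C * nrm M (fst z)" using S[of "fst z" "snd z"] that by simp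
  then have "J z \<ge> (nrm M (fst z))\<^sup>2 - 2 * (C * nrm M (fst z))" by (simp add: J_def)
  also have "(nrm M (fst z))\<^sup>2 - 2 * (C * nrm M (fst z)) = (nrm M (fst z) - C)\<^sup>2 - C\<^sup>2"
   by (simp add: power2_eq_square algebra_simps)
  finally show ?thesis using zero_le_power2[of "nrm M (fst z) - C"] by linarith
 qed
 define I where "I = Inf (J ` S)"
 have bdd: "bdd_below (J ` S)" using low by (intro bdd_belowI2) auto
 have I: "I \<le> J z" if "z \<in> S" for z unfolding I_def using that bdd by (intro cInf_lower) auto
 have "\<exists>z\<in>S. J z < I + 1 / real (Suc k)" for k
 proof -
  have "Inf (J ` S) < I + 1 / real (Suc k)" by (simp add: I_def)
  then show ?thesis using cInf_less_iff[of "J ` S"] ne bdd by auto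
 qed
 then obtain z where z: "\<And>k. z k \<in> S" "\<And>k. J (z k) < I + 1 / real (Suc k)" by metis
 define s l where "s k = fst (z k)" and "l k = snd (z k)" for k
 have sl: "(s k, l k) \<in> S" for k using z(1) by (simp add: s_def l_def)
 have ssq: "sq M (s k)" for k using S[OF sl] by blast
 have Jk: "(nrm M (s k))\<^sup>2 - 2 * l k < I + 1 / real (Suc k)" for k using z(2)[of k] by (simp add: J_def s_def l_def)
 \<comment> \<open>Parallelogram identity: the midpoint of two members of \<open>S\<close> is again
   a competitor.\<close>
 have dist: "(nrm M (%x. s m x - s n x))\<^sup>2 \<le> 2 / real (Suc m) + 2 / real (Suc n)" for m n
 proof -
  have z: "(%x. 0, 0) \<in> S" using lin[OF sl sl, of "- 1" m m] by simp
  have "(%x. s m x + s n x, l m + l n) \<in> S" using lin[OF sl sl, of 1 m n] by simp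
  from lin[OF this z, of "1/2"] have "(%x. (1/2) *\<^sub>R (s m x + s n x), (1/2) * (l m + l n)) \<in> S" by simp
  from I[OF this] have "I \<le> (1/4) * (nrm M (%x. s m x + s n x))\<^sup>2 - (l m + l n)"
   by (simp add: J_def nrm_scaleR power_mult_distrib power2_eq_square add_divide_distrib)
  then have "I \<le> (1/4) * ((nrm M (s m))\<^sup>2 + 2 * ip M (s m) (s n) + (nrm M (s n))\<^sup>2) - (l m + l n)"
   by (simp add: nrm_add_sq ssq)
  moreover have "2 / real (Suc i) = 2 * (1 / real (Suc i))" for i by simp
  ultimately show ?thesis using Jk[of m] Jk[of n] unfolding nrm_diff_sq[OF ssq ssq] by argo
 qed
 have cau: "\<exists>K. \<forall>m\<ge>K. \<forall>n\<ge>K. nrm M (%x. s m x - s n x) < e" if "e > 0" for e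
 proof -
  obtain K where K: "4 / e\<^sup>2 < real K" using reals_Archimedean2 by blast
  have "nrm M (%x. s m x - s n x) < e" if "m \<ge> K" "n \<ge> K" for m n
  proof (rule power2_less_imp_less)
   have "1 / real (Suc i) < e\<^sup>2 / 4" if "i \<ge> K" for i
   proof -
    have "4 / e\<^sup>2 < real (Suc i)" using K that by simp
    then show ?thesis using \<open>e > 0\<close> by (simp add: field_simps)
   qed
   from this[OF \<open>m \<ge> K\<close>] this[OF \<open>n \<ge> K\<close>] show "(nrm M (%x. s m x - s n x))\<^sup>2 < e\<^sup>2"
    using dist[of m n] by simp
  qed (use \<open>e > 0\<close> in simp)
  then show ?thesis by blast
 qed
 obtain p where p: "sq M p" "\<forall>x\<in>space M. p x \<in> W" "(%k. nrm M (%x. s k x - p x)) \<longlonglongrightarrow> 0"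
  using L2_complete[of M s, OF ssq cau W(1,2) W(3)[OF sl]] by blast
 have "ip M p u = m" if um: "(u, m) \<in> S" for u m
 proof -
  have usq: "sq M u" using S[OF um] by blast
  \<comment> \<open>First variation at the approximate minimiser \<open>s k\<close> in the direction
    \<open>u\<close>; the error \<open>1 / real (Suc k)\<close> disappears in the limit.\<close>
  have "2 * a * (ip M p u - m) + a\<^sup>2 * (nrm M u)\<^sup>2 \<ge> 0" for a
  proof (rule LIMSEQ_le_const)
   show "(%k. 2 * a * (ip M (s k) u - m) + a\<^sup>2 * (nrm M u)\<^sup>2 + 1 / real (Suc k)) \<longlonglongrightarrow> 2 * a * (ip M p u - m) + a\<^sup>2 * (nrm M u)\<^sup>2"
   proof -
    have "(%k. 2 * a * (ip M (s k) u - m) + a\<^sup>2 * (nrm M u)\<^sup>2 + 1 / real (Suc k)) \<longlonglongrightarrow> 2 * a * (ip M p u - m) + a\<^sup>2 * (nrm M u)\<^sup>2 + 0"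
     by (intro tendsto_add tendsto_mult tendsto_diff tendsto_const ip_tendsto[OF ssq p(1) usq p(3)] LIMSEQ_Suc[OF lim_1_over_n])
    then show ?thesis by simp
   qed
   have "0 \<le> 2 * a * (ip M (s k) u - m) + a\<^sup>2 * (nrm M u)\<^sup>2 + 1 / real (Suc k)" for k
    using I[OF lin[OF um sl[of k], of a]] Jk[of k]
    by (simp add: J_def nrm_add_sq sq_scaleR usq ssq nrm_scaleR power_mult_distrib ip_scaleR_left ip_scaleR_right ip_commute[of M u] algebra_simps)
   then show "\<exists>N. \<forall>n\<ge>N. 0 \<le> 2 * a * (ip M (s n) u - m) + a\<^sup>2 * (nrm M u)\<^sup>2 + 1 / real (Suc n)" by blast
  qed
  then have "ip M p u - m = 0" by (rule quadratic_zero)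
  then show ?thesis by simp
 qed
 then show ?thesis using that[OF p(1) _ sl p(3)] p(2) by blast
qed

section \<open>Bump functions and cut-off functions\<close>

lemma flat_exp_0: "flat_exp 0 x = (if x \<le> 0 then 0 else exp (- 1 / x))"
 by (simp add: flat_exp_def)

lemma flat_exp_0_range [simp]: "0 \<le> flat_exp 0 x" "flat_exp 0 x \<le> 1"
 by (auto simp: flat_exp_0)

lemma flat_exp_0_pos: "0 < x ==> 0 < flat_exp 0 x"
 by (auto simp: flat_exp_0)

lemma continuous_flat_exp: "continuous_on UNIV (flat_exp m)"
 by (rule DERIV_continuous_on) (rule has_field_derivative_at_within[OF flat_exp_deriv])

lemma Ck_sqdist: "Ck_on k UNIV (%x. (x - c) \<bullet> (x - c))"
 by (intro Ck_inner Ck_diff Ck_ident Ck_const)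

text \<open>The argument of \<open>flat_exp 0\<close> tends to infinity inside the ball and is
  nonpositive outside, so the bumps tend to the indicator of the ball from below. The factor
  \<open>\<kappa>\<close> admits both the plain bump and the one dilated by
  \<open>1 / r\<^sup>2\<close>.\<close>

lemma bump_limit:
 fixes g :: "real ^ 'n::finite => real"
 assumes g: "g \<in> borel_measurable lebesgue" and i: "integrable lebesgue (%x. indicator (ball c r) x * g x)"
  and r: "r > 0" "\<kappa> > 0"
 shows "(%j. integral\<^sup>L lebesgue (%x. g x * flat_exp 0 (real (Suc j) * (\<kappa> * (r\<^sup>2 - (x - c) \<bullet> (x - c))))))
  \<longlonglongrightarrow> integral\<^sup>L lebesgue (%x. indicator (ball c r) x * g x)"
proof (rule integral_dominated_convergence)
 show "integrable lebesgue (%x. norm (indicator (ball c r) x * g x))" using i by (rule integrable_norm)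
 show "(%x. indicator (ball c r) x * g x) \<in> borel_measurable lebesgue" using i by blast
 have mem: "x \<in> ball c r \<longleftrightarrow> \<kappa> * (r\<^sup>2 - (x - c) \<bullet> (x - c)) > 0" for x
 proof -
  have "x \<in> ball c r \<longleftrightarrow> (norm (x - c))\<^sup>2 < r\<^sup>2"
   using r power2_less_imp_less[of "norm (x - c)" r] power_strict_mono[of "norm (x - c)" r 2]
   by (auto simp: dist_norm norm_minus_commute)
  then show ?thesis using r by (simp add: dot_square_norm zero_less_mult_iff)
 qed
 show "(%x. g x * flat_exp 0 (real (Suc j) * (\<kappa> * (r\<^sup>2 - (x - c) \<bullet> (x - c))))) \<in> borel_measurable lebesgue" for j
 proof -
  have "continuous_on UNIV (%x. flat_exp 0 (real (Suc j) * (\<kappa> * (r\<^sup>2 - (x - c) \<bullet> (x - c)))))"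
   by (rule continuous_on_compose2[OF continuous_flat_exp]) (auto intro!: continuous_intros)
  then have "(%x. flat_exp 0 (real (Suc j) * (\<kappa> * (r\<^sup>2 - (x - c) \<bullet> (x - c))))) \<in> borel_measurable lebesgue"
   by (simp add: borel_measurable_continuous_onI measurable_completion)
  then show ?thesis using g by (rule borel_measurable_times[rotated])
 qed
 show "AE x in lebesgue. norm (g x * flat_exp 0 (real (Suc j) * (\<kappa> * (r\<^sup>2 - (x - c) \<bullet> (x - c)))))
   \<le> norm (indicator (ball c r) x * g x)" for j
 proof (intro AE_I2)
  fix x
  show "norm (g x * flat_exp 0 (real (Suc j) * (\<kappa> * (r\<^sup>2 - (x - c) \<bullet> (x - c))))) \<le> norm (indicator (ball c r) x * g x)"
  proof (cases "x \<in> ball c r")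
   case True
   then show ?thesis by (simp add: abs_mult mult_left_le)
  next
   case False
   then have "real (Suc j) * (\<kappa> * (r\<^sup>2 - (x - c) \<bullet> (x - c))) \<le> 0"
    by (intro mult_nonneg_nonpos[OF of_nat_0_le_iff]) (use mem[of x] in linarith)
   then show ?thesis by (simp add: flat_exp_0)
  qed
 qed
 show "AE x in lebesgue. (%j. g x * flat_exp 0 (real (Suc j) * (\<kappa> * (r\<^sup>2 - (x - c) \<bullet> (x - c)))))
   \<longlonglongrightarrow> indicator (ball c r) x * g x"
 proof (intro AE_I2)
  fix x
  let ?s = "\<kappa> * (r\<^sup>2 - (x - c) \<bullet> (x - c))"
  show "(%j. g x * flat_exp 0 (real (Suc j) * ?s)) \<longlonglongrightarrow> indicator (ball c r) x * g x"
  proof (cases "x \<in> ball c r")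
   case True
   then have s: "?s > 0" using mem by blast
   have "(%j. exp (- (1 / real (Suc j)) * (1 / ?s))) \<longlonglongrightarrow> exp (- 0 * (1 / ?s))"
    by (intro tendsto_intros LIMSEQ_Suc[OF lim_1_over_n])
   moreover have "flat_exp 0 (real (Suc j) * ?s) = exp (- (1 / real (Suc j)) * (1 / ?s))" for j
   proof -
    have "real (Suc j) * ?s > 0" using s by (intro mult_pos_pos[OF _ s]) simp
    then show ?thesis by (simp add: flat_exp_0)
   qed
   ultimately have "(%j. flat_exp 0 (real (Suc j) * ?s)) \<longlonglongrightarrow> 1" by simp
   from tendsto_mult[OF tendsto_const this, of "g x"] show ?thesis using True by simp
  next
   case False
   then have "real (Suc j) * ?s \<le> 0" for j
    by (intro mult_nonneg_nonpos[OF of_nat_0_le_iff]) (use mem[of x] in linarith)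
   then show ?thesis using False by (simp add: flat_exp_0)
  qed
 qed
qed

text \<open>By Vitali's theorem an open set is, up to a null set, a disjoint union of countably many
  balls whose closures it contains; countable additivity does the rest.\<close>

lemma balls_zero_open:
 fixes g :: "real ^ 'n::finite => real"
 assumes U: "open U" and i: "integrable lebesgue (%x. indicator U x * g x)"
  and z: "\<And>c r. 0 < r ==> cball c r \<subseteq> U ==> integral\<^sup>L lebesgue (%x. indicator (ball c r) x * g x) = 0"
 shows "integral\<^sup>L lebesgue (%x. indicator U x * g x) = 0"
proof -
 define K where "K = {(c, \<rho>). 0 < \<rho> \<and> cball c \<rho> \<subseteq> U}"
 have v: "\<exists>i. i \<in> K \<and> x \<in> ball (fst i) (snd i) \<and> snd i < d" if xd: "x \<in> U" "0 < d" for x d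
 proof -
  obtain e where e: "e > 0" "cball x e \<subseteq> U" using U xd open_contains_cball by blast
  define \<rho> where "\<rho> = min e (d / 2)"
  have "\<rho> > 0" "\<rho> < d" "\<rho> \<le> e" using e xd by (auto simp: \<rho>_def)
  moreover have "cball x \<rho> \<subseteq> U" using e(2) \<open>\<rho> \<le> e\<close> subset_cball[of \<rho> e x] by blast
  ultimately show ?thesis by (intro exI[of _ "(x, \<rho>)"]) (simp add: K_def)
 qed
 obtain C where C: "countable C" "C \<subseteq> K"
  "pairwise (%i j. disjnt (ball (fst i) (snd i)) (ball (fst j) (snd j))) C"
  "negligible (U - (\<Union>i\<in>C. ball (fst i) (snd i)))"
  using Vitali_covering_theorem_balls[of U K fst snd, OF v] by blast
 \<comment> \<open>Indices that do not enumerate an element of \<open>C\<close> get the empty set,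
   so that \<open>A\<close> is a sequence of disjoint sets also when \<open>C\<close> is
   finite.\<close>
 define A where "A n = (if n \<in> to_nat_on C ` C then ball (fst (from_nat_into C n)) (snd (from_nat_into C n)) else {})" for n
 have inC: "from_nat_into C n \<in> C \<and> to_nat_on C (from_nat_into C n) = n" if "n \<in> to_nat_on C ` C" for n
  using that C(1) by auto
 have UA: "(\<Union>n. A n) = (\<Union>i\<in>C. ball (fst i) (snd i))"
 proof (intro equalityI subsetI)
  fix x assume "x \<in> (\<Union>n. A n)"
  then obtain n where "x \<in> A n" by blast
  then show "x \<in> (\<Union>i\<in>C. ball (fst i) (snd i))" using inC[of n] by (auto simp: A_def split: if_splits)
 next
  fix x assume "x \<in> (\<Union>i\<in>C. ball (fst i) (snd i))"
  then obtain i where i: "i \<in> C" "x \<in> ball (fst i) (snd i)" by blast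
  then have "x \<in> A (to_nat_on C i)" using C(1) by (simp add: A_def)
  then show "x \<in> (\<Union>n. A n)" by blast
 qed
 have sub: "cball (fst i) (snd i) \<subseteq> U" "snd i > 0" if "i \<in> C" for i
  using subsetD[OF C(2) that] unfolding K_def by (simp_all add: split_beta)
 have subU: "(\<Union>n. A n) \<subseteq> U" unfolding UA using sub(1) ball_subset_cball by blast
 have Am: "A n \<in> sets lebesgue" for n by (simp add: A_def)
 have dis: "A m \<inter> A n = {}" if mn: "m \<noteq> n" for m n
 proof (cases "m \<in> to_nat_on C ` C \<and> n \<in> to_nat_on C ` C")
  case True
  then have "from_nat_into C m \<noteq> from_nat_into C n" using inC[of m] inC[of n] mn by metis
  then show ?thesis using True inC[of m] inC[of n] pairwiseD[OF C(3)] by (simp add: A_def disjnt_def)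
 qed (auto simp: A_def)
 have i': "set_integrable lebesgue U g" using i by (simp add: set_integrable_def)
 have iA: "set_integrable lebesgue (\<Union>n. A n) g" by (rule set_integrable_subset[OF i' _ subU]) (use Am in auto)
 have "(LINT x:A n|lebesgue. g x) = 0" for n
  using z sub inC[of n] by (simp add: A_def set_lebesgue_integral_def)
 then have 0: "(LINT x:(\<Union>n. A n)|lebesgue. g x) = 0"
  using lebesgue_integral_countable_add[OF Am dis iA] by simp
 have "integral\<^sup>L lebesgue (%x. indicator U x * g x) = (LINT x:(\<Union>n. A n)|lebesgue. g x)"
  unfolding set_lebesgue_integral_def
 proof (rule integral_cong_AE)
  show "(%x. indicator U x * g x) \<in> borel_measurable lebesgue" using i by blast
  show "(%x. indicator (\<Union>n. A n) x *\<^sub>R g x) \<in> borel_measurable lebesgue"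
   using iA unfolding set_integrable_def by blast
  have "AE x in lebesgue. x \<notin> U - (\<Union>n. A n)"
   using C(4) unfolding UA negligible_iff_null_sets by (rule AE_not_in)
  then show "AE x in lebesgue. indicator U x * g x = indicator (\<Union>n. A n) x *\<^sub>R g x"
  proof eventually_elim
   case (elim x)
   then have "x \<in> U \<longleftrightarrow> x \<in> (\<Union>n. A n)" using subU by blast
   then show ?case by (simp add: indicator_def)
  qed
 qed
 with 0 show ?thesis by simp
qed

text \<open>From balls one passes to open sets, then to measurable sets as decreasing limits of open
  ones up to a null set, and finally to the sets where \<open>g\<close> is positive or
  negative.\<close>

lemma balls_zero_AE:
 fixes g :: "real ^ 'n::finite => real"
 assumes Om: "open Om" and g: "g \<in> borel_measurable lebesgue"
  and i: "\<And>R. integrable lebesgue (%x. indicator (ball 0 R) x * g x)"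
  and z: "\<And>c r. 0 < r ==> cball c r \<subseteq> Om ==> integral\<^sup>L lebesgue (%x. indicator (ball c r) x * g x) = 0"
 shows "AE x in lebesgue. x \<in> Om \<longrightarrow> g x = 0"
proof -
 have sub: "integrable lebesgue (%x. indicator A x * g x)" if "A \<in> sets lebesgue" "A \<subseteq> ball 0 R" for A R
 proof -
  have "integrable lebesgue (%x. indicator A x * (indicator (ball 0 R) x * g x))"
   using integrable_mult_indicator[OF that(1) i[of R]] by simp
  also have "(%x. indicator A x * (indicator (ball 0 R) x * g x)) = (%x. indicator A x * g x)"
   using that(2) by (auto simp: indicator_def fun_eq_iff)
  finally show ?thesis .
 qed
 have op: "integral\<^sup>L lebesgue (%x. indicator U x * g x) = 0" if "open U" "U \<subseteq> Om \<inter> ball 0 R" for U R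
 proof (rule balls_zero_open[OF that(1)])
  show "integrable lebesgue (%x. indicator U x * g x)" using that by (intro sub[of U R]) auto
  show "integral\<^sup>L lebesgue (%x. indicator (ball c r) x * g x) = 0" if "0 < r" "cball c r \<subseteq> U" for c r
   using that \<open>U \<subseteq> Om \<inter> ball 0 R\<close> by (intro z) auto
 qed
 have me: "integral\<^sup>L lebesgue (%x. indicator A x * g x) = 0" if A: "A \<in> sets lebesgue" "A \<subseteq> Om \<inter> ball 0 R" for A R
 proof -
  \<comment> \<open>Up to the null set \<open>T\<close> a measurable set is a countable intersection
    of open sets; the finite intersections \<open>V k\<close> are open, so their integrals vanish
    already.\<close>
  obtain G T where G: "gdelta G" "T \<in> null_sets lebesgue" "A \<union> T = G" "disjnt A T"
   using lebesgue_set_almost_gdelta[OF A(1)] by blast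
  obtain F where F: "\<And>i::nat. open (F i)" "G = (\<Inter>i. F i)"
   using G(1) by (auto elim: gdelta.cases)
  define V where "V k = (\<Inter>i\<le>k. F i) \<inter> (Om \<inter> ball 0 R)" for k
  have Vo: "open (V k)" for k unfolding V_def using F(1) Om by (intro open_Int open_INT) auto
  define B where "B = G \<inter> (Om \<inter> ball 0 R)"
  have lim: "(%k. integral\<^sup>L lebesgue (%x. indicator (V k) x * g x)) \<longlonglongrightarrow> integral\<^sup>L lebesgue (%x. indicator A x * g x)"
  proof (rule integral_dominated_convergence)
   show "integrable lebesgue (%x. norm (indicator (ball 0 R) x * g x))" by (rule integrable_norm[OF i])
   show "(%x. indicator A x * g x) \<in> borel_measurable lebesgue" using A g by simp
   show "(%x. indicator (V k) x * g x) \<in> borel_measurable lebesgue" for k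
    using Vo[of k] g by (intro borel_measurable_times borel_measurable_indicator) auto
   show "AE x in lebesgue. norm (indicator (V k) x * g x) \<le> norm (indicator (ball 0 R) x * g x)" for k
    by (intro AE_I2) (auto simp: V_def indicator_def)
   have "AE x in lebesgue. x \<notin> T" using G(2) by (rule AE_not_in)
   then show "AE x in lebesgue. (%k. indicator (V k) x * g x) \<longlonglongrightarrow> indicator A x * g x"
   proof eventually_elim
    case (elim x)
    show ?case
    proof (cases "x \<in> A")
     case True
     then have "x \<in> V k" for k using A(2) G(3) F(2) by (auto simp: V_def)
     then show ?thesis using True by simp
    next
     case False
     then have "x \<notin> G" using elim G(3) by blast
     then obtain i where i: "x \<notin> F i" using F(2) by blast
     then have "x \<notin> V k" if "k \<ge> i" for k using that by (auto simp: V_def)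
     then have "\<forall>\<^sub>F k in sequentially. indicator (V k) x * g x = indicator A x * g x"
      using False by (auto simp: eventually_sequentially intro!: exI[of _ i])
     then show ?thesis by (rule tendsto_eventually)
    qed
   qed
  qed
  have "integral\<^sup>L lebesgue (%x. indicator (V k) x * g x) = 0" for k
   by (rule op[OF Vo, of k R]) (auto simp: V_def)
  with lim show ?thesis by (simp add: LIMSEQ_const_iff)
 qed
 have R: "AE x in lebesgue. x \<in> Om \<inter> ball 0 R \<longrightarrow> g x = 0" for R
 proof -
  have one: "AE x in lebesgue. x \<in> {x \<in> Om \<inter> ball 0 R. s * g x > 0} \<longrightarrow> g x = 0" for s :: real
  proof -
   let ?A = "{x \<in> Om \<inter> ball 0 R. s * g x > 0}"
   have "(Om \<inter> ball 0 R) \<inter> {x \<in> space lebesgue. s * g x > 0} \<in> sets lebesgue"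
   proof (intro sets.Int)
    have "(%x. s * g x) \<in> borel_measurable lebesgue" using g by simp
    from borel_measurable_less[OF borel_measurable_const this, of 0]
    show "{x \<in> space lebesgue. s * g x > 0} \<in> sets lebesgue" .
   qed (use Om in auto)
   then have A: "?A \<in> sets lebesgue" by (simp add: Int_def conj_commute conj_left_commute)
   have int: "integrable lebesgue (%x. s * (indicator ?A x * g x))"
    by (intro integrable_mult_right sub[OF A, of R]) auto
   have "integral\<^sup>L lebesgue (%x. s * (indicator ?A x * g x)) = 0"
    by (subst integral_mult_right_zero, subst me[OF A, of R]) auto
   moreover have nn: "0 \<le> s * (indicator ?A x * g x)" for x by (auto simp: indicator_def)
   ultimately have "AE x in lebesgue. s * (indicator ?A x * g x) = 0"
    using integral_nonneg_eq_0_iff_AE[OF int] by simp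
   then show ?thesis by eventually_elim (auto simp: indicator_def)
  qed
  show ?thesis using one[of 1] one[of "-1"]
  proof eventually_elim
   case (elim x)
   then show ?case by (metis (mono_tags, lifting) mem_Collect_eq mult_1 mult_minus1 neg_0_less_iff_less linorder_neqE_linordered_idom)
  qed
 qed
 have "AE x in lebesgue. \<forall>k::nat. x \<in> Om \<inter> ball 0 (real k) \<longrightarrow> g x = 0"
  using R by (subst AE_all_countable) blast
 then show ?thesis
 proof eventually_elim
  case (elim x)
  obtain k where "norm x < real k" using reals_Archimedean2 by blast
  then show ?case using elim by auto
 qed
qed

text \<open>The smooth bumps that approximate the indicator of a ball are admissible test functions
  as soon as the closed ball lies in \<open>Om\<close>.\<close>

lemma fundamental_lemma:
 fixes g :: "real ^ 'n::finite => real"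
 assumes Om: "open Om" and g: "g \<in> borel_measurable lebesgue"
  and i: "\<And>R. integrable lebesgue (%x. indicator (ball 0 R) x * g x)"
  and z: "\<And>\<phi>. \<phi> \<in> C0_inf Om ==> integral\<^sup>L lebesgue (%x. g x * \<phi> x) = 0"
 shows "AE x in lebesgue. x \<in> Om \<longrightarrow> g x = 0"
proof (rule balls_zero_AE[OF Om g i])
 fix c :: "real^'n" and r :: real assume r: "0 < r" "cball c r \<subseteq> Om"
 have sub: "ball c r \<subseteq> ball 0 (norm c + r)"
 proof
  fix x assume "x \<in> ball c r"
  then show "x \<in> ball 0 (norm c + r)" using norm_triangle_ineq2[of x c] by (simp add: dist_norm norm_minus_commute)
 qed
 have "integrable lebesgue (%x. indicator (ball c r) x * (indicator (ball 0 (norm c + r)) x * g x))"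
  using integrable_mult_indicator[OF _ i[of "norm c + r"], of "ball c r"] by simp
 also have "(%x. indicator (ball c r) x * (indicator (ball 0 (norm c + r)) x * g x)) = (%x. indicator (ball c r) x * g x)"
  using sub by (auto simp: indicator_def fun_eq_iff)
 finally have int: "integrable lebesgue (%x. indicator (ball c r) x * g x)" .
 have "integral\<^sup>L lebesgue (%x. g x * flat_exp 0 (real (Suc j) * (1 * (r\<^sup>2 - (x - c) \<bullet> (x - c))))) = 0" for j
 proof (rule z)
  have "Ck_on k UNIV (%x. flat_exp 0 (real (Suc j) * (1 * (r\<^sup>2 - (x - c) \<bullet> (x - c)))))" for k
   by (intro Ck_flat_exp Ck_mult Ck_diff Ck_const Ck_sqdist)
  moreover have "flat_exp 0 (real (Suc j) * (1 * (r\<^sup>2 - (x - c) \<bullet> (x - c)))) = 0" if "x \<notin> cball c r" for x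
  proof -
   have "r < norm (x - c)" using that by (simp add: dist_norm norm_minus_commute)
   then have "r\<^sup>2 \<le> (norm (x - c))\<^sup>2" using r by (intro power_mono) auto
   then have "real (Suc j) * (1 * (r\<^sup>2 - (x - c) \<bullet> (x - c))) \<le> 0"
    by (intro mult_nonneg_nonpos) (auto simp: dot_square_norm)
   then show ?thesis by (simp add: flat_exp_0)
  qed
  ultimately show "(%x. flat_exp 0 (real (Suc j) * (1 * (r\<^sup>2 - (x - c) \<bullet> (x - c))))) \<in> C0_inf Om"
   using r(2) unfolding C0_inf_def by (auto intro!: exI[of _ "cball c r"])
 qed
 then have "(%j::nat. 0) \<longlonglongrightarrow> integral\<^sup>L lebesgue (%x. indicator (ball c r) x * g x)"
  using bump_limit[OF g int r(1), of 1] by (simp only: zero_less_one)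
 then show "integral\<^sup>L lebesgue (%x. indicator (ball c r) x * g x) = 0" by (simp add: LIMSEQ_const_iff)
qed

text \<open>The two flat functions never vanish simultaneously; the quotient equals 1 for |x| \<le>
  1 and 0 for |x| \<ge> 2.\<close>

definition cutoff :: "real ^ 'n::finite => real" where
 "cutoff x = flat_exp 0 (4 - x \<bullet> x) * inverse (flat_exp 0 (4 - x \<bullet> x) + flat_exp 0 (x \<bullet> x - 1))"

lemma cutoff_denom: "flat_exp 0 (4 - x \<bullet> x) + flat_exp 0 (x \<bullet> x - 1) > 0"
proof (cases "x \<bullet> x < 4")
 case True
 then show ?thesis by (intro add_pos_nonneg flat_exp_0_pos) auto
next
 case False
 then show ?thesis by (intro add_nonneg_pos flat_exp_0_pos) auto
qed

lemma smooth_cutoff: "smooth cutoff"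
 unfolding cutoff_def[abs_def]
 by (intro allI Ck_mult Ck_inverse Ck_add Ck_flat_exp Ck_diff Ck_inner Ck_ident Ck_const)
  (simp add: less_imp_neq[OF cutoff_denom, symmetric])

lemma cutoff_range: "0 \<le> cutoff x" "cutoff x \<le> 1"
proof -
 have d: "flat_exp 0 (4 - x \<bullet> x) + flat_exp 0 (x \<bullet> x - 1) > 0" by (rule cutoff_denom)
 then show "0 \<le> cutoff x" by (simp add: cutoff_def)
 have "flat_exp 0 (4 - x \<bullet> x) \<le> 1 * (flat_exp 0 (4 - x \<bullet> x) + flat_exp 0 (x \<bullet> x - 1))" by simp
 then show "cutoff x \<le> 1" using d by (simp add: cutoff_def divide_inverse[symmetric] pos_divide_le_eq)
qed

lemma cutoff_one: assumes "norm x \<le> 1" shows "cutoff x = 1"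
proof -
 have "x \<bullet> x \<le> 1" using assms power_mono[OF assms, of 2] by (simp add: dot_square_norm)
 then have "flat_exp 0 (x \<bullet> x - 1) = 0" by (simp add: flat_exp_0)
 then show ?thesis using cutoff_denom[of x] by (simp add: cutoff_def)
qed

lemma cutoff_zero: assumes "norm x \<ge> 2" shows "cutoff x = 0"
proof -
 have "x \<bullet> x \<ge> 4" using assms power_mono[OF assms, of 2] by (simp add: dot_square_norm)
 then show ?thesis by (simp add: cutoff_def flat_exp_0)
qed

definition cut :: "real => real ^ 'n::finite => real" where
 "cut R x = cutoff ((1 / R) *\<^sub>R x)"

lemma smooth_cut: "smooth (cut R)"
 unfolding cut_def[abs_def] using Ck_affine[OF smooth_cutoff, of _ "1 / R" 0] by auto

lemma cut_range [simp]: "0 \<le> cut R x" "cut R x \<le> 1"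
 by (simp_all add: cut_def cutoff_range)

lemma cut_one: "R > 0 ==> norm x \<le> R ==> cut R x = 1"
 unfolding cut_def by (rule cutoff_one) (simp add: pos_divide_le_eq)

lemma cut_zero: "R > 0 ==> norm x \<ge> 2 * R ==> cut R x = 0"
 unfolding cut_def by (rule cutoff_zero) (simp add: pos_le_divide_eq)

lemma C0_inf_cut: "R > 0 ==> cut R \<in> C0_inf UNIV"
 unfolding C0_inf_def using smooth_cut[of R]
 by (auto intro!: exI[of _ "cball 0 (2 * R)"] cut_zero)

lemma cut_grad_zero:
 assumes "R > 0" "norm x < R \<or> norm x > 2 * R" shows "grad (cut R) x = 0"
proof -
 have "partial_deriv n (cut R) x = 0" for n
  using assms(2)
 proof
  assume x: "norm x < R"
  have "partial_deriv n (%x. cut R x - 1) x = 0"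
   by (rule partial_deriv_outside_support[of "- ball 0 R"]) (use x assms(1) in \<open>auto intro!: cut_one\<close>)
  moreover have "partial_deriv n (%x. cut R x - 1) x = partial_deriv n (cut R) x - partial_deriv n (%x. 1) x"
   by (rule partial_deriv_diff) (auto simp: smooth_cut[rule_format])
  ultimately show ?thesis by simp
 next
  assume "norm x > 2 * R"
  then show ?thesis
   by (intro partial_deriv_outside_support[of "cball 0 (2 * R)"]) (use assms(1) in \<open>auto intro!: cut_zero\<close>)
 qed
 then show ?thesis by (simp add: grad_def vec_eq_iff)
qed

text \<open>Scaling. The factor 1 / R compensates the size of the weight \<open>rho\<close> on the
  annulus where the gradient of \<open>cut R\<close> lives.\<close>

lemma cut_grad_bound:
 "\<exists>C>0. \<forall>R>0. \<forall>x::real^'n::finite. (\<Sum>n\<in>UNIV. \<bar>grad (cut R) x $ n\<bar>) \<le> C / R"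
proof -
 have "csupp (cutoff :: real^'n => real)" unfolding csupp_def
  by (intro exI[of _ "cball 0 2"]) (auto intro: cutoff_zero)
 then have "\<exists>B>0. \<forall>x. norm (partial_deriv n cutoff x) \<le> B" for n :: 'n
  by (intro csupp_bounded csupp_partial smooth_continuous smooth_partial smooth_cutoff)
 then obtain B where B: "\<And>n. B n > 0" "\<And>n x. norm (partial_deriv n (cutoff :: real^'n => real) x) \<le> B n" by metis
 show ?thesis
 proof (intro exI[of _ "sum B UNIV"] conjI allI impI)
  show "sum B UNIV > 0" using B(1) by (intro sum_pos) auto
  fix R :: real and x :: "real^'n" assume R: "R > 0"
  have "grad (cut R) x $ n = (1 / R) *\<^sub>R partial_deriv n cutoff ((1 / R) *\<^sub>R x)" for n
   using partial_deriv_affine[OF smooth_cutoff, of n "1 / R" 0 x] by (simp add: grad_def cut_def[abs_def])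
  then have "\<bar>grad (cut R) x $ n\<bar> \<le> B n / R" for n
   using B(2)[of n "(1 / R) *\<^sub>R x"] R by (simp add: abs_mult divide_right_mono)
  then have "(\<Sum>n\<in>UNIV. \<bar>grad (cut R) x $ n\<bar>) \<le> (\<Sum>n\<in>UNIV. B n / R)" by (intro sum_mono)
  also have "\<dots> = sum B UNIV / R" by (simp add: sum_divide_distrib)
  finally show "(\<Sum>n\<in>UNIV. \<bar>grad (cut R) x $ n\<bar>) \<le> sum B UNIV / R" .
 qed
qed

section \<open>Hardy inequality and a weighted Liouville theorem\<close>

lemma rho_ge_1: "rho x \<ge> 1" and rho_pos [simp]: "rho x > 0"
proof -
 have "sqrt 1 \<le> rho x" unfolding rho_def by (intro real_sqrt_le_mono) simp
 then show "rho x \<ge> 1" by simp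
 then show "rho x > 0" by linarith
qed

lemma rho_sq: "(rho x)\<^sup>2 = 1 + x \<bullet> x"
 by (simp add: rho_def dot_square_norm)

lemma rho_le: "rho x \<le> 1 + norm x"
 by (rule power2_le_imp_le) (simp_all add: rho_sq dot_square_norm power2_sum)

lemma norm_le_rho: "norm x \<le> rho x"
 by (rule power2_le_imp_le) (auto simp: rho_sq dot_square_norm less_imp_le)

lemma rho_powr_eq: "rho x powr s = (1 + x \<bullet> x) powr (s / 2)"
 by (simp add: rho_def dot_square_norm powr_half_sqrt[symmetric] powr_powr add_nonneg_nonneg)

lemma smooth_rho_powr: "Ck_on k UNIV (%x. rho x powr s)"
 unfolding rho_powr_eq
 by (intro Ck_powr Ck_add Ck_const Ck_inner Ck_ident) (simp add: add_pos_nonneg)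

lemma continuous_rho_powr: "continuous_on S (%x. rho x powr s)"
 using Ck_imp_cont[OF smooth_rho_powr] continuous_on_subset by blast

lemma rho_powr_measurable [measurable]: "(%x. rho x powr s) \<in> borel_measurable lebesgue"
 by (intro measurable_completion) (simp add: borel_measurable_continuous_onI continuous_rho_powr)

lemma rho_powr_mono: "s \<le> t ==> rho x powr s \<le> rho x powr t"
 using rho_ge_1[of x] by (intro powr_mono) auto

text \<open>Integrate the divergence of the field x / (1 + |x|^2) times |\<phi>|^2, which gives 0.
  The field itself has divergence at least (N - 2) / (1 + |x|^2), and absorbing the gradient term
  costs another 1/2 in the coefficient, so that N \<ge> 3 leaves N - 5/2 \<ge> 1/2. With the factor
  2 in front of the gradient this is the constant 4.\<close>

theorem hardy_inequality:
 fixes \<phi> :: "real ^ 'n::finite => 'b::euclidean_space"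
 assumes N: "CARD('n) \<ge> 3" and s: "smooth \<phi>" and c: "csupp \<phi>"
 shows "integral\<^sup>L lebesgue (%x. (norm (\<phi> x))\<^sup>2 / (1 + x \<bullet> x)) \<le>
  4 * (\<Sum>n\<in>UNIV. integral\<^sup>L lebesgue (%x. (norm (partial_deriv n \<phi> x))\<^sup>2))"
proof -
 let ?S = "%x::real^'n. 1 + x \<bullet> x" and ?F = "%x. \<phi> x \<bullet> \<phi> x" and ?g = "%n. partial_deriv n \<phi>"
 let ?w = "%n x. (x \<bullet> axis n 1) * inverse (?S x)"
 let ?w' = "%n x. inverse (?S x) - 2 * (x $ n)\<^sup>2 * (inverse (?S x))\<^sup>2"
 have Sp: "?S x > 0" for x by (simp add: add_pos_nonneg)
 have Sn: "?S x \<noteq> 0" for x using Sp[of x] by simp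
 have sF: "smooth ?F" using s by (auto intro: Ck_inner)
 have sw: "smooth (?w n)" for n
  by (intro allI Ck_mult Ck_inverse Ck_inner Ck_ident Ck_const Ck_add) (rule Sn)
 have pF: "partial_deriv n ?F x = 2 * (\<phi> x \<bullet> ?g n x)" for n x
  using partial_deriv_bilinear[OF bounded_bilinear_inner s s] by (simp add: inner_commute)
 have pw: "partial_deriv n (?w n) x = ?w' n x" for n x
 proof -
  have "(?w n has_derivative (%h. (x \<bullet> axis n 1) * (- (inverse (?S x) * (0 + (x \<bullet> h + h \<bullet> x)) * inverse (?S x))) + (h \<bullet> axis n 1 + x \<bullet> 0) * inverse (?S x))) (at x)"
   by (auto intro!: derivative_eq_intros Sn simp: fun_eq_iff algebra_simps)
  from partial_deriv_eq[OF this] show ?thesis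
   by (simp add: inner_axis inner_axis' inner_commute power2_eq_square algebra_simps)
 qed
 have ih: "integral\<^sup>L lebesgue (%x. ?w n x * (2 * (\<phi> x \<bullet> ?g n x)) + ?w' n x * ?F x) = 0" for n
 proof -
  have "integral\<^sup>L lebesgue (partial_deriv n (%x. ?w n x * ?F x)) = 0"
  proof (rule integral_partial_zero)
   show "csupp (%x. ?w n x * ?F x)" by (rule csupp_mono[OF c]) simp
  qed (use sw sF in \<open>auto intro: Ck_mult\<close>)
  moreover have "partial_deriv n (%x. ?w n x * ?F x) = (%x. ?w n x * (2 * (\<phi> x \<bullet> ?g n x)) + ?w' n x * ?F x)"
   by (rule ext, subst partial_deriv_bilinear[OF bounded_bilinear_mult sw sF], subst pF, subst pw) (rule refl)
  ultimately show ?thesis by simp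
 qed
 have cs: "csupp (%x. a x * ?F x)" "csupp (%x. a x * (\<phi> x \<bullet> b x))" for a :: "real^'n => real" and b
  by (rule csupp_mono[OF c], simp)+
 have cg: "csupp (%x. (norm (?g n x))\<^sup>2)" for n by (rule csupp_mono[OF csupp_partial[OF c]]) simp
 have cphi: "continuous_on UNIV \<phi>" "continuous_on UNIV (?g n)" for n
  using s smooth_continuous smooth_partial by blast+
 have cS: "continuous_on UNIV (%x. inverse (?S x))" by (intro continuous_intros ballI Sn)
 have cw: "continuous_on UNIV (?w n)" for n using smooth_continuous[OF sw] .
 have cw': "continuous_on UNIV (?w' n)" for n by (intro continuous_intros cS)
 have i1: "integrable lebesgue (%x. ?w n x * (2 * (\<phi> x \<bullet> ?g n x)) + ?w' n x * ?F x)" for n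
 proof (rule integrable_csupp)
  show "csupp (%x. ?w n x * (2 * (\<phi> x \<bullet> ?g n x)) + ?w' n x * ?F x)" by (rule csupp_mono[OF c]) simp
  show "continuous_on UNIV (%x. ?w n x * (2 * (\<phi> x \<bullet> ?g n x)) + ?w' n x * ?F x)"
  proof (rule continuous_on_add)
   show "continuous_on UNIV (%x. ?w n x * (2 * (\<phi> x \<bullet> ?g n x)))"
    by (rule continuous_on_mult[OF cw]) (intro continuous_intros cphi)
   show "continuous_on UNIV (%x. ?w' n x * ?F x)"
    by (rule continuous_on_mult[OF cw']) (intro continuous_intros cphi)
  qed
 qed
 have i2: "integrable lebesgue (%x. inverse (?S x) * ?F x)"
  by (rule integrable_csupp[OF cs(1)]) (intro continuous_intros cS cphi)
 have i3: "integrable lebesgue (%x. (norm (?g n x))\<^sup>2)" for n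
  by (rule integrable_csupp[OF cg]) (intro continuous_intros cphi)
 have pt: "(1/2) * (inverse (?S x) * ?F x) - 2 * (\<Sum>n\<in>UNIV. (norm (?g n x))\<^sup>2) \<le>
   (\<Sum>n\<in>UNIV. ?w n x * (2 * (\<phi> x \<bullet> ?g n x)) + ?w' n x * ?F x)" for x
 proof -
  let ?i = "inverse (?S x)"
  have i: "?i > 0" using Sp by simp
  have ri: "(x \<bullet> x) * ?i \<le> 1" using Sp[of x] by (simp add: divide_inverse[symmetric] pos_divide_le_eq)
  have sx: "(\<Sum>n\<in>UNIV. (x $ n)\<^sup>2) = x \<bullet> x" by (simp add: inner_vec_def power2_eq_square)
  \<comment> \<open>Young's inequality with the weights 1/2 and 2, obtained by expanding a
    square.\<close>
  have a: "?w n x * (2 * (\<phi> x \<bullet> ?g n x)) \<ge> - ((1/2) * ((x $ n)\<^sup>2 * ?i\<^sup>2 * ?F x) + 2 * (norm (?g n x))\<^sup>2)" for n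
  proof -
   have "0 \<le> (norm ((x $ n * ?i / 2) *\<^sub>R \<phi> x + ?g n x))\<^sup>2" by simp
   also have "\<dots> = (x $ n * ?i / 2)\<^sup>2 * ?F x + 2 * ((x $ n * ?i / 2) * (\<phi> x \<bullet> ?g n x)) + (norm (?g n x))\<^sup>2"
    unfolding power2_norm_eq_inner
    by (simp add: inner_add_left inner_add_right inner_commute power2_eq_square)
   finally show ?thesis by (simp add: inner_axis power_mult_distrib power_divide algebra_simps)
  qed
  have "(\<Sum>n\<in>UNIV. ?w n x * (2 * (\<phi> x \<bullet> ?g n x)) + ?w' n x * ?F x) \<ge>
   (\<Sum>n\<in>UNIV. - ((1/2) * ((x $ n)\<^sup>2 * ?i\<^sup>2 * ?F x) + 2 * (norm (?g n x))\<^sup>2) + ?w' n x * ?F x)"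
   by (intro sum_mono add_mono a order_refl)
  also have "(\<Sum>n\<in>UNIV. - ((1/2) * ((x $ n)\<^sup>2 * ?i\<^sup>2 * ?F x) + 2 * (norm (?g n x))\<^sup>2) + ?w' n x * ?F x) =
   (\<Sum>n\<in>UNIV. ?i * ?F x - (5/2) * ((x $ n)\<^sup>2 * (?i\<^sup>2 * ?F x)) - 2 * (norm (?g n x))\<^sup>2)"
   by (intro sum.cong refl) (simp add: algebra_simps)
  also have "\<dots> = real CARD('n) * (?i * ?F x) - (5/2) * ((x \<bullet> x) * (?i\<^sup>2 * ?F x)) - 2 * (\<Sum>n\<in>UNIV. (norm (?g n x))\<^sup>2)"
  proof -
   have "(\<Sum>n\<in>UNIV. (5/2) * ((x $ n)\<^sup>2 * (?i\<^sup>2 * ?F x))) = (5/2) * ((x \<bullet> x) * (?i\<^sup>2 * ?F x))"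
    unfolding sx[symmetric] sum_distrib_right sum_distrib_left ..
   then show ?thesis by (simp only: sum_subtractf sum_distrib_left sum_constant)
  qed
  finally have 1: "(\<Sum>n\<in>UNIV. ?w n x * (2 * (\<phi> x \<bullet> ?g n x)) + ?w' n x * ?F x) \<ge>
   real CARD('n) * (?i * ?F x) - (5/2) * ((x \<bullet> x) * (?i\<^sup>2 * ?F x)) - 2 * (\<Sum>n\<in>UNIV. (norm (?g n x))\<^sup>2)" .
  have iF: "?i * ?F x \<ge> 0" using i by simp
  have "(x \<bullet> x) * (?i\<^sup>2 * ?F x) = ((x \<bullet> x) * ?i) * (?i * ?F x)" by (simp add: power2_eq_square algebra_simps)
  also have "\<dots> \<le> 1 * (?i * ?F x)" using ri iF by (intro mult_right_mono)
  finally have 2: "(x \<bullet> x) * (?i\<^sup>2 * ?F x) \<le> ?i * ?F x" by simp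
  have 3: "3 * (?i * ?F x) \<le> real CARD('n) * (?i * ?F x)" using N iF by (intro mult_right_mono) auto
  show ?thesis using 1 2 3 by linarith
 qed
 have "integral\<^sup>L lebesgue (%x. (1/2) * (inverse (?S x) * ?F x) - 2 * (\<Sum>n\<in>UNIV. (norm (?g n x))\<^sup>2)) \<le>
   integral\<^sup>L lebesgue (%x. \<Sum>n\<in>UNIV. ?w n x * (2 * (\<phi> x \<bullet> ?g n x)) + ?w' n x * ?F x)"
 proof (rule integral_mono)
  show "integrable lebesgue (%x. (1/2) * (inverse (?S x) * ?F x) - 2 * (\<Sum>n\<in>UNIV. (norm (?g n x))\<^sup>2))"
   by (intro Bochner_Integration.integrable_diff integrable_mult_right Bochner_Integration.integrable_sum i2 i3)
  show "integrable lebesgue (%x. \<Sum>n\<in>UNIV. ?w n x * (2 * (\<phi> x \<bullet> ?g n x)) + ?w' n x * ?F x)"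
   by (intro Bochner_Integration.integrable_sum i1)
 qed (rule pt)
 also have "\<dots> = 0" by (subst Bochner_Integration.integral_sum[OF i1]) (simp only: ih sum.neutral_const)
 finally have "integral\<^sup>L lebesgue (%x. (1/2) * (inverse (?S x) * ?F x) - 2 * (\<Sum>n\<in>UNIV. (norm (?g n x))\<^sup>2)) \<le> 0" .
 moreover have "integral\<^sup>L lebesgue (%x. (1/2) * (inverse (?S x) * ?F x) - 2 * (\<Sum>n\<in>UNIV. (norm (?g n x))\<^sup>2)) =
  (1/2) * integral\<^sup>L lebesgue (%x. inverse (?S x) * ?F x) - 2 * (\<Sum>n\<in>UNIV. integral\<^sup>L lebesgue (%x. (norm (?g n x))\<^sup>2))"
  using i2 i3 by (subst Bochner_Integration.integral_diff) (auto intro!: integrable_mult_right Bochner_Integration.integrable_sum)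
 moreover have "(%x. inverse (?S x) * ?F x) = (%x. (norm (\<phi> x))\<^sup>2 / ?S x)"
  by (simp add: fun_eq_iff divide_inverse power2_norm_eq_inner mult.commute)
 ultimately show ?thesis by simp
qed

text \<open>Cauchy-Schwarz on the ball: the reciprocal weight is at most
  \<open>(1 + norm c + r) powr (- \<sigma>)\<close> there, and the square root of the volume
  contributes r^(N / 2).\<close>

lemma weighted_ball_estimate:
 fixes f :: "real ^ 'n::finite => real"
 assumes f: "f \<in> borel_measurable lebesgue" and sq: "sq lebesgue (%x. rho x powr \<sigma> * f x)"
  and \<sigma>: "\<sigma> \<le> 0"
 shows "\<exists>C\<ge>0. \<forall>c r. 0 < r \<longrightarrow> integrable lebesgue (%x. indicator (ball c r) x * f x) \<and>
  integral\<^sup>L lebesgue (%x. \<bar>indicator (ball c r) x * f x\<bar>) \<le> C * ((1 + norm c + r) powr (- \<sigma>) * r powr (real CARD('n) / 2))"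
proof -
 define C where "C = sqrt (unit_ball_vol (real CARD('n))) * nrm lebesgue (%x. rho x powr \<sigma> * f x)"
 have C0: "C \<ge> 0" by (simp add: C_def)
 have "integrable lebesgue (%x. indicator (ball c r) x * f x) \<and>
  integral\<^sup>L lebesgue (%x. \<bar>indicator (ball c r) x * f x\<bar>) \<le> C * ((1 + norm c + r) powr (- \<sigma>) * r powr (real CARD('n) / 2))"
  if r: "r > 0" for c r
 proof -
  let ?B = "ball c r" and ?K = "(1 + norm c + r) powr (- \<sigma>)"
  let ?u = "%x. indicator ?B x * rho x powr (- \<sigma>)" and ?v = "%x. \<bar>rho x powr \<sigma> * f x\<bar>"
  have Bf: "emeasure lebesgue ?B < \<infinity>" using emeasure_bounded_finite[of ?B] by simp
  have iB: "sq lebesgue (indicator ?B :: _ => real)"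
  proof -
   have "integrable lebesgue (indicator ?B :: _ => real)" using Bf by (intro integrable_real_indicator) auto
   moreover have "(%x. (norm (indicator ?B x :: real))\<^sup>2) = indicator ?B" by (auto simp: indicator_def)
   ultimately show ?thesis by (simp add: sq_def)
  qed
  have nB: "nrm lebesgue (indicator ?B :: _ => real) = sqrt (unit_ball_vol (real CARD('n))) * r powr (real CARD('n) / 2)"
  proof -
   have "(%x. (norm (indicator ?B x :: real))\<^sup>2) = indicator ?B" by (auto simp: indicator_def)
   then have "nrm lebesgue (indicator ?B :: _ => real) = sqrt (measure lborel ?B)"
    by (simp add: nrm_def)
   also have "\<dots> = sqrt (unit_ball_vol (real CARD('n))) * sqrt (r ^ CARD('n))"
    using r by (simp add: content_ball real_sqrt_mult)
   also have "sqrt (r ^ CARD('n)) = r powr (real CARD('n) / 2)"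
    using r by (simp add: powr_half_sqrt[symmetric] powr_realpow[symmetric] powr_powr)
   finally show ?thesis .
  qed
  have ule: "norm (?u x) \<le> ?K * norm (indicator ?B x :: real)" for x
  proof (cases "x \<in> ?B")
   case True
   have "rho x \<le> 1 + norm c + r" using rho_le[of x] True norm_triangle_ineq2[of x c] by (simp add: dist_norm norm_minus_commute)
   then have "rho x powr (- \<sigma>) \<le> ?K" using \<sigma> by (intro powr_mono2) (auto simp: less_imp_le)
   then show ?thesis using True by simp
  qed simp
  have um: "?u \<in> borel_measurable lebesgue" by (intro borel_measurable_times rho_powr_measurable borel_measurable_indicator) auto
  have us: "sq lebesgue ?u" and un: "nrm lebesgue ?u \<le> ?K * nrm lebesgue (indicator ?B :: _ => real)"
   using sq_dom[OF iB um AE_I2[OF ule]] by auto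
  have vs: "sq lebesgue ?v" and vn: "nrm lebesgue ?v \<le> 1 * nrm lebesgue (%x. rho x powr \<sigma> * f x)"
   using sq_dom[OF sq, of ?v 1] sq_measurable[OF sq] by auto
  have eq: "?u x \<bullet> ?v x = \<bar>indicator ?B x * f x\<bar>" for x
   by (simp add: abs_mult powr_minus) (simp add: less_imp_neq[OF rho_pos, symmetric])
  have i: "integrable lebesgue (%x. \<bar>indicator ?B x * f x\<bar>)" using sq_inner[OF us vs] unfolding eq .
  have "(%x. indicator ?B x * f x) \<in> borel_measurable lebesgue" using f by (intro borel_measurable_times borel_measurable_indicator) auto
  from integrable_abs_cancel[OF i this] have i': "integrable lebesgue (%x. indicator ?B x * f x)" .
  have "integral\<^sup>L lebesgue (%x. \<bar>indicator ?B x * f x\<bar>) = ip lebesgue ?u ?v" unfolding ip_def eq ..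
  also have "\<dots> \<le> nrm lebesgue ?u * nrm lebesgue ?v" using ip_CS[OF us vs] by simp
  also have "\<dots> \<le> (?K * nrm lebesgue (indicator ?B :: _ => real)) * nrm lebesgue (%x. rho x powr \<sigma> * f x)"
   using un vn by (intro mult_mono) auto
  also have "\<dots> = C * (?K * r powr (real CARD('n) / 2))" unfolding nB C_def by (simp add: mult_ac)
  finally show ?thesis using i' by simp
 qed
 with C0 show ?thesis by blast
qed

section \<open>Dilated profiles and the Liouville theorem\<close>

lemma flat_exp_bounded: "\<exists>B\<ge>0. \<forall>x\<le>J. \<bar>flat_exp m x\<bar> \<le> B"
proof -
 have "compact (flat_exp m ` {0..J})"
  by (intro compact_continuous_image continuous_on_subset[OF continuous_flat_exp]) auto
 then obtain B where B: "\<forall>y\<in>flat_exp m ` {0..J}. norm y \<le> B" "B > 0"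
  using bounded_pos compact_imp_bounded by metis
 have "\<bar>flat_exp m x\<bar> \<le> B" if "x \<le> J" for x
 proof (cases "x \<le> 0")
  case True
  then show ?thesis using B(2) by (simp add: flat_exp_def)
 next
  case False
  then show ?thesis using B(1) that by auto
 qed
 then show ?thesis using B(2) by (intro exI[of _ B]) auto
qed

text \<open>The integrand vanishes for \<open>s \<ge> 1\<close>, so a primitive is constant there
  and can be normalised to 0; composed with a multiple of a squared distance it has compact
  support.\<close>

lemma flat_exp_antiderivative:
 assumes J: "J > 0"
 shows "\<exists>m. (\<forall>s. (m has_real_derivative flat_exp 0 (J * (1 - s))) (at s)) \<and> (\<forall>s\<ge>1. m s = 0)"
proof -
 have c: "continuous_on UNIV (%s. flat_exp 0 (J * (1 - s)))"
  by (rule continuous_on_compose2[OF continuous_flat_exp]) (auto intro!: continuous_intros)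
 then have "isCont (%s. flat_exp 0 (J * (1 - s))) s" for s by (simp add: continuous_on_eq_continuous_at)
 then obtain M where M: "\<And>s. (M has_real_derivative flat_exp 0 (J * (1 - s))) (at s)"
  using einterval_antiderivative[of "-\<infinity>" "\<infinity>" "%s. flat_exp 0 (J * (1 - s))"]
  by (auto simp: has_real_derivative_iff_has_vector_derivative)
 have c1: "M s = M 1" if "s \<ge> 1" for s
 proof (cases "s = 1")
  case False
  then have s: "1 < s" using that by simp
  have "\<exists>z>1. z < s \<and> M s - M 1 = (s - 1) * flat_exp 0 (J * (1 - z))"
   by (rule MVT2[OF s]) (rule M)
  then obtain z where z: "z > 1" "M s - M 1 = (s - 1) * flat_exp 0 (J * (1 - z))" by blast
  have "J * (1 - z) \<le> 0" using J z(1) by (intro mult_nonneg_nonpos) auto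
  then show ?thesis using z(2) by (simp add: flat_exp_0)
 qed simp
 have d1: "((%s. M s - M 1) has_real_derivative flat_exp 0 (J * (1 - s))) (at s)" for s
  using DERIV_diff[OF M DERIV_const, of "M 1" s] by simp
 have "M s - M 1 = 0" if "s \<ge> 1" for s unfolding c1[OF that] by simp
 with d1 show ?thesis by blast
qed

text \<open>The test function is that primitive evaluated at \<open>a * d y\<close>. With k the
  profile, its Laplacian is 2 a (N k + 2 a k'), the prime being the derivative in \<open>a\<close>.
  Integrated against a harmonic function this becomes a differential equation in the dilation
  parameter.\<close>

lemma dilated_profile_test:
 fixes c :: "real ^ 'n::finite"
 assumes J: "J > 0" and a: "a > 0"
 defines "d \<equiv> %y. (y - c) \<bullet> (y - c)"
 obtains \<Phi> where "\<Phi> \<in> C0_inf UNIV"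
  "\<And>y. lap \<Phi> y = 2 * a * (real CARD('n) * flat_exp 0 (J * (1 - a * d y)) - 2 * a * (d y * (J * flat_exp 2 (J * (1 - a * d y)))))"
proof -
 obtain m where m: "\<And>s. (m has_real_derivative flat_exp 0 (J * (1 - s))) (at s)" "\<And>s. s \<ge> 1 ==> m s = 0"
  using flat_exp_antiderivative[OF J] by blast
 let ?k = "%i y. flat_exp i (J * (1 - a * d y))" and ?l = "%n y. 2 * a * ((y - c) \<bullet> axis n 1)"
 let ?\<Phi> = "%y. m (a * d y)"
 have dd: "((%y. a * d y) has_derivative (%h. a * (2 * ((y - c) \<bullet> h)))) (at y)" for y
  unfolding d_def by (auto intro!: derivative_eq_intros simp: inner_commute)
 have D: "(?\<Phi> has_derivative (%h. ?k 0 y * (a * (2 * ((y - c) \<bullet> h))))) (at y)" for y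
  by (rule has_derivative_compose[OF dd m(1)[unfolded has_field_derivative_def]])
 have p1: "partial_deriv n ?\<Phi> = (%y. ?k 0 y * ?l n y)" for n
  using partial_deriv_eq[OF D] by (simp add: fun_eq_iff mult_ac)
 have sk: "Ck_on j UNIV (?k i)" for i j
  unfolding d_def by (intro Ck_flat_exp Ck_mult Ck_diff Ck_const Ck_sqdist)
 have sl: "Ck_on j UNIV (?l n)" for j n by (intro Ck_mult Ck_const Ck_inner Ck_diff Ck_ident)
 have "Ck_on (Suc j) UNIV ?\<Phi>" for j
 proof (rule Ck_SucI[OF D])
  show "Ck_on j UNIV (%y. ?k 0 y * (a * (2 * ((y - c) \<bullet> axis n 1))))" for n
   by (intro Ck_mult Ck_const Ck_inner Ck_diff Ck_ident sk)
 qed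
 then have sm: "Ck_on j UNIV ?\<Phi>" for j using Ck_SucD by blast
 have z: "?\<Phi> y = 0" if "y \<notin> cball c (sqrt (1 / a))" for y
 proof -
  have "sqrt (1 / a) \<le> norm (y - c)" using that by (simp add: dist_norm norm_minus_commute)
  then have "1 / a \<le> (norm (y - c))\<^sup>2" using a power_mono[of "sqrt (1 / a)" "norm (y - c)" 2] by simp
  then have "1 \<le> a * d y" using a by (simp add: d_def dot_square_norm pos_divide_le_eq mult.commute)
  then show ?thesis by (rule m(2))
 qed
 have C: "?\<Phi> \<in> C0_inf UNIV"
  unfolding C0_inf_def using sm z by (auto intro!: exI[of _ "cball c (sqrt (1 / a))"])
 have p2: "partial_deriv n (?k 0) y = - (J * ?k 2 y) * ?l n y" for n y
 proof -
  have "((%y. J * (1 - a * d y)) has_derivative (%h. - (J * (a * (2 * ((y - c) \<bullet> h)))))) (at y)"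
   using has_derivative_mult_right[OF has_derivative_diff[OF has_derivative_const dd[of y]], of J 1] by simp
  from has_derivative_compose[OF this flat_exp_deriv[of 0, unfolded has_field_derivative_def]]
  have "(?k 0 has_derivative (%h. ?k 2 y * (- (J * (a * (2 * ((y - c) \<bullet> h))))))) (at y)"
   by (simp add: numeral_2_eq_2)
  from partial_deriv_eq[OF this] show ?thesis by simp
 qed
 have p3: "partial_deriv n (?l n) y = 2 * a" for n y
 proof -
  have "(?l n has_derivative (%h. 2 * a * (h \<bullet> axis n 1))) (at y)"
   by (auto intro!: derivative_eq_intros)
  from partial_deriv_eq[OF this] show ?thesis by (simp add: inner_axis_axis)
 qed
 have "lap ?\<Phi> y = 2 * a * (real CARD('n) * ?k 0 y - 2 * a * (d y * (J * ?k 2 y)))" for y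
 proof -
  have "lap ?\<Phi> y = (\<Sum>n\<in>UNIV. ?k 0 y * (2 * a) + - (J * ?k 2 y) * ?l n y * ?l n y)"
   unfolding lap_def p1
   by (intro sum.cong refl, subst partial_deriv_bilinear[OF bounded_bilinear_mult]) (use sk sl p2 p3 in auto)
  also have "\<dots> = (\<Sum>n\<in>UNIV. ?k 0 y * (2 * a) - (4 * a * a * J * ?k 2 y) * (((y - c) $ n) * ((y - c) $ n)))"
   by (intro sum.cong refl) (simp add: inner_axis algebra_simps)
  also have "\<dots> = real CARD('n) * (?k 0 y * (2 * a)) - (4 * a * a * J * ?k 2 y) * d y"
   by (simp only: sum_subtractf sum_constant sum_distrib_left[symmetric] d_def inner_vec_def inner_real_def)
  finally show ?thesis by (simp add: algebra_simps)
 qed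
 with C show ?thesis by (rule that)
qed

text \<open>A mean value argument that takes no derivatives of \<open>f\<close>. The integral P(b)
  of \<open>f\<close> against the profile dilated by \<open>b\<close> solves N P + 2 b P' = 0, so
  b^(N / 2) P(b) is constant in \<open>b\<close>; as the support grows, the weighted bound forces
  the constant to be 0. When the profiles tend to indicators, all integrals over balls are seen to
  vanish.\<close>

theorem weighted_liouville:
 fixes f :: "real ^ 'n::finite => real"
 assumes f: "f \<in> borel_measurable lebesgue" and sqf: "sq lebesgue (%x. rho x powr \<sigma> * f x)"
  and \<sigma>: "- real CARD('n) / 2 < \<sigma>"
  and harm: "\<And>\<phi>. \<phi> \<in> C0_inf UNIV ==> integral\<^sup>L lebesgue (%x. f x * lap \<phi> x) = 0"
 shows "AE x in lebesgue. f x = 0"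
proof -
 define N where "N = real CARD('n)"
 have N: "N > 0" by (simp add: N_def)
 \<comment> \<open>A weight exponent \<le> 0 makes the reciprocal weight nondecreasing in |x|, as
   the ball estimate requires; the lower bound - N / 2 is preserved.\<close>
 define \<tau> where "\<tau> = min \<sigma> 0"
 have \<tau>: "\<tau> \<le> 0" "- N / 2 < \<tau>" using \<sigma> N by (auto simp: \<tau>_def N_def)
 have "norm (rho x powr \<tau> * f x) \<le> 1 * norm (rho x powr \<sigma> * f x)" for x
  using rho_powr_mono[of \<tau> \<sigma> x] by (simp add: abs_mult \<tau>_def mult_right_mono)
 then have sqt: "sq lebesgue (%x. rho x powr \<tau> * f x)"
  using f by (intro sq_dom(1)[OF sqf, of _ 1] AE_I2) auto
 obtain C where C: "C \<ge> 0" "\<And>c r. 0 < r ==> integrable lebesgue (%x. indicator (ball c r) x * f x)"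
  "\<And>c r. 0 < r ==> integral\<^sup>L lebesgue (%x. \<bar>indicator (ball c r) x * f x\<bar>) \<le> C * ((1 + norm c + r) powr (- \<tau>) * r powr (N / 2))"
  using weighted_ball_estimate[OF f sqt \<tau>(1)] unfolding N_def by blast
 have profile: "integral\<^sup>L lebesgue (%y. f y * flat_exp 0 (J * (1 - a * ((y - c) \<bullet> (y - c))))) = 0"
  if J: "J > 0" and a: "a > 0" for J a c
 proof -
  define d where "d y = (y - c) \<bullet> (y - c)" for y
  have d0: "d y \<ge> 0" for y by (simp add: d_def)
  define P where "P b = integral\<^sup>L lebesgue (%y. f y * flat_exp 0 (J * (1 - b * d y)))" for b
  \<comment> \<open>\<open>Q\<close> is the formal derivative of \<open>P\<close>; \<open>DP\<close>
    below justifies the differentiation under the integral.\<close>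
  define Q where "Q b = integral\<^sup>L lebesgue (%y. f y * (- d y * (J * flat_exp 2 (J * (1 - b * d y)))))" for b
  obtain B where B: "B \<ge> 0" "\<And>x. x \<le> J ==> \<bar>flat_exp 2 x\<bar> \<le> B" using flat_exp_bounded[of J 2] by blast
  have dball: "d y < 1 / b" if "b > 0" "b * d y < 1" for b y using that by (simp add: pos_less_divide_eq mult.commute)
  have inball: "y \<in> ball c r" if "d y < r\<^sup>2" "r > 0" for y r
   using that power2_less_imp_less[of "norm (y - c)" r] by (simp add: d_def dot_square_norm dist_norm norm_minus_commute)
  have contd: "continuous_on UNIV d" unfolding d_def by (intro continuous_intros)
  have km: "(%y. flat_exp i (J * (1 - b * d y))) \<in> borel_measurable lebesgue" for i b
  proof -
   have "continuous_on UNIV (%y. flat_exp i (J * (1 - b * d y)))"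
    by (rule continuous_on_compose2[OF continuous_flat_exp]) (auto intro!: continuous_intros contd)
   then show ?thesis by (intro measurable_completion) (simp add: borel_measurable_continuous_onI)
  qed
  have dm: "d \<in> borel_measurable lebesgue"
   by (intro measurable_completion) (simp add: borel_measurable_continuous_onI contd)
  have flat0: "flat_exp i (J * (1 - b * d y)) = 0" if "b * d y \<ge> 1" for i b y
  proof -
   have "J * (1 - b * d y) \<le> 0" using that J by (intro mult_nonneg_nonpos) auto
   then show ?thesis by (simp add: flat_exp_def)
  qed
  have flatB: "\<bar>flat_exp 2 (J * (1 - b * d y))\<bar> \<le> B" if "b > 0" for b y
   using J d0[of y] that by (intro B) (simp add: mult_le_cancel_left1)
  have intP: "integrable lebesgue (%y. f y * flat_exp 0 (J * (1 - b * d y)))" if b: "b > 0" for b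
  proof (rule Bochner_Integration.integrable_bound[OF C(2)[of "sqrt (1 / b)" c]])
   show "(%y. f y * flat_exp 0 (J * (1 - b * d y))) \<in> borel_measurable lebesgue" by (intro borel_measurable_times f km)
   show "AE y in lebesgue. norm (f y * flat_exp 0 (J * (1 - b * d y))) \<le> norm (indicator (ball c (sqrt (1 / b))) y * f y)"
   proof (intro AE_I2)
    fix y
    show "norm (f y * flat_exp 0 (J * (1 - b * d y))) \<le> norm (indicator (ball c (sqrt (1 / b))) y * f y)"
    proof (cases "b * d y < 1")
     case True
     then have "y \<in> ball c (sqrt (1 / b))" using dball[OF b True] b by (intro inball) auto
     then show ?thesis by (simp add: abs_mult mult_left_le)
    qed (simp add: flat0)
   qed
  qed (use b in simp)
  have intQ: "integrable lebesgue (%y. f y * (- d y * (J * flat_exp 2 (J * (1 - b * d y)))))" if b: "b > 0" for b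
  proof (rule Bochner_Integration.integrable_bound)
   show "integrable lebesgue (%y. (1 / b * J * B) * (indicator (ball c (sqrt (1 / b))) y * f y))"
    by (intro integrable_mult_right C(2)) (use b in simp)
   show "(%y. f y * (- d y * (J * flat_exp 2 (J * (1 - b * d y))))) \<in> borel_measurable lebesgue"
    by (intro borel_measurable_times borel_measurable_uminus f km dm borel_measurable_const)
   show "AE y in lebesgue. norm (f y * (- d y * (J * flat_exp 2 (J * (1 - b * d y))))) \<le> norm ((1 / b * J * B) * (indicator (ball c (sqrt (1 / b))) y * f y))"
   proof (intro AE_I2)
    fix y
    show "norm (f y * (- d y * (J * flat_exp 2 (J * (1 - b * d y))))) \<le> norm ((1 / b * J * B) * (indicator (ball c (sqrt (1 / b))) y * f y))"
    proof (cases "b * d y < 1")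
     case True
     then have yb: "y \<in> ball c (sqrt (1 / b))" using dball[OF b True] b by (intro inball) auto
     have "d y * (J * \<bar>flat_exp 2 (J * (1 - b * d y))\<bar>) \<le> 1 / b * (J * B)"
      using dball[OF b True] flatB[OF b, of y] J d0[of y] b B(1) by (intro mult_mono) auto
     then have "\<bar>f y\<bar> * (d y * (J * \<bar>flat_exp 2 (J * (1 - b * d y))\<bar>)) \<le> \<bar>f y\<bar> * (1 / b * (J * B))"
      by (intro mult_left_mono) auto
     then show ?thesis using yb J d0[of y] B(1) b by (simp add: abs_mult mult_ac)
    qed (simp add: flat0)
   qed
  qed
  have PQ: "N * P b + 2 * b * Q b = 0" if b: "b > 0" for b
  proof -
   obtain \<Phi> where \<Phi>: "\<Phi> \<in> C0_inf UNIV"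
    "\<And>y. lap \<Phi> y = 2 * b * (real CARD('n) * flat_exp 0 (J * (1 - b * d y)) - 2 * b * (d y * (J * flat_exp 2 (J * (1 - b * d y)))))"
    using dilated_profile_test[OF J b, of c] unfolding d_def by blast
   have "0 = integral\<^sup>L lebesgue (%x. f x * lap \<Phi> x)" using harm[OF \<Phi>(1)] by simp
   also have "(%x. f x * lap \<Phi> x) = (%y. 2 * b * (N * (f y * flat_exp 0 (J * (1 - b * d y))) + 2 * b * (f y * (- d y * (J * flat_exp 2 (J * (1 - b * d y)))))))"
    unfolding \<Phi>(2) N_def by (simp add: fun_eq_iff algebra_simps)
   also have "integral\<^sup>L lebesgue \<dots> = 2 * b * (N * P b + 2 * b * Q b)"
    using intP[OF b] intQ[OF b] unfolding P_def Q_def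
    by (subst integral_mult_right_zero, subst Bochner_Integration.integral_add) (auto intro: integrable_mult_right)
   finally show ?thesis using b by simp
  qed
  have DP: "(P has_real_derivative Q b) (at b)" if b: "b > 0" for b
  proof -
   \<comment> \<open>Staying above \<open>b / 2\<close> confines all profiles to the ball of radius
     \<open>sqrt (2 / b)\<close>, which provides the dominating function.\<close>
   define S where "S = {b / 2 <..}"
   have "((%b'. (P b' - P b) / (b' - b)) \<longlongrightarrow> Q b) (at b within S)"
    unfolding tendsto_at_iff_sequentially
   proof (intro allI impI)
    fix X assume X: "\<forall>i. X i \<in> S - {b}" "X \<longlonglongrightarrow> b"
    have Xp: "X i > 0" "X i > b / 2" "X i \<noteq> b" for i using X(1) b by (auto simp: S_def) (smt (verit) half_gt_zero)
    let ?q = "%i y. f y * ((flat_exp 0 (J * (1 - X i * d y)) - flat_exp 0 (J * (1 - b * d y))) / (X i - b))"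
    have kder: "((%v. flat_exp 0 (J * (1 - v * d y))) has_real_derivative - d y * (J * flat_exp 2 (J * (1 - v * d y)))) (at v)" for v y
    proof -
     have "((%v. J * (1 - v * d y)) has_real_derivative - (J * d y)) (at v)"
      by (auto intro!: derivative_eq_intros)
     from DERIV_chain2[OF flat_exp_deriv[of 0] this] show ?thesis by (simp add: numeral_2_eq_2 mult_ac)
    qed
    have "(%i. integral\<^sup>L lebesgue (?q i)) \<longlonglongrightarrow> Q b" unfolding Q_def
    proof (rule integral_dominated_convergence)
     let ?w = "%y. (2 / b * J * B) * \<bar>indicator (ball c (sqrt (2 / b))) y * f y\<bar>"
     show "integrable lebesgue ?w"
      by (intro integrable_mult_right integrable_abs C(2)) (use b in simp)
     show "(%y. f y * (- d y * (J * flat_exp 2 (J * (1 - b * d y))))) \<in> borel_measurable lebesgue"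
      by (intro borel_measurable_times borel_measurable_uminus f km dm borel_measurable_const)
     show "?q i \<in> borel_measurable lebesgue" for i
      by (intro borel_measurable_times borel_measurable_divide borel_measurable_diff f km borel_measurable_const)
     show "AE y in lebesgue. (%i. ?q i y) \<longlonglongrightarrow> f y * (- d y * (J * flat_exp 2 (J * (1 - b * d y))))"
     proof (intro AE_I2 tendsto_mult tendsto_const)
      fix y
      have "((%v. (flat_exp 0 (J * (1 - v * d y)) - flat_exp 0 (J * (1 - b * d y))) / (v - b)) \<longlongrightarrow> - d y * (J * flat_exp 2 (J * (1 - b * d y)))) (at b)"
       using kder[where v=b and y=y] by (simp add: has_field_derivative_iff)
      then show "(%i. (flat_exp 0 (J * (1 - X i * d y)) - flat_exp 0 (J * (1 - b * d y))) / (X i - b)) \<longlonglongrightarrow> - d y * (J * flat_exp 2 (J * (1 - b * d y)))"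
       unfolding tendsto_at_iff_sequentially using X(2) Xp(3) by (simp add: o_def)
     qed
     show "AE y in lebesgue. norm (?q i y) \<le> ?w y" for i
     proof (intro AE_I2)
      fix y
      show "norm (?q i y) \<le> ?w y"
      proof (cases "b / 2 * d y < 1")
       case True
       have "d y < 1 / (b / 2)" using b by (intro dball True) auto
       then have dy: "d y < 2 / b" by simp
       then have yb: "y \<in> ball c (sqrt (2 / b))" using b by (intro inball) auto
       \<comment> \<open>A mean value bound for the difference quotient, uniform in the dilation
         parameter.\<close>
       have "norm (flat_exp 0 (J * (1 - X i * d y)) - flat_exp 0 (J * (1 - b * d y))) \<le> (2 / b * J * B) * norm (X i - b)"
       proof (rule field_differentiable_bound[of "{0<..}" _ "%v. - d y * (J * flat_exp 2 (J * (1 - v * d y)))"])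
        show "((%v. flat_exp 0 (J * (1 - v * d y))) has_field_derivative - d y * (J * flat_exp 2 (J * (1 - v * d y)))) (at v within {0<..})" for v
         by (rule has_field_derivative_at_within[OF kder])
        show "norm (- d y * (J * flat_exp 2 (J * (1 - v * d y)))) \<le> 2 / b * J * B" if "v \<in> {0<..}" for v
        proof -
         have "d y * (J * \<bar>flat_exp 2 (J * (1 - v * d y))\<bar>) \<le> 2 / b * (J * B)"
          using dy flatB[of v y] that J d0[of y] b B(1) by (intro mult_mono) auto
         then show ?thesis using J d0[of y] by (simp add: abs_mult mult_ac)
        qed
       qed (use b Xp(1) in auto)
       then have "\<bar>(flat_exp 0 (J * (1 - X i * d y)) - flat_exp 0 (J * (1 - b * d y))) / (X i - b)\<bar> \<le> 2 / b * J * B"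
        using Xp(3)[of i] by (simp add: abs_divide pos_divide_le_eq)
       then have "\<bar>f y\<bar> * \<bar>(flat_exp 0 (J * (1 - X i * d y)) - flat_exp 0 (J * (1 - b * d y))) / (X i - b)\<bar> \<le> \<bar>f y\<bar> * (2 / b * J * B)"
        by (intro mult_left_mono) auto
       then show ?thesis using yb by (simp add: abs_mult mult_ac)
      next
       case False
       have "b / 2 * d y \<le> X i * d y" "b / 2 * d y \<le> b * d y"
        using Xp(2)[of i] b d0[of y] by (intro mult_right_mono, auto)+
       then have "1 \<le> X i * d y" "1 \<le> b * d y" using False by linarith+
       then show ?thesis using J B(1) b by (simp add: flat0)
      qed
     qed
    qed
    moreover have "integral\<^sup>L lebesgue (?q i) = (P (X i) - P b) / (X i - b)" for i
     unfolding P_def using intP[OF Xp(1)[of i]] intP[OF b]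
     by (simp add: right_diff_distrib diff_divide_distrib[symmetric])
    ultimately have "(%i. (P (X i) - P b) / (X i - b)) \<longlonglongrightarrow> Q b" by (simp only:)
    then show "((%b'. (P b' - P b) / (b' - b)) \<circ> X) \<longlonglongrightarrow> Q b" by (simp only: o_def)
   qed
   moreover have "at b within S = at b" unfolding S_def by (rule at_within_open) (use b in auto)
   ultimately show ?thesis by (simp add: has_field_derivative_iff)
  qed
  define I where "I b = b powr (N / 2) * P b" for b
  have DI: "(I has_real_derivative 0) (at b)" if b: "b > 0" for b
  proof -
   have "(I has_real_derivative (N / 2 * b powr (N / 2 - 1)) * P b + Q b * b powr (N / 2)) (at b)"
    unfolding I_def using b by (intro DERIV_mult has_real_derivative_powr DP)
   moreover have "(N / 2 * b powr (N / 2 - 1)) * P b + Q b * b powr (N / 2) = b powr (N / 2 - 1) / 2 * (N * P b + 2 * b * Q b)"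
   proof -
    have e: "b powr (N / 2) = b * b powr (N / 2 - 1)" using powr_mult_base[of b "N / 2 - 1"] b by simp
    show ?thesis unfolding e by (simp add: algebra_simps)
   qed
   ultimately show ?thesis using PQ[OF b] by simp
  qed
  have Iconst: "I u = I v" if uv: "u > 0" "v > 0" for u v
  proof -
   have "\<exists>z. \<forall>x\<in>{0<..}. I x = z"
    by (rule has_field_derivative_zero_constant) (auto intro: has_field_derivative_at_within DI)
   then show ?thesis using uv by auto
  qed
  \<comment> \<open>The constant is evaluated at \<open>1 / r\<^sup>2\<close>, where the profile
    lives in the ball of radius \<open>r\<close>.\<close>
  have Ibound: "\<bar>I a\<bar> \<le> C * ((1 + norm c + r) powr (- \<tau>) * r powr (- N / 2))" if r: "r > 0" for r
  proof -
   have r2: "1 / r\<^sup>2 > 0" using r by simp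
   have "\<bar>P (1 / r\<^sup>2)\<bar> \<le> integral\<^sup>L lebesgue (%y. \<bar>f y * flat_exp 0 (J * (1 - 1 / r\<^sup>2 * d y))\<bar>)"
    unfolding P_def using integral_norm_bound by (simp only: real_norm_def[symmetric])
   also have "\<dots> \<le> integral\<^sup>L lebesgue (%x. \<bar>indicator (ball c r) x * f x\<bar>)"
   proof (rule integral_mono)
    show "integrable lebesgue (%y. \<bar>f y * flat_exp 0 (J * (1 - 1 / r\<^sup>2 * d y))\<bar>)" by (rule integrable_abs[OF intP[OF r2]])
    show "integrable lebesgue (%x. \<bar>indicator (ball c r) x * f x\<bar>)" by (rule integrable_abs[OF C(2)[OF r]])
    fix y
    show "\<bar>f y * flat_exp 0 (J * (1 - 1 / r\<^sup>2 * d y))\<bar> \<le> \<bar>indicator (ball c r) y * f y\<bar>"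
    proof (cases "1 / r\<^sup>2 * d y < 1")
     case True
     then have "y \<in> ball c r" using dball[OF r2 True] r by (intro inball) auto
     then show ?thesis by (simp add: abs_mult mult_left_le)
    next
     case False
     then have "flat_exp 0 (J * (1 - 1 / r\<^sup>2 * d y)) = 0" by (intro flat0) linarith
     then show ?thesis by (simp only: mult_zero_right abs_zero abs_ge_zero)
    qed
   qed
   also have "\<dots> \<le> C * ((1 + norm c + r) powr (- \<tau>) * r powr (N / 2))" by (rule C(3)[OF r])
   finally have "\<bar>P (1 / r\<^sup>2)\<bar> \<le> C * ((1 + norm c + r) powr (- \<tau>) * r powr (N / 2))" .
   then have "\<bar>I (1 / r\<^sup>2)\<bar> \<le> (1 / r\<^sup>2) powr (N / 2) * (C * ((1 + norm c + r) powr (- \<tau>) * r powr (N / 2)))"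
    unfolding I_def by (simp add: abs_mult mult_left_mono)
   also have "(1 / r\<^sup>2) powr (N / 2) = r powr (- N)"
   proof -
    have e: "1 / r\<^sup>2 = r powr (- 2)" using powr_minus_divide[of r 2] powr_numeral[of r] r by simp
    show ?thesis unfolding e powr_powr by simp
   qed
   also have "r powr (- N) * (C * ((1 + norm c + r) powr (- \<tau>) * r powr (N / 2))) = C * ((1 + norm c + r) powr (- \<tau>) * (r powr (- N) * r powr (N / 2)))"
    by (simp add: mult_ac)
   also have "r powr (- N) * r powr (N / 2) = r powr (- N / 2)"
    by (simp add: powr_add[symmetric])
   finally show ?thesis using Iconst[OF a r2] by simp
  qed
  \<comment> \<open>For \<open>r \<ge> 1 + norm c\<close> the centre is absorbed in a factor 2, and
    the bound decays like r^(- \<tau> - N / 2).\<close>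
  have "\<bar>I a\<bar> \<le> 0"
  proof (rule tendsto_lowerbound[of "%r. C * (2 powr (- \<tau>) * r powr (- \<tau> - N / 2))" _ at_top])
   have "((%r. r powr (- \<tau> - N / 2)) \<longlongrightarrow> 0) at_top"
    using \<tau> by (intro tendsto_neg_powr filterlim_ident) auto
   from tendsto_mult[OF tendsto_const tendsto_mult[OF tendsto_const this], of C "2 powr (- \<tau>)"]
   show "((%r. C * (2 powr (- \<tau>) * r powr (- \<tau> - N / 2))) \<longlongrightarrow> 0) at_top" by simp
   show "\<forall>\<^sub>F r in at_top. \<bar>I a\<bar> \<le> C * (2 powr (- \<tau>) * r powr (- \<tau> - N / 2))"
   proof (rule eventually_at_top_linorderI[of "1 + norm c"])
    fix r assume r: "r \<ge> 1 + norm c"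
    then have r0: "r > 0" using norm_ge_zero[of c] by linarith
    have "(1 + norm c + r) powr (- \<tau>) \<le> (2 * r) powr (- \<tau>)" using r r0 \<tau> by (intro powr_mono2) auto
    then have "(1 + norm c + r) powr (- \<tau>) * r powr (- N / 2) \<le> (2 * r) powr (- \<tau>) * r powr (- N / 2)"
     by (intro mult_right_mono) auto
    also have "\<dots> = 2 powr (- \<tau>) * r powr (- \<tau> - N / 2)"
     using r0 by (simp add: powr_mult mult.assoc powr_add[symmetric])
    finally have "C * ((1 + norm c + r) powr (- \<tau>) * r powr (- N / 2)) \<le> C * (2 powr (- \<tau>) * r powr (- \<tau> - N / 2))"
     using C(1) by (rule mult_left_mono)
    then show "\<bar>I a\<bar> \<le> C * (2 powr (- \<tau>) * r powr (- \<tau> - N / 2))" using Ibound[OF r0] by linarith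
   qed
  qed simp
  then have "P a = 0" using a by (simp add: I_def)
  then show ?thesis by (simp add: P_def d_def)
 qed
 have "AE x in lebesgue. x \<in> UNIV \<longrightarrow> f x = 0"
 proof (rule balls_zero_AE[OF open_UNIV f])
  show "integrable lebesgue (%x. indicator (ball 0 R) x * f x)" for R
  proof (cases "R > 0")
   case False
   then have b: "ball (0::real^'n) R = {}" by simp
   show ?thesis unfolding b by simp
  qed (rule C(2))
  fix c :: "real^'n" and r :: real assume r: "0 < r"
  \<comment> \<open>With \<open>J = real (Suc j)\<close> and \<open>a = 1 / r\<^sup>2\<close> the
    profile is the bump of \<open>bump_limit\<close> for
    \<open>\<kappa> = 1 / r\<^sup>2\<close>.\<close>
  have "integral\<^sup>L lebesgue (%x. f x * flat_exp 0 (real (Suc j) * (1 / r\<^sup>2 * (r\<^sup>2 - (x - c) \<bullet> (x - c))))) = 0" for j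
  proof -
   have "1 / r\<^sup>2 * (r\<^sup>2 - z) = 1 - 1 / r\<^sup>2 * z" for z using r by (simp add: right_diff_distrib)
   then show ?thesis using profile[of "real (Suc j)" "1 / r\<^sup>2" c] r by simp
  qed
  moreover have "1 / r\<^sup>2 > 0" using r by simp
  ultimately have "(%j::nat. 0) \<longlonglongrightarrow> integral\<^sup>L lebesgue (%x. indicator (ball c r) x * f x)"
   using bump_limit[OF f C(2)[OF r, of c] r, of "1 / r\<^sup>2"] by (simp only: )
  then show "integral\<^sup>L lebesgue (%x. indicator (ball c r) x * f x) = 0" by (simp add: LIMSEQ_const_iff)
 qed
 then show ?thesis by simp
qed

section \<open>Square integrability at infinity of weakly harmonic fields on the whole space\<close>

lemma wedge1_zero [simp]: "wedge1 n 0 = 0" by (rule linear_0[OF linear_wedge1])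
lemma contr_zero [simp]: "contr n 0 = 0" by (rule linear_0[OF linear_contr])
lemma R_op_zero [simp]: "R_op p 0 = 0" by (rule linear_0[OF linear_R_op])
lemma ctr_zero [simp]: "ctr p 0 = 0" by (rule linear_0[OF linear_ctr])

section \<open>Test forms, Dirichlet integrals and potentials\<close>

lemma test_formsD:
 assumes "\<Phi> \<in> test_forms Om q"
 shows "smooth \<Phi>" "csupp \<Phi>" "\<Phi> x \<in> alt q"
  "\<exists>K. compact K \<and> K \<subseteq> Om \<and> (\<forall>x. x \<notin> K \<longrightarrow> \<Phi> x = 0)"
 using assms by (auto simp: test_forms_def C0_inf_def csupp_def)

lemma test_formsI:
 assumes "smooth \<Phi>" "compact K" "K \<subseteq> Om" "\<And>x. x \<notin> K ==> \<Phi> x = 0" "\<And>x. \<Phi> x \<in> alt q"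
 shows "\<Phi> \<in> test_forms Om q"
 using assms by (auto simp: test_forms_def C0_inf_def)

lemma partial_deriv_alt:
 assumes "smooth \<Phi>" "\<And>x. \<Phi> x \<in> alt q" shows "partial_deriv n \<Phi> x \<in> alt q"
proof -
 have "partial_deriv n \<Phi> x $ I = 0" if I: "int (card I) \<noteq> q" for I
 proof -
  have "partial_deriv n (%x. \<Phi> x $ I) x = partial_deriv n \<Phi> x $ I"
   by (rule partial_deriv_linear[OF bounded_linear_vec_nth assms(1)])
  moreover have "(%x. \<Phi> x $ I) = (%x. 0)" using assms(2) I by (auto simp: alt_def)
  ultimately show ?thesis by simp
 qed
 then show ?thesis by (simp add: alt_def)
qed

lemma
 assumes "\<Phi> \<in> test_forms Om q"
 shows test_forms_ext_d: "ext_d \<Phi> \<in> test_forms Om (q + 1)"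
 and test_forms_codd: "codd \<Phi> \<in> test_forms Om (q - 1)"
proof -
 note t = test_formsD[OF assms]
 obtain K where K: "compact K" "K \<subseteq> Om" "\<And>x. x \<notin> K ==> \<Phi> x = 0" using t(4) by blast
 have z: "x \<notin> K ==> partial_deriv n \<Phi> x = 0" for n x
  using partial_deriv_outside_support[OF compact_imp_closed[OF K(1)]] K(3) by blast
 have a: "partial_deriv n \<Phi> x \<in> alt q" for n x by (rule partial_deriv_alt[OF t(1) t(3)])
 show "ext_d \<Phi> \<in> test_forms Om (q + 1)"
 proof (rule test_formsI[OF smooth_ext_d[OF t(1)] K(1,2)])
  show "ext_d \<Phi> x = 0" if "x \<notin> K" for x using z[OF that] by (simp add: ext_d_def)
  show "ext_d \<Phi> x \<in> alt (q + 1)" for x unfolding ext_d_def by (intro alt_sum wedge1_alt a)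
 qed
 show "codd \<Phi> \<in> test_forms Om (q - 1)"
 proof (rule test_formsI[OF smooth_codd[OF t(1)] K(1,2)])
  show "codd \<Phi> x = 0" if "x \<notin> K" for x using z[OF that] by (simp add: codd_def)
  show "codd \<Phi> x \<in> alt (q - 1)" for x unfolding codd_def by (intro alt_sum contr_alt a)
 qed
qed

lemma test_forms_lincomb:
 assumes "\<Phi> \<in> test_forms Om q" "\<Psi> \<in> test_forms Om q" shows "(%x. a *\<^sub>R \<Phi> x + \<Psi> x) \<in> test_forms Om q"
proof -
 note t = test_formsD[OF assms(1)] and u = test_formsD[OF assms(2)]
 obtain K L where K: "compact K" "K \<subseteq> Om" "\<And>x. x \<notin> K ==> \<Phi> x = 0"
  and L: "compact L" "L \<subseteq> Om" "\<And>x. x \<notin> L ==> \<Psi> x = 0" using t(4) u(4) by blast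
 show ?thesis
 proof (rule test_formsI[OF _ compact_Un[OF K(1) L(1)]])
  show "smooth (%x. a *\<^sub>R \<Phi> x + \<Psi> x)" using t(1) u(1) by (auto intro!: Ck_add Ck_linear[OF bounded_linear_scaleR_right])
  show "a *\<^sub>R \<Phi> x + \<Psi> x \<in> alt q" for x by (intro alt_add alt_scaleR t(3) u(3))
 qed (use K L in auto)
qed

lemma test_forms_zero: "(%x. 0) \<in> test_forms Om q"
 by (rule test_formsI[of _ "{}"]) auto

lemma test_forms_mult:
 assumes "smooth \<phi>" "\<Phi> \<in> test_forms Om q" shows "(%x. \<phi> x *\<^sub>R \<Phi> x) \<in> test_forms Om q"
proof -
 note t = test_formsD[OF assms(2)]
 obtain K where K: "compact K" "K \<subseteq> Om" "\<And>x. x \<notin> K ==> \<Phi> x = 0" using t(4) by blast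
 show ?thesis
 proof (rule test_formsI[OF _ K(1,2)])
  show "smooth (%x. \<phi> x *\<^sub>R \<Phi> x)" using t(1) assms(1) by (auto intro!: Ck_scaleR)
  show "\<phi> x *\<^sub>R \<Phi> x \<in> alt q" for x by (intro alt_scaleR t(3))
 qed (use K in auto)
qed

lemma test_forms_scalar:
 assumes "\<phi> \<in> C0_inf Om" "v \<in> alt q" shows "(%x. \<phi> x *\<^sub>R v) \<in> test_forms Om q"
proof -
 obtain K where K: "compact K" "K \<subseteq> Om" "\<And>x. x \<notin> K ==> \<phi> x = 0" and s: "smooth \<phi>"
  using assms(1) by (auto simp: C0_inf_def)
 show ?thesis
 proof (rule test_formsI[OF _ K(1,2)])
  show "smooth (%x. \<phi> x *\<^sub>R v)" using s by (auto intro!: Ck_scaleR)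
 qed (use K assms(2) in \<open>auto intro: alt_scaleR\<close>)
qed

lemma bounded_linear_smult: "bounded_linear (%v :: ('n::finite) alg. c *s v)"
 by (rule bounded_linear_intro[of _ "cmod c"]) (auto simp: norm_smult vec_eq_iff algebra_simps)

lemma test_forms_smult: assumes "\<Phi> \<in> test_forms Om q" shows "(%x. c *s \<Phi> x) \<in> test_forms Om q"
proof -
 note t = test_formsD[OF assms]
 obtain K where K: "compact K" "K \<subseteq> Om" "\<And>x. x \<notin> K ==> \<Phi> x = 0" using t(4) by blast
 show ?thesis
 proof (rule test_formsI[OF _ K(1,2)])
  show "smooth (%x. c *s \<Phi> x)" using t(1) by (auto intro!: Ck_linear[OF bounded_linear_smult])
  show "c *s \<Phi> x \<in> alt q" for x by (intro alt_smult t(3))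
 qed (use K in auto)
qed

lemma
 fixes \<Phi> :: "('n::{finite,linorder}) form"
 shows ext_d_smult: "smooth \<Phi> ==> ext_d (%x. c *s \<Phi> x) x = c *s ext_d \<Phi> x"
 and codd_smult: "smooth \<Phi> ==> codd (%x. c *s \<Phi> x) x = c *s codd \<Phi> x"
proof -
 assume s: "smooth \<Phi>"
 have sm: "c *s (\<Sum>n\<in>UNIV. f n) = (\<Sum>n\<in>UNIV. c *s f n)" for f :: "'n => 'n alg"
  by (rule linear_sum[OF bounded_linear.linear[OF bounded_linear_smult]])
 show "ext_d (%x. c *s \<Phi> x) x = c *s ext_d \<Phi> x" "codd (%x. c *s \<Phi> x) x = c *s codd \<Phi> x"
  by (simp_all add: ext_d_def codd_def partial_deriv_linear[OF bounded_linear_smult s] wedge1_smult contr_smult sm)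
qed

lemma bounded_linear_hodge: "bounded_linear (hodge :: ('n::{finite,linorder}) alg => 'n alg)"
proof -
 have "linear (hodge :: 'n alg => 'n alg)"
  by (rule linearI) (auto simp: hodge_def vec_eq_iff algebra_simps)
 then show ?thesis by (simp add: linear_conv_bounded_linear)
qed

text \<open>\<open>hodge\<close> and multiplication by the sign are constant linear maps and commute
  with partial derivatives, so the pointwise identity for contractions applies to each
  derivative.\<close>

lemma co_d_eq_codd:
 fixes \<Psi> :: "('n::{finite,linorder}) form"
 assumes "\<Psi> \<in> test_forms Om (q + 1)"
 shows "co_d q \<Psi> x = codd \<Psi> x"
proof -
 note t = test_formsD[OF assms]
 have "co_d q \<Psi> x = (\<Sum>n\<in>UNIV. codiff_sign TYPE('n) q *s hodge (wedge1 n (hodge (partial_deriv n \<Psi> x))))"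
  unfolding co_d_def ext_d_def partial_deriv_linear[OF bounded_linear_hodge t(1)]
   linear_sum[OF bounded_linear.linear[OF bounded_linear_hodge]] linear_sum[OF bounded_linear.linear[OF bounded_linear_smult]] ..
 also have "\<dots> = codd \<Psi> x"
  unfolding codd_def by (intro sum.cong refl codiff_contr partial_deriv_alt t)
 finally show ?thesis .
qed

lemma sq_csupp:
 fixes f :: "real ^ 'n::finite => 'b::euclidean_space"
 assumes "csupp f" "continuous_on UNIV f" shows "sq lebesgue f"
proof -
 have "integrable lebesgue (%x. (norm (f x))\<^sup>2)"
  by (rule integrable_csupp[OF csupp_mono[OF assms(1)]]) (auto intro!: continuous_intros assms(2))
 moreover have "f \<in> borel_measurable lebesgue"
  by (intro measurable_completion) (simp add: borel_measurable_continuous_onI assms(2))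
 ultimately show ?thesis by (simp add: sq_def)
qed

lemma sq_test: "\<Phi> \<in> test_forms Om q ==> sq lebesgue \<Phi>"
 using test_formsD by (intro sq_csupp smooth_continuous) blast+

lemma sq_bounded_linear:
 fixes L :: "'b::euclidean_space => 'c::euclidean_space" and u :: "'a => 'b"
 assumes "sq M u" "bounded_linear L"
 shows "sq M (%x. L (u x))" "\<exists>K\<ge>0. \<forall>u. sq (M :: 'a measure) u \<longrightarrow> nrm M (%x. L (u x)) \<le> K * nrm M u"
proof -
 obtain K where K: "K \<ge> 0" "\<And>v. norm (L v) \<le> norm v * K"
  using bounded_linear.nonneg_bounded[OF assms(2)] by blast
 have m: "(%x. L (u x)) \<in> borel_measurable M" if "sq M u" for u
  using that borel_measurable_continuous_on[OF linear_continuous_on[OF assms(2)]] by (auto simp: sq_def)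
 show "sq M (%x. L (u x))"
  by (rule sq_dom(1)[OF assms(1) m[OF assms(1)], of K]) (use K in \<open>auto simp: mult.commute\<close>)
 show "\<exists>K\<ge>0. \<forall>u. sq M u \<longrightarrow> nrm M (%x. L (u x)) \<le> K * nrm M u"
 proof (intro exI[of _ K] conjI allI impI K(1))
  fix u :: "'a => 'b" assume "sq M u"
  then show "nrm M (%x. L (u x)) \<le> K * nrm M u"
   using K by (intro sq_dom(2) m) (auto simp: mult.commute)
 qed
qed

text \<open>The Dirichlet norm of a form is the \<open>nrm\<close> of this function, so that the
  Riesz theorem can be applied to gradients.\<close>

definition gradv :: "(real ^ 'n::finite => 'b::real_normed_vector) => real ^ 'n => 'b ^ 'n" where
 "gradv \<Phi> x = (\<chi> n. partial_deriv n \<Phi> x)"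

lemma norm_gradv_sq: "(norm (gradv \<Phi> x))\<^sup>2 = (\<Sum>n\<in>UNIV. (norm (partial_deriv n \<Phi> x))\<^sup>2)"
 by (simp add: gradv_def norm_vec_def L2_set_def sum_nonneg)

lemma sq_gradv:
 fixes \<Phi> :: "real ^ 'n::finite => 'b::euclidean_space"
 assumes "smooth \<Phi>" "csupp \<Phi>" shows "sq lebesgue (gradv \<Phi>)"
proof (rule sq_csupp)
 obtain K where K: "compact K" "\<And>x. x \<notin> K ==> \<Phi> x = 0" using assms(2) by (auto simp: csupp_def)
 then show "csupp (gradv \<Phi>)" unfolding csupp_def gradv_def vec_eq_iff
  using partial_deriv_outside_support[OF compact_imp_closed[OF K(1)]] by (intro exI[of _ K]) auto
 show "continuous_on UNIV (gradv \<Phi>)" unfolding gradv_def[abs_def]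
  by (intro continuous_on_vec_lambda smooth_continuous smooth_partial assms)
qed

lemma ip_gradv:
 fixes \<Phi> \<Psi> :: "real ^ 'n::finite => 'b::euclidean_space"
 assumes "smooth \<Phi>" "csupp \<Phi>" "smooth \<Psi>"
 shows "ip lebesgue (gradv \<Phi>) (gradv \<Psi>) = - ip lebesgue \<Phi> (lap \<Psi>)"
proof -
 have i: "integrable lebesgue (%x. partial_deriv n \<Phi> x \<bullet> partial_deriv n \<Psi> x)" for n
  by (intro integrable_csupp csupp_inner1 csupp_partial continuous_intros smooth_continuous smooth_partial assms)
 have "ip lebesgue (gradv \<Phi>) (gradv \<Psi>) = (\<Sum>n\<in>UNIV. integral\<^sup>L lebesgue (%x. partial_deriv n \<Phi> x \<bullet> partial_deriv n \<Psi> x))"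
  unfolding ip_def gradv_def inner_vec_def using i by simp
 then show ?thesis unfolding ip_def using lap_by_parts[OF assms(1,3,2)] by simp
qed

lemma hardy_nrm:
 fixes \<Phi> :: "real ^ 'n::finite => 'b::euclidean_space"
 assumes "CARD('n) \<ge> 3" "smooth \<Phi>" "csupp \<Phi>"
 shows "sq lebesgue (%x. rho x powr (- 1) *\<^sub>R \<Phi> x)" "nrm lebesgue (%x. rho x powr (- 1) *\<^sub>R \<Phi> x) \<le> 2 * nrm lebesgue (gradv \<Phi>)"
proof -
 show s: "sq lebesgue (%x. rho x powr (- 1) *\<^sub>R \<Phi> x)"
  by (rule sq_csupp[OF csupp_mono[OF assms(3)]], simp)
   (intro continuous_on_scaleR continuous_rho_powr smooth_continuous[OF assms(2)])
 have e: "(norm (rho x powr (- 1) *\<^sub>R \<Phi> x))\<^sup>2 = (norm (\<Phi> x))\<^sup>2 / (1 + x \<bullet> x)" for x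
  by (simp add: power_mult_distrib powr_minus rho_sq[symmetric] divide_inverse power_inverse mult.commute)
 have i: "integrable lebesgue (%x. (norm (partial_deriv n \<Phi> x))\<^sup>2)" for n
  by (rule integrable_csupp[OF csupp_mono[OF csupp_partial[OF assms(3)]]], simp)
   (intro continuous_intros smooth_continuous[OF smooth_partial[OF assms(2)]])
 have "(nrm lebesgue (%x. rho x powr (- 1) *\<^sub>R \<Phi> x))\<^sup>2 \<le> 4 * (nrm lebesgue (gradv \<Phi>))\<^sup>2"
  unfolding nrm_sq e norm_gradv_sq using hardy_inequality[OF assms] i by simp
 also have "\<dots> = (2 * nrm lebesgue (gradv \<Phi>))\<^sup>2" by (simp add: power_mult_distrib)
 finally show "nrm lebesgue (%x. rho x powr (- 1) *\<^sub>R \<Phi> x) \<le> 2 * nrm lebesgue (gradv \<Phi>)"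
  by (rule power2_le_imp_le) simp
qed

definition altv :: "int => (complex ^ ('n set) ^ ('n::finite)) set" where
 "altv p = {v. \<forall>n. v $ n \<in> alt p}"

lemma closed_altv: "closed (altv p)"
proof -
 have e: "altv p = (\<Inter>n. (%v. v $ n) -` alt p)" by (auto simp: altv_def)
 show ?thesis unfolding e by (intro closed_INT ballI closed_vimage closed_alt continuous_intros)
qed

text \<open>Riesz representation in the closure of the gradients of test forms, that is, a weak
  solution of a Poisson equation whose source is \<open>j\<close> plus the adjoint of
  \<open>D\<close> applied to \<open>w\<close>. Only the gradient \<open>V\<close> of the potential
  is kept: the potential itself may fail to be square integrable, and only its first derivatives are
  used.\<close>

lemma dirichlet_representation:
 fixes j w :: "('n::{finite,linorder}) form" and D :: "'n form => 'n form"
 assumes N: "CARD('n) \<ge> 3" and j: "sq lebesgue (%x. rho x powr 1 *\<^sub>R j x)" and w: "sq lebesgue w"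
  and D: "\<And>\<Phi> x. D \<Phi> x = L (gradv \<Phi> x)" and L: "bounded_linear L"
 obtains V A where "sq lebesgue V" "\<And>x n. V x $ n \<in> alt p" "\<And>k. A k \<in> test_forms UNIV p"
  "(%k. nrm lebesgue (%x. gradv (A k) x - V x)) \<longlonglongrightarrow> 0"
  "\<And>\<Phi>. \<Phi> \<in> test_forms UNIV p ==> ip lebesgue V (gradv \<Phi>) = ip lebesgue j \<Phi> + ip lebesgue w (D \<Phi>)"
proof -
 define S where "S = (%\<Phi>. (gradv \<Phi>, ip lebesgue j \<Phi> + ip lebesgue w (D \<Phi>))) ` test_forms UNIV p"
 have sg: "sq lebesgue (gradv \<Phi>)" if "\<Phi> \<in> test_forms UNIV p" for \<Phi> :: "'n form"
  by (rule sq_gradv) (use test_formsD[OF that] in blast)+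
 obtain K where K: "K \<ge> 0" "\<And>u. sq (lebesgue :: (real ^ ('n::{finite,linorder})) measure) u ==> nrm lebesgue (%x. L (u x)) \<le> K * nrm lebesgue u"
  using sq_bounded_linear(2)[OF sg[OF test_forms_zero] L] by blast
 have sD: "sq lebesgue (D \<Phi>)" if "\<Phi> \<in> test_forms UNIV p" for \<Phi>
  unfolding D[abs_def] by (rule sq_bounded_linear(1)[OF sg[OF that] L])
 \<comment> \<open>Hardy's inequality supplies the weight - 1 for the test form, matched by the
   weight 1 of the source.\<close>
 have rr: "j x \<bullet> \<Phi> x = (rho x powr 1 *\<^sub>R j x) \<bullet> (rho x powr (- 1) *\<^sub>R \<Phi> x)" for \<Phi> x
 proof -
  have "rho x powr (- 1) * rho x powr 1 = 1" using rho_ge_1[of x] by (simp only: powr_add[symmetric]) simp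
  then show ?thesis by (simp only: inner_scaleR_left inner_scaleR_right mult.assoc[symmetric] mult_1)
 qed
 have sh: "sq lebesgue (%x. rho x powr (- 1) *\<^sub>R \<Phi> x)" if "\<Phi> \<in> test_forms UNIV p" for \<Phi> :: "'n form"
  using hardy_nrm(1)[OF N] test_formsD[OF that] by blast
 have ij: "integrable lebesgue (%x. j x \<bullet> \<Phi> x)" if "\<Phi> \<in> test_forms UNIV p" for \<Phi>
  unfolding rr by (rule sq_inner[OF j sh[OF that]])
 have iw: "integrable lebesgue (%x. w x \<bullet> D \<Phi> x)" if "\<Phi> \<in> test_forms UNIV p" for \<Phi>
  by (rule sq_inner[OF w sD[OF that]])
 let ?C = "2 * nrm lebesgue (%x. rho x powr 1 *\<^sub>R j x) + nrm lebesgue w * K"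
 have bnd: "\<bar>ip lebesgue j \<Phi> + ip lebesgue w (D \<Phi>)\<bar> \<le> ?C * nrm lebesgue (gradv \<Phi>)" if P: "\<Phi> \<in> test_forms UNIV p" for \<Phi>
 proof -
  have "\<bar>ip lebesgue j \<Phi>\<bar> = \<bar>ip lebesgue (%x. rho x powr 1 *\<^sub>R j x) (%x. rho x powr (- 1) *\<^sub>R \<Phi> x)\<bar>"
   unfolding ip_def rr ..
  also have "\<dots> \<le> nrm lebesgue (%x. rho x powr 1 *\<^sub>R j x) * nrm lebesgue (%x. rho x powr (- 1) *\<^sub>R \<Phi> x)"
   by (rule ip_CS[OF j sh[OF P]])
  also have "\<dots> \<le> nrm lebesgue (%x. rho x powr 1 *\<^sub>R j x) * (2 * nrm lebesgue (gradv \<Phi>))"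
   using hardy_nrm(2)[OF N] test_formsD[OF P] by (intro mult_left_mono) auto
  finally have 1: "\<bar>ip lebesgue j \<Phi>\<bar> \<le> nrm lebesgue (%x. rho x powr 1 *\<^sub>R j x) * (2 * nrm lebesgue (gradv \<Phi>))" .
  have "\<bar>ip lebesgue w (D \<Phi>)\<bar> \<le> nrm lebesgue w * nrm lebesgue (D \<Phi>)" by (rule ip_CS[OF w sD[OF P]])
  also have "\<dots> \<le> nrm lebesgue w * (K * nrm lebesgue (gradv \<Phi>))"
   unfolding D[abs_def] by (rule mult_left_mono[OF K(2)[OF sg[OF P]]]) simp
  finally have 2: "\<bar>ip lebesgue w (D \<Phi>)\<bar> \<le> nrm lebesgue w * (K * nrm lebesgue (gradv \<Phi>))" .
  show ?thesis using 1 2 by (simp add: algebra_simps)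
 qed
 have gl: "gradv (%x. a *\<^sub>R \<Phi> x + \<Psi> x) x = a *\<^sub>R gradv \<Phi> x + gradv \<Psi> x"
  if "\<Phi> \<in> test_forms UNIV p" "\<Psi> \<in> test_forms UNIV p" for a and \<Phi> \<Psi> :: "'n form" and x
 proof -
  have s: "smooth \<Phi>" "smooth \<Psi>" using test_formsD(1) that by blast+
  then have "smooth (%x. a *\<^sub>R \<Phi> x)" by (auto intro: Ck_linear[OF bounded_linear_scaleR_right])
  from partial_deriv_add[OF this s(2)] partial_deriv_linear[OF bounded_linear_scaleR_right s(1)] show ?thesis
   by (simp add: gradv_def vec_eq_iff)
 qed
 obtain V t l where V: "sq lebesgue V" "\<And>x. x \<in> space lebesgue ==> V x \<in> altv p" "\<And>k. (t k, l k) \<in> S"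
  "(%k. nrm lebesgue (%x. t k x - V x)) \<longlonglongrightarrow> 0" "\<And>u m. (u, m) \<in> S ==> ip lebesgue V u = m"
 proof (rule L2_riesz[of S lebesgue ?C "altv p"])
  show "sq lebesgue u \<and> \<bar>l\<bar> \<le> ?C * nrm lebesgue u" if "(u, l) \<in> S" for u l
   using that sg bnd unfolding S_def by auto
  show "(%x. a *\<^sub>R u x + v x, a * l + m) \<in> S" if "(u, l) \<in> S" "(v, m) \<in> S" for u l v m a
  proof -
   note ulS = that
   obtain \<Phi> \<Psi> where P: "\<Phi> \<in> test_forms UNIV p" "u = gradv \<Phi>" "l = ip lebesgue j \<Phi> + ip lebesgue w (D \<Phi>)"
    "\<Psi> \<in> test_forms UNIV p" "v = gradv \<Psi>" "m = ip lebesgue j \<Psi> + ip lebesgue w (D \<Psi>)"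
    using ulS unfolding S_def by auto
   let ?X = "%x. a *\<^sub>R \<Phi> x + \<Psi> x"
   have X: "?X \<in> test_forms UNIV p" by (rule test_forms_lincomb[OF P(1,4)])
   have "D ?X x = a *\<^sub>R D \<Phi> x + D \<Psi> x" for x
    unfolding D gl[OF P(1,4)] using bounded_linear.linear[OF L] by (simp add: linear_add linear_scale)
   then have "ip lebesgue j ?X + ip lebesgue w (D ?X) = a * l + m"
    unfolding P ip_def using ij[OF P(1)] ij[OF P(4)] iw[OF P(1)] iw[OF P(4)]
    by (simp add: inner_add_right algebra_simps)
   moreover have "gradv ?X = (%x. a *\<^sub>R u x + v x)" unfolding P using gl[OF P(1,4)] by blast
   ultimately show ?thesis unfolding S_def using X by (auto intro!: image_eqI[of _ _ ?X])
  qed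
  show "S \<noteq> {}" unfolding S_def using test_forms_zero by auto
  show "closed (altv p)" by (rule closed_altv)
  show "0 \<in> altv p" by (simp add: altv_def)
  show "u x \<in> altv p" if "(u, l) \<in> S" for u l x
   using that unfolding S_def by (auto simp: gradv_def altv_def intro!: partial_deriv_alt[OF test_formsD(1) test_formsD(3)])
 qed blast
 have "\<exists>A. \<forall>k. A k \<in> test_forms UNIV p \<and> t k = gradv (A k)"
  using V(3) unfolding S_def by (intro choice) auto
 then obtain A where A: "\<And>k. A k \<in> test_forms UNIV p" "\<And>k. t k = gradv (A k)" by blast
 show ?thesis
 proof (rule that[OF V(1) _ A(1)])
  show "V x $ n \<in> alt p" for x n using V(2)[of x] by (simp add: altv_def)
  show "(%k. nrm lebesgue (%x. gradv (A k) x - V x)) \<longlonglongrightarrow> 0" using V(4) unfolding A(2) .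
  show "ip lebesgue V (gradv \<Phi>) = ip lebesgue j \<Phi> + ip lebesgue w (D \<Phi>)" if "\<Phi> \<in> test_forms UNIV p" for \<Phi>
   by (rule V(5)) (use that in \<open>auto simp: S_def\<close>)
 qed
qed

lemma altproj_alt: "altproj q v \<in> alt q" by (simp add: altproj_def alt_def)
lemma altproj_adjoint: "u \<bullet> altproj q v = altproj q u \<bullet> v"
 by (auto simp: altproj_def inner_vec_def intro!: sum.cong)
lemma altproj_id: "v \<in> alt q ==> altproj q v = v"
 by (auto simp: altproj_def alt_def vec_eq_iff)
lemma lap_scaleR_const:
 assumes "smooth \<phi>" shows "lap (%x. \<phi> x *\<^sub>R v) x = lap \<phi> x *\<^sub>R v"
proof -
 have 1: "partial_deriv n (%x. \<psi> x *\<^sub>R v) = (%x. partial_deriv n \<psi> x *\<^sub>R v)" if "smooth \<psi>" for n \<psi>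
  using partial_deriv_linear[OF bounded_linear_scaleR_left that] by blast
 have 2: "partial_deriv n (%x. \<phi> x *\<^sub>R v) = (%x. partial_deriv n \<phi> x *\<^sub>R v)" for n by (rule 1[OF assms])
 have 3: "partial_deriv n (%x. partial_deriv n \<phi> x *\<^sub>R v) = (%x. partial_deriv n (partial_deriv n \<phi>) x *\<^sub>R v)" for n
  by (rule 1[OF smooth_partial[OF assms]])
 show ?thesis by (simp only: lap_def 2 3 scaleR_sum_left)
qed

text \<open>The square integrable representatives of \<open>d \<Delta>\<^sup>-\<^sup>1\<close> and \<open>\<delta> \<Delta>\<^sup>-\<^sup>1\<close> of the data differ from \<open>u\<close> by a
 harmonic form, which vanishes by Liouville's theorem.\<close>

theorem whole_space_regularity:
 fixes u J j w1 w2 :: "('n::{finite,linorder}) form"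
 assumes N: "CARD('n) \<ge> 3" and um: "u \<in> borel_measurable lebesgue" and ua: "\<And>x. u x \<in> alt q"
  and us: "sq lebesgue (%x. rho x powr \<sigma> *\<^sub>R u x)" and \<sigma>: "- real CARD('n) / 2 < \<sigma>"
  and J: "sq lebesgue (%x. rho x powr 1 *\<^sub>R J x)" and j: "sq lebesgue (%x. rho x powr 1 *\<^sub>R j x)"
  and w1: "sq lebesgue w1" and w2: "sq lebesgue w2"
  and rot: "\<And>\<Psi>. \<Psi> \<in> test_forms UNIV (q + 1) ==> ip lebesgue u (codd \<Psi>) = ip lebesgue J \<Psi> + ip lebesgue w1 (codd \<Psi>)"
  and div: "\<And>\<Phi>. \<Phi> \<in> test_forms UNIV (q - 1) ==> ip lebesgue u (ext_d \<Phi>) = ip lebesgue j \<Phi> + ip lebesgue w2 (ext_d \<Phi>)"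
 shows "sq lebesgue u"
proof -
 \<comment> \<open>\<open>ext_d\<close> and \<open>codd\<close> are bounded linear images of the
   full gradient, so they make sense for the limits \<open>V\<close> and \<open>V'\<close> of
   gradients.\<close>
 let ?La = "%v :: (complex ^ ('n set)) ^ ('n::{finite,linorder}). \<Sum>n\<in>UNIV. wedge1 n (v $ n)"
  and ?Lb = "%v :: (complex ^ ('n set)) ^ ('n::{finite,linorder}). \<Sum>n\<in>UNIV. contr n (v $ n)"
 have La: "bounded_linear ?La" and Lb: "bounded_linear ?Lb"
  by (intro bounded_linear_sum bounded_linear_compose[OF bounded_linear_wedge1 bounded_linear_vec_nth]
    bounded_linear_compose[OF bounded_linear_contr bounded_linear_vec_nth])+
 have Da: "ext_d \<Phi> x = ?La (gradv \<Phi> x)" and Db: "codd \<Phi> x = ?Lb (gradv \<Phi> x)" for \<Phi> :: "'n form" and x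
  by (simp_all add: ext_d_def codd_def gradv_def)
 obtain V A where V: "sq lebesgue V" "\<And>x n. V x $ n \<in> alt (q - 1)" "\<And>k. A k \<in> test_forms UNIV (q - 1)"
  "(%k. nrm lebesgue (%x. gradv (A k) x - V x)) \<longlonglongrightarrow> 0"
  "\<And>\<Phi>. \<Phi> \<in> test_forms UNIV (q - 1) ==> ip lebesgue V (gradv \<Phi>) = ip lebesgue j \<Phi> + ip lebesgue w2 (ext_d \<Phi>)"
  using dirichlet_representation[where D=ext_d, OF N j w2 Da La] by blast
 obtain V' A' where V': "sq lebesgue V'" "\<And>x n. V' x $ n \<in> alt (q + 1)" "\<And>k. A' k \<in> test_forms UNIV (q + 1)"
  "(%k. nrm lebesgue (%x. gradv (A' k) x - V' x)) \<longlonglongrightarrow> 0"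
  "\<And>\<Phi>. \<Phi> \<in> test_forms UNIV (q + 1) ==> ip lebesgue V' (gradv \<Phi>) = ip lebesgue J \<Phi> + ip lebesgue w1 (codd \<Phi>)"
  using dirichlet_representation[where D=codd, OF N J w1 Db Lb] by blast
 \<comment> \<open>\<open>a\<close> is the rotation of the potential of the divergence data,
   \<open>b\<close> the divergence of the potential of the rotation data; both are square integrable
   by construction.\<close>
 define a where "a x = ?La (V x)" for x
 define b where "b x = ?Lb (V' x)" for x
 have as: "sq lebesgue a" and bs: "sq lebesgue b" unfolding a_def[abs_def] b_def[abs_def]
  by (rule sq_bounded_linear(1)[OF V(1) La] sq_bounded_linear(1)[OF V'(1) Lb])+
 have aa: "a x \<in> alt q" for x unfolding a_def
  using wedge1_alt[OF V(2)[of x]] by (intro alt_sum) simp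
 have ba: "b x \<in> alt q" for x unfolding b_def
  using contr_alt[OF V'(2)[of x]] by (intro alt_sum) simp
 have sg: "sq lebesgue (gradv \<Phi>)" if "\<Phi> \<in> test_forms UNIV p" for \<Phi> :: "'n form" and p
  by (rule sq_gradv) (use test_formsD[OF that] in blast)+
 \<comment> \<open>Identities valid for gradients of test forms are carried over to the limit, both
   sides being continuous.\<close>
 have lim: "ip lebesgue (%x. L (V x)) \<Theta> = ip lebesgue V (gradv \<Xi>)"
  if L: "bounded_linear L" and V: "sq lebesgue V" and g: "\<And>k. sq lebesgue (g k)"
   and l: "(%k. nrm lebesgue (%x. g k x - V x)) \<longlonglongrightarrow> 0" and \<Theta>: "sq lebesgue \<Theta>" and \<Xi>: "sq lebesgue (gradv \<Xi>)"
   and e: "\<And>k. ip lebesgue (%x. L (g k x)) \<Theta> = ip lebesgue (g k) (gradv \<Xi>)"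
  for L :: "(complex ^ ('n set)) ^ ('n::{finite,linorder}) => 'n alg" and V g \<Theta> \<Xi>
 proof -
  obtain K where K: "K \<ge> 0" "\<And>u. sq (lebesgue :: (real ^ ('n::{finite,linorder})) measure) u ==> nrm lebesgue (%x. L (u x)) \<le> K * nrm lebesgue u"
   using sq_bounded_linear(2)[OF V L] by blast
  have "(%k. nrm lebesgue (%x. L (g k x) - L (V x))) \<longlonglongrightarrow> 0"
  proof (rule Lim_null_comparison)
   show "\<forall>\<^sub>F k in sequentially. norm (nrm lebesgue (%x. L (g k x) - L (V x))) \<le> K * nrm lebesgue (%x. g k x - V x)"
    using K(2)[OF sq_diff[OF g V]] by (simp add: linear_diff[OF bounded_linear.linear[OF L]])
   show "(%k. K * nrm lebesgue (%x. g k x - V x)) \<longlonglongrightarrow> 0" using tendsto_mult_right_zero[OF l] by simp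
  qed
  then have "(%k. ip lebesgue (%x. L (g k x)) \<Theta>) \<longlonglongrightarrow> ip lebesgue (%x. L (V x)) \<Theta>"
   by (intro ip_tendsto sq_bounded_linear(1)[OF g L] sq_bounded_linear(1)[OF V L] \<Theta>)
  moreover have "(%k. ip lebesgue (g k) (gradv \<Xi>)) \<longlonglongrightarrow> ip lebesgue V (gradv \<Xi>)"
   by (rule ip_tendsto[OF g V \<Xi> l])
  ultimately show ?thesis unfolding e by (rule LIMSEQ_unique)
 qed
 \<comment> \<open>Tested with \<open>lap \<Phi>\<close>, the field \<open>a\<close> reproduces the
   part of \<open>u\<close> tested with \<open>ext_d (codd \<Phi>)\<close> and \<open>b\<close> the
   part tested with \<open>codd (ext_d \<Phi>)\<close>; the two test forms add up to
   \<open>lap \<Phi>\<close>.\<close>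
 have harm: "ip lebesgue u (lap \<Phi>) = ip lebesgue a (lap \<Phi>) + ip lebesgue b (lap \<Phi>)" if P: "\<Phi> \<in> test_forms UNIV q" for \<Phi>
 proof -
  note t = test_formsD[OF P]
  have dP: "ext_d \<Phi> \<in> test_forms UNIV (q + 1)" and cP: "codd \<Phi> \<in> test_forms UNIV (q - 1)"
   by (rule test_forms_ext_d[OF P] test_forms_codd[OF P])+
  have dcP: "ext_d (codd \<Phi>) \<in> test_forms UNIV q" and cdP: "codd (ext_d \<Phi>) \<in> test_forms UNIV q"
   using test_forms_ext_d[OF cP] test_forms_codd[OF dP] by simp_all
  have lapE: "lap \<Phi> = (%x. ext_d (codd \<Phi>) x + codd (ext_d \<Phi>) x)" using hodge_laplacian[OF t(1)] by simp
  have sl: "sq lebesgue (lap \<Phi>)" unfolding lapE by (intro sq_add sq_test[OF dcP] sq_test[OF cdP])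
  have slap: "smooth (lap \<Phi>)" by (rule smooth_lap[OF t(1)])
  \<comment> \<open>Commuting with the Laplacian turns the pairing into a Dirichlet product with
    \<open>codd \<Phi>\<close>, for which the representation of the data is available.\<close>
  have cl: "codd (lap \<Phi>) x = lap (codd \<Phi>) x" for x
  proof -
   have "codd (lap \<Phi>) x = codd (%x. 1 *\<^sub>R ext_d (codd \<Phi>) x + codd (ext_d \<Phi>) x) x" unfolding lapE by simp
   also have "\<dots> = codd (ext_d (codd \<Phi>)) x + codd (codd (ext_d \<Phi>)) x"
    by (subst codd_lincomb) (use test_formsD(1)[OF dcP] test_formsD(1)[OF cdP] in auto)
   also have "codd (codd (ext_d \<Phi>)) x = 0" by (rule codd_codd[OF test_formsD(1)[OF dP]])
   finally have 1: "codd (lap \<Phi>) x = codd (ext_d (codd \<Phi>)) x" by simp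
   have z: "codd (codd \<Phi>) = (%x. 0)" using codd_codd[OF t(1)] by blast
   have "ext_d (codd (codd \<Phi>)) x = 0" unfolding z ext_d_def by simp
   then show ?thesis using 1 hodge_laplacian[OF test_formsD(1)[OF cP], of x] by simp
  qed
  have dl: "ext_d (lap \<Phi>) x = lap (ext_d \<Phi>) x" for x
  proof -
   have "ext_d (lap \<Phi>) x = ext_d (%x. 1 *\<^sub>R ext_d (codd \<Phi>) x + codd (ext_d \<Phi>) x) x" unfolding lapE by simp
   also have "\<dots> = ext_d (ext_d (codd \<Phi>)) x + ext_d (codd (ext_d \<Phi>)) x"
    by (subst ext_d_lincomb) (use test_formsD(1)[OF dcP] test_formsD(1)[OF cdP] in auto)
   also have "ext_d (ext_d (codd \<Phi>)) x = 0" by (rule ext_d_ext_d[OF test_formsD(1)[OF cP]])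
   finally have 1: "ext_d (lap \<Phi>) x = ext_d (codd (ext_d \<Phi>)) x" by simp
   have z: "ext_d (ext_d \<Phi>) = (%x. 0)" using ext_d_ext_d[OF t(1)] by blast
   have "codd (ext_d (ext_d \<Phi>)) x = 0" unfolding z codd_def by simp
   then show ?thesis using 1 hodge_laplacian[OF test_formsD(1)[OF dP], of x] by simp
  qed
  have ia: "ip lebesgue a (lap \<Phi>) = ip lebesgue V (gradv (codd \<Phi>))"
   unfolding a_def[abs_def]
  proof (rule lim[OF La V(1) sg[OF V(3)] V(4) sl sg[OF cP]])
   fix k
   note tA = test_formsD[OF V(3)[of k]]
   have "ip lebesgue (%x. ?La (gradv (A k) x)) (lap \<Phi>) = ip lebesgue (ext_d (A k)) (lap \<Phi>)"
    unfolding ip_def Da ..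
   also have "\<dots> = - ip lebesgue (A k) (lap (codd \<Phi>))"
    unfolding ip_def cl[symmetric] using tA by (intro ext_d_by_parts slap) auto
   also have "\<dots> = ip lebesgue (gradv (A k)) (gradv (codd \<Phi>))"
    using ip_gradv[OF tA(1,2) test_formsD(1)[OF cP]] by simp
   finally show "ip lebesgue (%x. ?La (gradv (A k) x)) (lap \<Phi>) = ip lebesgue (gradv (A k)) (gradv (codd \<Phi>))" .
  qed
  have ib: "ip lebesgue b (lap \<Phi>) = ip lebesgue V' (gradv (ext_d \<Phi>))"
   unfolding b_def[abs_def]
  proof (rule lim[OF Lb V'(1) sg[OF V'(3)] V'(4) sl sg[OF dP]])
   fix k
   note tA = test_formsD[OF V'(3)[of k]]
   have "ip lebesgue (%x. ?Lb (gradv (A' k) x)) (lap \<Phi>) = ip lebesgue (lap \<Phi>) (codd (A' k))"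
    unfolding ip_def Db by (simp add: inner_commute)
   also have "\<dots> = - ip lebesgue (ext_d (lap \<Phi>)) (A' k)"
    using ext_d_by_parts[OF slap tA(1)] tA(2) unfolding ip_def by simp
   also have "\<dots> = - ip lebesgue (A' k) (lap (ext_d \<Phi>))"
    unfolding ip_def dl by (simp add: inner_commute)
   also have "\<dots> = ip lebesgue (gradv (A' k)) (gradv (ext_d \<Phi>))"
    using ip_gradv[OF tA(1,2) test_formsD(1)[OF dP]] by simp
   finally show "ip lebesgue (%x. ?Lb (gradv (A' k) x)) (lap \<Phi>) = ip lebesgue (gradv (A' k)) (gradv (ext_d \<Phi>))" .
  qed
  have iu: "integrable lebesgue (%x. u x \<bullet> \<Theta> x)" if "\<Theta> \<in> test_forms UNIV q" for \<Theta>
  proof -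
   have "sq lebesgue (%x. rho x powr (- \<sigma>) *\<^sub>R \<Theta> x)"
    by (rule sq_test[OF test_forms_mult[OF _ that]]) (use smooth_rho_powr in blast)
   from sq_inner[OF us this] show ?thesis
    by (simp add: powr_minus mult.assoc[symmetric] less_imp_neq[OF rho_pos, symmetric])
  qed
  have "ip lebesgue u (lap \<Phi>) = ip lebesgue u (ext_d (codd \<Phi>)) + ip lebesgue u (codd (ext_d \<Phi>))"
   unfolding ip_def lapE inner_add_right by (intro Bochner_Integration.integral_add iu dcP cdP)
  then show ?thesis unfolding ia ib V(5)[OF cP] V'(5)[OF dP] div[OF cP] rot[OF dP] by simp
 qed
 define h where "h x = u x - a x - b x" for x
 have hm: "h \<in> borel_measurable lebesgue" unfolding h_def[abs_def]
  using um as bs by (auto simp: sq_def)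
 have ha: "h x \<in> alt q" for x unfolding h_def by (intro alt_diff ua aa ba)
 \<comment> \<open>A common weight for \<open>u\<close> and for the unweighted \<open>a\<close> and
   \<open>b\<close>, still above - N / 2.\<close>
 define \<tau> where "\<tau> = min \<sigma> 0"
 have \<tau>N: "- real CARD('n) / 2 < \<tau>" using \<sigma> N by (auto simp: \<tau>_def)
 have wa: "sq lebesgue (%x. rho x powr \<tau> *\<^sub>R v x)" if "sq lebesgue v" for v :: "'n form"
 proof (rule sq_dom(1)[OF that, of _ 1])
  show "(%x. rho x powr \<tau> *\<^sub>R v x) \<in> borel_measurable lebesgue"
   using sq_measurable[OF that] by (intro borel_measurable_scaleR rho_powr_measurable)
  have r1: "rho x powr \<tau> \<le> 1" for x using rho_powr_mono[of \<tau> 0 x] rho_ge_1[of x] by (simp add: \<tau>_def)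
  then show "AE x in lebesgue. norm (rho x powr \<tau> *\<^sub>R v x) \<le> 1 * norm (v x)"
   using mult_right_mono[OF r1 norm_ge_zero] by (intro AE_I2) simp
 qed
 have wu: "sq lebesgue (%x. rho x powr \<tau> *\<^sub>R u x)"
 proof (rule sq_dom(1)[OF us, of _ 1])
  show "(%x. rho x powr \<tau> *\<^sub>R u x) \<in> borel_measurable lebesgue"
   using um by (intro borel_measurable_scaleR rho_powr_measurable)
  show "AE x in lebesgue. norm (rho x powr \<tau> *\<^sub>R u x) \<le> 1 * norm (rho x powr \<sigma> *\<^sub>R u x)"
   by (intro AE_I2) (simp add: mult_right_mono rho_powr_mono \<tau>_def)
 qed
 have wh: "sq lebesgue (%x. rho x powr \<tau> *\<^sub>R h x)"
  using sq_diff[OF sq_diff[OF wu wa[OF as]] wa[OF bs]] by (simp add: h_def scaleR_diff_right)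
 have zero: "AE x in lebesgue. h x \<bullet> altproj q w = 0" for w
 proof (rule weighted_liouville[OF _ _ \<tau>N])
  show m: "(%x. h x \<bullet> altproj q w) \<in> borel_measurable lebesgue" using hm by simp
  show "sq lebesgue (%x. rho x powr \<tau> * (h x \<bullet> altproj q w))"
  proof (rule sq_dom(1)[OF wh, of _ "norm (altproj q w)"])
   show "(%x. rho x powr \<tau> * (h x \<bullet> altproj q w)) \<in> borel_measurable lebesgue"
    using m by (intro borel_measurable_times rho_powr_measurable)
   show "AE x in lebesgue. norm (rho x powr \<tau> * (h x \<bullet> altproj q w)) \<le> norm (altproj q w) * norm (rho x powr \<tau> *\<^sub>R h x)"
   proof (intro AE_I2)
    fix x
    have "rho x powr \<tau> * \<bar>h x \<bullet> altproj q w\<bar> \<le> rho x powr \<tau> * (norm (h x) * norm (altproj q w))"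
     by (intro mult_left_mono Cauchy_Schwarz_ineq2) simp
    then show "norm (rho x powr \<tau> * (h x \<bullet> altproj q w)) \<le> norm (altproj q w) * norm (rho x powr \<tau> *\<^sub>R h x)"
     by (simp add: abs_mult mult_ac)
   qed
  qed
  fix \<phi> :: "real ^ ('n::{finite,linorder}) => real" assume \<phi>: "\<phi> \<in> C0_inf UNIV"
  then have s: "smooth \<phi>" by (simp add: C0_inf_def)
  let ?P = "%x. \<phi> x *\<^sub>R altproj q w"
  have P: "?P \<in> test_forms UNIV q" by (rule test_forms_scalar[OF \<phi> altproj_alt])
  note t = test_formsD[OF P]
  have lp: "lap ?P \<in> test_forms UNIV q"
  proof -
   have "lap ?P = (%x. 1 *\<^sub>R ext_d (codd ?P) x + codd (ext_d ?P) x)" using hodge_laplacian[OF t(1)] by simp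
   moreover have "\<dots> \<in> test_forms UNIV q"
    using test_forms_ext_d[OF test_forms_codd[OF P]] test_forms_codd[OF test_forms_ext_d[OF P]]
    by (intro test_forms_lincomb) simp_all
   ultimately show ?thesis by simp
  qed
  have iu: "integrable lebesgue (%x. u x \<bullet> lap ?P x)"
  proof -
   have "sq lebesgue (%x. rho x powr (- \<sigma>) *\<^sub>R lap ?P x)"
    by (rule sq_test[OF test_forms_mult[OF _ lp]]) (use smooth_rho_powr in blast)
   from sq_inner[OF us this] show ?thesis
    by (simp add: powr_minus mult.assoc[symmetric] less_imp_neq[OF rho_pos, symmetric])
  qed
  have iab: "integrable lebesgue (%x. a x \<bullet> lap ?P x)" "integrable lebesgue (%x. b x \<bullet> lap ?P x)"
   by (intro sq_inner as bs sq_test[OF lp])+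
  have "integral\<^sup>L lebesgue (%x. h x \<bullet> lap ?P x) = 0"
   using harm[OF P] iu iab unfolding ip_def h_def by (simp add: inner_diff_left)
  then show "integral\<^sup>L lebesgue (%x. (h x \<bullet> altproj q w) * lap \<phi> x) = 0"
   unfolding lap_scaleR_const[OF s] by (simp add: mult.commute)
 qed
 \<comment> \<open>Finitely many real directions suffice, and \<open>altproj\<close> changes nothing
   since \<open>h\<close> has rank \<open>q\<close>.\<close>
 have "AE x in lebesgue. \<forall>w\<in>Basis. h x \<bullet> altproj q w = 0"
  by (rule AE_finite_allI) (auto intro: zero)
 then have "AE x in lebesgue. a x + b x = u x"
 proof eventually_elim
  case (elim x)
  then have "\<forall>w\<in>Basis. h x \<bullet> w = 0" using altproj_adjoint[of "h x" q] altproj_id[OF ha[of x]] by simp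
  then have "h x = 0" by (metis euclidean_eqI inner_zero_left)
  then show ?case by (simp add: h_def algebra_simps)
 qed
 then show ?thesis by (rule sq_cong_AE[OF sq_add[OF as bs] um])
qed

section \<open>Weighted spaces and weak derivatives\<close>

abbreviation wt :: "real => (real ^ 'n::finite => 'b::real_vector) => real ^ 'n => 'b" where
 "wt s u \<equiv> (%x. rho x powr s *\<^sub>R u x)"

lemma rho_nonzero [simp]: "rho x \<noteq> 0"
 using rho_pos[of x] by linarith

lemma L2_norm_nrm: "L2_norm Om u = nrm (lebesgue_on Om) u"
 by (simp add: L2_norm_def nrm_def)

lemma L2_iff: "u \<in> L2 Om q \<longleftrightarrow> sq (lebesgue_on Om) u \<and> (\<forall>x\<in>Om. u x \<in> alt q)"
 by (auto simp: L2_def sq_def)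

lemma alt_scaleR_iff: "c \<noteq> 0 ==> c *\<^sub>R v \<in> alt q \<longleftrightarrow> v \<in> alt q"
 by (simp add: alt_def)

lemma L2w_iff: "u \<in> L2w Om q s \<longleftrightarrow> sq (lebesgue_on Om) (wt s u) \<and> (\<forall>x\<in>Om. u x \<in> alt q)"
 by (simp add: L2w_def L2_iff alt_scaleR_iff)

lemma L2w_norm_nrm: "L2w_norm Om s u = nrm (lebesgue_on Om) (wt s u)"
 by (simp add: L2w_norm_def L2_norm_nrm)

lemma rho_powr_measurable_on: "(%x. rho x powr s) \<in> borel_measurable (lebesgue_on Om)"
 by (rule measurable_restrict_space1[OF rho_powr_measurable])

lemma wt_inverse: "wt (- s) (wt s u) = u"
 by (rule ext) (simp add: powr_add[symmetric])

lemma wt_0: "wt 0 u = u"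
 by (rule ext) simp

lemma L2w_0: "L2w Om q 0 = L2 Om q" and L2w_norm_0: "L2w_norm Om 0 u = L2_norm Om u"
 by (simp_all add: L2w_def L2w_norm_def wt_0)

lemma wt_measurable_iff:
 "wt s u \<in> borel_measurable (lebesgue_on Om) \<longleftrightarrow> u \<in> borel_measurable (lebesgue_on Om)"
 for u :: "real ^ 'n::finite => 'b::euclidean_space"
proof
 assume "wt s u \<in> borel_measurable (lebesgue_on Om)"
 then have "wt (- s) (wt s u) \<in> borel_measurable (lebesgue_on Om)"
  by (rule borel_measurable_scaleR[OF rho_powr_measurable_on])
 then show "u \<in> borel_measurable (lebesgue_on Om)" by (simp only: wt_inverse)
next
 assume "u \<in> borel_measurable (lebesgue_on Om)"
 then show "wt s u \<in> borel_measurable (lebesgue_on Om)"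
  by (intro borel_measurable_scaleR rho_powr_measurable_on)
qed

lemma L2w_measurable: "u \<in> L2w Om q s ==> u \<in> borel_measurable (lebesgue_on Om)"
 using wt_measurable_iff by (auto simp: L2w_iff sq_def)

lemma L2w_sq: "u \<in> L2w Om q s ==> sq (lebesgue_on Om) (wt s u)"
 and L2w_alt: "u \<in> L2w Om q s ==> x \<in> Om ==> u x \<in> alt q"
 by (auto simp: L2w_iff)

lemma ip_wt: "ip M u v = ip M (wt s u) (wt (- s) v)"
proof -
 have "wt s u x \<bullet> wt (- s) v x = u x \<bullet> v x" for x
 proof -
  have "rho x powr (- s) * rho x powr s = 1" by (simp add: powr_add[symmetric])
  then show ?thesis by (simp only: inner_scaleR_left inner_scaleR_right mult.assoc[symmetric] mult_1)
 qed
 then show ?thesis by (simp only: ip_def)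
qed

lemma L2w_lincomb: "u \<in> L2w Om q s ==> v \<in> L2w Om q s ==> (%x. a *\<^sub>R u x + v x) \<in> L2w Om q s"
 using sq_add[OF sq_scaleR[of "lebesgue_on Om" "wt s u" a], of "wt s v"]
 by (auto simp: L2w_iff scaleR_add_right mult.commute intro: alt_add alt_scaleR)

lemma L2w_zero: "(%x. 0) \<in> L2w Om q s"
 by (simp add: L2w_iff)

lemma L2w_scaleR: "u \<in> L2w Om q s ==> (%x. a *\<^sub>R u x) \<in> L2w Om q s"
 using L2w_lincomb[OF _ L2w_zero, of u Om q s a] by simp
lemma L2w_add: "u \<in> L2w Om q s ==> v \<in> L2w Om q s ==> (%x. u x + v x) \<in> L2w Om q s"
 using L2w_lincomb[of u Om q s v 1] by simp
lemma L2w_diff: "u \<in> L2w Om q s ==> v \<in> L2w Om q s ==> (%x. u x - v x) \<in> L2w Om q s"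
 using L2w_lincomb[of v Om q s u "-1"] by simp

lemma L2w_norm_nonneg [simp]: "0 \<le> L2w_norm Om s u" by (simp add: L2w_norm_nrm)

lemma L2w_norm_scaleR: "L2w_norm Om s (%x. a *\<^sub>R u x) = \<bar>a\<bar> * L2w_norm Om s u"
proof -
 have "wt s (%x. a *\<^sub>R u x) = (%x. a *\<^sub>R wt s u x)" by (simp add: mult.commute)
 then show ?thesis by (simp only: L2w_norm_nrm nrm_scaleR)
qed

lemma L2w_norm_add: "u \<in> L2w Om q s ==> v \<in> L2w Om q s ==> L2w_norm Om s (%x. u x + v x) \<le> L2w_norm Om s u + L2w_norm Om s v"
 using nrm_triangle[OF L2w_sq L2w_sq] by (simp add: L2w_norm_nrm scaleR_add_right)

lemma L2w_norm_diff: "u \<in> L2w Om q s ==> v \<in> L2w Om q s ==> L2w_norm Om s (%x. u x - v x) \<le> L2w_norm Om s u + L2w_norm Om s v"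
 using nrm_triangle_diff[OF L2w_sq L2w_sq] by (simp add: L2w_norm_nrm scaleR_diff_right)

lemma L2w_norm_commute: "L2w_norm Om s (%x. u x - v x) = L2w_norm Om s (%x. v x - u x)"
 using nrm_minus_commute[of _ "wt s u" "wt s v"] by (simp add: L2w_norm_nrm scaleR_diff_right)

lemma L2w_dom:
 assumes "v \<in> L2w Om p s" "u \<in> borel_measurable (lebesgue_on Om)" "\<And>x. x \<in> Om ==> u x \<in> alt q"
  "AE x in lebesgue_on Om. rho x powr t * norm (u x) \<le> C * (rho x powr s * norm (v x))"
 shows "u \<in> L2w Om q t" "C \<ge> 0 ==> L2w_norm Om t u \<le> C * L2w_norm Om s v"
proof -
 have m: "wt t u \<in> borel_measurable (lebesgue_on Om)" using assms(2) wt_measurable_iff by blast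
 have le: "AE x in lebesgue_on Om. norm (wt t u x) \<le> C * norm (wt s v x)" using assms(4) by simp
 note * = sq_dom[OF L2w_sq[OF assms(1)] m le]
 show "u \<in> L2w Om q t" using *(1) assms(3) by (simp add: L2w_iff)
 show "C \<ge> 0 ==> L2w_norm Om t u \<le> C * L2w_norm Om s v" unfolding L2w_norm_nrm by (rule *(2))
qed

lemma
 assumes "t \<le> s" "u \<in> L2w Om q s"
 shows L2w_mono: "u \<in> L2w Om q t" and L2w_norm_mono: "L2w_norm Om t u \<le> L2w_norm Om s u"
proof -
 have "AE x in lebesgue_on Om. rho x powr t * norm (u x) \<le> 1 * (rho x powr s * norm (u x))"
  by (intro AE_I2) (simp add: mult_right_mono rho_powr_mono[OF assms(1)])
 note * = L2w_dom[OF assms(2) L2w_measurable[OF assms(2)] L2w_alt[OF assms(2)] this]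
 show "u \<in> L2w Om q t" "L2w_norm Om t u \<le> L2w_norm Om s u" using * by auto
qed

lemma L2w_AE:
 assumes "u \<in> L2w Om q s" "v \<in> borel_measurable (lebesgue_on Om)" "\<And>x. x \<in> Om ==> v x \<in> alt p"
  "AE x in lebesgue_on Om. u x = v x"
 shows "v \<in> L2w Om p s" "L2w_norm Om s u = L2w_norm Om s v"
proof -
 have "AE x in lebesgue_on Om. rho x powr s * norm (v x) \<le> 1 * (rho x powr s * norm (u x))"
  using assms(4) by eventually_elim simp
 from L2w_dom(1)[OF assms(1-3) this] show "v \<in> L2w Om p s" .
 show "L2w_norm Om s u = L2w_norm Om s v" unfolding L2w_norm_nrm
  by (rule nrm_cong_AE[OF L2w_sq[OF assms(1)]])
   (use assms(2,4) wt_measurable_iff in \<open>auto elim: AE_mp\<close>)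
qed

section \<open>Local square integrability\<close>

lemma open_lebesgue: "open Om ==> Om \<in> sets lebesgue" for Om :: "(real ^ 'n::finite) set"
 by (simp add: borel_open sets_completionI_sets)

lemma lebesgue_on_Int: "open Om ==> lebesgue_on (Om \<inter> ball 0 R) = restrict_space (lebesgue_on Om) (ball 0 R)"
 for Om :: "(real ^ 'n::finite) set"
 by (subst restrict_restrict_space) (auto intro: open_lebesgue)

lemma ball_sets_on: "open Om ==> ball c R \<inter> space (lebesgue_on Om) \<in> sets (lebesgue_on Om)"
 for Om :: "(real ^ 'n::finite) set"
 by (auto simp: sets_restrict_space image_iff intro!: bexI[of _ "ball c R \<inter> Om"] open_lebesgue)

text \<open>Restricting the measure to a ball and multiplying by its indicator give the same norms;
  the second form keeps a single measure for all radii.\<close>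

lemma sq_ball_iff:
 fixes Om :: "(real ^ 'n::finite) set" and u :: "real ^ 'n => 'b::euclidean_space"
 assumes "open Om"
 shows "sq (lebesgue_on (Om \<inter> ball 0 R)) u \<longleftrightarrow> sq (lebesgue_on Om) (%x. indicator (ball 0 R) x *\<^sub>R u x)"
  and "nrm (lebesgue_on (Om \<inter> ball 0 R)) u = nrm (lebesgue_on Om) (%x. indicator (ball 0 R) x *\<^sub>R u x)"
proof -
 have e: "(norm (indicator (ball 0 R) x *\<^sub>R u x))\<^sup>2 = indicator (ball 0 R) x *\<^sub>R (norm (u x))\<^sup>2" for x
  by (simp add: indicator_def)
 show "sq (lebesgue_on (Om \<inter> ball 0 R)) u \<longleftrightarrow> sq (lebesgue_on Om) (%x. indicator (ball 0 R) x *\<^sub>R u x)"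
  unfolding sq_def lebesgue_on_Int[OF assms] e
  by (simp add: borel_measurable_restrict_space_iff[OF ball_sets_on[OF assms]] integrable_restrict_space[OF ball_sets_on[OF assms]])
 show "nrm (lebesgue_on (Om \<inter> ball 0 R)) u = nrm (lebesgue_on Om) (%x. indicator (ball 0 R) x *\<^sub>R u x)"
  unfolding nrm_def lebesgue_on_Int[OF assms] e integral_restrict_space[OF ball_sets_on[OF assms]] ..
qed

lemma L2loc_iff:
 assumes "open Om"
 shows "u \<in> L2loc Om q \<longleftrightarrow> (\<forall>x\<in>Om. u x \<in> alt q) \<and> (\<forall>R>0. sq (lebesgue_on Om) (%x. indicator (ball 0 R) x *\<^sub>R u x))"
proof -
 have "(\<forall>R>0. \<forall>x\<in>Om \<inter> ball 0 R. u x \<in> alt q) \<longleftrightarrow> (\<forall>x\<in>Om. u x \<in> alt q)"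
 proof (intro iffI ballI)
  fix x assume h: "\<forall>R>0. \<forall>x\<in>Om \<inter> ball 0 R. u x \<in> alt q" and x: "x \<in> Om"
  have "norm x + 1 > 0" using norm_ge_zero[of x] by linarith
  with h x show "u x \<in> alt q" by (auto dest!: spec[of _ "norm x + 1"])
 qed auto
 then show ?thesis by (auto simp: L2loc_def L2_iff sq_ball_iff[OF assms])
qed

lemma L2loc_measurable:
 assumes "open Om" "u \<in> L2loc Om q" shows "u \<in> borel_measurable (lebesgue_on Om)"
proof (rule borel_measurable_LIMSEQ_metric)
 show "(%x. indicator (ball 0 (real (Suc k))) x *\<^sub>R u x) \<in> borel_measurable (lebesgue_on Om)" for k
  using assms(2) by (auto simp: L2loc_iff[OF assms(1)] sq_def)
 show "(%k. indicator (ball 0 (real (Suc k))) x *\<^sub>R u x) \<longlonglongrightarrow> u x" for x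
 proof (rule tendsto_eventually)
  obtain K where K: "norm x < real K" using reals_Archimedean2 by blast
  have "indicator (ball 0 (real (Suc k))) x *\<^sub>R u x = u x" if "k \<ge> K" for k using K that by simp
  then show "\<forall>\<^sub>F k in sequentially. indicator (ball 0 (real (Suc k))) x *\<^sub>R u x = u x"
   by (auto simp: eventually_sequentially)
 qed
qed

lemma L2loc_dom:
 assumes "open Om" "v \<in> L2loc Om p" "u \<in> borel_measurable (lebesgue_on Om)" "\<And>x. x \<in> Om ==> u x \<in> alt q"
  "\<And>R. R > 0 ==> \<exists>C. AE x in lebesgue_on Om. norm x < R \<longrightarrow> norm (u x) \<le> C * norm (v x)"
 shows "u \<in> L2loc Om q"
 unfolding L2loc_iff[OF assms(1)]
proof (intro conjI ballI allI impI)
 fix R :: real assume R: "R > 0"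
 obtain C where C: "AE x in lebesgue_on Om. norm x < R \<longrightarrow> norm (u x) \<le> C * norm (v x)" using assms(5)[OF R] by blast
 show "sq (lebesgue_on Om) (%x. indicator (ball 0 R) x *\<^sub>R u x)"
 proof (rule sq_dom(1)[of _ "%x. indicator (ball 0 R) x *\<^sub>R v x" _ C])
  show "sq (lebesgue_on Om) (%x. indicator (ball 0 R) x *\<^sub>R v x)" using assms(2) R by (simp add: L2loc_iff[OF assms(1)])
  have "(indicator (ball 0 R) :: _ => real) \<in> borel_measurable (lebesgue_on Om)"
   by (rule measurable_restrict_space1) (auto intro!: borel_measurable_indicator)
  then show "(%x. indicator (ball 0 R) x *\<^sub>R u x) \<in> borel_measurable (lebesgue_on Om)"
   using assms(3) by (intro borel_measurable_scaleR)
  show "AE x in lebesgue_on Om. norm (indicator (ball 0 R) x *\<^sub>R u x) \<le> C * norm (indicator (ball 0 R) x *\<^sub>R v x)"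
   using C by eventually_elim (auto simp: indicator_def)
 qed
qed (use assms(4) in auto)

lemma L2loc_lincomb:
 assumes "open Om" "u \<in> L2loc Om q" "v \<in> L2loc Om q" shows "(%x. a *\<^sub>R u x + v x) \<in> L2loc Om q"
 unfolding L2loc_iff[OF assms(1)]
proof (intro conjI ballI allI impI)
 fix R :: real assume R: "R > 0"
 have "sq (lebesgue_on Om) (%x. a *\<^sub>R (indicator (ball 0 R) x *\<^sub>R u x) + indicator (ball 0 R) x *\<^sub>R v x)"
  using assms(2,3) R by (intro sq_add sq_scaleR) (auto simp: L2loc_iff[OF assms(1)])
 then show "sq (lebesgue_on Om) (%x. indicator (ball 0 R) x *\<^sub>R (a *\<^sub>R u x + v x))"
  by (simp add: scaleR_add_right mult.commute)
qed (use assms in \<open>auto simp: L2loc_iff intro!: alt_add alt_scaleR\<close>)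

lemma continuous_ball_bounded:
 fixes f :: "real ^ 'n::finite => 'b::real_normed_vector"
 assumes "continuous_on UNIV f" shows "\<exists>C\<ge>0. \<forall>x. norm x < R \<longrightarrow> norm (f x) \<le> C"
proof -
 have "compact (f ` cball 0 R)" by (intro compact_continuous_image continuous_on_subset[OF assms]) auto
 then obtain C where "C > 0" "\<forall>y\<in>f ` cball 0 R. norm y \<le> C" using bounded_pos compact_imp_bounded by metis
 then show ?thesis by (intro exI[of _ C]) auto
qed

lemma continuous_measurable_on:
 fixes f :: "real ^ 'n::finite => 'b::euclidean_space"
 assumes "continuous_on UNIV f" shows "f \<in> borel_measurable (lebesgue_on Om)"
 by (intro measurable_restrict_space1 measurable_completion) (simp add: borel_measurable_continuous_onI assms)

lemma L2loc_mult:
 assumes "open Om" "u \<in> L2loc Om q" "continuous_on UNIV (\<phi> :: _ => real)" shows "(%x. \<phi> x *\<^sub>R u x) \<in> L2loc Om q"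
proof (rule L2loc_dom[OF assms(1,2)])
 show "(%x. \<phi> x *\<^sub>R u x) \<in> borel_measurable (lebesgue_on Om)"
  by (intro borel_measurable_scaleR continuous_measurable_on assms L2loc_measurable[OF assms(1,2)])
 show "\<phi> x *\<^sub>R u x \<in> alt q" if "x \<in> Om" for x using that assms(2) by (auto simp: L2loc_iff[OF assms(1)] intro: alt_scaleR)
 show "\<exists>C. AE x in lebesgue_on Om. norm x < R \<longrightarrow> norm (\<phi> x *\<^sub>R u x) \<le> C * norm (u x)" for R
 proof -
  obtain C where "\<And>x. norm x < R ==> norm (\<phi> x) \<le> C" using continuous_ball_bounded[OF assms(3), of R] by blast
  then show ?thesis by (intro exI[of _ C] AE_I2) (auto intro!: mult_right_mono)
 qed
qed

lemma L2w_imp_L2loc: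
 assumes "open Om" "u \<in> L2w Om q s" shows "u \<in> L2loc Om q"
proof -
 have "wt s u \<in> L2loc Om q" unfolding L2loc_iff[OF assms(1)]
 proof (intro conjI ballI allI impI)
  fix R :: real
  have i: "(indicator (ball 0 R) :: _ => real) \<in> borel_measurable (lebesgue_on Om)"
   by (rule measurable_restrict_space1) (auto intro!: borel_measurable_indicator)
  show "sq (lebesgue_on Om) (%x. indicator (ball 0 R) x *\<^sub>R wt s u x)"
   by (rule sq_dom(1)[OF L2w_sq[OF assms(2)], of _ 1])
    (intro borel_measurable_scaleR[OF i] sq_measurable[OF L2w_sq[OF assms(2)]], simp add: indicator_def)
 qed (use assms(2) in \<open>auto simp: L2w_iff intro: alt_scaleR\<close>)
 from L2loc_mult[OF assms(1) this continuous_rho_powr, of "- s"] show ?thesis by (simp only: wt_inverse)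
qed

lemma sq_csupp_on:
 fixes f :: "real ^ 'n::finite => 'b::euclidean_space"
 assumes "open Om" "csupp f" "continuous_on UNIV f" shows "sq (lebesgue_on Om) f"
proof -
 have "integrable lebesgue (%x. indicator Om x *\<^sub>R (norm (f x))\<^sup>2)"
  using integrable_mult_indicator[OF open_lebesgue[OF assms(1)] sq_integrable[OF sq_csupp[OF assms(2,3)]]] .
 then show ?thesis using continuous_measurable_on[OF assms(3)]
  by (simp add: sq_def integrable_restrict_space open_lebesgue[OF assms(1)])
qed

lemma test_L2w:
 assumes "open Om" "\<Phi> \<in> test_forms Om q" shows "\<Phi> \<in> L2w Om q s"
proof -
 note t = test_formsD[OF assms(2)]
 have "sq (lebesgue_on Om) (wt s \<Phi>)"
  by (rule sq_csupp_on[OF assms(1) csupp_mono[OF t(2)]], simp)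
   (intro continuous_on_scaleR continuous_rho_powr smooth_continuous t(1))
 then show ?thesis using t(3) by (simp add: L2w_iff)
qed

text \<open>A local form paired with a compactly supported one may be cut off by the indicator of a
  ball that contains the support; then both factors are globally square integrable.\<close>

lemma L2loc_test_integrable:
 fixes v :: "('n::{finite,linorder}) form"
 assumes "open Om" "u \<in> L2loc Om q" "csupp v" "continuous_on UNIV v"
 obtains R where "R > 0" "sq (lebesgue_on Om) (%x. indicator (ball 0 R) x *\<^sub>R u x)" "sq (lebesgue_on Om) v"
  "\<And>x. v x \<noteq> 0 ==> norm x < R"
proof -
 obtain R where R: "R > 0" "\<And>x. norm x > R ==> v x = 0" using assms(3) by (auto simp: csupp_cball)
 show ?thesis
 proof (rule that[of "R + 1"])
  show "sq (lebesgue_on Om) (%x. indicator (ball 0 (R + 1)) x *\<^sub>R u x)"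
   using assms(2) R(1) by (simp add: L2loc_iff[OF assms(1)])
  show "norm x < R + 1" if "v x \<noteq> 0" for x using R(2)[of x] that by force
 qed (use R sq_csupp_on[OF assms(1,3,4)] in auto)
qed

section \<open>Complex pairings and weak derivatives\<close>

lemma hinner_Complex: "hinner u v = Complex (u \<bullet> v) (u \<bullet> (\<i> *s v))"
 by (simp add: complex_eq_iff hinner_Re hinner_Im)

lemma sq_smult: "sq M u ==> sq M (%x. c *s u x)" for u :: "_ => ('n::finite) alg"
 by (rule sq_bounded_linear(1)[OF _ bounded_linear_smult])

lemma nrm_smult: "nrm M (%x. c *s u x) = cmod c * nrm M u" for u :: "_ => ('n::finite) alg"
 by (simp add: nrm_def norm_smult power_mult_distrib real_sqrt_mult)

lemma hinner_integral:
 assumes "sq M u" "sq M v"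
 shows "integrable M (%x. hinner (u x) (v x))"
  "integral\<^sup>L M (%x. hinner (u x) (v x)) = Complex (ip M u v) (ip M u (%x. \<i> *s v x))"
proof -
 have i: "integrable M (%x. u x \<bullet> v x)" "integrable M (%x. u x \<bullet> (\<i> *s v x))"
  by (intro sq_inner assms sq_smult)+
 have e: "hinner (u x) (v x) = of_real (u x \<bullet> v x) + \<i> * of_real (u x \<bullet> (\<i> *s v x))" for x
  by (simp add: hinner_Complex complex_eq_iff)
 show "integrable M (%x. hinner (u x) (v x))" unfolding e
  using i by (intro Bochner_Integration.integrable_add integrable_mult_right integrable_of_real)
 have "integral\<^sup>L M (%x. complex_of_real (u x \<bullet> v x) + \<i> * complex_of_real (u x \<bullet> (\<i> *s v x))) =
   complex_of_real (ip M u v) + \<i> * complex_of_real (ip M u (%x. \<i> *s v x))"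
  unfolding ip_def using i
  by (subst Bochner_Integration.integral_add) (auto simp: integral_complex_of_real intro!: integrable_mult_right integrable_of_real)
 then show "integral\<^sup>L M (%x. hinner (u x) (v x)) = Complex (ip M u v) (ip M u (%x. \<i> *s v x))"
  unfolding e by (simp add: complex_eq_iff)
qed

lemma L2_pair_sq: "sq (lebesgue_on Om) u ==> sq (lebesgue_on Om) v ==>
  L2_pair Om u v = Complex (ip (lebesgue_on Om) u v) (ip (lebesgue_on Om) u (%x. \<i> *s v x))"
 unfolding L2_pair_def by (rule hinner_integral(2))

lemma L2_pair_loc:
 fixes v :: "('n::{finite,linorder}) form"
 assumes "open Om" "u \<in> L2loc Om q" "csupp v" "continuous_on UNIV v"
 shows "L2_pair Om u v = Complex (ip (lebesgue_on Om) u v) (ip (lebesgue_on Om) u (%x. \<i> *s v x))"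
  "integrable (lebesgue_on Om) (%x. u x \<bullet> v x)"
proof -
 obtain R where R: "R > 0" "sq (lebesgue_on Om) (%x. indicator (ball 0 R) x *\<^sub>R u x)" "sq (lebesgue_on Om) v"
  "\<And>x. v x \<noteq> 0 ==> norm x < R" using L2loc_test_integrable[OF assms] by blast
 let ?u = "%x. indicator (ball 0 R) x *\<^sub>R u x"
 have e: "?u x \<bullet> v x = u x \<bullet> v x" "?u x \<bullet> (\<i> *s v x) = u x \<bullet> (\<i> *s v x)" "hinner (?u x) (v x) = hinner (u x) (v x)" for x
 proof -
  consider "v x = 0" | "norm x < R" using R(4)[of x] by blast
  then show "?u x \<bullet> v x = u x \<bullet> v x" "?u x \<bullet> (\<i> *s v x) = u x \<bullet> (\<i> *s v x)" "hinner (?u x) (v x) = hinner (u x) (v x)"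
   by (cases, simp_all add: hinner_def)+
 qed
 show "L2_pair Om u v = Complex (ip (lebesgue_on Om) u v) (ip (lebesgue_on Om) u (%x. \<i> *s v x))"
  using L2_pair_sq[OF R(2,3)] unfolding L2_pair_def ip_def e .
 show "integrable (lebesgue_on Om) (%x. u x \<bullet> v x)" using sq_inner[OF R(2,3)] unfolding e .
qed

lemma test_cont: "\<Phi> \<in> test_forms Om q ==> continuous_on UNIV \<Phi>"
 by (intro smooth_continuous test_formsD)

lemma L2loc_test:
 fixes \<Phi> :: "('n::{finite,linorder}) form"
 assumes "open Om" "u \<in> L2loc Om p" "\<Phi> \<in> test_forms Om q"
 shows "integrable (lebesgue_on Om) (%x. u x \<bullet> \<Phi> x)"
  "L2_pair Om u \<Phi> = Complex (ip (lebesgue_on Om) u \<Phi>) (ip (lebesgue_on Om) u (%x. \<i> *s \<Phi> x))"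
 using L2_pair_loc[OF assms(1,2) test_formsD(2)[OF assms(3)] test_cont[OF assms(3)]] by blast+

text \<open>The imaginary part of the identity for a test form is the real identity for i times that
  form, and test forms are closed under this multiplication. Hence the complex and the real weak
  formulations agree.\<close>

lemma weak_iff:
 fixes u v :: "('n::{finite,linorder}) form"
 assumes "open Om" "u \<in> L2loc Om p" "v \<in> L2loc Om r"
  and D: "\<And>\<Psi>. \<Psi> \<in> test_forms Om q ==> D \<Psi> \<in> test_forms Om p \<and> D (%x. \<i> *s \<Psi> x) = (%x. \<i> *s D \<Psi> x)"
 shows "(\<forall>\<Psi>\<in>test_forms Om q. L2_pair Om u (D \<Psi>) = - L2_pair Om v \<Psi>) \<longleftrightarrow>
  (\<forall>\<Psi>\<in>test_forms Om q. ip (lebesgue_on Om) u (D \<Psi>) = - ip (lebesgue_on Om) v \<Psi>)"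
proof -
 have 1: "L2_pair Om u (D \<Psi>) = - L2_pair Om v \<Psi> \<longleftrightarrow> ip (lebesgue_on Om) u (D \<Psi>) = - ip (lebesgue_on Om) v \<Psi> \<and>
   ip (lebesgue_on Om) u (D (%x. \<i> *s \<Psi> x)) = - ip (lebesgue_on Om) v (%x. \<i> *s \<Psi> x)" if P: "\<Psi> \<in> test_forms Om q" for \<Psi>
  using D[OF P] unfolding L2loc_test(2)[OF assms(1,2) conjunct1[OF D[OF P]]] L2loc_test(2)[OF assms(1,3) P]
  by (simp add: complex_eq_iff)
 show ?thesis using 1 test_forms_smult[of _ Om q "\<i>"] by blast
qed

lemma has_rot_iff:
 assumes "open Om"
 shows "has_rot Om q E G \<longleftrightarrow> E \<in> L2loc Om q \<and> G \<in> L2loc Om (q + 1) \<and>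
  (\<forall>\<Psi>\<in>test_forms Om (q + 1). ip (lebesgue_on Om) E (codd \<Psi>) = - ip (lebesgue_on Om) G \<Psi>)"
proof -
 have c: "co_d q \<Psi> = codd \<Psi>" if "\<Psi> \<in> test_forms Om (q + 1)" for \<Psi> using co_d_eq_codd[OF that] by blast
 have D: "codd \<Psi> \<in> test_forms Om q \<and> codd (%x. \<i> *s \<Psi> x) = (%x. \<i> *s codd \<Psi> x)" if "\<Psi> \<in> test_forms Om (q + 1)" for \<Psi>
  using test_forms_codd[OF that] codd_smult[OF test_formsD(1)[OF that]] by auto
 have "(\<forall>\<Psi>\<in>test_forms Om (q + 1). L2_pair Om E (co_d q \<Psi>) = - L2_pair Om G \<Psi>) \<longleftrightarrow>
   (\<forall>\<Psi>\<in>test_forms Om (q + 1). L2_pair Om E (codd \<Psi>) = - L2_pair Om G \<Psi>)" using c by simp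
 then show ?thesis unfolding has_rot_def
  using weak_iff[where D=codd and u=E and v=G and p=q and q="q + 1" and r="q + 1" and Om=Om] assms D by blast
qed

lemma has_div_iff:
 assumes "open Om"
 shows "has_div Om q H F \<longleftrightarrow> H \<in> L2loc Om q \<and> F \<in> L2loc Om (q - 1) \<and>
  (\<forall>\<Phi>\<in>test_forms Om (q - 1). ip (lebesgue_on Om) H (ext_d \<Phi>) = - ip (lebesgue_on Om) F \<Phi>)"
proof -
 have D: "ext_d \<Psi> \<in> test_forms Om q \<and> ext_d (%x. \<i> *s \<Psi> x) = (%x. \<i> *s ext_d \<Psi> x)" if "\<Psi> \<in> test_forms Om (q - 1)" for \<Psi>
  using test_forms_ext_d[OF that] ext_d_smult[OF test_formsD(1)[OF that]] by auto
 show ?thesis unfolding has_div_def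
  using weak_iff[where D=ext_d and u=H and v=F and p=q and q="q - 1" and r="q - 1" and Om=Om] assms D by blast
qed

lemma ip_restrict:
 fixes Om :: "(real ^ 'n::finite) set"
 assumes "open Om" "\<And>x. x \<notin> Om ==> u x \<bullet> v x = 0"
 shows "ip (lebesgue_on Om) u v = ip lebesgue u v"
proof -
 have "ip (lebesgue_on Om) u v = integral\<^sup>L lebesgue (%x. indicator Om x *\<^sub>R (u x \<bullet> v x))"
  unfolding ip_def by (rule integral_restrict_space) (simp add: open_lebesgue[OF assms(1)])
 also have "(%x. indicator Om x *\<^sub>R (u x \<bullet> v x)) = (%x. u x \<bullet> v x)"
  using assms(2) by (auto simp: indicator_def fun_eq_iff)
 finally show ?thesis unfolding ip_def .
qed

lemma ip_lincomb_test:
 fixes u v \<Phi> :: "('n::{finite,linorder}) form"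
 assumes "open Om" "u \<in> L2loc Om p" "v \<in> L2loc Om p" "\<Phi> \<in> test_forms Om q"
 shows "ip (lebesgue_on Om) (%x. a *\<^sub>R u x + v x) \<Phi> = a * ip (lebesgue_on Om) u \<Phi> + ip (lebesgue_on Om) v \<Phi>"
 using L2loc_test(1)[OF assms(1,2,4)] L2loc_test(1)[OF assms(1,3,4)] by (simp add: ip_def inner_add_left)

lemma has_rot_test:
 assumes "open Om" "\<Phi> \<in> test_forms Om q" shows "has_rot Om q \<Phi> (ext_d \<Phi>)"
 unfolding has_rot_iff[OF assms(1)]
proof (intro conjI ballI)
 note t = test_formsD[OF assms(2)] and d = test_forms_ext_d[OF assms(2)]
 show "\<Phi> \<in> L2loc Om q" "ext_d \<Phi> \<in> L2loc Om (q + 1)"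
  by (rule L2w_imp_L2loc[OF assms(1) test_L2w[OF assms(1,2)]] L2w_imp_L2loc[OF assms(1) test_L2w[OF assms(1) d]])+
 have z: "\<Theta> x = 0" if "\<Theta> \<in> test_forms Om p" "x \<notin> Om" for \<Theta> :: "'a form" and p x
  using test_formsD(4)[OF that(1)] that(2) by blast
 fix \<Psi> assume P: "\<Psi> \<in> test_forms Om (q + 1)"
 have "ip (lebesgue_on Om) \<Phi> (codd \<Psi>) = ip lebesgue \<Phi> (codd \<Psi>)"
  by (rule ip_restrict[OF assms(1)]) (simp add: z[OF assms(2)])
 also have "\<dots> = - ip lebesgue (ext_d \<Phi>) \<Psi>"
  unfolding ip_def using ext_d_by_parts[OF t(1) test_formsD(1)[OF P]] t(2) by simp
 also have "\<dots> = - ip (lebesgue_on Om) (ext_d \<Phi>) \<Psi>"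
  by (subst ip_restrict[OF assms(1)]) (simp_all add: z[OF P])
 finally show "ip (lebesgue_on Om) \<Phi> (codd \<Psi>) = - ip (lebesgue_on Om) (ext_d \<Phi>) \<Psi>" .
qed

lemma has_rot_L2loc: "has_rot Om q E G ==> E \<in> L2loc Om q" "has_rot Om q E G ==> G \<in> L2loc Om (q + 1)"
 and has_div_L2loc: "has_div Om q H F ==> H \<in> L2loc Om q" "has_div Om q H F ==> F \<in> L2loc Om (q - 1)"
 by (auto simp: has_rot_def has_div_def)

lemma has_rot_lincomb:
 assumes "open Om" "has_rot Om q E G" "has_rot Om q E' G'"
 shows "has_rot Om q (%x. a *\<^sub>R E x + E' x) (%x. a *\<^sub>R G x + G' x)"
 unfolding has_rot_iff[OF assms(1)]
proof (intro conjI ballI L2loc_lincomb assms(1) has_rot_L2loc[OF assms(2)] has_rot_L2loc[OF assms(3)])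
 fix \<Psi> assume P: "\<Psi> \<in> test_forms Om (q + 1)"
 show "ip (lebesgue_on Om) (%x. a *\<^sub>R E x + E' x) (codd \<Psi>) = - ip (lebesgue_on Om) (%x. a *\<^sub>R G x + G' x) \<Psi>"
  using assms(2,3) P
  by (simp add: ip_lincomb_test[OF assms(1) has_rot_L2loc(1)[OF assms(2)] has_rot_L2loc(1)[OF assms(3)] test_forms_codd[OF P]]
   ip_lincomb_test[OF assms(1) has_rot_L2loc(2)[OF assms(2)] has_rot_L2loc(2)[OF assms(3)] P] has_rot_iff[OF assms(1)])
qed

lemma has_div_lincomb:
 assumes "open Om" "has_div Om q H F" "has_div Om q H' F'"
 shows "has_div Om q (%x. a *\<^sub>R H x + H' x) (%x. a *\<^sub>R F x + F' x)"
 unfolding has_div_iff[OF assms(1)]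
proof (intro conjI ballI L2loc_lincomb assms(1) has_div_L2loc[OF assms(2)] has_div_L2loc[OF assms(3)])
 fix \<Psi> assume P: "\<Psi> \<in> test_forms Om (q - 1)"
 show "ip (lebesgue_on Om) (%x. a *\<^sub>R H x + H' x) (ext_d \<Psi>) = - ip (lebesgue_on Om) (%x. a *\<^sub>R F x + F' x) \<Psi>"
  using assms(2,3) P
  by (simp add: ip_lincomb_test[OF assms(1) has_div_L2loc(1)[OF assms(2)] has_div_L2loc(1)[OF assms(3)] test_forms_ext_d[OF P]]
   ip_lincomb_test[OF assms(1) has_div_L2loc(2)[OF assms(2)] has_div_L2loc(2)[OF assms(3)] P] has_div_iff[OF assms(1)])
qed

lemma has_rot_diff: "open Om ==> has_rot Om q E G ==> has_rot Om q E' G' ==> has_rot Om q (%x. E x - E' x) (%x. G x - G' x)"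
 using has_rot_lincomb[of Om q E' G' E G "-1"] by simp

lemma has_div_diff: "open Om ==> has_div Om q E G ==> has_div Om q E' G' ==> has_div Om q (%x. E x - E' x) (%x. G x - G' x)"
 using has_div_lincomb[of Om q E' G' E G "-1"] by simp

lemma adjoint_smult: "(c *s u) \<bullet> v = u \<bullet> (cnj c *s v)" for u v :: "('n::finite) alg"
 by (auto simp: inner_vec_def inner_complex_def algebra_simps intro!: sum.cong)

lemma L2loc_smult:
 assumes "open Om" "u \<in> L2loc Om q" shows "(%x. c *s u x) \<in> L2loc Om q"
proof (rule L2loc_dom[OF assms])
 show "(%x. c *s u x) \<in> borel_measurable (lebesgue_on Om)"
  using borel_measurable_continuous_on[OF linear_continuous_on[OF bounded_linear_smult] L2loc_measurable[OF assms]] by auto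
 show "c *s u x \<in> alt q" if "x \<in> Om" for x using assms that by (auto simp: L2loc_iff intro: alt_smult)
qed (auto simp: norm_smult)

lemma has_rot_smult:
 assumes "open Om" "has_rot Om q E G" shows "has_rot Om q (%x. c *s E x) (%x. c *s G x)"
 unfolding has_rot_iff[OF assms(1)]
proof (intro conjI ballI L2loc_smult assms(1) has_rot_L2loc[OF assms(2)])
 fix \<Psi> assume P: "\<Psi> \<in> test_forms Om (q + 1)"
 have "codd (%x. cnj c *s \<Psi> x) = (%x. cnj c *s codd \<Psi> x)" using codd_smult[OF test_formsD(1)[OF P]] by blast
 moreover have "ip (lebesgue_on Om) E (codd (%x. cnj c *s \<Psi> x)) = - ip (lebesgue_on Om) G (%x. cnj c *s \<Psi> x)"
  using assms(2) test_forms_smult[OF P, of "cnj c"] unfolding has_rot_iff[OF assms(1)] by blast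
 ultimately show "ip (lebesgue_on Om) (%x. c *s E x) (codd \<Psi>) = - ip (lebesgue_on Om) (%x. c *s G x) \<Psi>"
  by (simp only: ip_def adjoint_smult)
qed

lemma has_div_smult:
 assumes "open Om" "has_div Om q E G" shows "has_div Om q (%x. c *s E x) (%x. c *s G x)"
 unfolding has_div_iff[OF assms(1)]
proof (intro conjI ballI L2loc_smult assms(1) has_div_L2loc[OF assms(2)])
 fix \<Psi> assume P: "\<Psi> \<in> test_forms Om (q - 1)"
 have "ext_d (%x. cnj c *s \<Psi> x) = (%x. cnj c *s ext_d \<Psi> x)" using ext_d_smult[OF test_formsD(1)[OF P]] by blast
 moreover have "ip (lebesgue_on Om) E (ext_d (%x. cnj c *s \<Psi> x)) = - ip (lebesgue_on Om) G (%x. cnj c *s \<Psi> x)"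
  using assms(2) test_forms_smult[OF P, of "cnj c"] unfolding has_div_iff[OF assms(1)] by blast
 ultimately show "ip (lebesgue_on Om) (%x. c *s E x) (ext_d \<Psi>) = - ip (lebesgue_on Om) (%x. c *s G x) \<Psi>"
  by (simp only: ip_def adjoint_smult)
qed

text \<open>The scalar fundamental lemma applies to the pairing with each constant vector;
  projecting the vector to rank \<open>q\<close> makes it a legitimate coefficient, and
  \<open>u\<close> does not notice the projection.\<close>

lemma weakly_zero_AE:
 fixes u :: "('n::{finite,linorder}) form"
 assumes Om: "open Om" and u: "u \<in> L2loc Om q"
  and z: "\<And>\<Phi>. \<Phi> \<in> test_forms Om q ==> ip (lebesgue_on Om) u \<Phi> = 0"
 shows "AE x in lebesgue_on Om. u x = 0"
proof -
 have Omm: "Om \<in> sets lebesgue" by (rule open_lebesgue[OF Om])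
 have one: "AE x in lebesgue. x \<in> Om \<longrightarrow> indicator Om x * (u x \<bullet> altproj q w) = 0" for w
 proof (rule fundamental_lemma[OF Om])
  have "(%x. u x \<bullet> altproj q w) \<in> borel_measurable (lebesgue_on Om)" using L2loc_measurable[OF Om u] by simp
  then show "(%x. indicator Om x * (u x \<bullet> altproj q w)) \<in> borel_measurable lebesgue"
   using borel_measurable_restrict_space_iff[of Om lebesgue "%x. u x \<bullet> altproj q w"] Omm by (simp add: mult.commute)
  show "integrable lebesgue (%x. indicator (ball 0 R) x * (indicator Om x * (u x \<bullet> altproj q w)))" for R
  proof (cases "R > 0")
   case True
   have s: "sq (lebesgue_on Om) (%x. indicator (ball 0 R) x *\<^sub>R u x)" using u True by (simp add: L2loc_iff[OF Om])
   have t: "sq (lebesgue_on Om) (%x. cut R x *\<^sub>R altproj q w)"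
   proof (rule sq_csupp_on[OF Om])
    show "csupp (%x. cut R x *\<^sub>R altproj q w)" unfolding csupp_def
     using True by (intro exI[of _ "cball 0 (2 * R)"]) (auto simp: cut_zero)
    show "continuous_on UNIV (%x. cut R x *\<^sub>R altproj q w)"
     by (intro continuous_on_scaleR continuous_on_const smooth_continuous smooth_cut)
   qed
   have "integrable (lebesgue_on Om) (%x. (indicator (ball 0 R) x *\<^sub>R u x) \<bullet> (cut R x *\<^sub>R altproj q w))" by (rule sq_inner[OF s t])
   also have "(%x. (indicator (ball 0 R) x *\<^sub>R u x) \<bullet> (cut R x *\<^sub>R altproj q w)) = (%x. indicator (ball 0 R) x * (u x \<bullet> altproj q w))"
    using True by (auto simp: indicator_def fun_eq_iff cut_one)
   finally show ?thesis by (simp add: integrable_restrict_space Omm mult_ac)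
  next
   case False
   then have b: "ball (0 :: real ^ ('n::{finite,linorder})) R = {}" by simp
   show ?thesis unfolding b by simp
  qed
  fix \<phi> :: "real ^ ('n::{finite,linorder}) => real" assume "\<phi> \<in> C0_inf Om"
  then have "(%x. \<phi> x *\<^sub>R altproj q w) \<in> test_forms Om q" by (rule test_forms_scalar[OF _ altproj_alt])
  from z[OF this] show "integral\<^sup>L lebesgue (%x. indicator Om x * (u x \<bullet> altproj q w) * \<phi> x) = 0"
   by (simp add: ip_def integral_restrict_space Omm mult_ac)
 qed
 have "AE x in lebesgue. \<forall>w\<in>Basis. x \<in> Om \<longrightarrow> indicator Om x * (u x \<bullet> altproj q w) = 0"
  by (rule AE_finite_allI[OF finite_Basis one])
 then have "AE x in lebesgue. x \<in> Om \<longrightarrow> u x = 0"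
 proof eventually_elim
  case (elim x)
  show ?case
  proof
   assume x: "x \<in> Om"
   have ua: "u x \<in> alt q" using u x by (simp add: L2loc_iff[OF Om])
   have "\<forall>w\<in>Basis. u x \<bullet> w = 0" using elim x altproj_adjoint[of "u x" q] altproj_id[OF ua] by simp
   then show "u x = 0" by (metis euclidean_eqI inner_zero_left)
  qed
 qed
 then show ?thesis by (simp add: AE_restrict_space_iff Omm)
qed

lemma L2loc_diff: "open Om ==> u \<in> L2loc Om q ==> v \<in> L2loc Om q ==> (%x. u x - v x) \<in> L2loc Om q"
 using L2loc_lincomb[of Om v q u "-1"] by simp

lemma has_rot_unique:
 assumes "open Om" "has_rot Om q E G" "has_rot Om q E G'"
 shows "AE x in lebesgue_on Om. G x = G' x"
proof -
 have "AE x in lebesgue_on Om. G x - G' x = 0"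
 proof (rule weakly_zero_AE[OF assms(1)])
  show "(%x. G x - G' x) \<in> L2loc Om (q + 1)" by (intro L2loc_diff assms(1) has_rot_L2loc[OF assms(2)] has_rot_L2loc[OF assms(3)])
  fix \<Phi> assume P: "\<Phi> \<in> test_forms Om (q + 1)"
  have "has_rot Om q (%x. 0) (%x. G x - G' x)" using has_rot_diff[OF assms] by simp
  then show "ip (lebesgue_on Om) (%x. G x - G' x) \<Phi> = 0" using P by (simp add: has_rot_iff[OF assms(1)]) (simp add: ip_def)
 qed
 then show ?thesis by eventually_elim simp
qed

lemma has_div_unique:
 assumes "open Om" "has_div Om q E G" "has_div Om q E G'"
 shows "AE x in lebesgue_on Om. G x = G' x"
proof -
 have "AE x in lebesgue_on Om. G x - G' x = 0"
 proof (rule weakly_zero_AE[OF assms(1)])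
  show "(%x. G x - G' x) \<in> L2loc Om (q - 1)" by (intro L2loc_diff assms(1) has_div_L2loc[OF assms(2)] has_div_L2loc[OF assms(3)])
  fix \<Phi> assume P: "\<Phi> \<in> test_forms Om (q - 1)"
  have "has_div Om q (%x. 0) (%x. G x - G' x)" using has_div_diff[OF assms] by simp
  then show "ip (lebesgue_on Om) (%x. G x - G' x) \<Phi> = 0" using P by (simp add: has_div_iff[OF assms(1)]) (simp add: ip_def)
 qed
 then show ?thesis by eventually_elim simp
qed

lemma ip_cong_AE:
 assumes "u \<in> borel_measurable M" "u' \<in> borel_measurable M" "v \<in> borel_measurable M" "AE x in M. u x = u' x"
 shows "ip M u v = ip M u' v"
 unfolding ip_def using assms by (intro integral_cong_AE) (auto elim: AE_mp)

lemma test_measurable: "\<Phi> \<in> test_forms Om q ==> \<Phi> \<in> borel_measurable (lebesgue_on Om')"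
 by (rule continuous_measurable_on[OF test_cont])

lemma has_div_AE:
 assumes "open Om" "has_div Om q E G" "E' \<in> L2loc Om q" "G' \<in> L2loc Om (q - 1)"
  "AE x in lebesgue_on Om. E x = E' x" "AE x in lebesgue_on Om. G x = G' x"
 shows "has_div Om q E' G'"
proof -
 have "ip (lebesgue_on Om) E' (ext_d \<Psi>) = - ip (lebesgue_on Om) G' \<Psi>" if P: "\<Psi> \<in> test_forms Om (q - 1)" for \<Psi>
 proof -
  have "ip (lebesgue_on Om) E (ext_d \<Psi>) = ip (lebesgue_on Om) E' (ext_d \<Psi>)"
   by (rule ip_cong_AE[OF L2loc_measurable[OF assms(1)] L2loc_measurable[OF assms(1)] continuous_measurable_on])
    (use assms has_div_L2loc(1)[OF assms(2)] in \<open>auto intro!: smooth_continuous smooth_ext_d test_formsD(1)[OF P]\<close>)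
  moreover have "ip (lebesgue_on Om) G \<Psi> = ip (lebesgue_on Om) G' \<Psi>"
   by (rule ip_cong_AE[OF L2loc_measurable[OF assms(1) has_div_L2loc(2)[OF assms(2)]] L2loc_measurable[OF assms(1,4)]
     test_measurable[OF P] assms(6)])
  ultimately show ?thesis using assms(2) P by (simp add: has_div_iff[OF assms(1)])
 qed
 then show ?thesis using assms(3,4) by (simp add: has_div_iff[OF assms(1)])
qed

section \<open>Leibniz rules for weak derivatives\<close>

lemma grad_sum_continuous: "smooth \<phi> ==> continuous_on UNIV (%x. \<Sum>n\<in>UNIV. \<bar>grad \<phi> x $ n\<bar>)"
 unfolding grad_def by (simp, intro continuous_on_sum continuous_on_rabs smooth_continuous) (metis smooth_partial)

lemma R_op_eq: "R_op (grad \<phi> x) v = (\<Sum>n\<in>UNIV. partial_deriv n \<phi> x *\<^sub>R wedge1 n v)"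
 and ctr_eq: "ctr (grad \<phi> x) v = (\<Sum>n\<in>UNIV. partial_deriv n \<phi> x *\<^sub>R contr n v)"
 by (simp_all add: R_op_def ctr_def grad_def)

lemma grad_term_measurable:
 assumes "smooth \<phi>" "u \<in> borel_measurable (lebesgue_on Om)"
 shows "(%x. R_op (grad \<phi> x) (u x)) \<in> borel_measurable (lebesgue_on Om)"
  "(%x. ctr (grad \<phi> x) (u x)) \<in> borel_measurable (lebesgue_on Om)"
proof -
 have p: "partial_deriv n \<phi> \<in> borel_measurable (lebesgue_on Om)" for n
  by (rule continuous_measurable_on[OF smooth_continuous[OF smooth_partial[OF assms(1)]]])
 have w: "(%x. wedge1 n (u x)) \<in> borel_measurable (lebesgue_on Om)" "(%x. contr n (u x)) \<in> borel_measurable (lebesgue_on Om)" for n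
  using borel_measurable_continuous_on[OF linear_continuous_on[OF bounded_linear_wedge1] assms(2)]
   borel_measurable_continuous_on[OF linear_continuous_on[OF bounded_linear_contr] assms(2)] by auto
 show "(%x. R_op (grad \<phi> x) (u x)) \<in> borel_measurable (lebesgue_on Om)"
  "(%x. ctr (grad \<phi> x) (u x)) \<in> borel_measurable (lebesgue_on Om)"
  unfolding R_op_eq ctr_eq by (intro borel_measurable_sum borel_measurable_scaleR p w)+
qed

lemma grad_term_L2loc:
 fixes u :: "('n::{finite,linorder}) form"
 assumes "open Om" "smooth \<phi>" "u \<in> L2loc Om q"
 shows "(%x. R_op (grad \<phi> x) (u x)) \<in> L2loc Om (q + 1)" "(%x. ctr (grad \<phi> x) (u x)) \<in> L2loc Om (q - 1)"
proof -
 have a: "u x \<in> alt q" if "x \<in> Om" for x using assms(3) that by (simp add: L2loc_iff[OF assms(1)])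
 have b: "\<exists>C. \<forall>x. norm x < R \<longrightarrow> (\<Sum>n\<in>UNIV. \<bar>grad \<phi> x $ n\<bar>) \<le> C" for R
 proof -
  obtain C where "\<And>x. norm x < R ==> norm (\<Sum>n\<in>UNIV. \<bar>grad \<phi> x $ n\<bar>) \<le> C"
   using continuous_ball_bounded[OF grad_sum_continuous[OF assms(2)], of R] by blast
  then show ?thesis by (intro exI[of _ C]) (auto intro: order_trans[OF abs_ge_self])
 qed
 have c: "\<exists>C. AE x in lebesgue_on Om. norm x < R \<longrightarrow> norm (R_op (grad \<phi> x) (u x)) \<le> C * norm (u x)"
  "\<exists>C. AE x in lebesgue_on Om. norm x < R \<longrightarrow> norm (ctr (grad \<phi> x) (u x)) \<le> C * norm (u x)" for R
 proof -
  obtain C where C: "\<And>x. norm x < R ==> (\<Sum>n\<in>UNIV. \<bar>grad \<phi> x $ n\<bar>) \<le> C" using b by blast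
  show "\<exists>C. AE x in lebesgue_on Om. norm x < R \<longrightarrow> norm (R_op (grad \<phi> x) (u x)) \<le> C * norm (u x)"
   by (intro exI[of _ C] AE_I2 impI order_trans[OF norm_R_op] mult_right_mono C) auto
  show "\<exists>C. AE x in lebesgue_on Om. norm x < R \<longrightarrow> norm (ctr (grad \<phi> x) (u x)) \<le> C * norm (u x)"
   by (intro exI[of _ C] AE_I2 impI order_trans[OF norm_ctr] mult_right_mono C) auto
 qed
 show "(%x. R_op (grad \<phi> x) (u x)) \<in> L2loc Om (q + 1)"
  by (rule L2loc_dom[OF assms(1,3) grad_term_measurable(1)[OF assms(2) L2loc_measurable[OF assms(1,3)]] _ c(1)]) (intro R_op_alt a)
 show "(%x. ctr (grad \<phi> x) (u x)) \<in> L2loc Om (q - 1)"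
  by (rule L2loc_dom[OF assms(1,3) grad_term_measurable(2)[OF assms(2) L2loc_measurable[OF assms(1,3)]] _ c(2)]) (intro ctr_alt a)
qed

lemma L2loc_add: "open Om ==> u \<in> L2loc Om q ==> v \<in> L2loc Om q ==> (%x. u x + v x) \<in> L2loc Om q"
 using L2loc_lincomb[of Om u q v 1] by simp

text \<open>The factor is moved to the test form, where the commutator is
  \<open>ctr (grad \<phi> x)\<close>; its adjoint \<open>R_op (grad \<phi> x)\<close> appears in the
  result.\<close>

lemma has_rot_mult:
 fixes E :: "('n::{finite,linorder}) form"
 assumes "open Om" "smooth \<phi>" "has_rot Om q E G"
 shows "has_rot Om q (%x. \<phi> x *\<^sub>R E x) (%x. \<phi> x *\<^sub>R G x + R_op (grad \<phi> x) (E x))"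
 unfolding has_rot_iff[OF assms(1)]
proof (intro conjI ballI)
 note E = has_rot_L2loc(1)[OF assms(3)] and G = has_rot_L2loc(2)[OF assms(3)]
 have c: "continuous_on UNIV \<phi>" by (rule smooth_continuous[OF assms(2)])
 show "(%x. \<phi> x *\<^sub>R E x) \<in> L2loc Om q" by (rule L2loc_mult[OF assms(1) E c])
 show "(%x. \<phi> x *\<^sub>R G x + R_op (grad \<phi> x) (E x)) \<in> L2loc Om (q + 1)"
  by (rule L2loc_add[OF assms(1) L2loc_mult[OF assms(1) G c] grad_term_L2loc(1)[OF assms(1,2) E]])
 fix \<Psi> :: "'n form" assume P: "\<Psi> \<in> test_forms Om (q + 1)"
 let ?\<phi>\<Psi> = "%x. \<phi> x *\<^sub>R \<Psi> x"
 have PP: "?\<phi>\<Psi> \<in> test_forms Om (q + 1)" by (rule test_forms_mult[OF assms(2) P])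
 have cP: "codd ?\<phi>\<Psi> x = \<phi> x *\<^sub>R codd \<Psi> x + ctr (grad \<phi> x) (\<Psi> x)" for x
  by (rule ext_d_scaleR(2)[OF assms(2) test_formsD(1)[OF P]])
 have i1: "integrable (lebesgue_on Om) (%x. E x \<bullet> codd ?\<phi>\<Psi> x)" by (rule L2loc_test(1)[OF assms(1) E test_forms_codd[OF PP]])
 have i2: "integrable (lebesgue_on Om) (%x. R_op (grad \<phi> x) (E x) \<bullet> \<Psi> x)"
  by (rule L2loc_test(1)[OF assms(1) grad_term_L2loc(1)[OF assms(1,2) E] P])
 have i3: "integrable (lebesgue_on Om) (%x. G x \<bullet> ?\<phi>\<Psi> x)" by (rule L2loc_test(1)[OF assms(1) G PP])
 have e: "(\<phi> x *\<^sub>R E x) \<bullet> codd \<Psi> x = E x \<bullet> codd ?\<phi>\<Psi> x - R_op (grad \<phi> x) (E x) \<bullet> \<Psi> x" for x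
  by (simp add: cP inner_add_right R_op_adjoint)
 have "ip (lebesgue_on Om) (%x. \<phi> x *\<^sub>R E x) (codd \<Psi>) =
   ip (lebesgue_on Om) E (codd ?\<phi>\<Psi>) - ip (lebesgue_on Om) (%x. R_op (grad \<phi> x) (E x)) \<Psi>"
  unfolding ip_def e by (rule Bochner_Integration.integral_diff[OF i1 i2])
 also have "ip (lebesgue_on Om) E (codd ?\<phi>\<Psi>) = - ip (lebesgue_on Om) G ?\<phi>\<Psi>"
  using assms(3) PP by (simp add: has_rot_iff[OF assms(1)])
 also have "- ip (lebesgue_on Om) G ?\<phi>\<Psi> - ip (lebesgue_on Om) (%x. R_op (grad \<phi> x) (E x)) \<Psi> =
  - ip (lebesgue_on Om) (%x. \<phi> x *\<^sub>R G x + R_op (grad \<phi> x) (E x)) \<Psi>"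
  unfolding ip_def using Bochner_Integration.integral_add[OF i3 i2] by (simp add: inner_add_left)
 finally show "ip (lebesgue_on Om) (%x. \<phi> x *\<^sub>R E x) (codd \<Psi>) = - ip (lebesgue_on Om) (%x. \<phi> x *\<^sub>R G x + R_op (grad \<phi> x) (E x)) \<Psi>" .
qed

lemma has_div_mult:
 fixes H :: "('n::{finite,linorder}) form"
 assumes "open Om" "smooth \<phi>" "has_div Om q H F"
 shows "has_div Om q (%x. \<phi> x *\<^sub>R H x) (%x. \<phi> x *\<^sub>R F x + ctr (grad \<phi> x) (H x))"
 unfolding has_div_iff[OF assms(1)]
proof (intro conjI ballI)
 note H = has_div_L2loc(1)[OF assms(3)] and F = has_div_L2loc(2)[OF assms(3)]
 have c: "continuous_on UNIV \<phi>" by (rule smooth_continuous[OF assms(2)])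
 show "(%x. \<phi> x *\<^sub>R H x) \<in> L2loc Om q" by (rule L2loc_mult[OF assms(1) H c])
 show "(%x. \<phi> x *\<^sub>R F x + ctr (grad \<phi> x) (H x)) \<in> L2loc Om (q - 1)"
  by (rule L2loc_add[OF assms(1) L2loc_mult[OF assms(1) F c] grad_term_L2loc(2)[OF assms(1,2) H]])
 fix \<Psi> :: "'n form" assume P: "\<Psi> \<in> test_forms Om (q - 1)"
 let ?\<phi>\<Psi> = "%x. \<phi> x *\<^sub>R \<Psi> x"
 have PP: "?\<phi>\<Psi> \<in> test_forms Om (q - 1)" by (rule test_forms_mult[OF assms(2) P])
 have cP: "ext_d ?\<phi>\<Psi> x = \<phi> x *\<^sub>R ext_d \<Psi> x + R_op (grad \<phi> x) (\<Psi> x)" for x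
  by (rule ext_d_scaleR(1)[OF assms(2) test_formsD(1)[OF P]])
 have i1: "integrable (lebesgue_on Om) (%x. H x \<bullet> ext_d ?\<phi>\<Psi> x)" by (rule L2loc_test(1)[OF assms(1) H test_forms_ext_d[OF PP]])
 have i2: "integrable (lebesgue_on Om) (%x. ctr (grad \<phi> x) (H x) \<bullet> \<Psi> x)"
  by (rule L2loc_test(1)[OF assms(1) grad_term_L2loc(2)[OF assms(1,2) H] P])
 have i3: "integrable (lebesgue_on Om) (%x. F x \<bullet> ?\<phi>\<Psi> x)" by (rule L2loc_test(1)[OF assms(1) F PP])
 have adj: "ctr p a \<bullet> b = a \<bullet> R_op p b" for p and a b :: "'n alg" using R_op_adjoint[of p b a] by (simp add: inner_commute)
 have e: "(\<phi> x *\<^sub>R H x) \<bullet> ext_d \<Psi> x = H x \<bullet> ext_d ?\<phi>\<Psi> x - ctr (grad \<phi> x) (H x) \<bullet> \<Psi> x" for x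
  by (simp add: cP inner_add_right adj)
 have "ip (lebesgue_on Om) (%x. \<phi> x *\<^sub>R H x) (ext_d \<Psi>) =
   ip (lebesgue_on Om) H (ext_d ?\<phi>\<Psi>) - ip (lebesgue_on Om) (%x. ctr (grad \<phi> x) (H x)) \<Psi>"
  unfolding ip_def e by (rule Bochner_Integration.integral_diff[OF i1 i2])
 also have "ip (lebesgue_on Om) H (ext_d ?\<phi>\<Psi>) = - ip (lebesgue_on Om) F ?\<phi>\<Psi>"
  using assms(3) PP by (simp add: has_div_iff[OF assms(1)])
 also have "- ip (lebesgue_on Om) F ?\<phi>\<Psi> - ip (lebesgue_on Om) (%x. ctr (grad \<phi> x) (H x)) \<Psi> =
  - ip (lebesgue_on Om) (%x. \<phi> x *\<^sub>R F x + ctr (grad \<phi> x) (H x)) \<Psi>"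
  unfolding ip_def using Bochner_Integration.integral_add[OF i3 i2] by (simp add: inner_add_left)
 finally show "ip (lebesgue_on Om) (%x. \<phi> x *\<^sub>R H x) (ext_d \<Psi>) = - ip (lebesgue_on Om) (%x. \<phi> x *\<^sub>R F x + ctr (grad \<phi> x) (H x)) \<Psi>" .
qed

lemma L2loc_zero: "open Om ==> (%x. 0) \<in> L2loc Om q"
 by (simp add: L2loc_iff)

text \<open>Test with an exact form. This turns the time-harmonic equations into equations for the
  divergence of \<open>\<epsilon> E\<close>, because the divergence of \<open>div H\<close> drops
  out.\<close>

lemma has_div_div: assumes "open Om" "has_div Om q H F" shows "has_div Om (q - 1) F (%x. 0)"
 unfolding has_div_iff[OF assms(1)]
proof (intro conjI ballI has_div_L2loc[OF assms(2)] L2loc_zero assms(1))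
 fix \<Phi> assume P: "\<Phi> \<in> test_forms Om (q - 1 - 1)"
 have d: "ext_d \<Phi> \<in> test_forms Om (q - 1)" using test_forms_ext_d[OF P] by simp
 have z: "ext_d (ext_d \<Phi>) = (%x. 0)" using ext_d_ext_d[OF test_formsD(1)[OF P]] by blast
 have "ip (lebesgue_on Om) H (ext_d (ext_d \<Phi>)) = - ip (lebesgue_on Om) F (ext_d \<Phi>)"
  using assms(2) d by (simp add: has_div_iff[OF assms(1)])
 then show "ip (lebesgue_on Om) F (ext_d \<Phi>) = - ip (lebesgue_on Om) (%x. 0) \<Phi>" unfolding z by (simp add: ip_def)
qed

lemma has_rot_rot: assumes "open Om" "has_rot Om q E G" shows "has_rot Om (q + 1) G (%x. 0)"
 unfolding has_rot_iff[OF assms(1)]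
proof (intro conjI ballI has_rot_L2loc[OF assms(2)] L2loc_zero assms(1))
 fix \<Phi> assume P: "\<Phi> \<in> test_forms Om (q + 1 + 1)"
 have d: "codd \<Phi> \<in> test_forms Om (q + 1)" using test_forms_codd[OF P] by (simp add: add.commute)
 have z: "codd (codd \<Phi>) = (%x. 0)" using codd_codd[OF test_formsD(1)[OF P]] by blast
 have "ip (lebesgue_on Om) E (codd (codd \<Phi>)) = - ip (lebesgue_on Om) G (codd \<Phi>)"
  using assms(2) d by (simp add: has_rot_iff[OF assms(1)])
 then show "ip (lebesgue_on Om) G (codd \<Phi>) = - ip (lebesgue_on Om) (%x. 0) \<Phi>" unfolding z by (simp add: ip_def)
qed

section \<open>Closedness of weak derivatives and computation of graph norms\<close>

lemma ip_tendsto_L2w: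
 assumes "\<And>k. u k \<in> L2w Om q s" "p \<in> L2w Om q s" "v \<in> L2w Om q' (- s)" "(%k. L2w_norm Om s (%x. u k x - p x)) \<longlonglongrightarrow> 0"
 shows "(%k. ip (lebesgue_on Om) (u k) v) \<longlonglongrightarrow> ip (lebesgue_on Om) p v"
 unfolding ip_wt[of _ _ v s]
 by (rule ip_tendsto[OF L2w_sq[OF assms(1)] L2w_sq[OF assms(2)] L2w_sq[OF assms(3)]])
  (use assms(4) in \<open>simp add: L2w_norm_nrm scaleR_diff_right\<close>)

lemma has_rot_limit:
 assumes Om: "open Om" and h: "\<And>k. has_rot Om q (E k) (G k)"
  and E: "\<And>k. E k \<in> L2w Om q s" "E' \<in> L2w Om q s" "(%k. L2w_norm Om s (%x. E k x - E' x)) \<longlonglongrightarrow> 0"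
  and G: "\<And>k. G k \<in> L2w Om (q + 1) s'" "G' \<in> L2w Om (q + 1) s'" "(%k. L2w_norm Om s' (%x. G k x - G' x)) \<longlonglongrightarrow> 0"
 shows "has_rot Om q E' G'"
 unfolding has_rot_iff[OF Om]
proof (intro conjI ballI L2w_imp_L2loc[OF Om E(2)] L2w_imp_L2loc[OF Om G(2)])
 fix \<Psi> assume P: "\<Psi> \<in> test_forms Om (q + 1)"
 have 1: "(%k. ip (lebesgue_on Om) (E k) (codd \<Psi>)) \<longlonglongrightarrow> ip (lebesgue_on Om) E' (codd \<Psi>)"
  by (rule ip_tendsto_L2w[OF E(1,2) test_L2w[OF Om test_forms_codd[OF P]] E(3)])
 have 2: "(%k. - ip (lebesgue_on Om) (G k) \<Psi>) \<longlonglongrightarrow> - ip (lebesgue_on Om) G' \<Psi>"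
  by (intro tendsto_minus ip_tendsto_L2w[OF G(1,2) test_L2w[OF Om P] G(3)])
 have "ip (lebesgue_on Om) (E k) (codd \<Psi>) = - ip (lebesgue_on Om) (G k) \<Psi>" for k
  using h[of k] P by (simp add: has_rot_iff[OF Om])
 with 1 2 show "ip (lebesgue_on Om) E' (codd \<Psi>) = - ip (lebesgue_on Om) G' \<Psi>" using LIMSEQ_unique by auto
qed

lemma has_div_limit:
 assumes Om: "open Om" and h: "\<And>k. has_div Om q (E k) (G k)"
  and E: "\<And>k. E k \<in> L2w Om q s" "E' \<in> L2w Om q s" "(%k. L2w_norm Om s (%x. E k x - E' x)) \<longlonglongrightarrow> 0"
  and G: "\<And>k. G k \<in> L2w Om (q - 1) s'" "G' \<in> L2w Om (q - 1) s'" "(%k. L2w_norm Om s' (%x. G k x - G' x)) \<longlonglongrightarrow> 0"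
 shows "has_div Om q E' G'"
 unfolding has_div_iff[OF Om]
proof (intro conjI ballI L2w_imp_L2loc[OF Om E(2)] L2w_imp_L2loc[OF Om G(2)])
 fix \<Psi> assume P: "\<Psi> \<in> test_forms Om (q - 1)"
 have 1: "(%k. ip (lebesgue_on Om) (E k) (ext_d \<Psi>)) \<longlonglongrightarrow> ip (lebesgue_on Om) E' (ext_d \<Psi>)"
  by (rule ip_tendsto_L2w[OF E(1,2) test_L2w[OF Om test_forms_ext_d[OF P]] E(3)])
 have 2: "(%k. - ip (lebesgue_on Om) (G k) \<Psi>) \<longlonglongrightarrow> - ip (lebesgue_on Om) G' \<Psi>"
  by (intro tendsto_minus ip_tendsto_L2w[OF G(1,2) test_L2w[OF Om P] G(3)])
 have "ip (lebesgue_on Om) (E k) (ext_d \<Psi>) = - ip (lebesgue_on Om) (G k) \<Psi>" for k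
  using h[of k] P by (simp add: has_div_iff[OF Om])
 with 1 2 show "ip (lebesgue_on Om) E' (ext_d \<Psi>) = - ip (lebesgue_on Om) G' \<Psi>" using LIMSEQ_unique by auto
qed

text \<open>\<open>wrot\<close> is an arbitrary choice; uniqueness almost everywhere lets any known
  weak rotation be used to compute the norm, and gives the chosen one the weight of the known
  one.\<close>

lemma rot_norm_eq:
 assumes "open Om" "has_rot Om q E G" "G \<in> L2w Om (q + 1) s'"
 shows "rot_norm Om q s s' E = sqrt ((L2w_norm Om s E)\<^sup>2 + (L2w_norm Om s' G)\<^sup>2)"
  and "has_rot Om q E (wrot Om q E)" and "wrot Om q E \<in> L2w Om (q + 1) s'" and "AE x in lebesgue_on Om. G x = wrot Om q E x"
proof -
 show h: "has_rot Om q E (wrot Om q E)" unfolding wrot_def by (rule someI[of "has_rot Om q E", OF assms(2)])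
 show ae: "AE x in lebesgue_on Om. G x = wrot Om q E x" by (rule has_rot_unique[OF assms(1,2) h])
 note L = has_rot_L2loc(2)[OF h]
 have a: "wrot Om q E x \<in> alt (q + 1)" if "x \<in> Om" for x using L that by (simp add: L2loc_iff[OF assms(1)])
 note * = L2w_AE[OF assms(3) L2loc_measurable[OF assms(1) L] a ae]
 show "wrot Om q E \<in> L2w Om (q + 1) s'" by (rule *(1))
 show "rot_norm Om q s s' E = sqrt ((L2w_norm Om s E)\<^sup>2 + (L2w_norm Om s' G)\<^sup>2)"
  unfolding rot_norm_def by (simp only: *(2))
qed

lemma div_norm_eq:
 assumes "open Om" "has_div Om q E G" "G \<in> L2w Om (q - 1) s'"
 shows "div_norm Om q s s' E = sqrt ((L2w_norm Om s E)\<^sup>2 + (L2w_norm Om s' G)\<^sup>2)"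
  and "has_div Om q E (wdiv Om q E)" and "wdiv Om q E \<in> L2w Om (q - 1) s'" and "AE x in lebesgue_on Om. G x = wdiv Om q E x"
proof -
 show h: "has_div Om q E (wdiv Om q E)" unfolding wdiv_def by (rule someI[of "has_div Om q E", OF assms(2)])
 show ae: "AE x in lebesgue_on Om. G x = wdiv Om q E x" by (rule has_div_unique[OF assms(1,2) h])
 note L = has_div_L2loc(2)[OF h]
 have a: "wdiv Om q E x \<in> alt (q - 1)" if "x \<in> Om" for x using L that by (simp add: L2loc_iff[OF assms(1)])
 note * = L2w_AE[OF assms(3) L2loc_measurable[OF assms(1) L] a ae]
 show "wdiv Om q E \<in> L2w Om (q - 1) s'" by (rule *(1))
 show "div_norm Om q s s' E = sqrt ((L2w_norm Om s E)\<^sup>2 + (L2w_norm Om s' G)\<^sup>2)"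
  unfolding div_norm_def by (simp only: *(2))
qed

section \<open>Limits of test forms\<close>

text \<open>Membership in \<open>rot0_space\<close> with the rotation as an explicit argument, so
  that no choice operator interferes, and with an approximating sequence of test forms at hand; form
  and rotation have separate weights.\<close>

definition has_rot0 :: "(real ^ 'n::{finite,linorder}) set => int => real => real => 'n form => 'n form => bool" where
 "has_rot0 Om q s s' E G \<longleftrightarrow> E \<in> L2w Om q s \<and> G \<in> L2w Om (q + 1) s' \<and>
  (\<exists>\<Phi>. (\<forall>k::nat. \<Phi> k \<in> test_forms Om q) \<and> (%k. L2w_norm Om s (%x. E x - \<Phi> k x)) \<longlonglongrightarrow> 0 \<and>
   (%k. L2w_norm Om s' (%x. G x - ext_d (\<Phi> k) x)) \<longlonglongrightarrow> 0)"

lemma has_rot0E: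
 assumes "has_rot0 Om q s s' E G"
 obtains \<Phi> where "\<And>k::nat. \<Phi> k \<in> test_forms Om q" "(%k. L2w_norm Om s (%x. E x - \<Phi> k x)) \<longlonglongrightarrow> 0"
  "(%k. L2w_norm Om s' (%x. G x - ext_d (\<Phi> k) x)) \<longlonglongrightarrow> 0"
 using assms unfolding has_rot0_def by blast

lemma has_rot0I:
 assumes "E \<in> L2w Om q s" "G \<in> L2w Om (q + 1) s'" "\<And>k::nat. \<Phi> k \<in> test_forms Om q"
  "(%k. L2w_norm Om s (%x. E x - \<Phi> k x)) \<longlonglongrightarrow> 0" "(%k. L2w_norm Om s' (%x. G x - ext_d (\<Phi> k) x)) \<longlonglongrightarrow> 0"
 shows "has_rot0 Om q s s' E G"
 using assms unfolding has_rot0_def by blast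

lemma has_rot0_L2w: "has_rot0 Om q s s' E G ==> E \<in> L2w Om q s" "has_rot0 Om q s s' E G ==> G \<in> L2w Om (q + 1) s'"
 by (auto simp: has_rot0_def)

lemma has_rot0_has_rot:
 assumes "open Om" "has_rot0 Om q s s' E G" shows "has_rot Om q E G"
proof -
 obtain \<Phi> where P: "\<And>k::nat. \<Phi> k \<in> test_forms Om q" "(%k. L2w_norm Om s (%x. E x - \<Phi> k x)) \<longlonglongrightarrow> 0"
  "(%k. L2w_norm Om s' (%x. G x - ext_d (\<Phi> k) x)) \<longlonglongrightarrow> 0" using has_rot0E[OF assms(2)] by blast
 show ?thesis
  using P(2,3) by (intro has_rot_limit[OF assms(1) has_rot_test[OF assms(1) P(1)] test_L2w[OF assms(1) P(1)] has_rot0_L2w(1)[OF assms(2)] _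
    test_L2w[OF assms(1) test_forms_ext_d[OF P(1)]] has_rot0_L2w(2)[OF assms(2)]]) (simp_all add: L2w_norm_commute[of _ _ E] L2w_norm_commute[of _ _ G])
qed

lemma sqrt_sum_sq_tendsto_0:
 assumes "a \<longlonglongrightarrow> 0" "b \<longlonglongrightarrow> (0::real)" shows "(%k. sqrt ((a k)\<^sup>2 + (b k)\<^sup>2)) \<longlonglongrightarrow> 0"
 using tendsto_real_sqrt[OF tendsto_add[OF tendsto_power[OF assms(1), of 2] tendsto_power[OF assms(2), of 2]]] by simp

lemma rot0_iff:
 assumes "open Om" shows "E \<in> rot0_space Om q s s' \<longleftrightarrow> (\<exists>G. has_rot0 Om q s s' E G)"
proof
 assume E: "E \<in> rot0_space Om q s s'"
 then obtain G where G: "E \<in> L2w Om q s" "G \<in> L2w Om (q + 1) s'" "has_rot Om q E G"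
  by (auto simp: rot0_space_def rot_space_def)
 have "\<exists>\<Phi>\<in>test_forms Om q. rot_norm Om q s s' (%x. E x - \<Phi> x) < 1 / real (Suc k)" for k
  using E by (simp add: rot0_space_def)
 then obtain \<Phi> where P: "\<And>k. \<Phi> k \<in> test_forms Om q" "\<And>k. rot_norm Om q s s' (%x. E x - \<Phi> k x) < 1 / real (Suc k)" by metis
 have b: "L2w_norm Om s (%x. E x - \<Phi> k x) \<le> 1 / real (Suc k) \<and> L2w_norm Om s' (%x. G x - ext_d (\<Phi> k) x) \<le> 1 / real (Suc k)" for k
 proof -
  have d: "has_rot Om q (%x. E x - \<Phi> k x) (%x. G x - ext_d (\<Phi> k) x)"
   by (rule has_rot_diff[OF assms G(3) has_rot_test[OF assms P(1)]])
  have "(%x. G x - ext_d (\<Phi> k) x) \<in> L2w Om (q + 1) s'"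
   by (rule L2w_diff[OF G(2) test_L2w[OF assms test_forms_ext_d[OF P(1)]]])
  from rot_norm_eq(1)[OF assms d this, of s] P(2)[of k]
  have "sqrt ((L2w_norm Om s (%x. E x - \<Phi> k x))\<^sup>2 + (L2w_norm Om s' (%x. G x - ext_d (\<Phi> k) x))\<^sup>2) < 1 / real (Suc k)" by simp
  then show ?thesis
   using real_sqrt_sum_squares_ge1[of "L2w_norm Om s (%x. E x - \<Phi> k x)" "L2w_norm Om s' (%x. G x - ext_d (\<Phi> k) x)"]
    real_sqrt_sum_squares_ge2[of "L2w_norm Om s' (%x. G x - ext_d (\<Phi> k) x)" "L2w_norm Om s (%x. E x - \<Phi> k x)"] by linarith
 qed
 have lim: "a \<longlonglongrightarrow> 0" if "\<And>k. 0 \<le> a k" "\<And>k. a k \<le> 1 / real (Suc k)" for a :: "nat => real"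
  by (rule Lim_null_comparison[OF _ LIMSEQ_Suc[OF lim_1_over_n]]) (use that in simp)
 have "has_rot0 Om q s s' E G"
  by (rule has_rot0I[OF G(1,2) P(1)]; rule lim) (use b in auto)
 then show "\<exists>G. has_rot0 Om q s s' E G" by blast
next
 assume "\<exists>G. has_rot0 Om q s s' E G"
 then obtain G where G: "has_rot0 Om q s s' E G" by blast
 note h = has_rot0_has_rot[OF assms G] and L = has_rot0_L2w[OF G]
 obtain \<Phi> where P: "\<And>k::nat. \<Phi> k \<in> test_forms Om q" "(%k. L2w_norm Om s (%x. E x - \<Phi> k x)) \<longlonglongrightarrow> 0"
  "(%k. L2w_norm Om s' (%x. G x - ext_d (\<Phi> k) x)) \<longlonglongrightarrow> 0" using has_rot0E[OF G] by blast
 have e: "rot_norm Om q s s' (%x. E x - \<Phi> k x) = sqrt ((L2w_norm Om s (%x. E x - \<Phi> k x))\<^sup>2 + (L2w_norm Om s' (%x. G x - ext_d (\<Phi> k) x))\<^sup>2)" for k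
  by (intro rot_norm_eq(1)[OF assms has_rot_diff[OF assms h has_rot_test[OF assms P(1)]] L2w_diff[OF L(2) test_L2w[OF assms test_forms_ext_d[OF P(1)]]]])
 have lim: "(%k. rot_norm Om q s s' (%x. E x - \<Phi> k x)) \<longlonglongrightarrow> 0"
  unfolding e by (rule sqrt_sum_sq_tendsto_0[OF P(2,3)])
 have "\<exists>\<Phi>\<in>test_forms Om q. rot_norm Om q s s' (%x. E x - \<Phi> x) < e" if "e > 0" for e
 proof -
  have "\<forall>\<^sub>F k in sequentially. rot_norm Om q s s' (%x. E x - \<Phi> k x) < e" using order_tendstoD(2)[OF lim that] .
  then obtain k where "rot_norm Om q s s' (%x. E x - \<Phi> k x) < e" by (auto simp: eventually_sequentially)
  then show ?thesis using P(1) by blast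
 qed
 then show "E \<in> rot0_space Om q s s'" using L h by (auto simp: rot0_space_def rot_space_def)
qed

text \<open>The chosen representative may replace the rotation found by approximation, since the two
  agree almost everywhere.\<close>

lemma rot0_has_rot0:
 assumes "open Om" "E \<in> rot0_space Om q s s'" shows "has_rot0 Om q s s' E (wrot Om q E)"
proof -
 obtain G where G: "has_rot0 Om q s s' E G" using assms rot0_iff by blast
 note * = rot_norm_eq[OF assms(1) has_rot0_has_rot[OF assms(1) G] has_rot0_L2w(2)[OF G]]
 obtain \<Phi> where P: "\<And>k::nat. \<Phi> k \<in> test_forms Om q" "(%k. L2w_norm Om s (%x. E x - \<Phi> k x)) \<longlonglongrightarrow> 0"
  "(%k. L2w_norm Om s' (%x. G x - ext_d (\<Phi> k) x)) \<longlonglongrightarrow> 0" using has_rot0E[OF G] by blast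
 have "L2w_norm Om s' (%x. G x - ext_d (\<Phi> k) x) = L2w_norm Om s' (%x. wrot Om q E x - ext_d (\<Phi> k) x)" for k
 proof (rule L2w_AE(2)[OF L2w_diff[OF has_rot0_L2w(2)[OF G] test_L2w[OF assms(1) test_forms_ext_d[OF P(1)]]]])
  have d: "(%x. wrot Om q E x - ext_d (\<Phi> k) x) \<in> L2w Om (q + 1) s'"
   by (rule L2w_diff[OF *(3) test_L2w[OF assms(1) test_forms_ext_d[OF P(1)]]])
  show "(%x. wrot Om q E x - ext_d (\<Phi> k) x) \<in> borel_measurable (lebesgue_on Om)" by (rule L2w_measurable[OF d])
  show "wrot Om q E x - ext_d (\<Phi> k) x \<in> alt (q + 1)" if "x \<in> Om" for x by (rule L2w_alt[OF d that])
  show "AE x in lebesgue_on Om. G x - ext_d (\<Phi> k) x = wrot Om q E x - ext_d (\<Phi> k) x"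
   using *(4) by eventually_elim simp
 qed
 then show ?thesis using P by (intro has_rot0I[OF has_rot0_L2w(1)[OF G] *(3) P(1,2)]) simp
qed

lemma L2w_norm_lincomb:
 assumes "u \<in> L2w Om q s" "v \<in> L2w Om q s"
 shows "L2w_norm Om s (%x. a *\<^sub>R u x + v x) \<le> \<bar>a\<bar> * L2w_norm Om s u + L2w_norm Om s v"
 using L2w_norm_add[OF L2w_scaleR[OF assms(1)] assms(2)] by (simp add: L2w_norm_scaleR)

lemma has_rot0_lincomb:
 assumes "open Om" "has_rot0 Om q s s' E G" "has_rot0 Om q s s' E' G'"
 shows "has_rot0 Om q s s' (%x. a *\<^sub>R E x + E' x) (%x. a *\<^sub>R G x + G' x)"
proof -
 obtain \<Phi> where P: "\<And>k::nat. \<Phi> k \<in> test_forms Om q" "(%k. L2w_norm Om s (%x. E x - \<Phi> k x)) \<longlonglongrightarrow> 0"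
  "(%k. L2w_norm Om s' (%x. G x - ext_d (\<Phi> k) x)) \<longlonglongrightarrow> 0" using has_rot0E[OF assms(2)] by blast
 obtain \<Psi> where Q: "\<And>k::nat. \<Psi> k \<in> test_forms Om q" "(%k. L2w_norm Om s (%x. E' x - \<Psi> k x)) \<longlonglongrightarrow> 0"
  "(%k. L2w_norm Om s' (%x. G' x - ext_d (\<Psi> k) x)) \<longlonglongrightarrow> 0" using has_rot0E[OF assms(3)] by blast
 have lim: "(%k. L2w_norm Om w (%x. a *\<^sub>R u k x + v k x)) \<longlonglongrightarrow> 0"
  if "\<And>k. u k \<in> L2w Om p w" "\<And>k. v k \<in> L2w Om p w" "(%k. L2w_norm Om w (u k)) \<longlonglongrightarrow> 0" "(%k. L2w_norm Om w (v k)) \<longlonglongrightarrow> 0" for u v p w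
 proof (rule Lim_null_comparison)
  show "\<forall>\<^sub>F k in sequentially. norm (L2w_norm Om w (%x. a *\<^sub>R u k x + v k x)) \<le> \<bar>a\<bar> * L2w_norm Om w (u k) + L2w_norm Om w (v k)"
   using L2w_norm_lincomb[OF that(1,2)] by simp
  show "(%k. \<bar>a\<bar> * L2w_norm Om w (u k) + L2w_norm Om w (v k)) \<longlonglongrightarrow> 0"
   using tendsto_add[OF tendsto_mult_right_zero[OF that(3)] that(4), of "\<bar>a\<bar>"] by simp
 qed
 have e1: "(a *\<^sub>R E x + E' x) - (a *\<^sub>R \<Phi> k x + \<Psi> k x) = a *\<^sub>R (E x - \<Phi> k x) + (E' x - \<Psi> k x)" for k x
  by (simp add: algebra_simps)
 have e2: "(a *\<^sub>R G x + G' x) - ext_d (%x. a *\<^sub>R \<Phi> k x + \<Psi> k x) x = a *\<^sub>R (G x - ext_d (\<Phi> k) x) + (G' x - ext_d (\<Psi> k) x)" for k x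
  unfolding ext_d_lincomb[OF test_formsD(1)[OF P(1)] test_formsD(1)[OF Q(1)]] by (simp add: algebra_simps)
 show ?thesis
 proof (rule has_rot0I[where \<Phi>="%k x. a *\<^sub>R \<Phi> k x + \<Psi> k x"])
  show "(%k. L2w_norm Om s (%x. a *\<^sub>R E x + E' x - (a *\<^sub>R \<Phi> k x + \<Psi> k x))) \<longlonglongrightarrow> 0"
   unfolding e1 by (rule lim[OF L2w_diff[OF has_rot0_L2w(1)[OF assms(2)] test_L2w[OF assms(1) P(1)]]
     L2w_diff[OF has_rot0_L2w(1)[OF assms(3)] test_L2w[OF assms(1) Q(1)]] P(2) Q(2)])
  show "(%k. L2w_norm Om s' (%x. a *\<^sub>R G x + G' x - ext_d (%x. a *\<^sub>R \<Phi> k x + \<Psi> k x) x)) \<longlonglongrightarrow> 0"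
   unfolding e2 by (rule lim[OF L2w_diff[OF has_rot0_L2w(2)[OF assms(2)] test_L2w[OF assms(1) test_forms_ext_d[OF P(1)]]]
     L2w_diff[OF has_rot0_L2w(2)[OF assms(3)] test_L2w[OF assms(1) test_forms_ext_d[OF Q(1)]]] P(3) Q(3)])
 qed (intro L2w_lincomb has_rot0_L2w[OF assms(2)] has_rot0_L2w[OF assms(3)] test_forms_lincomb P Q)+
qed

lemma has_rot0_diff: "open Om ==> has_rot0 Om q s s' E G ==> has_rot0 Om q s s' E' G' ==> has_rot0 Om q s s' (%x. E x - E' x) (%x. G x - G' x)"
 using has_rot0_lincomb[of Om q s s' E' G' E G "-1"] by simp

lemma has_rot0_mono:
 assumes "open Om" "has_rot0 Om q s s' E G" "t \<le> s" "t' \<le> s'" shows "has_rot0 Om q t t' E G"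
proof -
 obtain \<Phi> where P: "\<And>k::nat. \<Phi> k \<in> test_forms Om q" "(%k. L2w_norm Om s (%x. E x - \<Phi> k x)) \<longlonglongrightarrow> 0"
  "(%k. L2w_norm Om s' (%x. G x - ext_d (\<Phi> k) x)) \<longlonglongrightarrow> 0" using has_rot0E[OF assms(2)] by blast
 show ?thesis
 proof (rule has_rot0I[OF L2w_mono[OF assms(3) has_rot0_L2w(1)[OF assms(2)]] L2w_mono[OF assms(4) has_rot0_L2w(2)[OF assms(2)]] P(1)])
  show "(%k. L2w_norm Om t (%x. E x - \<Phi> k x)) \<longlonglongrightarrow> 0"
   by (rule Lim_null_comparison[OF always_eventually[OF allI] P(2)])
    (use L2w_norm_mono[OF assms(3) L2w_diff[OF has_rot0_L2w(1)[OF assms(2)] test_L2w[OF assms(1) P(1)]]] in simp)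
  show "(%k. L2w_norm Om t' (%x. G x - ext_d (\<Phi> k) x)) \<longlonglongrightarrow> 0"
   by (rule Lim_null_comparison[OF always_eventually[OF allI] P(3)])
    (use L2w_norm_mono[OF assms(4) L2w_diff[OF has_rot0_L2w(2)[OF assms(2)] test_L2w[OF assms(1) test_forms_ext_d[OF P(1)]]]] in simp)
 qed
qed

text \<open>Diagonal choice: the k-th approximant is taken within \<open>1 / real (Suc k)\<close> of
  the k-th pair in both norms.\<close>

lemma has_rot0_closed:
 assumes Om: "open Om" and r: "\<And>k::nat. has_rot0 Om q s s' (E k) (G k)"
  and E: "E' \<in> L2w Om q s" "(%k. L2w_norm Om s (%x. E k x - E' x)) \<longlonglongrightarrow> 0"
  and G: "G' \<in> L2w Om (q + 1) s'" "(%k. L2w_norm Om s' (%x. G k x - G' x)) \<longlonglongrightarrow> 0"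
 shows "has_rot0 Om q s s' E' G'"
proof -
 have "\<forall>k. \<exists>\<Phi>. \<Phi> \<in> test_forms Om q \<and> L2w_norm Om s (%x. E k x - \<Phi> x) < 1 / real (Suc k) \<and> L2w_norm Om s' (%x. G k x - ext_d \<Phi> x) < 1 / real (Suc k)"
 proof
  fix k
  obtain \<Phi> where P: "\<And>i::nat. \<Phi> i \<in> test_forms Om q" "(%i. L2w_norm Om s (%x. E k x - \<Phi> i x)) \<longlonglongrightarrow> 0"
   "(%i. L2w_norm Om s' (%x. G k x - ext_d (\<Phi> i) x)) \<longlonglongrightarrow> 0" using has_rot0E[OF r[of k]] by blast
  have p: "0 < 1 / real (Suc k)" by simp
  have "\<forall>\<^sub>F i in sequentially. L2w_norm Om s (%x. E k x - \<Phi> i x) < 1 / real (Suc k) \<and> L2w_norm Om s' (%x. G k x - ext_d (\<Phi> i) x) < 1 / real (Suc k)"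
   by (rule eventually_conj[OF order_tendstoD(2)[OF P(2) p] order_tendstoD(2)[OF P(3) p]])
  then obtain i where "L2w_norm Om s (%x. E k x - \<Phi> i x) < 1 / real (Suc k) \<and> L2w_norm Om s' (%x. G k x - ext_d (\<Phi> i) x) < 1 / real (Suc k)"
   unfolding eventually_sequentially by blast
  then show "\<exists>\<Phi>. \<Phi> \<in> test_forms Om q \<and> L2w_norm Om s (%x. E k x - \<Phi> x) < 1 / real (Suc k) \<and> L2w_norm Om s' (%x. G k x - ext_d \<Phi> x) < 1 / real (Suc k)" using P(1) by blast
 qed
 from choice[OF this] obtain \<Phi> where P: "\<And>k. \<Phi> k \<in> test_forms Om q" "\<And>k. L2w_norm Om s (%x. E k x - \<Phi> k x) < 1 / real (Suc k)"
  "\<And>k. L2w_norm Om s' (%x. G k x - ext_d (\<Phi> k) x) < 1 / real (Suc k)" by auto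
 have lim: "(%k. L2w_norm Om w (%x. u' x - v k x)) \<longlonglongrightarrow> 0"
  if "\<And>k. u k \<in> L2w Om p w" "u' \<in> L2w Om p w" "\<And>k. v k \<in> L2w Om p w" "(%k. L2w_norm Om w (%x. u k x - u' x)) \<longlonglongrightarrow> 0"
   "\<And>k. L2w_norm Om w (%x. u k x - v k x) < 1 / real (Suc k)" for u u' v p w
 proof (rule Lim_null_comparison)
  have "L2w_norm Om w (%x. u' x - v k x) \<le> L2w_norm Om w (%x. u k x - u' x) + 1 / real (Suc k)" for k
  proof -
   have "L2w_norm Om w (%x. (u k x - v k x) - (u k x - u' x)) \<le> L2w_norm Om w (%x. u k x - v k x) + L2w_norm Om w (%x. u k x - u' x)"
    by (rule L2w_norm_diff[OF L2w_diff[OF that(1,3)] L2w_diff[OF that(1,2)]])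
   then show ?thesis using that(5)[of k] by simp
  qed
  then show "\<forall>\<^sub>F k in sequentially. norm (L2w_norm Om w (%x. u' x - v k x)) \<le> L2w_norm Om w (%x. u k x - u' x) + 1 / real (Suc k)"
   by simp
  show "(%k. L2w_norm Om w (%x. u k x - u' x) + 1 / real (Suc k)) \<longlonglongrightarrow> 0"
   using tendsto_add[OF that(4) LIMSEQ_Suc[OF lim_1_over_n]] by simp
 qed
 show ?thesis
  by (rule has_rot0I[OF E(1) G(1) P(1) lim[OF has_rot0_L2w(1)[OF r] E(1) test_L2w[OF Om P(1)] E(2) P(2)]
   lim[OF has_rot0_L2w(2)[OF r] G(1) test_L2w[OF Om test_forms_ext_d[OF P(1)]] G(2) P(3)]])
qed

lemma mult_L2w:
 assumes "u \<in> L2w Om q s" "continuous_on UNIV (\<phi> :: _ => real)" "C \<ge> 0" "\<And>x. \<bar>\<phi> x\<bar> * rho x powr a \<le> C * rho x powr s"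
 shows "(%x. \<phi> x *\<^sub>R u x) \<in> L2w Om q a" "L2w_norm Om a (%x. \<phi> x *\<^sub>R u x) \<le> C * L2w_norm Om s u"
proof -
 have m: "(%x. \<phi> x *\<^sub>R u x) \<in> borel_measurable (lebesgue_on Om)"
  by (intro borel_measurable_scaleR continuous_measurable_on assms L2w_measurable[OF assms(1)])
 have le: "AE x in lebesgue_on Om. rho x powr a * norm (\<phi> x *\<^sub>R u x) \<le> C * (rho x powr s * norm (u x))"
  using mult_right_mono[OF assms(4) norm_ge_zero[of "u _"]] by (intro AE_I2) (simp add: mult_ac)
 note * = L2w_dom[OF assms(1) m alt_scaleR[OF L2w_alt[OF assms(1)]] le]
 show "(%x. \<phi> x *\<^sub>R u x) \<in> L2w Om q a" "L2w_norm Om a (%x. \<phi> x *\<^sub>R u x) \<le> C * L2w_norm Om s u"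
  using * assms(3) by auto
qed

lemma grad_L2w:
 fixes u :: "('n::{finite,linorder}) form"
 assumes "u \<in> L2w Om q s" "smooth \<phi>" "C \<ge> 0" "\<And>x. (\<Sum>n\<in>UNIV. \<bar>grad \<phi> x $ n\<bar>) * rho x powr a \<le> C * rho x powr s"
 shows "(%x. R_op (grad \<phi> x) (u x)) \<in> L2w Om (q + 1) a" "L2w_norm Om a (%x. R_op (grad \<phi> x) (u x)) \<le> C * L2w_norm Om s u"
  "(%x. ctr (grad \<phi> x) (u x)) \<in> L2w Om (q - 1) a" "L2w_norm Om a (%x. ctr (grad \<phi> x) (u x)) \<le> C * L2w_norm Om s u"
proof -
 have le: "rho x powr a * ((\<Sum>n\<in>UNIV. \<bar>grad \<phi> x $ n\<bar>) * norm (u x)) \<le> C * (rho x powr s * norm (u x))" for x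
  using mult_right_mono[OF assms(4)[of x] norm_ge_zero[of "u x"]] by (simp only: mult_ac)
 have 1: "AE x in lebesgue_on Om. rho x powr a * norm (R_op (grad \<phi> x) (u x)) \<le> C * (rho x powr s * norm (u x))"
  by (intro AE_I2 order_trans[OF mult_left_mono[OF norm_R_op] le]) simp
 have 2: "AE x in lebesgue_on Om. rho x powr a * norm (ctr (grad \<phi> x) (u x)) \<le> C * (rho x powr s * norm (u x))"
  by (intro AE_I2 order_trans[OF mult_left_mono[OF norm_ctr] le]) simp
 note m = grad_term_measurable[OF assms(2) L2w_measurable[OF assms(1)]]
 note *  = L2w_dom[OF assms(1) m(1) R_op_alt[OF L2w_alt[OF assms(1)]] 1]
 note ** = L2w_dom[OF assms(1) m(2) ctr_alt[OF L2w_alt[OF assms(1)]] 2]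
 show "(%x. R_op (grad \<phi> x) (u x)) \<in> L2w Om (q + 1) a" "L2w_norm Om a (%x. R_op (grad \<phi> x) (u x)) \<le> C * L2w_norm Om s u"
  "(%x. ctr (grad \<phi> x) (u x)) \<in> L2w Om (q - 1) a" "L2w_norm Om a (%x. ctr (grad \<phi> x) (u x)) \<le> C * L2w_norm Om s u"
  using * ** assms(3) by auto
qed

lemma R_op_diff: "R_op p (u - v) = R_op p u - R_op p v" by (rule linear_diff[OF linear_R_op])

text \<open>The three bounds say how \<open>\<phi>\<close> and its gradient may trade weights; the
  gradient term carries the weight \<open>s\<close> of the form into the weight \<open>a'\<close> of
  the new rotation. Compactly supported factors and powers of \<open>rho\<close> are the instances
  used.\<close>

lemma has_rot0_mult:
 fixes E :: "('n::{finite,linorder}) form"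
 assumes Om: "open Om" and r: "has_rot0 Om q s s' E G" and \<phi>: "smooth \<phi>" and C: "C \<ge> 0"
  and b: "\<And>x. \<bar>\<phi> x\<bar> * rho x powr a \<le> C * rho x powr s" "\<And>x. \<bar>\<phi> x\<bar> * rho x powr a' \<le> C * rho x powr s'"
   "\<And>x. (\<Sum>n\<in>UNIV. \<bar>grad \<phi> x $ n\<bar>) * rho x powr a' \<le> C * rho x powr s"
 shows "has_rot0 Om q a a' (%x. \<phi> x *\<^sub>R E x) (%x. \<phi> x *\<^sub>R G x + R_op (grad \<phi> x) (E x))"
proof -
 obtain \<Phi> where P: "\<And>k::nat. \<Phi> k \<in> test_forms Om q" "(%k. L2w_norm Om s (%x. E x - \<Phi> k x)) \<longlonglongrightarrow> 0"
  "(%k. L2w_norm Om s' (%x. G x - ext_d (\<Phi> k) x)) \<longlonglongrightarrow> 0" using has_rot0E[OF r] by blast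
 note E = has_rot0_L2w(1)[OF r] and G = has_rot0_L2w(2)[OF r]
 have c: "continuous_on UNIV \<phi>" by (rule smooth_continuous[OF \<phi>])
 note tE = L2w_diff[OF E test_L2w[OF Om P(1)]] and tG = L2w_diff[OF G test_L2w[OF Om test_forms_ext_d[OF P(1)]]]
 have e1: "\<phi> x *\<^sub>R E x - \<phi> x *\<^sub>R \<Phi> k x = \<phi> x *\<^sub>R (E x - \<Phi> k x)" for k x by (simp add: scaleR_diff_right)
 have e2: "\<phi> x *\<^sub>R G x + R_op (grad \<phi> x) (E x) - ext_d (%x. \<phi> x *\<^sub>R \<Phi> k x) x =
   \<phi> x *\<^sub>R (G x - ext_d (\<Phi> k) x) + R_op (grad \<phi> x) (E x - \<Phi> k x)" for k x
  by (simp add: ext_d_scaleR(1)[OF \<phi> test_formsD(1)[OF P(1)]] R_op_diff algebra_simps)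
 show ?thesis
 proof (rule has_rot0I[where \<Phi>="%k x. \<phi> x *\<^sub>R \<Phi> k x"])
  show "(%x. \<phi> x *\<^sub>R E x) \<in> L2w Om q a" by (rule mult_L2w(1)[OF E c C b(1)])
  show "(%x. \<phi> x *\<^sub>R G x + R_op (grad \<phi> x) (E x)) \<in> L2w Om (q + 1) a'"
   by (rule L2w_add[OF mult_L2w(1)[OF G c C b(2)] grad_L2w(1)[OF E \<phi> C b(3)]])
  show "(%x. \<phi> x *\<^sub>R \<Phi> k x) \<in> test_forms Om q" for k by (rule test_forms_mult[OF \<phi> P(1)])
  show "(%k. L2w_norm Om a (%x. \<phi> x *\<^sub>R E x - \<phi> x *\<^sub>R \<Phi> k x)) \<longlonglongrightarrow> 0" unfolding e1
  proof (rule Lim_null_comparison)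
   show "\<forall>\<^sub>F k in sequentially. norm (L2w_norm Om a (%x. \<phi> x *\<^sub>R (E x - \<Phi> k x))) \<le> C * L2w_norm Om s (%x. E x - \<Phi> k x)"
    using mult_L2w(2)[OF tE c C b(1)] by simp
  qed (rule tendsto_mult_right_zero[OF P(2)])
  show "(%k. L2w_norm Om a' (%x. \<phi> x *\<^sub>R G x + R_op (grad \<phi> x) (E x) - ext_d (%x. \<phi> x *\<^sub>R \<Phi> k x) x)) \<longlonglongrightarrow> 0" unfolding e2
  proof (rule Lim_null_comparison)
   have "L2w_norm Om a' (%x. \<phi> x *\<^sub>R (G x - ext_d (\<Phi> k) x) + R_op (grad \<phi> x) (E x - \<Phi> k x)) \<le>
     C * L2w_norm Om s' (%x. G x - ext_d (\<Phi> k) x) + C * L2w_norm Om s (%x. E x - \<Phi> k x)" for k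
    using L2w_norm_add[OF mult_L2w(1)[OF tG[of k] c C b(2)] grad_L2w(1)[OF tE[of k] \<phi> C b(3)]]
     mult_L2w(2)[OF tG[of k] c C b(2)] grad_L2w(2)[OF tE[of k] \<phi> C b(3)] by linarith
   then show "\<forall>\<^sub>F k in sequentially. norm (L2w_norm Om a' (%x. \<phi> x *\<^sub>R (G x - ext_d (\<Phi> k) x) + R_op (grad \<phi> x) (E x - \<Phi> k x))) \<le>
     C * L2w_norm Om s' (%x. G x - ext_d (\<Phi> k) x) + C * L2w_norm Om s (%x. E x - \<Phi> k x)" by simp
   show "(%k. C * L2w_norm Om s' (%x. G x - ext_d (\<Phi> k) x) + C * L2w_norm Om s (%x. E x - \<Phi> k x)) \<longlonglongrightarrow> 0"
    using tendsto_add[OF tendsto_mult_right_zero[OF P(3)] tendsto_mult_right_zero[OF P(2)]] by simp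
  qed
 qed
qed

lemma csupp_weight_bound:
 assumes "csupp (f :: real ^ 'n::finite => real)" "continuous_on UNIV f"
 shows "\<exists>C\<ge>0. \<forall>x. \<bar>f x\<bar> * rho x powr a \<le> C * rho x powr s"
proof -
 have "csupp (%x. f x * rho x powr (a - s))" by (rule csupp_mono[OF assms(1)]) simp
 moreover have "continuous_on UNIV (%x. f x * rho x powr (a - s))"
  by (intro continuous_on_mult assms continuous_rho_powr)
 ultimately obtain C where C: "C > 0" "\<And>x. norm (f x * rho x powr (a - s)) \<le> C" using csupp_bounded by blast
 have "\<bar>f x\<bar> * rho x powr a \<le> C * rho x powr s" for x
 proof -
  have "\<bar>f x\<bar> * rho x powr a = norm (f x * rho x powr (a - s)) * rho x powr s"
   by (simp add: abs_mult powr_add[symmetric] mult.assoc)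
  also have "\<dots> \<le> C * rho x powr s" by (intro mult_right_mono C) simp
  finally show ?thesis .
 qed
 then show ?thesis using C(1) by (intro exI[of _ C]) auto
qed

lemma csupp_grad_sum: "csupp \<phi> ==> csupp (%x. \<Sum>n\<in>UNIV. \<bar>grad \<phi> x $ n\<bar>)" for \<phi> :: "real ^ 'n::finite => real"
proof -
 assume "csupp \<phi>"
 then obtain K where K: "compact K" "\<And>x. x \<notin> K ==> \<phi> x = 0" by (auto simp: csupp_def)
 have "x \<notin> K ==> partial_deriv n \<phi> x = 0" for n x
  using partial_deriv_outside_support[OF compact_imp_closed[OF K(1)]] K(2) by blast
 then show ?thesis unfolding csupp_def grad_def using K(1) by (intro exI[of _ K]) simp
qed

lemma C0_inf_bounds:
 fixes \<phi> :: "real ^ 'n::finite => real"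
 assumes "\<phi> \<in> C0_inf UNIV"
 obtains C where "C \<ge> 0" "\<And>x. \<bar>\<phi> x\<bar> * rho x powr a \<le> C * rho x powr s"
  "\<And>x. \<bar>\<phi> x\<bar> * rho x powr a' \<le> C * rho x powr s'" "\<And>x. (\<Sum>n\<in>UNIV. \<bar>grad \<phi> x $ n\<bar>) * rho x powr a' \<le> C * rho x powr s"
proof -
 have s: "smooth \<phi>" and c: "csupp \<phi>" using assms by (auto simp: C0_inf_def csupp_def)
 obtain C1 where 1: "C1 \<ge> 0" "\<And>x. \<bar>\<phi> x\<bar> * rho x powr a \<le> C1 * rho x powr s"
  using csupp_weight_bound[OF c smooth_continuous[OF s]] by blast
 obtain C2 where 2: "C2 \<ge> 0" "\<And>x. \<bar>\<phi> x\<bar> * rho x powr a' \<le> C2 * rho x powr s'"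
  using csupp_weight_bound[OF c smooth_continuous[OF s]] by blast
 obtain C3 where 3: "C3 \<ge> 0" "\<And>x. \<bar>\<Sum>n\<in>UNIV. \<bar>grad \<phi> x $ n\<bar>\<bar> * rho x powr a' \<le> C3 * rho x powr s"
  using csupp_weight_bound[OF csupp_grad_sum[OF c] grad_sum_continuous[OF s]] by blast
 have i: "k * rho x powr w \<le> (C1 + C2 + C3) * rho x powr w" if "k \<le> C1 + C2 + C3" for k w x
  using that by (intro mult_right_mono) auto
 show ?thesis
 proof (rule that[of "C1 + C2 + C3"])
  show "\<bar>\<phi> x\<bar> * rho x powr a \<le> (C1 + C2 + C3) * rho x powr s" for x using 1 2(1) 3(1) by (intro order_trans[OF 1(2) i]) auto
  show "\<bar>\<phi> x\<bar> * rho x powr a' \<le> (C1 + C2 + C3) * rho x powr s'" for x using 1(1) 2 3(1) by (intro order_trans[OF 2(2) i]) auto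
  show "(\<Sum>n\<in>UNIV. \<bar>grad \<phi> x $ n\<bar>) * rho x powr a' \<le> (C1 + C2 + C3) * rho x powr s" for x
  proof -
   have "(\<Sum>n\<in>UNIV. \<bar>grad \<phi> x $ n\<bar>) = \<bar>\<Sum>n\<in>UNIV. \<bar>grad \<phi> x $ n\<bar>\<bar>" by (simp add: sum_nonneg)
   then show ?thesis using order_trans[OF 3(2)[of x] i[of C3]] 1(1) 2(1) by simp
  qed
 qed (use 1 2 3 in auto)
qed

text \<open>On a compact support all weights are equivalent, so the old and the new weights are
  unrelated.\<close>

lemma has_rot0_cut:
 fixes E :: "('n::{finite,linorder}) form"
 assumes "open Om" "has_rot0 Om q s s' E G" "\<phi> \<in> C0_inf UNIV"
 shows "has_rot0 Om q a a' (%x. \<phi> x *\<^sub>R E x) (%x. \<phi> x *\<^sub>R G x + R_op (grad \<phi> x) (E x))"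
proof -
 have s: "smooth \<phi>" using assms(3) by (simp add: C0_inf_def)
 obtain C where "C \<ge> 0" "\<And>x. \<bar>\<phi> x\<bar> * rho x powr a \<le> C * rho x powr s"
  "\<And>x. \<bar>\<phi> x\<bar> * rho x powr a' \<le> C * rho x powr s'" "\<And>x. (\<Sum>n\<in>UNIV. \<bar>grad \<phi> x $ n\<bar>) * rho x powr a' \<le> C * rho x powr s"
  using C0_inf_bounds[OF assms(3), of a s a' s'] by blast
 then show ?thesis by (rule has_rot0_mult[OF assms(1,2) s])
qed

text \<open>Differentiating a weight does not worsen it. This crude bound suffices because the
  spaces with bold letters put the same weight on a form and on its derivative.\<close>

lemma rho_powr_grad:
 "(\<Sum>n\<in>UNIV. \<bar>grad (%x. rho x powr t) x $ n\<bar>) \<le> real CARD('n) * \<bar>t\<bar> * rho x powr t" for x :: "real ^ 'n::finite"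
proof -
 have p: "1 + x \<bullet> x > 0" by (simp add: add_pos_nonneg)
 have pd: "partial_deriv n (%x. rho x powr t) x = t * (1 + x \<bullet> x) powr (t / 2 - 1) * (x $ n)" for n
 proof -
  have "((%x. (1 + x \<bullet> x) powr (t / 2)) has_derivative (%h. (t / 2 * (1 + x \<bullet> x) powr (t / 2 - 1)) * (2 * (x \<bullet> h)))) (at x)"
   by (rule has_derivative_compose[where g="%z. z powr (t / 2)" and f="%x. 1 + x \<bullet> x" and f'="%h. 2 * (x \<bullet> h)" and g'="(*) (t / 2 * (1 + x \<bullet> x) powr (t / 2 - 1))", OF _ has_real_derivative_powr[OF p, unfolded has_field_derivative_def]])
    (auto intro!: derivative_eq_intros simp: inner_commute)
  from partial_deriv_eq[OF this] show ?thesis unfolding rho_powr_eq by (simp add: inner_axis)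
 qed
 have "\<bar>grad (%x. rho x powr t) x $ n\<bar> \<le> \<bar>t\<bar> * rho x powr t" for n
 proof -
  have "\<bar>x $ n\<bar> \<le> rho x" using component_le_norm_cart[of x n] norm_le_rho[of x] by linarith
  also have "\<dots> \<le> (rho x)\<^sup>2" using rho_ge_1[of x] by (simp add: power2_eq_square)
  finally have "\<bar>x $ n\<bar> \<le> 1 + x \<bullet> x" by (simp add: rho_sq)
  then have "\<bar>t\<bar> * (1 + x \<bullet> x) powr (t / 2 - 1) * \<bar>x $ n\<bar> \<le> \<bar>t\<bar> * (1 + x \<bullet> x) powr (t / 2 - 1) * (1 + x \<bullet> x)"
   by (intro mult_left_mono) auto
  also have "\<dots> = \<bar>t\<bar> * (1 + x \<bullet> x) powr (t / 2)"
   using powr_mult_base[of "1 + x \<bullet> x" "t / 2 - 1"] p by (simp add: mult_ac)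
  finally show ?thesis unfolding grad_def using pd[of n] by (simp add: abs_mult rho_powr_eq)
 qed
 then have "(\<Sum>n\<in>UNIV. \<bar>grad (%x. rho x powr t) x $ n\<bar>) \<le> (\<Sum>n\<in>(UNIV :: 'n set). \<bar>t\<bar> * rho x powr t)" by (intro sum_mono)
 then show ?thesis by simp
qed

text \<open>Green's formula without a boundary term: the first factor is a limit of test forms, to
  which the weak definition of the divergence applies, and the dual weights make both sides
  continuous.\<close>

lemma has_rot0_pair:
 fixes E :: "('n::{finite,linorder}) form"
 assumes Om: "open Om" and r: "has_rot0 Om q s s' E G" and h: "has_div Om (q + 1) Y f"
  and Y: "Y \<in> L2w Om (q + 1) (- s')" and f: "f \<in> L2w Om q (- s)"
 shows "ip (lebesgue_on Om) G Y = - ip (lebesgue_on Om) E f"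
proof -
 obtain \<Phi> where P: "\<And>k::nat. \<Phi> k \<in> test_forms Om q" "(%k. L2w_norm Om s (%x. E x - \<Phi> k x)) \<longlonglongrightarrow> 0"
  "(%k. L2w_norm Om s' (%x. G x - ext_d (\<Phi> k) x)) \<longlonglongrightarrow> 0" using has_rot0E[OF r] by blast
 have P': "(%k. L2w_norm Om s (%x. \<Phi> k x - E x)) \<longlonglongrightarrow> 0" "(%k. L2w_norm Om s' (%x. ext_d (\<Phi> k) x - G x)) \<longlonglongrightarrow> 0"
  using P(2,3) by (simp_all add: L2w_norm_commute[of _ _ E] L2w_norm_commute[of _ _ G])
 have 1: "(%k. ip (lebesgue_on Om) (ext_d (\<Phi> k)) Y) \<longlonglongrightarrow> ip (lebesgue_on Om) G Y"
  by (rule ip_tendsto_L2w[OF test_L2w[OF Om test_forms_ext_d[OF P(1)]] has_rot0_L2w(2)[OF r] Y P'(2)])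
 have 2: "(%k. - ip (lebesgue_on Om) (\<Phi> k) f) \<longlonglongrightarrow> - ip (lebesgue_on Om) E f"
  by (intro tendsto_minus ip_tendsto_L2w[OF test_L2w[OF Om P(1)] has_rot0_L2w(1)[OF r] f P'(1)])
 have "ip (lebesgue_on Om) (ext_d (\<Phi> k)) Y = - ip (lebesgue_on Om) (\<Phi> k) f" for k
 proof -
  have "\<Phi> k \<in> test_forms Om (q + 1 - 1)" using P(1)[of k] by simp
  then show ?thesis using h unfolding has_div_iff[OF Om] by (simp add: ip_commute[of _ _ Y] ip_commute[of _ _ f])
 qed
 with 1 2 show ?thesis using LIMSEQ_unique by auto
qed

section \<open>A div-rot lemma\<close>

text \<open>The orthogonal projection onto the closure of \<open>S\<close>, as the Riesz
  representative of the pairing with \<open>X\<close>. The approximating sequence in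
  \<open>S\<close> is kept for later use.\<close>

lemma L2_project:
 fixes X :: "'a => 'b::euclidean_space"
 assumes X: "sq M X" and S: "\<And>u. u \<in> S ==> sq M u" and ne: "S \<noteq> {}"
  and lin: "\<And>u v a. u \<in> S ==> v \<in> S ==> (%x. a *\<^sub>R u x + v x) \<in> S"
  and W: "closed W" "0 \<in> W" "\<And>u x. u \<in> S ==> x \<in> space M ==> u x \<in> W"
 obtains p s where "sq M p" "\<And>x. x \<in> space M ==> p x \<in> W" "\<And>k::nat. s k \<in> S"
  "(%k. nrm M (%x. s k x - p x)) \<longlonglongrightarrow> 0" "\<And>u. u \<in> S ==> ip M p u = ip M X u" "nrm M p \<le> nrm M X"
proof -
 let ?S = "(%u. (u, ip M X u)) ` S"
 obtain p s l where p: "sq M p" "\<And>x. x \<in> space M ==> p x \<in> W" "\<And>k. (s k, l k) \<in> ?S"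
  "(%k. nrm M (%x. s k x - p x)) \<longlonglongrightarrow> 0" "\<And>u l. (u, l) \<in> ?S ==> ip M p u = l"
 proof (rule L2_riesz[of ?S M "nrm M X" W])
  show "sq M u \<and> \<bar>l\<bar> \<le> nrm M X * nrm M u" if "(u, l) \<in> ?S" for u l
   using that S ip_CS[OF X] by auto
  show "(%x. a *\<^sub>R u x + v x, a * l + m) \<in> ?S" if "(u, l) \<in> ?S" "(v, m) \<in> ?S" for u l v m a
  proof -
   have *: "u \<in> S" "v \<in> S" "l = ip M X u" "m = ip M X v" using that by auto
   have "ip M X (%x. a *\<^sub>R u x + v x) = a * l + m"
    unfolding * by (simp add: ip_add_right[OF sq_scaleR[OF S[OF *(1)]] S[OF *(2)] X] ip_scaleR_right)
   then show ?thesis using lin[OF *(1,2), of a] by auto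
  qed
 qed (use ne W in auto)
 have s: "s k \<in> S" and i: "\<And>u. u \<in> S ==> ip M p u = ip M X u" for k using p(3)[of k] p(5) by auto
 \<comment> \<open>Testing with the approximants themselves shows that the squared norm of
   \<open>p\<close> is its product with \<open>X\<close>; the norm bound follows by
   Cauchy-Schwarz.\<close>
 have "(%k. ip M (s k) p) \<longlonglongrightarrow> ip M p p" "(%k. ip M (s k) X) \<longlonglongrightarrow> ip M p X"
  by (rule ip_tendsto[OF S[OF s] p(1) _ p(4)]; fact)+
 moreover have "ip M (s k) p = ip M (s k) X" for k using i[OF s, of k] by (simp add: ip_commute[of M "s k"])
 ultimately have "ip M p p = ip M p X" using LIMSEQ_unique by simp
 then have "nrm M p * nrm M p \<le> nrm M p * nrm M X"
  using ip_CS[OF p(1) X] nrm_ip[of M p] by (simp add: power2_eq_square)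
 then have "nrm M p \<le> nrm M X" using nrm_nonneg[of M p] nrm_nonneg[of M X] by (cases "nrm M p = 0") auto
 then show ?thesis using that[OF p(1,2) s p(4) i] by blast
qed

lemma assumes "sq M u" "sq M v"
 shows sq_Pair: "sq M (%x. (u x, v x))"
  and nrm_Pair: "nrm M u \<le> nrm M (%x. (u x, v x))" "nrm M v \<le> nrm M (%x. (u x, v x))"
proof -
 show p: "sq M (%x. (u x, v x))"
  using assms unfolding sq_def by (auto simp: norm_Pair intro!: borel_measurable_Pair)
 have a: "norm (u x) \<le> 1 * norm (u x, v x)" "norm (v x) \<le> 1 * norm (u x, v x)" for x
  by (simp_all add: norm_Pair real_le_rsqrt)
 show "nrm M u \<le> nrm M (%x. (u x, v x))" "nrm M v \<le> nrm M (%x. (u x, v x))"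
  using sq_dom(2)[OF p sq_measurable[OF assms(1)] AE_I2[OF a(1)]] sq_dom(2)[OF p sq_measurable[OF assms(2)] AE_I2[OF a(2)]] by simp_all
qed

lemma sq_fst_snd:
 assumes "sq M p" shows "sq M (%x. fst (p x))" "sq M (%x. snd (p x))"
  "nrm M (%x. fst (p x)) \<le> nrm M p" "nrm M (%x. snd (p x)) \<le> nrm M p"
proof -
 have m: "(%x. fst (p x)) \<in> borel_measurable M" "(%x. snd (p x)) \<in> borel_measurable M"
  by (rule measurable_compose[OF sq_measurable[OF assms] borel_measurable_continuous_onI],
    rule linear_continuous_on, rule bounded_linear_fst bounded_linear_snd)+
 have a: "norm (fst z) \<le> 1 * norm z" "norm (snd z) \<le> 1 * norm z" for z :: "'b \<times> 'c" by (cases z; simp add: norm_fst_le norm_snd_le)+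
 show "sq M (%x. fst (p x))" "sq M (%x. snd (p x))"
  "nrm M (%x. fst (p x)) \<le> nrm M p" "nrm M (%x. snd (p x)) \<le> nrm M p"
  using sq_dom[OF assms m(1) AE_I2[OF a(1)]] sq_dom[OF assms m(2) AE_I2[OF a(2)]] by simp_all
qed

lemma ip_Pair:
 assumes "sq M p" "sq M u" "sq M v"
 shows "ip M p (%x. (u x, v x)) = ip M (%x. fst (p x)) u + ip M (%x. snd (p x)) v"
proof -
 have "ip M p (%x. (u x, v x)) = integral\<^sup>L M (%x. fst (p x) \<bullet> u x + snd (p x) \<bullet> v x)"
  unfolding ip_def by (simp add: inner_prod_def)
 then show ?thesis unfolding ip_def
  by (simp add: sq_inner[OF sq_fst_snd(1)[OF assms(1)] assms(2)] sq_inner[OF sq_fst_snd(2)[OF assms(1)] assms(3)])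
qed

lemma L2w_zero_iff: "u \<in> L2w Om q 0 \<longleftrightarrow> sq (lebesgue_on Om) u \<and> (\<forall>x\<in>Om. u x \<in> alt q)"
 by (simp add: L2w_0 L2_iff)

lemma L2w_norm_zero: "L2w_norm Om 0 u = nrm (lebesgue_on Om) u" by (simp add: L2w_norm_0 L2_norm_nrm)

text \<open>Minimising \<open>\<parallel>P\<parallel>\<^sup>2 + \<parallel>rot P - X\<parallel>\<^sup>2\<close> splits off a rotation \<open>\<Gamma> = rot P\<close> with \<open>div (X - \<Gamma>) = - P\<close>.\<close>

lemma rot_decomposition:
 fixes X :: "('n::{finite,linorder}) form"
 assumes Om: "open Om" and X: "X \<in> L2w Om q 0"
 obtains P \<Gamma> where "has_rot0 Om (q - 1) 0 0 P \<Gamma>" "has_rot0 Om q 0 0 \<Gamma> (%x. 0)" "has_div Om q (%x. X x - \<Gamma> x) (%x. - P x)"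
  "has_div Om (q - 1) P (%x. 0)" "L2w_norm Om 0 P \<le> L2w_norm Om 0 X" "L2w_norm Om 0 \<Gamma> \<le> L2w_norm Om 0 X"
proof -
 let ?M = "lebesgue_on Om" and ?T = "test_forms Om (q - 1)"
 \<comment> \<open>The graph of \<open>ext_d\<close> on test forms. Projecting \<open>(0, X)\<close>
   onto its closure keeps \<open>P\<close> itself bounded, so that no Poincare estimate is
   required.\<close>
 let ?S = "(%\<psi> x. (\<psi> x, ext_d \<psi> x)) ` ?T"
 have sX: "sq ?M X" using X by (simp add: L2w_zero_iff)
 have t: "sq ?M \<psi>" "sq ?M (ext_d \<psi>)" "ext_d \<psi> \<in> test_forms Om q" if "\<psi> \<in> ?T" for \<psi>
  using test_L2w[OF Om that, of 0] test_L2w[OF Om test_forms_ext_d[OF that], of 0] test_forms_ext_d[OF that] by (simp_all add: L2w_zero_iff)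
 obtain p s where p: "sq ?M p" "\<And>x. x \<in> space ?M ==> p x \<in> alt (q - 1) \<times> alt q" "\<And>k::nat. s k \<in> ?S"
  "(%k. nrm ?M (%x. s k x - p x)) \<longlonglongrightarrow> 0" "\<And>u. u \<in> ?S ==> ip ?M p u = ip ?M (%x. (0, X x)) u"
  "nrm ?M p \<le> nrm ?M (%x. (0 :: 'n alg, X x))"
 proof (rule L2_project[of ?M "%x. (0, X x)" ?S "alt (q - 1) \<times> alt q"])
  show "sq ?M (%x. (0, X x))" by (rule sq_Pair[OF sq_zero sX])
  show "sq ?M u" if "u \<in> ?S" for u using that t by (auto intro: sq_Pair)
  show "?S \<noteq> {}" using test_forms_zero by auto
  show "(%x. a *\<^sub>R u x + v x) \<in> ?S" if uv: "u \<in> ?S" "v \<in> ?S" for u v a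
  proof -
   obtain \<phi> \<psi> where T: "\<phi> \<in> ?T" "\<psi> \<in> ?T" "u = (%x. (\<phi> x, ext_d \<phi> x))" "v = (%x. (\<psi> x, ext_d \<psi> x))" using uv by auto
   have "(%x. a *\<^sub>R u x + v x) = (%x. ((%x. a *\<^sub>R \<phi> x + \<psi> x) x, ext_d (%x. a *\<^sub>R \<phi> x + \<psi> x) x))"
    unfolding T ext_d_lincomb[OF test_formsD(1)[OF T(1)] test_formsD(1)[OF T(2)]] by auto
   then show ?thesis using test_forms_lincomb[OF T(1,2), of a] by auto
  qed
  show "closed (alt (q - 1) \<times> alt q :: ('n alg \<times> 'n alg) set)" by (intro closed_Times closed_alt)
  show "0 \<in> (alt (q - 1) \<times> alt q :: ('n alg \<times> 'n alg) set)" by (simp add: zero_prod_def)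
  show "u x \<in> alt (q - 1) \<times> alt q" if "u \<in> ?S" for u x
   using that test_formsD(3)[of _ Om "q - 1"] test_formsD(3)[OF t(3)] by auto
 qed blast
 define P \<Gamma> where "P x = fst (p x)" and "\<Gamma> x = snd (p x)" for x
 have "\<forall>k. \<exists>\<psi>. \<psi> \<in> ?T \<and> s k = (%x. (\<psi> x, ext_d \<psi> x))" using p(3) by auto
 from choice[OF this] obtain \<psi> where \<psi>: "\<And>k. \<psi> k \<in> ?T" "\<And>k. s k = (%x. (\<psi> k x, ext_d (\<psi> k) x))" by blast
 have P: "P \<in> L2w Om (q - 1) 0" and G: "\<Gamma> \<in> L2w Om q 0"
  using sq_fst_snd(1,2)[OF p(1)] p(2) unfolding L2w_zero_iff P_def \<Gamma>_def by (force simp: mem_Times_iff)+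
 have ns: "sq ?M (%x. s k x - p x)" for k unfolding \<psi> by (intro sq_diff sq_Pair t \<psi> p(1))
 have lP: "(%k. nrm ?M (%x. P x - \<psi> k x)) \<longlonglongrightarrow> 0" and lG: "(%k. nrm ?M (%x. \<Gamma> x - ext_d (\<psi> k) x)) \<longlonglongrightarrow> 0"
  using sq_fst_snd(3,4)[OF ns] unfolding nrm_minus_commute[of _ P] nrm_minus_commute[of _ \<Gamma>]
  by (auto intro!: Lim_null_comparison[OF always_eventually[OF allI] p(4)] simp: \<psi> P_def \<Gamma>_def)
 have r: "has_rot0 Om (q - 1) 0 0 P \<Gamma>" using lP lG G
  by (intro has_rot0I[OF P _ \<psi>(1)]) (simp_all add: L2w_norm_zero)
 have r': "has_rot0 Om q 0 0 \<Gamma> (%x. 0)"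
 proof (rule has_rot0I[OF G L2w_zero t(3)[OF \<psi>(1)]])
  have "ext_d (ext_d (\<psi> k)) x = 0" for k x by (rule ext_d_ext_d[OF test_formsD(1)[OF \<psi>(1)]])
  then show "(%k. L2w_norm Om 0 (%x. 0 - ext_d (ext_d (\<psi> k)) x)) \<longlonglongrightarrow> 0" by (simp add: L2w_norm_zero)
 qed (use lG in \<open>simp add: L2w_norm_zero\<close>)
 have d: "has_div Om q (%x. X x - \<Gamma> x) (%x. - P x)"
  unfolding has_div_iff[OF Om]
 proof (intro conjI ballI)
  have "(%x. - P x) \<in> L2w Om (q - 1) 0" using L2w_scaleR[OF P, of "-1"] by simp
  then show "(%x. - P x) \<in> L2loc Om (q - 1)" by (rule L2w_imp_L2loc[OF Om])
  show "(%x. X x - \<Gamma> x) \<in> L2loc Om q" by (rule L2w_imp_L2loc[OF Om L2w_diff[OF X G]])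
  fix \<phi> assume T: "\<phi> \<in> ?T"
  have "ip ?M P \<phi> + ip ?M \<Gamma> (ext_d \<phi>) = ip ?M X (ext_d \<phi>)"
   using p(5)[of "%x. (\<phi> x, ext_d \<phi> x)"] T ip_Pair[OF p(1) t(1,2)[OF T]] ip_Pair[OF sq_Pair[OF sq_zero sX] t(1,2)[OF T]]
   by (simp add: P_def[abs_def] \<Gamma>_def[abs_def] ip_def)
  moreover have "ip ?M (%x. - P x) \<phi> = - ip ?M P \<phi>" by (simp add: ip_def)
  moreover have "ip ?M (%x. X x - \<Gamma> x) (ext_d \<phi>) = ip ?M X (ext_d \<phi>) - ip ?M \<Gamma> (ext_d \<phi>)"
   using G by (intro ip_diff_left[OF sX _ t(2)[OF T]]) (simp add: L2w_zero_iff)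
  ultimately show "ip ?M (%x. X x - \<Gamma> x) (ext_d \<phi>) = - ip ?M (%x. - P x) \<phi>" by simp
 qed
 \<comment> \<open>\<open>- P\<close> is a divergence, hence divergence-free.\<close>
 have d': "has_div Om (q - 1) P (%x. 0)" using has_div_smult[OF Om has_div_div[OF Om d], of "-1"] by simp
 have "nrm ?M (%x. (0 :: 'n alg, X x)) = nrm ?M X" by (simp add: nrm_def norm_Pair)
 then have "L2w_norm Om 0 P \<le> L2w_norm Om 0 X" "L2w_norm Om 0 \<Gamma> \<le> L2w_norm Om 0 X"
  using sq_fst_snd(3,4)[OF p(1)] p(6) unfolding L2w_norm_zero P_def[abs_def] \<Gamma>_def[abs_def] by simp_all
 then show ?thesis using that[OF r r' d d'] by blast
qed

section \<open>Compactness along subsequences\<close>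

definition locally_Cauchy :: "(real ^ 'n::finite) set => (nat => 'n form) => bool" where
 "locally_Cauchy Om u \<longleftrightarrow> (\<forall>R>0. \<forall>e>0. \<exists>K. \<forall>m\<ge>K. \<forall>n\<ge>K. nrm (lebesgue_on (Om \<inter> ball 0 R)) (%x. u m x - u n x) < e)"

lemma locally_Cauchy_subseq:
 assumes "locally_Cauchy Om u" "strict_mono r" shows "locally_Cauchy Om (%k. u (r k))"
 unfolding locally_Cauchy_def
proof (intro allI impI)
 fix R e :: real assume "R > 0" "e > 0"
 then obtain K where "\<forall>m\<ge>K. \<forall>n\<ge>K. nrm (lebesgue_on (Om \<inter> ball 0 R)) (%x. u m x - u n x) < e"
  using assms(1) unfolding locally_Cauchy_def by blast
 then show "\<exists>K. \<forall>m\<ge>K. \<forall>n\<ge>K. nrm (lebesgue_on (Om \<inter> ball 0 R)) (%x. u (r m) x - u (r n) x) < e"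
  using seq_suble[OF assms(2)] order_trans by (intro exI[of _ K]) blast
qed

lemma MLCP_subseq:
 assumes Om: "open Om" "MLCP Om" and r: "\<And>n::nat. has_rot0 Om q 0 0 (B n) (G n)" and d: "\<And>n. has_div Om q (B n) (D n)"
  and D: "\<And>n. D n \<in> L2w Om (q - 1) 0"
  and C: "\<And>n. L2w_norm Om 0 (B n) \<le> C" "\<And>n. L2w_norm Om 0 (G n) \<le> C" "\<And>n. L2w_norm Om 0 (D n) \<le> C"
 shows "\<exists>r. strict_mono r \<and> locally_Cauchy Om (%k. B (r k))"
proof -
 have b: "sqrt (a\<^sup>2 + c\<^sup>2) \<le> C + C" if "0 \<le> a" "0 \<le> c" "a \<le> C" "c \<le> C" for a c :: real
  using sqrt_sum_squares_le_sum[OF that(1,2)] that(3,4) by linarith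
 have "B n \<in> bold_R0 Om q 0 \<inter> bold_D Om q 0" for n
 proof
  show "B n \<in> bold_R0 Om q 0" using rot0_iff[OF Om(1)] r by blast
  show "B n \<in> bold_D Om q 0" using has_rot0_L2w(1)[OF r] d D unfolding div_space_def by blast
 qed
 moreover have "rot_norm Om q 0 0 (B n) \<le> C + C \<and> div_norm Om q 0 0 (B n) \<le> C + C" for n
  unfolding rot_norm_eq(1)[OF Om(1) has_rot0_has_rot[OF Om(1) r] has_rot0_L2w(2)[OF r]] div_norm_eq(1)[OF Om(1) d D]
  using C by (intro conjI b) auto
 ultimately obtain r v where rv: "strict_mono r" "v \<in> L2loc Om q"
  "\<And>R. R > 0 ==> (%k. L2_norm (Om \<inter> ball 0 R) (%x. B (r k) x - v x)) \<longlonglongrightarrow> 0"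
  using Om(2)[unfolded MLCP_def, rule_format, of B q] by blast
 have "locally_Cauchy Om (%k. B (r k))" unfolding locally_Cauchy_def
 proof (intro allI impI)
  fix R e :: real assume R: "R > 0" and e: "e > 0"
  let ?M = "lebesgue_on (Om \<inter> ball 0 R)"
  have s: "sq ?M (B n)" for n
   using L2w_imp_L2loc[OF Om(1) has_rot0_L2w(1)[OF r]] R by (auto simp: L2loc_def L2_iff)
  have sv: "sq ?M v" using rv(2) R by (auto simp: L2loc_def L2_iff)
  obtain K where K: "\<And>k. k \<ge> K ==> nrm ?M (%x. B (r k) x - v x) < e / 2"
   using order_tendstoD(2)[OF rv(3)[OF R], of "e / 2"] e unfolding eventually_sequentially L2_norm_nrm by auto
  have "nrm ?M (%x. B (r m) x - B (r n) x) < e" if "m \<ge> K" "n \<ge> K" for m n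
   using nrm_triangle3[OF s sv s, of "r m" "r n"] K[OF that(1)] K[OF that(2)] nrm_minus_commute[of ?M v "B (r n)"] by linarith
  then show "\<exists>K. \<forall>m\<ge>K. \<forall>n\<ge>K. nrm ?M (%x. B (r m) x - B (r n) x) < e" by blast
 qed
 then show ?thesis using rv(1) by blast
qed

text \<open>The MLCP is applied twice. \<open>P\<close> has rotation \<open>\<Gamma>\<close> and
  divergence 0, and \<open>X - \<Gamma>\<close> has the rotation of \<open>X\<close> and divergence
  \<open>- P\<close>; so both sequences are bounded in the required space although nothing is known
  about the divergence of \<open>X\<close>.\<close>

lemma decompose_subseq:
 assumes Om: "open Om" "MLCP Om" and r: "\<And>n::nat. has_rot0 Om q 0 0 (X n) (G n)"
  and C: "\<And>n. L2w_norm Om 0 (X n) \<le> C" "\<And>n. L2w_norm Om 0 (G n) \<le> C"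
 obtains \<sigma> P \<Gamma> where "strict_mono \<sigma>" "\<And>n. has_rot0 Om (q - 1) 0 0 (P n) (\<Gamma> n)" "\<And>n. has_rot0 Om q 0 0 (\<Gamma> n) (%x. 0)"
  "locally_Cauchy Om (%k. P (\<sigma> k))" "locally_Cauchy Om (%k x. X (\<sigma> k) x - \<Gamma> (\<sigma> k) x)"
proof -
 let ?Q = "%n P \<Gamma>. has_rot0 Om (q - 1) 0 0 P \<Gamma> \<and> has_rot0 Om q 0 0 \<Gamma> (%x. 0) \<and> has_div Om q (%x. X n x - \<Gamma> x) (%x. - P x) \<and>
  has_div Om (q - 1) P (%x. 0) \<and> L2w_norm Om 0 P \<le> L2w_norm Om 0 (X n) \<and> L2w_norm Om 0 \<Gamma> \<le> L2w_norm Om 0 (X n)"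
 have "\<forall>n. \<exists>z. ?Q n (fst z) (snd z)"
 proof
  fix n
  obtain P \<Gamma> where "?Q n P \<Gamma>" by (rule rot_decomposition[OF Om(1) has_rot0_L2w(1)[OF r[of n]]]) blast
  then show "\<exists>z. ?Q n (fst z) (snd z)" by (intro exI[of _ "(P, \<Gamma>)"]) simp
 qed
 from choice[OF this] obtain z where z: "\<And>n. ?Q n (fst (z n)) (snd (z n))" by blast
 define P \<Gamma> where "P n = fst (z n)" and "\<Gamma> n = snd (z n)" for n
 have D: "has_rot0 Om (q - 1) 0 0 (P n) (\<Gamma> n)" "has_rot0 Om q 0 0 (\<Gamma> n) (%x. 0)" "has_div Om q (%x. X n x - \<Gamma> n x) (%x. - P n x)"
  "has_div Om (q - 1) (P n) (%x. 0)" "L2w_norm Om 0 (P n) \<le> C" "L2w_norm Om 0 (\<Gamma> n) \<le> C" for n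
  using z[of n] C(1)[of n] unfolding P_def \<Gamma>_def by auto
 have c: "C \<ge> 0" using C(1)[of 0] L2w_norm_nonneg[of Om 0 "X 0"] by linarith
 obtain \<sigma>1 where 1: "strict_mono \<sigma>1" "locally_Cauchy Om (%k. P (\<sigma>1 k))"
  using MLCP_subseq[OF Om, of "q - 1" P \<Gamma> "%n x. 0" C] D L2w_zero[of Om "q - 2" 0] c by (auto simp: L2w_norm_zero)
 have e: "has_rot0 Om q 0 0 (%x. X n x - \<Gamma> n x) (%x. G n x - 0)" for n by (rule has_rot0_diff[OF Om(1) r D(2)])
 have mP: "(%x. - P n x) \<in> L2w Om (q - 1) 0" for n using L2w_scaleR[OF has_rot0_L2w(1)[OF D(1)], of "-1"] by simp
 have "L2w_norm Om 0 (%x. X n x - \<Gamma> n x) \<le> 2 * C" for n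
  using L2w_norm_diff[OF has_rot0_L2w(1)[OF r] has_rot0_L2w(1)[OF D(2)], of n n] C(1)[of n] D(6)[of n] by linarith
 moreover have "L2w_norm Om 0 (%x. G n x - 0) \<le> 2 * C" for n using C(2)[of n] c by simp
 moreover have "L2w_norm Om 0 (%x. - P n x) \<le> 2 * C" for n using D(5)[of n] c by (simp add: L2w_norm_zero nrm_minus)
 ultimately obtain \<sigma>2 where 2: "strict_mono \<sigma>2" "locally_Cauchy Om (%k x. X (\<sigma>1 (\<sigma>2 k)) x - \<Gamma> (\<sigma>1 (\<sigma>2 k)) x)"
  using MLCP_subseq[OF Om, of q "%k x. X (\<sigma>1 k) x - \<Gamma> (\<sigma>1 k) x" "%k x. G (\<sigma>1 k) x - 0" "%k x. - P (\<sigma>1 k) x" "2 * C"] e D(3) mP by auto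
 show ?thesis
  by (rule that[where \<sigma>="%k. \<sigma>1 (\<sigma>2 k)", OF _ D(1,2) locally_Cauchy_subseq[OF 1(2) 2(1)] 2(2)])
   (use strict_mono_o[OF 1(1) 2(1)] in \<open>simp add: o_def\<close>)
qed

lemma C0_inf_support:
 fixes \<phi> :: "real ^ 'n::finite => real"
 assumes "\<phi> \<in> C0_inf UNIV"
 obtains R where "R > 0" "\<And>x. norm x \<ge> R ==> \<phi> x = 0" "\<And>x. norm x \<ge> R ==> grad \<phi> x = 0"
proof -
 have "csupp \<phi>" using assms by (auto simp: C0_inf_def csupp_def)
 then obtain R where R: "R > 0" "\<And>x. norm x > R ==> \<phi> x = 0" using csupp_cball by blast
 have "partial_deriv n \<phi> x = 0" if "norm x > R" for n x
  using partial_deriv_outside_support[of "cball 0 R" \<phi> x n] R(2) that by simp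
 then show ?thesis using R by (intro that[of "R + 1"]) (auto simp: grad_def vec_eq_iff)
qed

text \<open>The part \<open>\<Gamma> = rot P\<close> is integrated by parts, so that only \<open>P\<close> and not \<open>\<Gamma>\<close> enters the bound.\<close>

lemma divrot_estimate:
 fixes Om :: "(real ^ 'n::{finite,linorder}) set"
 assumes Om: "open Om" and \<phi>: "\<phi> \<in> C0_inf UNIV"
 shows "\<exists>R>0. \<exists>C\<ge>0. \<forall>B P \<Gamma> Y D. B \<in> L2w Om q 0 \<longrightarrow> has_rot0 Om (q - 1) 0 0 P \<Gamma> \<longrightarrow> has_div Om q Y D \<longrightarrow> Y \<in> L2w Om q 0 \<longrightarrow>
  D \<in> L2w Om (q - 1) 0 \<longrightarrow> \<bar>ip (lebesgue_on Om) (%x. B x + \<Gamma> x) (%x. \<phi> x *\<^sub>R Y x)\<bar> \<le>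
   C * (nrm (lebesgue_on (Om \<inter> ball 0 R)) B + nrm (lebesgue_on (Om \<inter> ball 0 R)) P) * (L2w_norm Om 0 Y + L2w_norm Om 0 D)"
proof -
 let ?M = "lebesgue_on Om"
 obtain R where R: "R > 0" "\<And>x. norm x \<ge> R ==> \<phi> x = 0" "\<And>x. norm x \<ge> R ==> grad \<phi> x = 0" by (rule C0_inf_support[OF \<phi>]) blast
 obtain C where C: "C \<ge> 0" "\<And>x. \<bar>\<phi> x\<bar> * rho x powr 0 \<le> C * rho x powr 0"
  "\<And>x. (\<Sum>n\<in>UNIV. \<bar>grad \<phi> x $ n\<bar>) * rho x powr 0 \<le> C * rho x powr 0"
  by (rule C0_inf_bounds[OF \<phi>, of 0 0 0 0], rule that) simp_all
 have s: "smooth \<phi>" using \<phi> by (simp add: C0_inf_def)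
 let ?I = "%u x. indicat_real (ball 0 R) x *\<^sub>R u x"
 have "\<bar>ip ?M (%x. B x + \<Gamma> x) (%x. \<phi> x *\<^sub>R Y x)\<bar> \<le>
   C * (nrm (lebesgue_on (Om \<inter> ball 0 R)) B + nrm (lebesgue_on (Om \<inter> ball 0 R)) P) * (L2w_norm Om 0 Y + L2w_norm Om 0 D)"
  if B: "B \<in> L2w Om q 0" and P: "has_rot0 Om (q - 1) 0 0 P \<Gamma>" and h: "has_div Om q Y D" and Y: "Y \<in> L2w Om q 0" and D: "D \<in> L2w Om (q - 1) 0" for B P \<Gamma> Y D
 proof -
  note m = mult_L2w[OF Y smooth_continuous[OF s] C(1,2)] mult_L2w[OF D smooth_continuous[OF s] C(1,2)] grad_L2w(3,4)[OF Y s C(1) C(3)]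
  let ?Z = "%x. \<phi> x *\<^sub>R D x + ctr (grad \<phi> x) (Y x)"
  have Z: "?Z \<in> L2w Om (q - 1) 0" "L2w_norm Om 0 ?Z \<le> C * (L2w_norm Om 0 Y + L2w_norm Om 0 D)"
   using L2w_add[OF m(3,5)] order_trans[OF L2w_norm_add[OF m(3,5)] add_mono[OF m(4,6)]] by (simp_all add: algebra_simps)
  have I: "sq ?M (?I u)" if "u \<in> L2w Om p 0" for u p
   using L2w_imp_L2loc[OF Om that] R(1) unfolding L2loc_iff[OF Om] by blast
  have i1: "ip ?M B (%x. \<phi> x *\<^sub>R Y x) = ip ?M (?I B) (%x. \<phi> x *\<^sub>R Y x)"
   unfolding ip_def using R(2) by (intro Bochner_Integration.integral_cong) (auto simp: indicator_def)
  have i2: "ip ?M P ?Z = ip ?M (?I P) ?Z"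
   unfolding ip_def using R(2,3) by (intro Bochner_Integration.integral_cong) (auto simp: indicator_def not_less ctr_def)
  have "\<bar>ip ?M B (%x. \<phi> x *\<^sub>R Y x)\<bar> \<le> nrm ?M (?I B) * L2w_norm Om 0 (%x. \<phi> x *\<^sub>R Y x)"
   unfolding i1 L2w_norm_zero using m(1) by (intro ip_CS I[OF B]) (simp add: L2w_zero_iff)
  also have "\<dots> \<le> nrm ?M (?I B) * (C * (L2w_norm Om 0 Y + L2w_norm Om 0 D))"
   using m(2) C(1) by (intro mult_left_mono nrm_nonneg order_trans[OF m(2)] mult_left_mono C(1)) simp_all
  finally have 1: "\<bar>ip ?M B (%x. \<phi> x *\<^sub>R Y x)\<bar> \<le> nrm ?M (?I B) * (C * (L2w_norm Om 0 Y + L2w_norm Om 0 D))" .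
  have "ip ?M \<Gamma> (%x. \<phi> x *\<^sub>R Y x) = - ip ?M P ?Z"
   using has_rot0_pair[OF Om P, of "%x. \<phi> x *\<^sub>R Y x" ?Z] has_div_mult[OF Om s h] m(1) Z(1) by simp
  then have "\<bar>ip ?M \<Gamma> (%x. \<phi> x *\<^sub>R Y x)\<bar> = \<bar>ip ?M (?I P) ?Z\<bar>" unfolding i2 by simp
  also have "\<dots> \<le> nrm ?M (?I P) * L2w_norm Om 0 ?Z"
   unfolding L2w_norm_zero using Z(1) by (intro ip_CS I[OF has_rot0_L2w(1)[OF P]]) (simp add: L2w_zero_iff)
  also have "\<dots> \<le> nrm ?M (?I P) * (C * (L2w_norm Om 0 Y + L2w_norm Om 0 D))" by (intro mult_left_mono nrm_nonneg Z(2))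
  finally have 2: "\<bar>ip ?M \<Gamma> (%x. \<phi> x *\<^sub>R Y x)\<bar> \<le> nrm ?M (?I P) * (C * (L2w_norm Om 0 Y + L2w_norm Om 0 D))" .
  have G: "\<Gamma> \<in> L2w Om q 0" using has_rot0_L2w(2)[OF P] by simp
  have "ip ?M (%x. B x + \<Gamma> x) (%x. \<phi> x *\<^sub>R Y x) = ip ?M B (%x. \<phi> x *\<^sub>R Y x) + ip ?M \<Gamma> (%x. \<phi> x *\<^sub>R Y x)"
   using B G m(1) by (intro ip_add_left) (simp_all add: L2w_zero_iff)
  with 1 2 show ?thesis unfolding sq_ball_iff(2)[OF Om] by (simp add: algebra_simps)
 qed
 with R(1) C(1) show ?thesis by blast
qed

text \<open>The products are quadratic in differences, so that with \<open>Y\<close> the image of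
  \<open>X\<close> under a positive transformation they control the distance of two members of the
  sequence.\<close>

definition divrot_Cauchy :: "(real ^ 'n::finite) set => (nat => 'n form) => (nat => 'n form) => bool" where
 "divrot_Cauchy Om X Y \<longleftrightarrow> (\<forall>\<phi>\<in>C0_inf UNIV. \<forall>e>0. \<exists>K. \<forall>m\<ge>K. \<forall>n\<ge>K.
  \<bar>ip (lebesgue_on Om) (%x. X m x - X n x) (%x. \<phi> x *\<^sub>R (Y m x - Y n x))\<bar> < e)"

text \<open>In the estimate for differences only the locally convergent parts
  \<open>X - \<Gamma>\<close> and \<open>P\<close> must be small; they are multiplied by quantities
  that are merely bounded. Hence no strong convergence of \<open>Y\<close> is required.\<close>

lemma divrot_subseq:
 fixes X :: "nat => ('n::{finite,linorder}) form"
 assumes Om: "open Om" "MLCP Om" and r: "\<And>n::nat. has_rot0 Om q 0 0 (X n) (G n)" and h: "\<And>n. has_div Om q (Y n) (D n)"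
  and YD: "\<And>n. Y n \<in> L2w Om q 0" "\<And>n. D n \<in> L2w Om (q - 1) 0"
  and C: "\<And>n. L2w_norm Om 0 (X n) \<le> C" "\<And>n. L2w_norm Om 0 (G n) \<le> C" "\<And>n. L2w_norm Om 0 (Y n) \<le> C" "\<And>n. L2w_norm Om 0 (D n) \<le> C"
 shows "\<exists>\<sigma>. strict_mono \<sigma> \<and> divrot_Cauchy Om (%k. X (\<sigma> k)) (%k. Y (\<sigma> k))"
proof -
 obtain \<sigma> P \<Gamma> where \<sigma>: "strict_mono \<sigma>" "\<And>n. has_rot0 Om (q - 1) 0 0 (P n) (\<Gamma> n)" "\<And>n. has_rot0 Om q 0 0 (\<Gamma> n) (%x. 0)"
  "locally_Cauchy Om (%k. P (\<sigma> k))" "locally_Cauchy Om (%k x. X (\<sigma> k) x - \<Gamma> (\<sigma> k) x)" by (rule decompose_subseq[where X=X and G=G and C=C, OF Om r C(1,2)]) blast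
 have c: "C \<ge> 0" using C(1)[of 0] L2w_norm_nonneg[of Om 0 "X 0"] by linarith
 have "divrot_Cauchy Om (%k. X (\<sigma> k)) (%k. Y (\<sigma> k))" unfolding divrot_Cauchy_def
 proof (intro ballI allI impI)
  fix \<phi> :: "real ^ ('n::{finite,linorder}) => real" and e :: real assume \<phi>: "\<phi> \<in> C0_inf UNIV" and e: "e > 0"
  obtain R C' where RC: "R > 0" "C' \<ge> 0" and est: "\<And>B P \<Gamma> Y D. B \<in> L2w Om q 0 ==> has_rot0 Om (q - 1) 0 0 P \<Gamma> ==> has_div Om q Y D ==> Y \<in> L2w Om q 0 ==>
   D \<in> L2w Om (q - 1) 0 ==> \<bar>ip (lebesgue_on Om) (%x. B x + \<Gamma> x) (%x. \<phi> x *\<^sub>R Y x)\<bar> \<le>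
   C' * (nrm (lebesgue_on (Om \<inter> ball 0 R)) B + nrm (lebesgue_on (Om \<inter> ball 0 R)) P) * (L2w_norm Om 0 Y + L2w_norm Om 0 D)"
   using divrot_estimate[OF Om(1) \<phi>, of q] by blast
  \<comment> \<open>The estimate yields \<open>C' * (\<delta> + \<delta>) * (4 * C)\<close>; the
    summand 1 excludes a zero denominator and makes the final inequality strict.\<close>
  define \<delta> where "\<delta> = e / (8 * C * C' + 1)"
  have p: "8 * C * C' + 1 > 0" using c RC(2) by (simp add: add_nonneg_pos)
  then have d: "\<delta> > 0" using e by (simp add: \<delta>_def)
  let ?N = "nrm (lebesgue_on (Om \<inter> ball 0 R))"
  obtain K1 where K1: "\<And>m n. m \<ge> K1 ==> n \<ge> K1 ==> ?N (%x. P (\<sigma> m) x - P (\<sigma> n) x) < \<delta>"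
   using \<sigma>(4)[unfolded locally_Cauchy_def, rule_format, OF RC(1) d] by auto
  obtain K2 where K2: "\<And>m n. m \<ge> K2 ==> n \<ge> K2 ==> ?N (%x. (X (\<sigma> m) x - \<Gamma> (\<sigma> m) x) - (X (\<sigma> n) x - \<Gamma> (\<sigma> n) x)) < \<delta>"
   using \<sigma>(5)[unfolded locally_Cauchy_def, rule_format, OF RC(1) d] by auto
  have "\<bar>ip (lebesgue_on Om) (%x. X (\<sigma> m) x - X (\<sigma> n) x) (%x. \<phi> x *\<^sub>R (Y (\<sigma> m) x - Y (\<sigma> n) x))\<bar> < e"
   if "m \<ge> max K1 K2" "n \<ge> max K1 K2" for m n
  proof -
   let ?B = "%x. (X (\<sigma> m) x - \<Gamma> (\<sigma> m) x) - (X (\<sigma> n) x - \<Gamma> (\<sigma> n) x)"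
   let ?P = "%x. P (\<sigma> m) x - P (\<sigma> n) x" and ?G = "%x. \<Gamma> (\<sigma> m) x - \<Gamma> (\<sigma> n) x"
   let ?Y = "%x. Y (\<sigma> m) x - Y (\<sigma> n) x" and ?D = "%x. D (\<sigma> m) x - D (\<sigma> n) x"
   have a: "L2w_norm Om 0 ?Y + L2w_norm Om 0 ?D \<le> 4 * C"
    using L2w_norm_diff[OF YD(1) YD(1), of "\<sigma> m" "\<sigma> n"] L2w_norm_diff[OF YD(2) YD(2), of "\<sigma> m" "\<sigma> n"]
     C(3)[of "\<sigma> m"] C(3)[of "\<sigma> n"] C(4)[of "\<sigma> m"] C(4)[of "\<sigma> n"] by linarith
   have "\<bar>ip (lebesgue_on Om) (%x. X (\<sigma> m) x - X (\<sigma> n) x) (%x. \<phi> x *\<^sub>R ?Y x)\<bar>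
     = \<bar>ip (lebesgue_on Om) (%x. ?B x + ?G x) (%x. \<phi> x *\<^sub>R ?Y x)\<bar>" by (simp add: algebra_simps)
   also have "\<dots> \<le> C' * (?N ?B + ?N ?P) * (L2w_norm Om 0 ?Y + L2w_norm Om 0 ?D)"
    by (intro est L2w_diff has_rot0_L2w(1)[OF r] has_rot0_L2w(1)[OF \<sigma>(3)] has_rot0_diff[OF Om(1)] \<sigma>(2) has_div_diff[OF Om(1)] h YD)
   also have "\<dots> \<le> C' * (\<delta> + \<delta>) * (4 * C)"
    using K1[of m n] K2[of m n] that RC(2) d c by (intro mult_mono mult_left_mono add_mono a) auto
   also have "\<dots> = 8 * C * C' * \<delta>" by simp
   also have "\<dots> < (8 * C * C' + 1) * \<delta>" using d by (simp add: algebra_simps)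
   also have "\<dots> = e" using p by (simp add: \<delta>_def)
   finally show ?thesis .
  qed
  then show "\<exists>K. \<forall>m\<ge>K. \<forall>n\<ge>K. \<bar>ip (lebesgue_on Om) (%x. X (\<sigma> m) x - X (\<sigma> n) x) (%x. \<phi> x *\<^sub>R (Y (\<sigma> m) x - Y (\<sigma> n) x))\<bar> < e" by blast
 qed
 then show ?thesis using \<sigma>(1) by blast
qed

text \<open>Multiplication by \<open>rho powr t\<close> reduces everything to weight 0; rotation and
  divergence of the products acquire gradient terms that are bounded by the same norms.\<close>

lemma divrot_weighted_subseq:
 fixes X :: "nat => ('n::{finite,linorder}) form"
 assumes Om: "open Om" "MLCP Om" and r: "\<And>n. has_rot0 Om q t t (X n) (G n)" and h: "\<And>n. has_div Om q (Y n) (D n)"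
  and YD: "\<And>n. Y n \<in> L2w Om q t" "\<And>n. D n \<in> L2w Om (q - 1) t"
  and C: "\<And>n. L2w_norm Om t (X n) \<le> C" "\<And>n. L2w_norm Om t (G n) \<le> C" "\<And>n. L2w_norm Om t (Y n) \<le> C" "\<And>n. L2w_norm Om t (D n) \<le> C"
 shows "\<exists>\<sigma>. strict_mono \<sigma> \<and> divrot_Cauchy Om (%k. wt t (X (\<sigma> k))) (%k. wt t (Y (\<sigma> k)))"
proof -
 let ?c = "1 + real CARD('n) * \<bar>t\<bar>" and ?w = "%x :: real ^ ('n::{finite,linorder}). rho x powr t"
 have w: "smooth ?w" "continuous_on UNIV ?w" "?c \<ge> 0" by (auto intro: smooth_rho_powr continuous_rho_powr)
 have b: "\<bar>?w x\<bar> * rho x powr 0 \<le> ?c * rho x powr t" "(\<Sum>n\<in>UNIV. \<bar>grad ?w x $ n\<bar>) * rho x powr 0 \<le> ?c * rho x powr t" for x :: "real ^ ('n::{finite,linorder})"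
  using rho_powr_grad[of t x] by (simp_all add: algebra_simps add_increasing)
 have c: "C \<ge> 0" using C(1)[of 0] L2w_norm_nonneg[of Om t "X 0"] by linarith
 have cc: "?c * a \<le> 2 * ?c * C" if "a \<le> C" for a
  using mult_left_mono[OF that w(3)] mult_nonneg_nonneg[OF w(3) c] by linarith
 \<comment> \<open>The factor 2 accounts for the weighted derivative and the gradient term.\<close>
 have cs: "a \<le> 2 * ?c * C" if "a \<le> b1 + b2" "b1 \<le> ?c * c1" "b2 \<le> ?c * c2" "c1 \<le> C" "c2 \<le> C" for a b1 b2 c1 c2
  using mult_left_mono[OF that(4) w(3)] mult_left_mono[OF that(5) w(3)] that(1-3) by linarith
 note mX = mult_L2w[OF has_rot0_L2w(1)[OF r] w(2,3) b(1)] and mG = mult_L2w[OF has_rot0_L2w(2)[OF r] w(2,3) b(1)]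
  and gX = grad_L2w(1,2)[OF has_rot0_L2w(1)[OF r] w(1,3) b(2)] and mY = mult_L2w[OF YD(1) w(2,3) b(1)]
  and mD = mult_L2w[OF YD(2) w(2,3) b(1)] and gY = grad_L2w(3,4)[OF YD(1) w(1,3) b(2)]
 show ?thesis
 proof (rule divrot_subseq[OF Om])
  show "has_rot0 Om q 0 0 (wt t (X n)) (%x. ?w x *\<^sub>R G n x + R_op (grad ?w x) (X n x))" for n
   by (rule has_rot0_mult[OF Om(1) r w(1,3) b(1) b(1) b(2)])
  show "has_div Om q (wt t (Y n)) (%x. ?w x *\<^sub>R D n x + ctr (grad ?w x) (Y n x))" for n
   by (rule has_div_mult[OF Om(1) w(1) h])
  show "L2w_norm Om 0 (wt t (X n)) \<le> 2 * ?c * C" for n using mX(2) cc[OF C(1)] order_trans by blast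
  show "L2w_norm Om 0 (wt t (Y n)) \<le> 2 * ?c * C" for n using mY(2) cc[OF C(3)] order_trans by blast
  show "L2w_norm Om 0 (%x. ?w x *\<^sub>R G n x + R_op (grad ?w x) (X n x)) \<le> 2 * ?c * C" for n
   by (rule cs[OF L2w_norm_add[OF mG(1) gX(1)] mG(2) gX(2) C(2,1)])
  show "L2w_norm Om 0 (%x. ?w x *\<^sub>R D n x + ctr (grad ?w x) (Y n x)) \<le> 2 * ?c * C" for n
   by (rule cs[OF L2w_norm_add[OF mD(1) gY(1)] mD(2) gY(2) C(4,3)])
  show "wt t (Y n) \<in> L2w Om q 0" for n by (rule mY(1))
  show "(%x. ?w x *\<^sub>R D n x + ctr (grad ?w x) (Y n x)) \<in> L2w Om (q - 1) 0" for n by (rule L2w_add[OF mD(1) gY(1)])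
 qed
qed

section \<open>From local to weighted convergence\<close>

lemma L2w_complete:
 assumes u: "\<And>n. u n \<in> L2w Om q s" and C: "\<And>e. e > 0 ==> \<exists>K. \<forall>m\<ge>K. \<forall>n\<ge>K. L2w_norm Om s (%x. u m x - u n x) < e"
 shows "\<exists>p\<in>L2w Om q s. (%n. L2w_norm Om s (%x. u n x - p x)) \<longlonglongrightarrow> 0"
proof -
 have e: "nrm (lebesgue_on Om) (%x. wt s (u m) x - wt s v x) = L2w_norm Om s (%x. u m x - v x)" for m v
  by (simp add: L2w_norm_nrm scaleR_diff_right)
 have a: "wt s (u n) x \<in> alt q" if "x \<in> space (lebesgue_on Om)" for n x
  using L2w_alt[OF u] that by (simp add: alt_scaleR)
 obtain p where p: "sq (lebesgue_on Om) p" "\<forall>x\<in>space (lebesgue_on Om). p x \<in> alt q"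
  "(%n. nrm (lebesgue_on Om) (%x. wt s (u n) x - p x)) \<longlonglongrightarrow> 0"
  using L2_complete[of "lebesgue_on Om" "%n. wt s (u n)" "alt q", OF L2w_sq[OF u] _ closed_alt _ a] C unfolding e by auto
 have w: "rho x powr s * rho x powr - s = 1" for x :: "real ^ 'a" using rho_ge_1[of x] by (simp add: powr_add[symmetric])
 then show ?thesis using p unfolding L2w_norm_nrm
  by (intro bexI[of _ "wt (- s) p"]) (simp_all add: L2w_iff alt_scaleR scaleR_diff_right)
qed

text \<open>Inside the ball the smaller weight is dominated by the larger one; outside,
  \<open>rho\<close> is at least \<open>R\<close>, and the surplus \<open>t - t'\<close> of the
  weight gives the factor.\<close>

lemma L2w_tail:
 assumes Om: "open Om" and u: "u \<in> L2w Om q t" and t: "t' \<le> t" and R: "R > 0"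
 shows "L2w_norm Om t' u \<le> nrm (lebesgue_on (Om \<inter> ball 0 R)) (wt t u) + R powr (t' - t) * L2w_norm Om t u"
proof -
 let ?M = "lebesgue_on Om" and ?I = "%x. indicat_real (ball 0 R) x"
 note s = L2w_sq[OF u] and m = L2w_measurable[OF u]
 have mI: "?I \<in> borel_measurable ?M"
  by (rule measurable_restrict_space1, rule borel_measurable_indicator) simp
 have sI: "sq ?M (%x. ?I x *\<^sub>R wt t u x)"
  by (rule sq_dom(1)[OF s borel_measurable_scaleR[OF mI sq_measurable[OF s]], of 1]) (auto simp: indicator_def)
 have mt: "wt t' u \<in> borel_measurable ?M" using m by (simp add: wt_measurable_iff)
 have a: "norm (?I x *\<^sub>R wt t' u x) \<le> 1 * norm (?I x *\<^sub>R wt t u x)" for x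
  using rho_powr_mono[OF t, of x] by (auto simp: indicator_def intro!: mult_right_mono)
 have b: "norm ((1 - ?I x) *\<^sub>R wt t' u x) \<le> R powr (t' - t) * norm (wt t u x)" for x
 proof (cases "norm x < R")
  case False
  then have "rho x powr (t' - t) \<le> R powr (t' - t)" using norm_le_rho[of x] R t by (intro powr_mono2') auto
  then have "rho x powr (t' - t) * rho x powr t * norm (u x) \<le> R powr (t' - t) * rho x powr t * norm (u x)"
   by (intro mult_right_mono) auto
  then show ?thesis using False by (simp add: indicator_def powr_add[symmetric] mult.assoc)
 qed (simp add: indicator_def)
 note 1 = sq_dom[OF sI _ AE_I2[OF a]] and 2 = sq_dom[OF s _ AE_I2[OF b]]
 have m1: "(%x. ?I x *\<^sub>R wt t' u x) \<in> borel_measurable ?M" "(%x. (1 - ?I x) *\<^sub>R wt t' u x) \<in> borel_measurable ?M"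
  by (intro borel_measurable_scaleR borel_measurable_diff borel_measurable_const mI mt)+
 have "L2w_norm Om t' u = nrm ?M (%x. ?I x *\<^sub>R wt t' u x + (1 - ?I x) *\<^sub>R wt t' u x)"
  unfolding scaleR_left_distrib[symmetric] L2w_norm_nrm by simp
 also have "\<dots> \<le> nrm ?M (%x. ?I x *\<^sub>R wt t' u x) + nrm ?M (%x. (1 - ?I x) *\<^sub>R wt t' u x)"
  by (rule nrm_triangle[OF 1(1)[OF m1(1)] 2(1)[OF m1(2)]])
 also have "\<dots> \<le> nrm ?M (%x. ?I x *\<^sub>R wt t u x) + R powr (t' - t) * nrm ?M (wt t u)"
  using 1(2)[OF m1(1)] 2(2)[OF m1(2)] by simp
 finally show ?thesis unfolding sq_ball_iff(2)[OF Om] L2w_norm_nrm .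
qed

text \<open>Boundedness in weight \<open>t\<close> makes the tails uniformly small in every smaller
  weight, so local convergence becomes convergence there. One representative \<open>p\<close> must
  serve all these weights: it is fixed for \<open>t - 1\<close>, and the limits in other weights
  agree with it almost everywhere.\<close>

lemma L2w_limit_of_locally_Cauchy:
 assumes Om: "open Om" and u: "\<And>n. u n \<in> L2w Om q t" "\<And>n. L2w_norm Om t (u n) \<le> C" and l: "locally_Cauchy Om (%n. wt t (u n))"
 obtains p where "\<And>t'. t' < t ==> p \<in> L2w Om q t'" "\<And>t'. t' < t ==> (%n. L2w_norm Om t' (%x. u n x - p x)) \<longlonglongrightarrow> 0"
proof -
 have c: "C \<ge> 0" using u(2)[of 0] L2w_norm_nonneg[of Om t "u 0"] by linarith
 have ex: "\<exists>p\<in>L2w Om q t'. (%n. L2w_norm Om t' (%x. u n x - p x)) \<longlonglongrightarrow> 0" if t': "t' < t" for t'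
 proof (rule L2w_complete[OF L2w_mono[OF less_imp_le[OF t'] u(1)]])
  fix e :: real assume e: "e > 0"
  have "((%R. R powr (t' - t) * (2 * C)) \<longlongrightarrow> 0 * (2 * C)) at_top"
   by (intro tendsto_mult tendsto_const tendsto_neg_powr filterlim_ident) (use t' in simp)
  then have "\<forall>\<^sub>F R in at_top. R powr (t' - t) * (2 * C) < e / 2"
   using e by (intro order_tendstoD(2)[of _ 0]) auto
  then obtain R0 where R0: "\<And>R. R \<ge> R0 ==> R powr (t' - t) * (2 * C) < e / 2" unfolding eventually_at_top_linorder by blast
  define R where "R = max R0 1"
  have R: "R > 0" "R powr (t' - t) * (2 * C) < e / 2" using R0 by (auto simp: R_def)
  obtain K where K: "\<And>m n. m \<ge> K ==> n \<ge> K ==> nrm (lebesgue_on (Om \<inter> ball 0 R)) (%x. wt t (u m) x - wt t (u n) x) < e / 2"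
   using l[unfolded locally_Cauchy_def, rule_format, OF R(1), of "e / 2"] e by auto
  have "L2w_norm Om t' (%x. u m x - u n x) < e" if "m \<ge> K" "n \<ge> K" for m n
  proof -
   have "L2w_norm Om t (%x. u m x - u n x) \<le> 2 * C"
    using L2w_norm_diff[OF u(1) u(1), of m n] u(2)[of m] u(2)[of n] by linarith
   then have "R powr (t' - t) * L2w_norm Om t (%x. u m x - u n x) < e / 2"
    using mult_left_mono[of _ "2 * C" "R powr (t' - t)"] R(2) by fastforce
   then show ?thesis
    using L2w_tail[OF Om L2w_diff[OF u(1) u(1)] less_imp_le[OF t'] R(1), of m n] K[OF that] by (simp add: scaleR_diff_right)
  qed
  then show "\<exists>K. \<forall>m\<ge>K. \<forall>n\<ge>K. L2w_norm Om t' (%x. u m x - u n x) < e" by blast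
 qed
 obtain p where p: "p \<in> L2w Om q (t - 1)" "(%n. L2w_norm Om (t - 1) (%x. u n x - p x)) \<longlonglongrightarrow> 0" using ex[of "t - 1"] by auto
 have "p \<in> L2w Om q t' \<and> (%n. L2w_norm Om t' (%x. u n x - p x)) \<longlonglongrightarrow> 0" if "t' < t" for t'
 proof -
  \<comment> \<open>The comparison takes place in a weight that dominates both \<open>t'\<close> and
    the reference weight \<open>t - 1\<close>.\<close>
  define w where "w = max t' (t - 1)"
  have w: "w < t" "t' \<le> w" "t - 1 \<le> w" using that by (auto simp: w_def)
  obtain p' where p': "p' \<in> L2w Om q w" "(%n. L2w_norm Om w (%x. u n x - p' x)) \<longlonglongrightarrow> 0" using ex[OF w(1)] by blast
  have uw: "u n \<in> L2w Om q w" for n by (rule L2w_mono[OF less_imp_le[OF w(1)] u(1)])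
  have lim: "(%n. L2w_norm Om v (%x. u n x - p' x)) \<longlonglongrightarrow> 0" if "v \<le> w" for v
   by (rule Lim_null_comparison[OF always_eventually[OF allI] p'(2)]) (use L2w_norm_mono[OF that L2w_diff[OF uw p'(1)]] in simp)
  have "AE x in lebesgue_on Om. wt (t - 1) p' x = wt (t - 1) p x"
   using lim[OF w(3)] p(2)
   by (intro sq_limit_unique[OF L2w_sq[OF L2w_mono[OF w(3) uw]] L2w_sq[OF L2w_mono[OF w(3) p'(1)]] L2w_sq[OF p(1)]])
    (simp_all add: L2w_norm_nrm scaleR_diff_right)
  then have ae: "AE x in lebesgue_on Om. p' x = p x" by eventually_elim simp
  note q = L2w_AE[OF p'(1) L2w_measurable[OF p(1)] L2w_alt[OF p(1)] ae]
  have "L2w_norm Om w (%x. u n x - p' x) = L2w_norm Om w (%x. u n x - p x)" for n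
   using ae by (intro L2w_AE(2)[OF L2w_diff[OF uw p'(1)] L2w_measurable[OF L2w_diff[OF uw q(1)]] L2w_alt[OF L2w_diff[OF uw q(1)]]]) auto
  then have "(%n. L2w_norm Om w (%x. u n x - p x)) \<longlonglongrightarrow> 0" using p'(2) by simp
  then have "(%n. L2w_norm Om t' (%x. u n x - p x)) \<longlonglongrightarrow> 0"
   by (rule Lim_null_comparison[OF always_eventually[OF allI], rotated]) (use L2w_norm_mono[OF w(2) L2w_diff[OF uw q(1)]] in simp)
  then show ?thesis using L2w_mono[OF w(2) q(1)] by simp
 qed
 then show ?thesis using that[of p] by simp
qed

section \<open>Admissible transformations\<close>

lemma alg_measurable:
 fixes f :: "'a => ('n::finite) alg"
 assumes "\<And>I. (%x. f x $ I) \<in> borel_measurable M" shows "f \<in> borel_measurable M"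
proof (subst borel_measurable_euclidean_space, intro ballI)
 fix i :: "'n alg" assume "i \<in> Basis"
 then obtain I b where "i = axis I b" by (auto simp: Basis_vec_def)
 then show "(%x. f x \<bullet> i) \<in> borel_measurable M" using assms[of I] by (simp add: inner_axis)
qed

text \<open>Entries of the matrix that involve other ranks are not assumed measurable or bounded. On
  a form of rank \<open>q\<close> the foreign columns meet zero coefficients and the foreign rows
  give zero, so the value is expressed by the controlled entries alone.\<close>

lemma app_component:
 assumes "admissible Om q \<tau> e \<epsilon>" "x \<in> Om" "v \<in> alt q"
 shows "(\<epsilon> x *v v) $ I = (if int (card I) = q then (\<Sum>J | int (card J) = q. \<epsilon> x $ I $ J * v $ J) else 0)"
proof -
 have "\<epsilon> x *v v \<in> alt q" using assms by (auto simp: admissible_def)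
 moreover have "(\<Sum>J\<in>UNIV. \<epsilon> x $ I $ J * v $ J) = (\<Sum>J | int (card J) = q. \<epsilon> x $ I $ J * v $ J)"
  using assms(3) by (intro sum.mono_neutral_right) (auto simp: alt_def)
 ultimately show ?thesis by (auto simp: alt_def matrix_vector_mult_def)
qed

lemma app_measurable:
 assumes a: "admissible Om q \<tau> e \<epsilon>" and u: "u \<in> borel_measurable (lebesgue_on Om)" "\<And>x. x \<in> Om ==> u x \<in> alt q"
 shows "app \<epsilon> u \<in> borel_measurable (lebesgue_on Om)"
proof (rule alg_measurable)
 fix I
 have e: "(%x. \<epsilon> x $ I $ J) \<in> borel_measurable (lebesgue_on Om)" if "int (card I) = q" "int (card J) = q" for J
  using a that by (auto simp: admissible_def)
 have c: "(%x. u x $ J) \<in> borel_measurable (lebesgue_on Om)" for J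
  by (rule measurable_compose[OF u(1) borel_measurable_continuous_onI]) (intro continuous_intros)
 have "(%x. if int (card I) = q then (\<Sum>J | int (card J) = q. \<epsilon> x $ I $ J * u x $ J) else 0) \<in> borel_measurable (lebesgue_on Om)"
  using e c by (cases "int (card I) = q") (auto intro!: borel_measurable_sum borel_measurable_times)
 then show "(%x. app \<epsilon> u x $ I) \<in> borel_measurable (lebesgue_on Om)"
  by (rule measurable_cong[THEN iffD1, rotated]) (simp add: app_def app_component[OF a _ u(2)])
qed

text \<open>Outside a large ball the decay of the entries is used, inside it their boundedness
  together with a lower bound for \<open>rho powr (- \<tau>)\<close>. Working with entries yields
  one null set for all \<open>v\<close> at once.\<close>

lemma pert_decay:
 fixes \<epsilon> :: "('n::finite) transf"
 assumes a: "admissible Om q \<tau> 1 \<epsilon>" and \<tau>: "\<tau> > 0"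
 obtains C where "C \<ge> 0" "AE x in lebesgue_on Om. \<forall>v\<in>alt q. norm (\<epsilon> x *v v - v) \<le> C * rho x powr (- \<tau>) * norm v"
proof -
 let ?M = "lebesgue_on Om" and ?Q = "{I :: 'n set. int (card I) = q}"
 have "\<exists>C\<ge>0. AE x in ?M. cmod (pert \<epsilon> 1 x $ I $ J) \<le> C * rho x powr (- \<tau>)" if IJ: "I \<in> ?Q" "J \<in> ?Q" for I J
 proof -
  obtain C1 where C1: "AE x in ?M. cmod (\<epsilon> x $ I $ J) \<le> C1" using a IJ unfolding admissible_def by blast
  obtain C2 R where C2: "AE x in ?M. norm x \<ge> R \<longrightarrow> cmod (pert \<epsilon> 1 x $ I $ J) \<le> C2 * norm x powr (- \<tau>)"
   using a IJ unfolding admissible_def by blast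
  define R' where "R' = max R 1"
  \<comment> \<open>The power of 2 comes from \<open>rho x \<le> 2 * norm x\<close> outside, the
    summand 1 from the identity matrix inside.\<close>
  define K where "K = \<bar>C2\<bar> * 2 powr \<tau> + (\<bar>C1\<bar> + 1) * (1 + R') powr \<tau>"
  have R': "R' \<ge> 1" "R' \<ge> R" by (auto simp: R'_def)
  have "AE x in ?M. cmod (pert \<epsilon> 1 x $ I $ J) \<le> K * rho x powr (- \<tau>)"
   using C1 C2
  proof eventually_elim
   case (elim x)
   have rr: "rho x powr \<tau> * rho x powr (- \<tau>) = 1" using rho_ge_1[of x] by (simp add: powr_add[symmetric])
   show ?case
   proof (cases "norm x \<ge> R'")
    case True
    then have n: "norm x \<ge> 1" "norm x \<ge> R" using R' by auto
    have "norm x powr (- \<tau>) = 2 powr \<tau> * (2 * norm x) powr (- \<tau>)"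
     by (simp add: powr_mult powr_minus field_simps)
    also have "(2 * norm x) powr (- \<tau>) \<le> rho x powr (- \<tau>)"
     using rho_le[of x] n(1) rho_ge_1[of x] \<tau> by (intro powr_mono2') auto
    finally have "norm x powr (- \<tau>) \<le> 2 powr \<tau> * rho x powr (- \<tau>)" by simp
    then have "\<bar>C2\<bar> * norm x powr (- \<tau>) \<le> \<bar>C2\<bar> * (2 powr \<tau> * rho x powr (- \<tau>))" by (rule mult_left_mono) simp
    moreover have "C2 * norm x powr (- \<tau>) \<le> \<bar>C2\<bar> * norm x powr (- \<tau>)" by (intro mult_right_mono) auto
    moreover have "0 \<le> (\<bar>C1\<bar> + 1) * (1 + R') powr \<tau> * rho x powr (- \<tau>)" by simp
    moreover have "K * rho x powr (- \<tau>) = \<bar>C2\<bar> * (2 powr \<tau> * rho x powr (- \<tau>)) + (\<bar>C1\<bar> + 1) * (1 + R') powr \<tau> * rho x powr (- \<tau>)"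
     by (simp add: K_def algebra_simps)
    ultimately show ?thesis using elim(2)[rule_format, OF n(2)] by linarith
   next
    case False
    have "cmod (pert \<epsilon> 1 x $ I $ J) \<le> cmod (\<epsilon> x $ I $ J) + cmod ((mat 1 :: complex ^ 'n set ^ 'n set) $ I $ J)"
     by (simp add: pert_def norm_triangle_ineq4)
    also have "\<dots> \<le> \<bar>C1\<bar> + 1" using elim(1) by (auto simp: mat_def)
    also have "\<dots> = (\<bar>C1\<bar> + 1) * (rho x powr \<tau> * rho x powr (- \<tau>))" by (simp add: rr)
    also have "\<dots> \<le> (\<bar>C1\<bar> + 1) * ((1 + R') powr \<tau> * rho x powr (- \<tau>))"
     using False rho_le[of x] rho_ge_1[of x] \<tau> by (intro mult_left_mono mult_right_mono powr_mono2) auto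
    also have "\<dots> \<le> K * rho x powr (- \<tau>)" by (simp add: K_def algebra_simps)
    finally show ?thesis .
   qed
  qed
  moreover have "K \<ge> 0" by (simp add: K_def)
  ultimately show ?thesis by blast
 qed
 then have "\<forall>z. \<exists>C. z \<in> ?Q \<times> ?Q \<longrightarrow> C \<ge> 0 \<and> (AE x in ?M. cmod (pert \<epsilon> 1 x $ fst z $ snd z) \<le> C * rho x powr (- \<tau>))" by auto
 from choice[OF this] obtain c where c: "\<And>I J. I \<in> ?Q ==> J \<in> ?Q ==> c (I, J) \<ge> 0"
  "\<And>I J. I \<in> ?Q ==> J \<in> ?Q ==> AE x in ?M. cmod (pert \<epsilon> 1 x $ I $ J) \<le> c (I, J) * rho x powr (- \<tau>)" by auto
 define C where "C = (\<Sum>I\<in>?Q. \<Sum>J\<in>?Q. c (I, J))"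
 have "AE x in ?M. x \<in> Om" by (rule AE_I2) simp
 moreover have "AE x in ?M. \<forall>I\<in>?Q. \<forall>J\<in>?Q. cmod (pert \<epsilon> 1 x $ I $ J) \<le> c (I, J) * rho x powr (- \<tau>)"
  by (intro AE_finite_allI c(2)) auto
 ultimately have "AE x in ?M. \<forall>v\<in>alt q. norm (\<epsilon> x *v v - v) \<le> C * rho x powr (- \<tau>) * norm v"
 proof eventually_elim
  case (elim x)
  show ?case
  proof
   fix v :: "'n alg" assume v: "v \<in> alt q"
   have w: "\<epsilon> x *v v - v = pert \<epsilon> 1 x *v v" by (simp add: pert_def matrix_vector_mult_diff_rdistrib)
   have z: "(pert \<epsilon> 1 x *v v) $ I = 0" if "I \<notin> ?Q" for I
    using app_component[OF a elim(1) v, of I] v that unfolding w[symmetric] by (simp add: alt_def)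
   have "norm ((pert \<epsilon> 1 x *v v) $ I) \<le> (\<Sum>J\<in>?Q. c (I, J)) * rho x powr (- \<tau>) * norm v" if I: "I \<in> ?Q" for I
   proof -
    have "(pert \<epsilon> 1 x *v v) $ I = (\<Sum>J\<in>?Q. pert \<epsilon> 1 x $ I $ J * v $ J)"
     unfolding matrix_vector_mult_def using v by (auto simp: alt_def intro!: sum.mono_neutral_right)
    also have "norm \<dots> \<le> (\<Sum>J\<in>?Q. c (I, J) * rho x powr (- \<tau>) * norm v)"
     by (rule order_trans[OF norm_sum], rule sum_mono, unfold norm_mult)
      (use elim(2) I c(1) in \<open>auto intro!: mult_mono Finite_Cartesian_Product.norm_nth_le\<close>)
    finally show ?thesis by (simp add: sum_distrib_right)
   qed
   then have "(\<Sum>I\<in>?Q. norm ((pert \<epsilon> 1 x *v v) $ I)) \<le> C * rho x powr (- \<tau>) * norm v"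
    unfolding C_def sum_distrib_right by (intro sum_mono) (simp add: sum_distrib_right)
   moreover have "norm (pert \<epsilon> 1 x *v v) \<le> (\<Sum>I\<in>?Q. norm ((pert \<epsilon> 1 x *v v) $ I))"
   proof -
    have "norm (pert \<epsilon> 1 x *v v) \<le> (\<Sum>I\<in>UNIV. norm ((pert \<epsilon> 1 x *v v) $ I))"
     unfolding norm_vec_def by (rule L2_set_le_sum) simp
    also have "\<dots> = (\<Sum>I\<in>?Q. norm ((pert \<epsilon> 1 x *v v) $ I))" using z by (intro sum.mono_neutral_right) auto
    finally show ?thesis .
   qed
   ultimately show "norm (\<epsilon> x *v v - v) \<le> C * rho x powr (- \<tau>) * norm v" unfolding w by simp
  qed
 qed
 moreover have "C \<ge> 0" unfolding C_def by (intro sum_nonneg c(1))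
 ultimately show ?thesis using that by blast
qed

text \<open>The difference from the identity gains the weight \<open>\<tau>\<close>, whereas the
  transformation itself preserves weights. Its constant comes from a pointwise estimate and is
  therefore uniform in the weight.\<close>

lemma
 assumes a: "admissible Om q \<tau> 1 \<epsilon>" and \<tau>: "\<tau> > 0"
 shows pert_L2w: "u \<in> L2w Om q s ==> (%x. app \<epsilon> u x - u x) \<in> L2w Om q (s + \<tau>)"
  and app_L2w: "u \<in> L2w Om q s ==> app \<epsilon> u \<in> L2w Om q s"
  and app_L2w_norm: "\<exists>C\<ge>0. \<forall>s. \<forall>u\<in>L2w Om q s. L2w_norm Om s (app \<epsilon> u) \<le> C * L2w_norm Om s u"
proof -
 obtain C where C: "C \<ge> 0" "AE x in lebesgue_on Om. \<forall>v\<in>alt q. norm (\<epsilon> x *v v - v) \<le> C * rho x powr (- \<tau>) * norm v"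
  by (rule pert_decay[OF a \<tau>]) blast
 have o: "AE x in lebesgue_on Om. x \<in> Om" by (rule AE_I2) simp
 have *: "AE x in lebesgue_on Om. rho x powr (s + \<tau>) * norm (app \<epsilon> u x - u x) \<le> C * (rho x powr s * norm (u x))"
  if u: "u \<in> L2w Om q s" for u s using C(2) o
 proof eventually_elim
  case (elim x)
  then have "norm (app \<epsilon> u x - u x) \<le> C * rho x powr (- \<tau>) * norm (u x)" using L2w_alt[OF u] by (simp add: app_def)
  then have "rho x powr (s + \<tau>) * norm (app \<epsilon> u x - u x) \<le> rho x powr (s + \<tau>) * (C * rho x powr (- \<tau>) * norm (u x))"
   by (rule mult_left_mono) simp
  also have "\<dots> = C * (rho x powr (s + \<tau> + - \<tau>) * norm (u x))" by (simp only: powr_add[of _ "s + \<tau>" "- \<tau>"] mult_ac)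
  finally show ?case by simp
 qed
 have al: "app \<epsilon> u x \<in> alt q" if "u \<in> L2w Om q s" "x \<in> Om" for u s x
  using a L2w_alt[OF that] that(2) by (auto simp: admissible_def app_def)
 have m: "app \<epsilon> u \<in> borel_measurable (lebesgue_on Om)" if "u \<in> L2w Om q s" for u s
  by (rule app_measurable[OF a L2w_measurable[OF that] L2w_alt[OF that]])
 show 1: "(%x. app \<epsilon> u x - u x) \<in> L2w Om q (s + \<tau>)" if "u \<in> L2w Om q s" for u s
  by (rule L2w_dom(1)[OF that _ _ *[OF that]]) (use m[OF that] L2w_measurable[OF that] al[OF that] L2w_alt[OF that] in \<open>auto intro: alt_diff\<close>)
 have 2: "L2w_norm Om (s + \<tau>) (%x. app \<epsilon> u x - u x) \<le> C * L2w_norm Om s u" if "u \<in> L2w Om q s" for u s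
  by (rule L2w_dom(2)[OF that _ _ *[OF that] C(1)]) (use m[OF that] L2w_measurable[OF that] al[OF that] L2w_alt[OF that] in \<open>auto intro: alt_diff\<close>)
 have 3: "(%x. app \<epsilon> u x - u x) \<in> L2w Om q s" "L2w_norm Om s (%x. app \<epsilon> u x - u x) \<le> C * L2w_norm Om s u" if "u \<in> L2w Om q s" for u s
  using L2w_mono[OF _ 1[OF that], of s] L2w_norm_mono[OF _ 1[OF that], of s] 2[OF that] \<tau> by auto
 show "app \<epsilon> u \<in> L2w Om q s" if "u \<in> L2w Om q s" for u s
  using L2w_add[OF 3(1)[OF that] that] by simp
 have "L2w_norm Om s (app \<epsilon> u) \<le> (C + 1) * L2w_norm Om s u" if "u \<in> L2w Om q s" for u s
  using L2w_norm_add[OF 3(1)[OF that] that] 3(2)[OF that] by (simp add: algebra_simps)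
 then show "\<exists>C\<ge>0. \<forall>s. \<forall>u\<in>L2w Om q s. L2w_norm Om s (app \<epsilon> u) \<le> C * L2w_norm Om s u"
  using C(1) by (intro exI[of _ "C + 1"]) auto
qed

lemma app_diff: "app \<epsilon> (%x. u x - v x) = (%x. app \<epsilon> u x - app \<epsilon> v x)"
 by (simp add: app_def matrix_vector_mult_diff_distrib)

lemma app_scaleR: "app \<epsilon> (%x. f x *\<^sub>R u x) = (%x. f x *\<^sub>R app \<epsilon> u x)"
proof -
 have e: "r *\<^sub>R v = complex_of_real r *s v" for r and v :: "'a alg" by (simp add: vec_eq_iff complex_eq_iff)
 show ?thesis unfolding e app_def vector_scalar_commute ..
qed

lemma app_positive:
 assumes a: "admissible Om q \<tau> 1 \<epsilon>" and \<tau>: "\<tau> > 0"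
 obtains c where "c > 0" "\<And>u. u \<in> L2w Om q 0 ==> c * (nrm (lebesgue_on Om) u)\<^sup>2 \<le> ip (lebesgue_on Om) u (app \<epsilon> u)"
proof -
 obtain c where c: "c > 0" "\<And>u. u \<in> L2 Om q ==> Re (L2_pair Om (app \<epsilon> u) u) \<ge> c * (L2_norm Om u)\<^sup>2"
  using a unfolding admissible_def by blast
 have "c * (nrm (lebesgue_on Om) u)\<^sup>2 \<le> ip (lebesgue_on Om) u (app \<epsilon> u)" if u: "u \<in> L2w Om q 0" for u
 proof -
  have "Re (L2_pair Om (app \<epsilon> u) u) = ip (lebesgue_on Om) (app \<epsilon> u) u"
   using u app_L2w[OF a \<tau> u] by (subst L2_pair_sq) (simp_all add: L2w_zero_iff)
  then show ?thesis using c(2)[of u] u by (simp add: L2w_0 L2_norm_nrm ip_commute)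
 qed
 then show ?thesis using that[OF c(1)] by blast
qed

text \<open>Positivity bounds the local norm of a difference by its product with its own image. The
  hypothesis has two versions because the rotation is controlled for \<open>E\<close> in the
  electric case but for \<open>\<mu> H\<close> in the magnetic one, which interchanges the
  factors.\<close>

lemma locally_Cauchy_of_divrot_Cauchy:
 assumes Om: "open Om" and a: "admissible Om q \<tau> 1 \<epsilon>" and \<tau>: "\<tau> > 0" and u: "\<And>n. u n \<in> L2w Om q t"
  and d: "divrot_Cauchy Om (%n. wt t (u n)) (%n. wt t (app \<epsilon> (u n))) \<or> divrot_Cauchy Om (%n. wt t (app \<epsilon> (u n))) (%n. wt t (u n))"
 shows "locally_Cauchy Om (%n. wt t (u n))"
 unfolding locally_Cauchy_def
proof (intro allI impI)
 let ?M = "lebesgue_on Om"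
 fix R e :: real assume R: "R > 0" and e: "e > 0"
 obtain c where c: "c > 0" "\<And>u. u \<in> L2w Om q 0 ==> c * (nrm ?M u)\<^sup>2 \<le> ip ?M u (app \<epsilon> u)" by (rule app_positive[OF a \<tau>]) blast
 \<comment> \<open>A square, because one factor of the cut-off goes to each side of the product;
   being scalar, it commutes with \<open>\<epsilon>\<close>.\<close>
 define \<phi> where "\<phi> x = cut R x * cut R x" for x :: "real ^ 'a"
 have \<phi>: "\<phi> \<in> C0_inf UNIV"
  using smooth_cut[of R] cut_zero[OF R] unfolding C0_inf_def \<phi>_def[abs_def]
  by (auto intro!: Ck_mult exI[of _ "cball 0 (2 * R)"] cut_zero[OF R])
 define w where "w m n x = wt t (u m) x - wt t (u n) x" for m n x
 have w0: "wt t (u n) \<in> L2w Om q 0" for n using L2w_sq[OF u] L2w_alt[OF u] by (simp add: L2w_zero_iff alt_scaleR)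
 have w: "w m n \<in> L2w Om q 0" for m n unfolding w_def[abs_def] by (rule L2w_diff[OF w0 w0])
 have aw: "app \<epsilon> (w m n) x = wt t (app \<epsilon> (u m)) x - wt t (app \<epsilon> (u n)) x" for m n x
  unfolding w_def[abs_def] app_diff app_scaleR ..
 have cw: "(%x. cut R x *\<^sub>R w m n x) \<in> L2w Om q 0" for m n
  by (rule mult_L2w(1)[OF w, of _ 1]) (use smooth_continuous[OF smooth_cut] in auto)
 have s: "ip ?M (w m n) (%x. \<phi> x *\<^sub>R app \<epsilon> (w m n) x) = ip ?M (%x. cut R x *\<^sub>R w m n x) (app \<epsilon> (%x. cut R x *\<^sub>R w m n x))"
  "ip ?M (app \<epsilon> (w m n)) (%x. \<phi> x *\<^sub>R w m n x) = ip ?M (%x. cut R x *\<^sub>R w m n x) (app \<epsilon> (%x. cut R x *\<^sub>R w m n x))" for m n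
  unfolding app_scaleR by (simp_all add: ip_def \<phi>_def inner_commute mult_ac)
 have "\<exists>K. \<forall>m\<ge>K. \<forall>n\<ge>K. \<bar>ip ?M (%x. cut R x *\<^sub>R w m n x) (app \<epsilon> (%x. cut R x *\<^sub>R w m n x))\<bar> < c * e\<^sup>2"
  using d
 proof
  assume "divrot_Cauchy Om (%n. wt t (u n)) (%n. wt t (app \<epsilon> (u n)))"
  from this[unfolded divrot_Cauchy_def, rule_format, OF \<phi>, of "c * e\<^sup>2"] c(1) e
  show ?thesis unfolding s(1)[symmetric] aw by (simp add: w_def[abs_def])
 next
  assume "divrot_Cauchy Om (%n. wt t (app \<epsilon> (u n))) (%n. wt t (u n))"
  from this[unfolded divrot_Cauchy_def, rule_format, OF \<phi>, of "c * e\<^sup>2"] c(1) e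
  show ?thesis unfolding s(2)[symmetric] aw by (simp add: w_def[abs_def] aw[abs_def] aw)
 qed
 then obtain K where K: "\<And>m n. m \<ge> K ==> n \<ge> K ==> \<bar>ip ?M (%x. cut R x *\<^sub>R w m n x) (app \<epsilon> (%x. cut R x *\<^sub>R w m n x))\<bar> < c * e\<^sup>2" by blast
 have "nrm (lebesgue_on (Om \<inter> ball 0 R)) (w m n) < e" if "m \<ge> K" "n \<ge> K" for m n
 proof -
  have sc: "sq ?M (%x. cut R x *\<^sub>R w m n x)" using cw by (simp add: L2w_zero_iff)
  have si: "(%x. indicat_real (ball 0 R) x *\<^sub>R w m n x) \<in> borel_measurable ?M"
   using L2w_imp_L2loc[OF Om w] R unfolding L2loc_iff[OF Om] sq_def by blast
  have "norm (indicat_real (ball 0 R) x *\<^sub>R w m n x) \<le> 1 * norm (cut R x *\<^sub>R w m n x)" for x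
   using cut_one[OF R, of x] by (auto simp: indicator_def)
  from sq_dom(2)[OF sc si AE_I2[OF this]]
  have "nrm (lebesgue_on (Om \<inter> ball 0 R)) (w m n) \<le> nrm ?M (%x. cut R x *\<^sub>R w m n x)" unfolding sq_ball_iff(2)[OF Om] by simp
  moreover have "c * (nrm ?M (%x. cut R x *\<^sub>R w m n x))\<^sup>2 < c * e\<^sup>2" using c(2)[OF cw, of m n] K[OF that] by linarith
  then have "nrm ?M (%x. cut R x *\<^sub>R w m n x) < e" using c(1) e by (simp add: power2_less_imp_less)
  ultimately show ?thesis by linarith
 qed
 then show "\<exists>K. \<forall>m\<ge>K. \<forall>n\<ge>K. nrm (lebesgue_on (Om \<inter> ball 0 R)) (%x. wt t (u m) x - wt t (u n) x) < e"
  unfolding w_def by blast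
qed

section \<open>Transfer of the far field to the whole space\<close>

lemma ip_extend:
 fixes Om :: "(real ^ 'n::finite) set"
 assumes "open Om" shows "ip lebesgue (%x. if x \<in> Om then f x else 0) g = ip (lebesgue_on Om) f g"
proof -
 have "ip lebesgue (%x. if x \<in> Om then f x else 0) g = ip (lebesgue_on Om) (%x. if x \<in> Om then f x else 0) g"
  by (rule ip_restrict[OF assms, symmetric]) simp
 also have "\<dots> = ip (lebesgue_on Om) f g" unfolding ip_def by (intro Bochner_Integration.integral_cong) auto
 finally show ?thesis .
qed

lemma sq_extend:
 fixes Om :: "(real ^ 'n::finite) set"
 assumes "open Om" shows "sq lebesgue (%x. if x \<in> Om then f x else 0) \<longleftrightarrow> sq (lebesgue_on Om) f"
proof -
 note S = open_lebesgue[OF assms]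
 have "(norm (if x \<in> Om then f x else 0))\<^sup>2 = (if x \<in> Om then (norm (f x))\<^sup>2 else 0)" for x by simp
 then show ?thesis unfolding sq_def by (simp add: borel_measurable_if[OF S] Lebesgue_Measure.integrable_restrict_UNIV[OF S])
qed

lemma grad_one_minus: "smooth f ==> grad (%x. 1 - f x) x = - grad f x"
 by (simp add: grad_def partial_deriv_diff[where f="%_. 1"] vec_eq_iff)

lemma R_op_minus: "R_op (- p) v = - R_op p v" and ctr_minus: "ctr (- p) v = - ctr p v"
 by (simp_all add: R_op_def ctr_def sum_negf)

lemma cutoff_test_forms:
 assumes "- Om \<subseteq> ball 0 a" "a > 0" "\<Psi> \<in> test_forms UNIV q"
 shows "(%x. (1 - cut a x) *\<^sub>R \<Psi> x) \<in> test_forms Om q"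
proof -
 note t = test_formsD[OF test_forms_mult[OF _ assms(3), of "%x. 1 - cut a x"]]
 have s: "smooth (%x. 1 - cut a x)" by (intro allI Ck_diff Ck_const spec[OF smooth_cut])
 obtain K where K: "compact K" "\<And>x. x \<notin> K ==> \<Psi> x = 0" using test_formsD(4)[OF assms(3)] by blast
 show ?thesis
 proof (rule test_formsI[OF t(1)[OF s], of "K - ball 0 a"])
  show "compact (K - ball 0 a)" by (rule compact_diff[OF K(1)]) simp
  show "K - ball 0 a \<subseteq> Om" using assms(1) by blast
  show "(1 - cut a x) *\<^sub>R \<Psi> x = 0" if "x \<notin> K - ball 0 a" for x
   using that K(2)[of x] cut_one[OF assms(2), of x] by auto
 qed (rule t(3)[OF s])
qed

text \<open>A test form on the whole space is made admissible for \<open>Om\<close> by a second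
  cut-off at radius \<open>a\<close>. For \<open>R \<ge> 2 * a\<close> this cut-off equals 1
  wherever \<open>1 - cut R\<close> or the gradient of \<open>cut R\<close> is nonzero, so it leaves
  no trace in the formulas.\<close>

lemma far_transfer:
 fixes Om :: "(real ^ 'n::{finite,linorder}) set"
 assumes Om: "open Om" and a: "- Om \<subseteq> ball 0 a" "a > 0" and R: "R \<ge> 2 * a"
 shows "has_rot Om q Z (%x. 0) ==> \<Psi> \<in> test_forms UNIV (q + 1) ==>
   ip (lebesgue_on Om) (%x. (1 - cut R x) *\<^sub>R Z x) (codd \<Psi>) = ip (lebesgue_on Om) (%x. R_op (grad (cut R) x) (Z x)) \<Psi>"
  and "has_div Om q Z (%x. 0) ==> \<Phi> \<in> test_forms UNIV (q - 1) ==>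
   ip (lebesgue_on Om) (%x. (1 - cut R x) *\<^sub>R Z x) (ext_d \<Phi>) = ip (lebesgue_on Om) (%x. ctr (grad (cut R) x) (Z x)) \<Phi>"
proof -
 let ?M = "lebesgue_on Om" and ?\<eta> = "%x :: real ^ ('n::{finite,linorder}). 1 - cut a x"
 have R0: "R > 0" using a R by simp
 have s: "smooth (%x :: real ^ ('n::{finite,linorder}). 1 - cut r x)" for r by (intro allI Ck_diff Ck_const spec[OF smooth_cut])
 have g: "grad ?\<eta> x = 0" "?\<eta> x = 1" if "norm x > R" for x
  using that R cut_grad_zero[OF a(2), of x] cut_zero[OF a(2), of x] by (simp_all add: grad_one_minus[OF smooth_cut])
 have z: "1 - cut R x = 0" if "\<not> norm x > R" for x :: "real ^ ('n::{finite,linorder})" using cut_one[OF R0, of x] that by simp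
 have gz: "grad (cut R) x = 0" if "\<not> norm x \<ge> R" for x :: "real ^ ('n::{finite,linorder})" using cut_grad_zero[OF R0, of x] that by simp
 have z0: "f p \<bullet> c *\<^sub>R v = f p \<bullet> v" if "\<not> r ==> p = 0" "r ==> c = 1" "f 0 = 0" for r and p :: "real ^ ('n::{finite,linorder})" and c and f :: "_ => 'n alg" and v
  using that by (cases r) auto
 have e1: "?\<eta> x = 1" if "norm x \<ge> R" for x :: "real ^ ('n::{finite,linorder})" using cut_zero[OF a(2), of x] that R by simp
 {
  assume h: "has_rot Om q Z (%x. 0)" and P: "\<Psi> \<in> test_forms UNIV (q + 1)"
  let ?P = "%x. ?\<eta> x *\<^sub>R \<Psi> x"
  have "codd ?P x = codd \<Psi> x" if "norm x > R" for x
   unfolding ext_d_scaleR(2)[OF s test_formsD(1)[OF P]] g[OF that] by (simp add: R_op_def ctr_def)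
  then have "ip ?M (%x. (1 - cut R x) *\<^sub>R Z x) (codd \<Psi>) = ip ?M (%x. (1 - cut R x) *\<^sub>R Z x) (codd ?P)"
   unfolding ip_def using z by (intro Bochner_Integration.integral_cong refl) (metis (no_types, lifting) inner_zero_left scaleR_zero_left)
  also have "\<dots> = - ip ?M (%x. (1 - cut R x) *\<^sub>R 0 + R_op (grad (%x. 1 - cut R x) x) (Z x)) ?P"
   using has_rot_mult[OF Om s h, of R] cutoff_test_forms[OF a P] unfolding has_rot_iff[OF Om] by blast
  also have "\<dots> = ip ?M (%x. R_op (grad (cut R) x) (Z x)) ?P"
   unfolding grad_one_minus[OF smooth_cut] R_op_minus by (simp add: ip_def)
  also have "\<dots> = ip ?M (%x. R_op (grad (cut R) x) (Z x)) \<Psi>"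
   unfolding ip_def by (intro Bochner_Integration.integral_cong refl, rule z0[where f="%p. R_op p _", OF gz e1]) (simp_all add: R_op_def)
  finally show "ip ?M (%x. (1 - cut R x) *\<^sub>R Z x) (codd \<Psi>) = ip ?M (%x. R_op (grad (cut R) x) (Z x)) \<Psi>" .
 next
  assume h: "has_div Om q Z (%x. 0)" and P: "\<Phi> \<in> test_forms UNIV (q - 1)"
  let ?P = "%x. ?\<eta> x *\<^sub>R \<Phi> x"
  have "ext_d ?P x = ext_d \<Phi> x" if "norm x > R" for x
   unfolding ext_d_scaleR(1)[OF s test_formsD(1)[OF P]] g[OF that] by (simp add: R_op_def ctr_def)
  then have "ip ?M (%x. (1 - cut R x) *\<^sub>R Z x) (ext_d \<Phi>) = ip ?M (%x. (1 - cut R x) *\<^sub>R Z x) (ext_d ?P)"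
   unfolding ip_def using z by (intro Bochner_Integration.integral_cong refl) (metis (no_types, lifting) inner_zero_left scaleR_zero_left)
  also have "\<dots> = - ip ?M (%x. (1 - cut R x) *\<^sub>R 0 + ctr (grad (%x. 1 - cut R x) x) (Z x)) ?P"
   using has_div_mult[OF Om s h, of R] cutoff_test_forms[OF a P] unfolding has_div_iff[OF Om] by blast
  also have "\<dots> = ip ?M (%x. ctr (grad (cut R) x) (Z x)) ?P"
   unfolding grad_one_minus[OF smooth_cut] ctr_minus by (simp add: ip_def)
  also have "\<dots> = ip ?M (%x. ctr (grad (cut R) x) (Z x)) \<Phi>"
   unfolding ip_def by (intro Bochner_Integration.integral_cong refl, rule z0[where f="%p. ctr p _", OF gz e1]) (simp_all add: ctr_def)
  finally show "ip ?M (%x. (1 - cut R x) *\<^sub>R Z x) (ext_d \<Phi>) = ip ?M (%x. ctr (grad (cut R) x) (Z x)) \<Phi>" .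
 }
qed

lemma cut_L2w:
 fixes u :: "('n::{finite,linorder}) form"
 assumes "R > 0" "u \<in> L2w Om q s"
 shows "(%x. R_op (grad (cut R) x) (u x)) \<in> L2w Om (q + 1) a" "(%x. ctr (grad (cut R) x) (u x)) \<in> L2w Om (q - 1) a"
  "(%x. cut R x *\<^sub>R u x) \<in> L2w Om q a" "(%x. (1 - cut R x) *\<^sub>R u x) \<in> L2w Om q s"
proof -
 obtain C where C: "C \<ge> 0" "\<And>x :: real ^ ('n::{finite,linorder}). \<bar>cut R x\<bar> * rho x powr a \<le> C * rho x powr s"
  "\<And>x :: real ^ ('n::{finite,linorder}). (\<Sum>n\<in>UNIV. \<bar>grad (cut R) x $ n\<bar>) * rho x powr a \<le> C * rho x powr s"
  by (rule C0_inf_bounds[OF C0_inf_cut[OF assms(1)], of a s a s], rule that) auto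
 show "(%x. R_op (grad (cut R) x) (u x)) \<in> L2w Om (q + 1) a" "(%x. ctr (grad (cut R) x) (u x)) \<in> L2w Om (q - 1) a"
  by (rule grad_L2w(1,3)[OF assms(2) smooth_cut C(1,3)])+
 show "(%x. cut R x *\<^sub>R u x) \<in> L2w Om q a" by (rule mult_L2w(1)[OF assms(2) smooth_continuous[OF smooth_cut] C(1,2)])
 show "(%x. (1 - cut R x) *\<^sub>R u x) \<in> L2w Om q s"
  by (rule mult_L2w(1)[OF assms(2), of _ 1])
   (use smooth_continuous[OF smooth_cut] in \<open>auto intro!: continuous_on_diff continuous_on_const mult_right_mono\<close>)
qed

text \<open>The cut-off field solves equations on the whole space with two kinds of sources:
  gradient terms of the cut-off, which have bounded support and hence any weight, and
  \<open>V1\<close>, \<open>V2\<close>, which enter under a derivative and may be merely square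
  integrable. The part near the boundary is square integrable anyway.\<close>

lemma far_field_L2:
 fixes Om :: "(real ^ 'n::{finite,linorder}) set"
 assumes N: "CARD('n) \<ge> 3" and Om: "open Om" and a: "- Om \<subseteq> ball 0 a" "a > 0"
  and E: "E \<in> L2w Om q \<sigma>" "- real CARD('n) / 2 < \<sigma>" and V: "V1 \<in> L2w Om q 0" "V2 \<in> L2w Om q 0"
  and h: "has_rot Om q (%x. E x + V1 x) (%x. 0)" "has_div Om q (%x. E x + V2 x) (%x. 0)"
 shows "E \<in> L2w Om q 0"
proof -
 let ?M = "lebesgue_on Om"
 define R where "R = 2 * a"
 have R: "R \<ge> 2 * a" "R > 0" using a by (auto simp: R_def)
 define z where "z f x = (if x \<in> Om then f x else 0)" for f :: "'n form" and x
 let ?f = "%u x. (1 - cut R x) *\<^sub>R u x"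
 define s where "s = min \<sigma> 0"
 have EV: "(%x. E x + V1 x) \<in> L2w Om q s" "(%x. E x + V2 x) \<in> L2w Om q s"
  by (intro L2w_add L2w_mono[OF _ E(1)] L2w_mono[OF _ V(1)] L2w_mono[OF _ V(2)]; simp add: s_def)+
 let ?J = "%x. R_op (grad (cut R) x) (E x + V1 x)" and ?j = "%x. ctr (grad (cut R) x) (E x + V2 x)"
 have ze: "rho x powr r *\<^sub>R z f x = z (wt r f) x" for r f x by (simp add: z_def)
 have zs: "sq lebesgue (z f) \<longleftrightarrow> sq ?M f" for f unfolding z_def[abs_def] by (rule sq_extend[OF Om])
 have zi: "ip lebesgue (z f) g = ip ?M f g" for f g unfolding z_def[abs_def] by (rule ip_extend[OF Om])
 note fE = cut_L2w(4)[OF R(2) E(1)]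
 have int: "integrable ?M (%x. u x \<bullet> v x)" if "u \<in> L2w Om q r" "v \<in> test_forms UNIV q" for u v r
  by (rule L2_pair_loc(2)[OF Om L2w_imp_L2loc[OF Om that(1)] test_formsD(2)[OF that(2)] test_cont[OF that(2)]])
 have split: "ip ?M (?f E) v = ip ?M (%x. (1 - cut R x) *\<^sub>R (E x + V x)) v + ip ?M (%x. - ?f V x) v"
  if "v \<in> test_forms UNIV q" "V \<in> L2w Om q 0" for v V
  using int[OF fE that(1)] int[OF cut_L2w(4)[OF R(2) that(2)] that(1)]
  by (simp add: ip_def scaleR_add_right inner_add_left)
 have "sq lebesgue (z (?f E))"
 proof (rule whole_space_regularity[where q=q and \<sigma>=\<sigma> and J="z ?J" and j="z ?j" and ?w1.0="z (%x. - ?f V1 x)" and ?w2.0="z (%x. - ?f V2 x)"])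
  show "3 \<le> CARD('n)" by (rule N)
  show "- real CARD('n) / 2 < \<sigma>" by (rule E(2))
  show "z (?f E) \<in> borel_measurable lebesgue"
   unfolding z_def[abs_def] borel_measurable_if[OF open_lebesgue[OF Om]] by (rule L2w_measurable[OF fE])
  show "z (?f E) x \<in> alt q" for x using L2w_alt[OF fE] by (simp add: z_def)
  show "sq lebesgue (%x. rho x powr \<sigma> *\<^sub>R z (?f E) x)" unfolding ze zs by (rule L2w_sq[OF fE])
  show "sq lebesgue (%x. rho x powr 1 *\<^sub>R z ?J x)" unfolding ze zs by (rule L2w_sq[OF cut_L2w(1)[OF R(2) EV(1)]])
  show "sq lebesgue (%x. rho x powr 1 *\<^sub>R z ?j x)" unfolding ze zs by (rule L2w_sq[OF cut_L2w(2)[OF R(2) EV(2)]])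
  show "sq lebesgue (z (%x. - ?f V1 x))" "sq lebesgue (z (%x. - ?f V2 x))"
   unfolding zs using cut_L2w(4)[OF R(2) V(1)] cut_L2w(4)[OF R(2) V(2)] by (auto intro!: sq_minus simp: L2w_zero_iff)
  show "ip lebesgue (z (?f E)) (codd \<Psi>) = ip lebesgue (z ?J) \<Psi> + ip lebesgue (z (%x. - ?f V1 x)) (codd \<Psi>)"
   if "\<Psi> \<in> test_forms UNIV (q + 1)" for \<Psi>
   unfolding zi far_transfer(1)[OF Om a R(1) h(1) that, symmetric] using split[OF _ V(1)] test_forms_codd[OF that] by simp
  show "ip lebesgue (z (?f E)) (ext_d \<Phi>) = ip lebesgue (z ?j) \<Phi> + ip lebesgue (z (%x. - ?f V2 x)) (ext_d \<Phi>)"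
   if "\<Phi> \<in> test_forms UNIV (q - 1)" for \<Phi>
   unfolding zi far_transfer(2)[OF Om a R(1) h(2) that, symmetric] using split[OF _ V(2)] test_forms_ext_d[OF that] by simp
 qed
 then have "?f E \<in> L2w Om q 0" unfolding zs using L2w_alt[OF fE] by (simp add: L2w_zero_iff)
 from L2w_add[OF this cut_L2w(3)[OF R(2) E(1)]] show ?thesis by (simp add: scaleR_left_distrib[symmetric])
qed

text \<open>The weight \<open>w\<close> serves only for the measurability and the rank of
  \<open>G'\<close>: being almost everywhere equal to \<open>G\<close>, it inherits the weight
  \<open>s'\<close>.\<close>

lemma has_rot0_change_rot:
 assumes Om: "open Om" and r: "has_rot0 Om q s s' E G" and G: "has_rot Om q E G'" "G' \<in> L2w Om (q + 1) w"
 shows "has_rot0 Om q s s' E G'"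
proof -
 have ae: "AE x in lebesgue_on Om. G x = G' x" by (rule has_rot_unique[OF Om has_rot0_has_rot[OF Om r] G(1)])
 note g = L2w_AE(1)[OF has_rot0_L2w(2)[OF r] L2w_measurable[OF G(2)] L2w_alt[OF G(2)] ae]
 have "L2w_norm Om s' (%x. G x - G' x) = L2w_norm Om s' (%x. 0 :: 'a alg)"
  by (rule L2w_AE(2)[OF L2w_diff[OF has_rot0_L2w(2)[OF r] g], of _ q]) (use ae in \<open>auto simp: alt_def\<close>)
 then have "L2w_norm Om s' (%x. G x - G' x) = 0" by (simp add: L2w_norm_nrm)
 then show ?thesis
  by (intro has_rot0_closed[where E="%_. E" and G="%_. G", OF Om r has_rot0_L2w(1)[OF r] _ g]) (simp_all add: L2w_norm_nrm)
qed

section \<open>Rotation-free and divergence-free forms\<close>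

lemma tail_tendsto_0:
 fixes E :: "real ^ 'n::finite => 'b::euclidean_space"
 assumes "sq (lebesgue_on Om) E"
 shows "sq (lebesgue_on Om) (%x. indicat_real (- ball 0 R) x *\<^sub>R E x)"
  and "(%k. nrm (lebesgue_on Om) (%x. indicat_real (- ball 0 (real k)) x *\<^sub>R E x)) \<longlonglongrightarrow> 0"
proof -
 let ?M = "lebesgue_on Om"
 have mi: "indicat_real (- ball 0 R) \<in> borel_measurable ?M" for R
  by (rule measurable_restrict_space1, rule borel_measurable_indicator) simp
 have m: "(%x. indicat_real (- ball 0 R) x *\<^sub>R E x) \<in> borel_measurable ?M" for R
  by (intro borel_measurable_scaleR mi sq_measurable[OF assms])
 show "sq ?M (%x. indicat_real (- ball 0 R) x *\<^sub>R E x)"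
  by (rule sq_dom(1)[OF assms m, where C=1]) (auto simp: indicator_def)
 have "(%k. integral\<^sup>L ?M (%x. (norm (indicat_real (- ball 0 (real k)) x *\<^sub>R E x))\<^sup>2)) \<longlonglongrightarrow> integral\<^sup>L ?M (%x. 0)"
 proof (rule integral_dominated_convergence[where w="%x. (norm (E x))\<^sup>2"])
  show "AE x in ?M. (%k. (norm (indicat_real (- ball 0 (real k)) x *\<^sub>R E x))\<^sup>2) \<longlonglongrightarrow> 0"
  proof (rule AE_I2, rule tendsto_eventually)
   fix x :: "real ^ 'n"
   obtain K where "norm x < real K" using reals_Archimedean2 by blast
   then have "(norm (indicat_real (- ball 0 (real k)) x *\<^sub>R E x))\<^sup>2 = 0" if "k \<ge> K" for k using that by (auto simp: indicator_def)
   then show "\<forall>\<^sub>F k in sequentially. (norm (indicat_real (- ball 0 (real k)) x *\<^sub>R E x))\<^sup>2 = 0"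
    unfolding eventually_sequentially by blast
  qed
  show "(%x. (norm (indicat_real (- ball 0 (real k)) x *\<^sub>R E x))\<^sup>2) \<in> borel_measurable ?M" for k
   by (rule borel_measurable_power[OF measurable_compose[OF m borel_measurable_norm]])
  show "AE x in ?M. norm ((norm (indicat_real (- ball 0 (real k)) x *\<^sub>R E x))\<^sup>2) \<le> (norm (E x))\<^sup>2" for k
   by (rule AE_I2) (auto simp: indicator_def)
 qed (use sq_integrable[OF assms] in auto)
 from tendsto_real_sqrt[OF this]
 show "(%k. nrm ?M (%x. indicat_real (- ball 0 (real k)) x *\<^sub>R E x)) \<longlonglongrightarrow> 0" by (simp add: nrm_def)
qed

text \<open>On the annulus where \<open>grad (cut R)\<close> lives, \<open>\<rho> \<bar>grad (cut R)\<bar>\<close> is bounded; this is what gains the weight \<open>1\<close>.\<close>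

lemma has_rot0_of_R0_loc:
 fixes Om :: "(real ^ 'n::{finite,linorder}) set"
 assumes Om: "open Om" and E: "E \<in> L2w Om q 0" "E \<in> R0_loc Om q" and h: "has_rot Om q E (%x. 0)"
 shows "has_rot0 Om q 0 1 E (%x. 0)"
proof -
 let ?M = "lebesgue_on Om"
 let ?G = "%R x. R_op (grad (cut R) x) (E x)"
 have r: "has_rot0 Om q 0 1 (%x. cut R x *\<^sub>R E x) (?G R)" if R: "R > 0" for R
 proof -
  have "(%x. cut R x *\<^sub>R E x) \<in> bold_R0 Om q 0" using E(2) by (simp add: R0_loc_def C0_inf_cut[OF R])
  then obtain G where G: "has_rot0 Om q 0 0 (%x. cut R x *\<^sub>R E x) G" using rot0_iff[OF Om] by blast
  have hr: "has_rot Om q (%x. cut R x *\<^sub>R E x) (?G R)" using has_rot_mult[OF Om smooth_cut h, of R] by simp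
  have r1: "has_rot0 Om q 0 0 (%x. cut R x *\<^sub>R E x) (?G R)" by (rule has_rot0_change_rot[OF Om G hr cut_L2w(1)[OF R E(1)]])
  \<comment> \<open>So far the rotation has weight 0. Multiplying by \<open>cut (2 * R)\<close>,
    which is 1 on the support of \<open>cut R\<close>, changes neither the form nor its rotation but
    permits the weight 1.\<close>
  have R2: "2 * R > 0" using R by simp
  have 1: "cut (2 * R) x *\<^sub>R cut R x *\<^sub>R E x = cut R x *\<^sub>R E x" for x
   using cut_one[OF R2, of x] cut_zero[OF R, of x] by (cases "norm x \<le> 2 * R") auto
  have 2: "cut (2 * R) x *\<^sub>R ?G R x + R_op (grad (cut (2 * R)) x) (cut R x *\<^sub>R E x) = ?G R x" for x
  proof (cases "norm x < 2 * R")
   case True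
   then show ?thesis using cut_one[OF R2, of x] cut_grad_zero[OF R2, of x] by (simp add: R_op_def)
  next
   case False
   then have c: "cut R x = 0" using cut_zero[OF R, of x] by simp
   show ?thesis
   proof (cases "norm x = 2 * R")
    case True
    then show ?thesis using cut_one[OF R2, of x] c by simp
   next
    case ne: False
    then show ?thesis using cut_grad_zero[OF R, of x] False c by (simp add: R_op_def)
   qed
  qed
  from has_rot0_cut[OF Om r1 C0_inf_cut[OF R2], of 0 1] show ?thesis unfolding 1 2 .
 qed
 obtain C where C: "C > 0" "\<And>R x. R > 0 ==> (\<Sum>n\<in>UNIV. \<bar>grad (cut R) (x :: real ^ ('n::{finite,linorder})) $ n\<bar>) \<le> C / R"
  using cut_grad_bound by blast
 have sE: "sq ?M E" using E(1) by (simp add: L2w_zero_iff)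
 let ?t = "%k. nrm ?M (%x. indicat_real (- ball 0 (real k)) x *\<^sub>R E x)"
 note T = tail_tendsto_0[OF sE]
 have T': "(%k. ?t (Suc k)) \<longlonglongrightarrow> 0" using LIMSEQ_Suc[OF T(2)] by simp
 have b1: "L2w_norm Om 0 (%x. cut (real (Suc k)) x *\<^sub>R E x - E x) \<le> ?t (Suc k)" for k
 proof -
  have m: "(%x. cut (real (Suc k)) x *\<^sub>R E x - E x) \<in> borel_measurable ?M"
   by (rule L2w_measurable[OF L2w_diff[OF cut_L2w(3)[OF _ E(1)] E(1)]]) simp
  have "norm (cut (real (Suc k)) x *\<^sub>R E x - E x) \<le> 1 * norm (indicat_real (- ball 0 (real (Suc k))) x *\<^sub>R E x)" for x
  proof (cases "norm x < real (Suc k)")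
   case True
   then show ?thesis using cut_one[of "real (Suc k)" x] by simp
  next
   case False
   have "cut (real (Suc k)) x *\<^sub>R E x - E x = - ((1 - cut (real (Suc k)) x) *\<^sub>R E x)" by (simp add: algebra_simps)
   then have "norm (cut (real (Suc k)) x *\<^sub>R E x - E x) = (1 - cut (real (Suc k)) x) * norm (E x)" by simp
   also have "\<dots> \<le> 1 * norm (E x)" by (intro mult_right_mono) auto
   finally show ?thesis using False by (simp add: indicator_def)
  qed
  from sq_dom(2)[OF T(1) m AE_I2[OF this]] show ?thesis by (simp add: L2w_norm_zero)
 qed
 have b2: "L2w_norm Om 1 (?G (real (Suc k))) \<le> (3 * C) * ?t (Suc k)" for k
 proof -
  let ?R = "real (Suc k)"
  note G = has_rot0_L2w(2)[OF r[of ?R]]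
  have "norm (wt 1 (?G ?R) x) \<le> (3 * C) * norm (indicat_real (- ball 0 ?R) x *\<^sub>R E x)" for x
  proof (cases "norm x < ?R \<or> norm x > 2 * ?R")
   case True
   then have "grad (cut ?R) x = 0" by (intro cut_grad_zero) auto
   then show ?thesis using C(1) by (simp add: R_op_def)
  next
   case False
   \<comment> \<open>On the annulus \<open>rho\<close> is at most 1 + 2 R, and the radii used are at
     least 1; the factor R cancels the 1 / R of the gradient.\<close>
   have "rho x \<le> 3 * ?R" using rho_le[of x] False by simp
   then have "rho x * (\<Sum>n\<in>UNIV. \<bar>grad (cut ?R) x $ n\<bar>) \<le> (3 * ?R) * (C / ?R)"
    using C(2)[of ?R x] by (intro mult_mono) (auto intro: sum_nonneg)
   also have "\<dots> = 3 * C" by (simp del: of_nat_Suc)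
   finally have a: "rho x * (\<Sum>n\<in>UNIV. \<bar>grad (cut ?R) x $ n\<bar>) * norm (E x) \<le> 3 * C * norm (E x)" by (rule mult_right_mono) simp
   have "norm (wt 1 (?G ?R) x) \<le> rho x * ((\<Sum>n\<in>UNIV. \<bar>grad (cut ?R) x $ n\<bar>) * norm (E x))"
    using rho_ge_1[of x] by (auto intro!: mult_left_mono norm_R_op)
   with a show ?thesis using False by (simp add: indicator_def mult.assoc)
  qed
  from sq_dom(2)[OF T(1) sq_measurable[OF L2w_sq[OF G]] AE_I2[OF this]] C(1) show ?thesis by (simp add: L2w_norm_nrm)
 qed
 show ?thesis
 proof (rule has_rot0_closed[OF Om r[of "real (Suc _)"] E(1) _ L2w_zero])
  show "(%k. L2w_norm Om 0 (%x. cut (real (Suc k)) x *\<^sub>R E x - E x)) \<longlonglongrightarrow> 0"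
   by (rule Lim_null_comparison[OF always_eventually[OF allI] T']) (use b1 in simp)
  show "(%k. L2w_norm Om 1 (%x. ?G (real (Suc k)) x - 0)) \<longlonglongrightarrow> 0"
   by (rule Lim_null_comparison[OF always_eventually[OF allI] tendsto_mult_right_zero[OF T', of "3 * C"]]) (use b2 in simp)
 qed simp
qed

lemma smult_scaleR: "c *s (r *\<^sub>R v) = r *\<^sub>R (c *s v)" for v :: "('n::finite) alg"
 by (simp add: vec_eq_iff)

lemma has_rot0_smult:
 assumes "open Om" "has_rot0 Om q s s' E G" shows "has_rot0 Om q s s' (%x. c *s E x) (%x. c *s G x)"
proof -
 obtain \<Phi> where P: "\<And>k::nat. \<Phi> k \<in> test_forms Om q" "(%k. L2w_norm Om s (%x. E x - \<Phi> k x)) \<longlonglongrightarrow> 0"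
  "(%k. L2w_norm Om s' (%x. G x - ext_d (\<Phi> k) x)) \<longlonglongrightarrow> 0" using has_rot0E[OF assms(2)] by blast
 have n: "L2w_norm Om w (%x. c *s u x) = cmod c * L2w_norm Om w u" for w u
  unfolding L2w_norm_nrm nrm_smult[symmetric] smult_scaleR ..
 have l: "(%x. c *s u x) \<in> L2w Om p w" if "u \<in> L2w Om p w" for u p w
  using sq_smult[OF L2w_sq[OF that], of c] L2w_alt[OF that] unfolding L2w_iff smult_scaleR by (auto intro: alt_smult)
 have d: "c *s u - c *s v = c *s (u - v)" for u v :: "'a alg" by (simp add: vector_sub_rdistrib vec_eq_iff algebra_simps)
 show ?thesis
 proof (rule has_rot0I[where \<Phi>="%k x. c *s \<Phi> k x"])
  show "(%k. L2w_norm Om s (%x. c *s E x - c *s \<Phi> k x)) \<longlonglongrightarrow> 0"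
   unfolding d n by (rule tendsto_mult_right_zero[OF P(2)])
  show "(%k. L2w_norm Om s' (%x. c *s G x - ext_d (%x. c *s \<Phi> k x) x)) \<longlonglongrightarrow> 0"
   unfolding ext_d_smult[OF test_formsD(1)[OF P(1)]] d n by (rule tendsto_mult_right_zero[OF P(3)])
 qed (intro l has_rot0_L2w[OF assms(2)] test_forms_smult P)+
qed

text \<open>A Helmholtz splitting: \<open>k\<close> is the projection of \<open>X\<close> onto the
  closure of the rotations of test forms. The remainder is divergence-free, and \<open>k\<close> is
  orthogonal to every divergence-free field; the factor \<open>c\<close> makes this cover real and
  imaginary parts of complex pairings.\<close>

lemma ker_split:
 fixes X :: "('n::{finite,linorder}) form"
 assumes Om: "open Om" and X: "X \<in> L2w Om q 0"
 obtains k where "has_rot0 Om q 0 1 k (%x. 0)" "has_div Om q (%x. X x - k x) (%x. 0)"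
  "\<And>Z c. Z \<in> L2w Om q 0 ==> has_div Om q Z (%x. 0) ==> ip (lebesgue_on Om) Z (%x. c *s k x) = 0"
proof -
 let ?M = "lebesgue_on Om" and ?T = "test_forms Om (q - 1)"
 have sX: "sq ?M X" using X by (simp add: L2w_zero_iff)
 have t: "ext_d \<psi> \<in> test_forms Om q" "ext_d \<psi> \<in> L2w Om q 0" "sq ?M (ext_d \<psi>)" if "\<psi> \<in> ?T" for \<psi>
  using test_forms_ext_d[OF that] test_L2w[OF Om test_forms_ext_d[OF that], of 0] by (simp_all add: L2w_zero_iff)
 obtain k s where k: "sq ?M k" "\<And>x. x \<in> space ?M ==> k x \<in> alt q" "\<And>j::nat. s j \<in> ext_d ` ?T"
  "(%j. nrm ?M (%x. s j x - k x)) \<longlonglongrightarrow> 0" "\<And>u. u \<in> ext_d ` ?T ==> ip ?M k u = ip ?M X u" "nrm ?M k \<le> nrm ?M X"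
 proof (rule L2_project[of ?M X "ext_d ` ?T" "alt q"])
  show "(%x. a *\<^sub>R u x + v x) \<in> ext_d ` ?T" if uv: "u \<in> ext_d ` ?T" "v \<in> ext_d ` ?T" for u v a
  proof -
   obtain \<phi> \<psi> where T: "\<phi> \<in> ?T" "\<psi> \<in> ?T" "u = ext_d \<phi>" "v = ext_d \<psi>" using uv by auto
   have "(%x. a *\<^sub>R u x + v x) = ext_d (%x. a *\<^sub>R \<phi> x + \<psi> x)"
    unfolding T using ext_d_lincomb[OF test_formsD(1)[OF T(1)] test_formsD(1)[OF T(2)]] by auto
   then show ?thesis using test_forms_lincomb[OF T(1,2), of a] by auto
  qed
  show "u x \<in> alt q" if "u \<in> ext_d ` ?T" for u x using that test_formsD(3)[OF t(1)] by auto
  show "0 \<in> (alt q :: 'n alg set)" by (simp add: alt_def)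
  show "ext_d ` ?T \<noteq> {}" using test_forms_zero by blast
 qed (use sX t(3) closed_alt in auto)
 have "\<forall>j. \<exists>\<psi>. \<psi> \<in> ?T \<and> s j = ext_d \<psi>" using k(3) by auto
 from choice[OF this] obtain \<psi> where \<psi>: "\<And>j. \<psi> j \<in> ?T" "\<And>j. s j = ext_d (\<psi> j)" by blast
 have kL: "k \<in> L2w Om q 0" using k(1,2) by (simp add: L2w_zero_iff)
 have e: "ext_d (ext_d (\<psi> j)) = (%x. 0)" for j using ext_d_ext_d[OF test_formsD(1)[OF \<psi>(1)]] by blast
 have 1: "has_rot0 Om q 0 1 k (%x. 0)"
  using k(4) unfolding nrm_minus_commute[of _ _ k]
  by (intro has_rot0I[OF kL L2w_zero t(1)[OF \<psi>(1)]]) (simp_all add: e L2w_norm_nrm \<psi>(2))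
 have 2: "has_div Om q (%x. X x - k x) (%x. 0)" unfolding has_div_iff[OF Om]
 proof (intro conjI ballI)
  show "(%x. X x - k x) \<in> L2loc Om q" by (rule L2w_imp_L2loc[OF Om L2w_diff[OF X kL]])
  show "(%x. 0) \<in> L2loc Om (q - 1)" by (rule L2loc_zero[OF Om])
  fix \<phi> assume T: "\<phi> \<in> ?T"
  have "ip ?M (%x. X x - k x) (ext_d \<phi>) = ip ?M X (ext_d \<phi>) - ip ?M k (ext_d \<phi>)" by (rule ip_diff_left[OF sX k(1) t(3)[OF T]])
  then show "ip ?M (%x. X x - k x) (ext_d \<phi>) = - ip ?M (%x. 0) \<phi>" using k(5) T by (simp add: ip_def)
 qed
 have 3: "ip ?M Z k = 0" if Z: "Z \<in> L2w Om q 0" "has_div Om q Z (%x. 0)" for Z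
 proof -
  have "(%j. ip ?M (s j) Z) \<longlonglongrightarrow> ip ?M k Z"
   using Z(1) by (intro ip_tendsto[OF _ k(1) _ k(4)]) (simp_all add: \<psi> t L2w_zero_iff)
  moreover have "ip ?M (s j) Z = 0" for j
   using Z(2) \<psi>(1) unfolding has_div_iff[OF Om] \<psi>(2) ip_commute[of _ _ Z] by (simp add: ip_def)
  ultimately have "ip ?M k Z = 0" using LIMSEQ_unique[OF _ tendsto_const] by simp
  then show ?thesis by (simp add: ip_commute)
 qed
 have 4: "ip ?M Z (%x. c *s k x) = 0" if Z: "Z \<in> L2w Om q 0" "has_div Om q Z (%x. 0)" for Z c
 proof -
  have "(%x. cnj c *s Z x) \<in> L2w Om q 0" using Z(1) by (auto simp: L2w_zero_iff intro: sq_smult alt_smult)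
  moreover have "has_div Om q (%x. cnj c *s Z x) (%x. 0)" using has_div_smult[OF Om Z(2), of "cnj c"] by simp
  ultimately have "ip ?M (%x. cnj c *s Z x) k = 0" by (rule 3)
  then show ?thesis by (simp add: ip_def adjoint_smult)
 qed
 show ?thesis by (rule that[OF 1 2 4])
qed

lemma harmonicI:
 assumes "open Om" "has_rot0 Om q 0 1 y (%x. 0)" "has_div Om q y (%x. 0)" shows "y \<in> harmonic Om q"
 using assms rot0_iff[OF assms(1)] has_rot0_has_rot[OF assms(1,2)] has_rot0_L2w(1)[OF assms(2)] L2w_zero[of Om "q - 1" 1]
 unfolding harmonic_def ker_R0_def ker_D_def div_space_def by auto

lemma ker_R0D:
 assumes "open Om" "E \<in> ker_R0 Om q" shows "has_rot0 Om q 0 1 E (%x. 0)"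
proof -
 obtain G where "has_rot0 Om q 0 1 E G" using assms rot0_iff[OF assms(1)] by (auto simp: ker_R0_def)
 from has_rot0_change_rot[OF assms(1) this _ L2w_zero] show ?thesis using assms(2) by (simp add: ker_R0_def)
qed

lemma L2_pair_eq_0:
 assumes "u \<in> L2w Om q 0" "v \<in> L2w Om q 0"
 shows "L2_pair Om u v = 0 \<longleftrightarrow> ip (lebesgue_on Om) u v = 0 \<and> ip (lebesgue_on Om) u (%x. \<i> *s v x) = 0"
 using assms by (subst L2_pair_sq) (auto simp: L2w_zero_iff complex_eq_iff)

lemma positive_AE_zero:
 assumes a: "admissible Om q \<tau> 1 \<epsilon>" and \<tau>: "\<tau> > 0" and u: "u \<in> L2w Om q 0" and z: "ip (lebesgue_on Om) u (app \<epsilon> u) = 0"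
 shows "ae_eq Om u (%_. 0)"
proof -
 obtain c where c: "c > 0" "\<And>u. u \<in> L2w Om q 0 ==> c * (nrm (lebesgue_on Om) u)\<^sup>2 \<le> ip (lebesgue_on Om) u (app \<epsilon> u)" by (rule app_positive[OF a \<tau>]) blast
 have "c * (nrm (lebesgue_on Om) u)\<^sup>2 \<le> 0" using c(2)[OF u] z by simp
 then have "nrm (lebesgue_on Om) u = 0" using c(1) by (simp add: mult_le_0_iff)
 then show ?thesis using nrm_eq_0 u unfolding ae_eq_def L2w_zero_iff by blast
qed

text \<open>Limits of rotations of test forms are orthogonal to \<open>\<epsilon> E\<close>, so only
  the harmonic part of \<open>E\<close> matters. It is projected onto the harmonic forms orthogonal
  to \<open>\<epsilon> E\<close>. The harmonic parts of the \<open>b l\<close> belong to these, so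
  the remainder is orthogonal to all \<open>b l\<close> and vanishes by the SMP. Hence
  \<open>E\<close> is orthogonal to \<open>\<epsilon> E\<close>; it is never shown that the harmonic
  parts of the \<open>b l\<close> span.\<close>

lemma unique_rot_free:
 fixes E :: "('n::{finite,linorder}) form"
 assumes Om: "open Om" and a: "admissible Om q \<tau> 1 \<epsilon>" and \<tau>: "\<tau> > 0"
  and b: "\<And>l. l < d ==> b l \<in> ker_R0 Om q" "\<And>u. u \<in> harmonic Om q ==> \<forall>l<d. L2_pair Om u (b l) = 0 ==> ae_eq Om u (%_. 0)"
  and E: "has_rot0 Om q 0 1 E (%x. 0)" "has_div Om q (app \<epsilon> E) (%x. 0)" "\<And>l. l < d ==> L2_pair Om (app \<epsilon> E) (b l) = 0"
 shows "ae_eq Om E (%_. 0)"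
proof -
 let ?M = "lebesgue_on Om"
 note EL = has_rot0_L2w(1)[OF E(1)] and aE = app_L2w[OF a \<tau> has_rot0_L2w(1)[OF E(1)]]
 have sa: "sq ?M (app \<epsilon> E)" using aE by (simp add: L2w_zero_iff)
 note bR = ker_R0D[OF Om b(1)]
 have "\<forall>l. \<exists>k. l < d \<longrightarrow> has_rot0 Om q 0 1 k (%x. 0) \<and> has_div Om q (%x. b l x - k x) (%x. 0) \<and>
   (\<forall>Z c. Z \<in> L2w Om q 0 \<longrightarrow> has_div Om q Z (%x. 0) \<longrightarrow> ip ?M Z (%x. c *s k x) = 0)"
 proof
  fix l
  show "\<exists>k. l < d \<longrightarrow> has_rot0 Om q 0 1 k (%x. 0) \<and> has_div Om q (%x. b l x - k x) (%x. 0) \<and>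
   (\<forall>Z c. Z \<in> L2w Om q 0 \<longrightarrow> has_div Om q Z (%x. 0) \<longrightarrow> ip ?M Z (%x. c *s k x) = 0)"
  proof (cases "l < d")
   case True
   show ?thesis by (rule ker_split[OF Om has_rot0_L2w(1)[OF bR[OF True]]]) blast
  qed simp
 qed
 from choice[OF this] obtain k where k: "\<And>l. l < d ==> has_rot0 Om q 0 1 (k l) (%x. 0)" "\<And>l. l < d ==> has_div Om q (%x. b l x - k l x) (%x. 0)"
  "\<And>l Z c. l < d ==> Z \<in> L2w Om q 0 ==> has_div Om q Z (%x. 0) ==> ip ?M Z (%x. c *s k l x) = 0" by blast
 obtain k0 where k0: "has_rot0 Om q 0 1 k0 (%x. 0)" "has_div Om q (%x. E x - k0 x) (%x. 0)"
  "\<And>Z c. Z \<in> L2w Om q 0 ==> has_div Om q Z (%x. 0) ==> ip ?M Z (%x. c *s k0 x) = 0"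
  by (rule ker_split[OF Om EL]) blast
 define H where "H y \<longleftrightarrow> has_rot0 Om q 0 1 y (%x. 0) \<and> has_div Om q y (%x. 0)" for y
 have HL: "y \<in> L2w Om q 0" "sq ?M y" if "H y" for y using has_rot0_L2w(1)[of Om q 0 1 y "%x. 0"] that by (simp_all add: H_def L2w_zero_iff)
 have Hl: "H (%x. r *\<^sub>R u x + v x)" if "H u" "H v" for u v r
  using that has_rot0_lincomb[OF Om, of q 0 1 u "%x. 0" v "%x. 0" r] has_div_lincomb[OF Om, of q u "%x. 0" v "%x. 0" r] by (simp add: H_def)
 have Hs: "H (%x. c *s u x)" if "H u" for u c
  using that has_rot0_smult[OF Om, of q 0 1 u "%x. 0" c] has_div_smult[OF Om, of q u "%x. 0" c] by (simp add: H_def)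
 have Hd: "H (%x. u x - v x)" if "H u" "H v" for u v using Hl[OF that(2,1), of "-1"] by simp
 have Hy: "H (%x. b l x - k l x)" if "l < d" for l using has_rot0_diff[OF Om bR[OF that] k(1)[OF that]] k(2)[OF that] by (simp add: H_def)
 have HE: "H (%x. E x - k0 x)" using has_rot0_diff[OF Om E(1) k0(1)] k0(2) by (simp add: H_def)
 let ?y = "%x. E x - k0 x"
 \<comment> \<open>This is treated as a real subspace; multiples by \<i> are tested separately,
   which is why \<open>c\<close> takes the values 1 and \<i> below.\<close>
 let ?S = "{u. H u \<and> ip ?M (app \<epsilon> E) u = 0}"
 obtain p s where p: "sq ?M p" "\<And>x. x \<in> space ?M ==> p x \<in> alt q" "\<And>j::nat. s j \<in> ?S"
  "(%j. nrm ?M (%x. s j x - p x)) \<longlonglongrightarrow> 0" "\<And>u. u \<in> ?S ==> ip ?M p u = ip ?M ?y u" "nrm ?M p \<le> nrm ?M ?y"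
 proof (rule L2_project[of ?M ?y ?S "alt q"])
  show "(%x. a *\<^sub>R u x + v x) \<in> ?S" if "u \<in> ?S" "v \<in> ?S" for u v a
   using that Hl by (simp add: ip_add_right[OF sq_scaleR[OF HL(2)] HL(2) sa] ip_scaleR_right)
  have "H (%x. 0)" using Hd[OF HE HE] by simp
  then show "?S \<noteq> {}" by (auto simp: ip_def intro!: exI[of _ "%x. 0"])
  show "u x \<in> alt q" if "u \<in> ?S" "x \<in> space ?M" for u x using L2w_alt[OF HL(1)[of u]] that by simp
  show "0 \<in> (alt q :: 'n alg set)" by (simp add: alt_def)
 qed (use HL HE closed_alt in auto)
 have pL: "p \<in> L2w Om q 0" using p(1,2) by (simp add: L2w_zero_iff)
 have Hs': "H (s j)" for j using p(3) by blast
 have Hp: "H p" unfolding H_def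
 proof
  show "has_rot0 Om q 0 1 p (%x. 0)"
   by (rule has_rot0_closed[OF Om, of q 0 1 s "%_ _. 0"]) (use Hs' p(4) pL in \<open>auto simp: H_def L2w_norm_nrm L2w_zero\<close>)
  show "has_div Om q p (%x. 0)"
   by (rule has_div_limit[where E=s and G="%_ _. 0" and s=0 and s'=0, OF Om]) (use Hs' HL(1)[OF Hs'] p(4) pL in \<open>auto simp: H_def L2w_norm_nrm L2w_zero\<close>)
 qed
 let ?z = "%x. ?y x - p x"
 have Hz: "H ?z" by (rule Hd[OF HE Hp])
 have az: "ip ?M (app \<epsilon> E) (%x. c *s (b l x - k l x)) = 0" if l: "l < d" and c: "c = 1 \<or> c = \<i>" for l c
 proof -
  have "ip ?M (app \<epsilon> E) (%x. c *s b l x) = 0"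
   using E(3)[OF l] c unfolding L2_pair_eq_0[OF aE has_rot0_L2w(1)[OF bR[OF l]]] by auto
  moreover have "(%x. c *s (b l x - k l x)) = (%x. c *s b l x - c *s k l x)" by (auto simp: vec_eq_iff algebra_simps)
  moreover have "ip ?M (app \<epsilon> E) (%x. c *s b l x - c *s k l x) = ip ?M (app \<epsilon> E) (%x. c *s b l x) - ip ?M (app \<epsilon> E) (%x. c *s k l x)"
   using has_rot0_L2w(1)[OF bR[OF l]] has_rot0_L2w(1)[OF k(1)[OF l]] by (intro ip_diff_right sq_smult sa) (auto simp: L2w_zero_iff)
  ultimately show ?thesis using k(3)[OF l aE E(2), of c] by simp
 qed
 \<comment> \<open>The rotational part \<open>k l\<close> is invisible to the divergence-free
   \<open>?z\<close>, so orthogonality to the harmonic part of \<open>b l\<close> is orthogonality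
   to \<open>b l\<close> itself.\<close>
 have zz: "ip ?M ?z (%x. c *s b l x) = 0" if l: "l < d" and c: "c = 1 \<or> c = \<i>" for l c
 proof -
  let ?u = "%x. c *s (b l x - k l x)"
  have u: "?u \<in> ?S" using Hs[OF Hy[OF l], of c] az[OF l c] by simp
  have "ip ?M ?z ?u = 0"
   using ip_diff_left[OF HL(2)[OF HE] p(1) HL(2)[OF Hs[OF Hy[OF l]]], of c] p(5)[OF u] by simp
  moreover have "ip ?M ?z (%x. c *s k l x) = 0" using k(3)[OF l HL(1)[OF Hz]] Hz by (simp add: H_def)
  moreover have "(%x. c *s b l x) = (%x. ?u x + c *s k l x)" by (auto simp: vec_eq_iff algebra_simps)
  moreover have "ip ?M ?z (%x. ?u x + c *s k l x) = ip ?M ?z ?u + ip ?M ?z (%x. c *s k l x)"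
   using has_rot0_L2w(1)[OF k(1)[OF l]] by (intro ip_add_right sq_smult HL(2)[OF Hz] HL(2)[OF Hy[OF l]]) (auto simp: L2w_zero_iff)
  ultimately show ?thesis by simp
 qed
 have "L2_pair Om ?z (b l) = 0" if "l < d" for l
  unfolding L2_pair_eq_0[OF HL(1)[OF Hz] has_rot0_L2w(1)[OF bR[OF that]]] using zz[OF that, of 1] zz[OF that, of \<i>] by simp
 then have ae: "ae_eq Om ?z (%_. 0)" using b(2)[of ?z] harmonicI[OF Om, of q ?z] Hz by (auto simp: H_def)
 have 1: "ip ?M (app \<epsilon> E) p = 0"
 proof -
  have "(%j. ip ?M (s j) (app \<epsilon> E)) \<longlonglongrightarrow> ip ?M p (app \<epsilon> E)" by (rule ip_tendsto[OF HL(2)[OF Hs'] p(1) sa p(4)])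
  moreover have "ip ?M (s j) (app \<epsilon> E) = 0" for j using p(3)[of j] by (simp add: ip_commute)
  ultimately show ?thesis using LIMSEQ_unique[OF _ tendsto_const] by (simp add: ip_commute)
 qed
 have 2: "ip ?M ?z (app \<epsilon> E) = 0"
  using ip_cong_AE[of ?z ?M "%x. 0" "app \<epsilon> E"] ae sq_measurable[OF HL(2)[OF Hz]] sq_measurable[OF sa] by (simp add: ae_eq_def ip_def)
 \<comment> \<open>\<open>E\<close> is the sum of \<open>?z\<close>, \<open>p\<close> and
   \<open>k0\<close>, each of which is orthogonal to \<open>\<epsilon> E\<close>.\<close>
 have "ip ?M (%x. (?z x + p x) + k0 x) (app \<epsilon> E) = ip ?M ?z (app \<epsilon> E) + ip ?M p (app \<epsilon> E) + ip ?M k0 (app \<epsilon> E)"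
  using has_rot0_L2w(1)[OF k0(1)] unfolding L2w_zero_iff
  by (simp only: ip_add_left[OF sq_add[OF HL(2)[OF Hz] p(1)] _ sa] ip_add_left[OF HL(2)[OF Hz] p(1) sa])
 moreover have "ip ?M k0 (app \<epsilon> E) = 0" using k0(3)[OF aE E(2), of 1] by (simp add: ip_commute)
 ultimately have "ip ?M E (app \<epsilon> E) = 0" using 1 2 by (simp add: ip_commute)
 then show ?thesis by (rule positive_AE_zero[OF a \<tau> EL])
qed

text \<open>Here the \<open>b l\<close> are themselves divergence-free, so they do not see the
  rotational part \<open>k\<close> of \<open>\<mu> H\<close>, and the harmonic part is orthogonal to
  all of them. Thus \<open>\<mu> H\<close> reduces to \<open>k\<close>, which is orthogonal to
  \<open>H\<close>.\<close>

lemma unique_div_free: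
 fixes H :: "('n::{finite,linorder}) form"
 assumes Om: "open Om" and a: "admissible Om q \<tau> 1 \<mu>" and \<tau>: "\<tau> > 0"
  and b: "\<And>l. l < d ==> b l \<in> ker_D Om q" "\<And>u. u \<in> harmonic Om q ==> \<forall>l<d. L2_pair Om u (b l) = 0 ==> ae_eq Om u (%_. 0)"
  and H: "H \<in> L2w Om q 0" "has_div Om q H (%x. 0)" "has_rot0 Om q 0 1 (app \<mu> H) (%x. 0)" "\<And>l. l < d ==> L2_pair Om (app \<mu> H) (b l) = 0"
 shows "ae_eq Om H (%_. 0)"
proof -
 let ?M = "lebesgue_on Om"
 note KL = has_rot0_L2w(1)[OF H(3)]
 obtain k where k: "has_rot0 Om q 0 1 k (%x. 0)" "has_div Om q (%x. app \<mu> H x - k x) (%x. 0)"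
  "\<And>Z c. Z \<in> L2w Om q 0 ==> has_div Om q Z (%x. 0) ==> ip ?M Z (%x. c *s k x) = 0"
  by (rule ker_split[OF Om KL]) blast
 let ?y = "%x. app \<mu> H x - k x"
 have y: "?y \<in> harmonic Om q" using has_rot0_diff[OF Om H(3) k(1)] k(2) by (intro harmonicI[OF Om]) simp_all
 note yL = L2w_diff[OF KL has_rot0_L2w(1)[OF k(1)]]
 have bD: "b l \<in> L2w Om q 0" "has_div Om q (b l) (%x. 0)" if "l < d" for l
  using b(1)[OF that] by (auto simp: ker_D_def div_space_def)
 have z: "ip ?M ?y (%x. c *s b l x) = 0" if l: "l < d" and c: "c = 1 \<or> c = \<i>" for l c
 proof -
  have "ip ?M (app \<mu> H) (%x. c *s b l x) = 0" using H(4)[OF l] c unfolding L2_pair_eq_0[OF KL bD(1)[OF l]] by auto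
  moreover have "ip ?M (b l) (%x. cnj c *s k x) = 0" by (rule k(3)[OF bD[OF l]])
  then have "ip ?M k (%x. c *s b l x) = 0" by (simp add: ip_def inner_commute[of "k _"] adjoint_smult)
  moreover have "ip ?M ?y (%x. c *s b l x) = ip ?M (app \<mu> H) (%x. c *s b l x) - ip ?M k (%x. c *s b l x)"
   using KL has_rot0_L2w(1)[OF k(1)] bD(1)[OF l] by (intro ip_diff_left sq_smult) (auto simp: L2w_zero_iff)
  ultimately show ?thesis by simp
 qed
 have "L2_pair Om ?y (b l) = 0" if "l < d" for l
  unfolding L2_pair_eq_0[OF yL bD(1)[OF that]] using z[OF that, of 1] z[OF that, of \<i>] by simp
 then have ae: "ae_eq Om ?y (%_. 0)" using b(2)[OF y] by blast
 have sH: "sq ?M H" using H(1) by (simp add: L2w_zero_iff)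
 have "ip ?M ?y H = 0"
  using ip_cong_AE[of ?y ?M "%x. 0" H] ae L2w_measurable[OF yL] sq_measurable[OF sH] by (simp add: ae_eq_def ip_def)
 moreover have "ip ?M k H = 0" using k(3)[OF H(1,2), of 1] by (simp add: ip_commute)
 moreover have "ip ?M (%x. ?y x + k x) H = ip ?M ?y H + ip ?M k H"
  using yL has_rot0_L2w(1)[OF k(1)] sH by (intro ip_add_left) (auto simp: L2w_zero_iff)
 ultimately have "ip ?M H (app \<mu> H) = 0" by (simp add: ip_commute)
 then show ?thesis by (rule positive_AE_zero[OF a \<tau> H(1)])
qed

section \<open>The static problem\<close>

lemma L2w_smult: "u \<in> L2w Om q s ==> (%x. c *s u x) \<in> L2w Om q s"
 unfolding L2w_iff smult_scaleR[symmetric] using sq_smult alt_smult by blast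

lemma L2w_norm_smult: "L2w_norm Om s (%x. c *s u x) = cmod c * L2w_norm Om s u"
 unfolding L2w_norm_nrm smult_scaleR[symmetric] nrm_smult ..

lemma hinner_wt: "hinner (wt s u x) (wt (- s) v x) = hinner (u x) (v x)"
proof -
 have "rho x powr s * rho x powr - s = 1" using rho_ge_1[of x] by (simp add: powr_add[symmetric])
 then have "rho x powr - s * rho x powr s = 1" by (simp add: mult.commute)
 then show ?thesis unfolding hinner_Complex smult_scaleR by (simp add: mult.assoc[symmetric])
qed

lemma
 assumes u: "u \<in> L2w Om q s" and v: "v \<in> L2w Om p (- s)"
 shows L2_pair_w: "L2_pair Om u v = Complex (ip (lebesgue_on Om) u v) (ip (lebesgue_on Om) u (%x. \<i> *s v x))"
  and hinner_integrable_w: "integrable (lebesgue_on Om) (%x. hinner (u x) (v x))"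
 using hinner_integral[OF L2w_sq[OF u] L2w_sq[OF v]] unfolding hinner_wt L2_pair_def smult_scaleR ip_wt[of _ u _ s] by auto

lemma hinner_diff: "hinner (u - v) w = hinner u w - hinner v w"
 by (simp add: hinner_def algebra_simps sum_subtractf)

lemma L2_pair_diff:
 "u \<in> L2w Om q s ==> u' \<in> L2w Om q s ==> v \<in> L2w Om p (- s) ==> L2_pair Om (%x. u x - u' x) v = L2_pair Om u v - L2_pair Om u' v"
 unfolding L2_pair_def hinner_diff by (rule Bochner_Integration.integral_diff; rule hinner_integrable_w)

lemma L2_pair_smult: "L2_pair Om (%x. c *s u x) v = c * L2_pair Om u v"
proof -
 have "hinner (c *s u x) (v x) = c * hinner (u x) (v x)" for x by (simp add: hinner_def sum_distrib_left mult.assoc)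
 then show ?thesis by (simp add: L2_pair_def)
qed

lemma L2_pair_tendsto:
 assumes "\<And>k. u k \<in> L2w Om q s" "p \<in> L2w Om q s" "v \<in> L2w Om r (- s)" "(%k. L2w_norm Om s (%x. u k x - p x)) \<longlonglongrightarrow> 0"
 shows "(%k. L2_pair Om (u k) v) \<longlonglongrightarrow> L2_pair Om p v"
 unfolding L2_pair_w[OF assms(1,3)] L2_pair_w[OF assms(2,3)]
 by (intro tendsto_Complex ip_tendsto_L2w[OF assms(1,2) assms(3) assms(4)] ip_tendsto_L2w[OF assms(1,2) L2w_smult[OF assms(3)] assms(4)])

text \<open>Weights are bounded on bounded sets. The forms of the SMP can therefore be paired with
  fields of any weight.\<close>

lemma bounded_support_L2w:
 assumes "bounded_support Om b" "b \<in> L2w Om q 0" shows "b \<in> L2w Om q s"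
proof -
 obtain R where R: "AE x in lebesgue_on Om. norm x > R \<longrightarrow> b x = 0" using assms(1) by (auto simp: bounded_support_def)
 obtain C where C: "C \<ge> 0" "\<And>x :: real ^ 'a. norm x < R + 1 ==> norm (rho x powr s) \<le> C"
  using continuous_ball_bounded[OF continuous_rho_powr, of "R + 1" s] by blast
 have "AE x in lebesgue_on Om. rho x powr s * norm (b x) \<le> C * (rho x powr 0 * norm (b x))"
  using R
 proof eventually_elim
  case (elim x)
  show ?case using C(2)[of x] elim by (cases "norm x < R + 1") (auto intro!: mult_right_mono)
 qed
 then show ?thesis using L2w_measurable[OF assms(2)] L2w_alt[OF assms(2)] by (intro L2w_dom(1)[OF assms(2)])
qed

lemma has_rot0_AE:
 assumes Om: "open Om" and r: "has_rot0 Om q s s' E G" and E: "E' \<in> L2w Om q w" "AE x in lebesgue_on Om. E x = E' x"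
  and G: "G' \<in> L2w Om (q + 1) w'" "AE x in lebesgue_on Om. G x = G' x"
 shows "has_rot0 Om q s s' E' G'"
proof -
 note E1 = L2w_AE(1)[OF has_rot0_L2w(1)[OF r] L2w_measurable[OF E(1)] L2w_alt[OF E(1)] E(2)]
  and G1 = L2w_AE(1)[OF has_rot0_L2w(2)[OF r] L2w_measurable[OF G(1)] L2w_alt[OF G(1)] G(2)]
 have z: "L2w_norm Om v (%x. u x - u' x) = 0" if "u \<in> L2w Om p v" "u' \<in> L2w Om p v" "AE x in lebesgue_on Om. u x = u' x" for u u' :: "'a form" and p v
 proof -
  have "L2w_norm Om v (%x. u x - u' x) = L2w_norm Om v (%x. 0 :: 'a alg)"
   by (rule L2w_AE(2)[OF L2w_diff[OF that(1,2)], of _ p]) (use that(3) in \<open>auto simp: alt_def\<close>)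
  then show ?thesis by (simp add: L2w_norm_nrm)
 qed
 show ?thesis
  by (rule has_rot0_closed[where E="%_. E" and G="%_. G", OF Om r E1 _ G1])
   (simp_all add: z[OF has_rot0_L2w(1)[OF r] E1 E(2)] z[OF has_rot0_L2w(2)[OF r] G1 G(2)])
qed

text \<open>A cut-off equal to 1 on the support changes nothing and makes the approximation by test
  forms valid for all weights.\<close>

lemma bounded_support_has_rot0:
 assumes Om: "open Om" and s: "bounded_support Om b" and r: "has_rot0 Om q 0 1 b (%x. 0)"
 shows "has_rot0 Om q w w' b (%x. 0)"
proof -
 obtain R0 where R0: "AE x in lebesgue_on Om. norm x > R0 \<longrightarrow> b x = 0" using s by (auto simp: bounded_support_def)
 define R where "R = max R0 0 + 1"
 have R: "R > 0" "R > R0" by (auto simp: R_def)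
 show ?thesis
 proof (rule has_rot0_AE[OF Om has_rot0_cut[OF Om r C0_inf_cut[OF R(1)]] bounded_support_L2w[OF s has_rot0_L2w(1)[OF r]] _ L2w_zero])
  show "AE x in lebesgue_on Om. cut R x *\<^sub>R b x = b x" using R0
  proof eventually_elim
   case (elim x) then show ?case using cut_one[OF R(1), of x] R(2) by (cases "norm x \<le> R") auto
  qed
  show "AE x in lebesgue_on Om. cut R x *\<^sub>R 0 + R_op (grad (cut R) x) (b x) = 0" using R0
  proof eventually_elim
   case (elim x) then show ?case using cut_grad_zero[OF R(1), of x] R(2) by (cases "norm x < R") (auto simp: R_op_def)
  qed
 qed
qed

lemma R0_loc_of_has_rot0: "open Om ==> has_rot0 Om q s s' E G ==> E \<in> R0_loc Om q"
 unfolding R0_loc_def by (intro CollectI allI impI rot0_iff[THEN iffD2, OF _ exI], assumption) (rule has_rot0_cut)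

lemma R0_loc_diff:
 fixes E :: "('n::{finite,linorder}) form"
 assumes "open Om" "E \<in> R0_loc Om q" "E' \<in> R0_loc Om q" shows "(%x. E x - E' x) \<in> R0_loc Om q"
 unfolding R0_loc_def
proof (intro CollectI allI impI)
 fix \<phi> :: "real ^ ('n::{finite,linorder}) => real" assume \<phi>: "\<phi> \<in> C0_inf UNIV"
 have "(%x. \<phi> x *\<^sub>R E x) \<in> bold_R0 Om q 0" "(%x. \<phi> x *\<^sub>R E' x) \<in> bold_R0 Om q 0"
  using assms(2,3) \<phi> by (auto simp: R0_loc_def)
 then obtain G G' where "has_rot0 Om q 0 0 (%x. \<phi> x *\<^sub>R E x) G" "has_rot0 Om q 0 0 (%x. \<phi> x *\<^sub>R E' x) G'" using rot0_iff[OF assms(1)] by blast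
 from has_rot0_diff[OF assms(1) this] show "(%x. \<phi> x *\<^sub>R (E x - E' x)) \<in> bold_R0 Om q 0"
  using rot0_iff[OF assms(1)] by (auto simp: scaleR_diff_right)
qed

text \<open>The bound \<tau> > N / 2 lifts the perturbation term of a field of weight above - N / 2
  to weight 0. It enters the far field as a divergence source for the electric and as a rotation
  source for the magnetic difference. Once both differences are square integrable, the orthogonality
  arguments for homogeneous data apply.\<close>

lemma static_unique:
 fixes Om :: "(real ^ 'n::{finite,linorder}) set"
 assumes N: "CARD('n) \<ge> 3" and q: "q \<ge> 1" and Om: "open Om" and a: "- Om \<subseteq> ball 0 a" "a > 0" and SMP: "SMP_data Om d b0 b"
  and \<tau>: "\<tau> > real CARD('n) / 2" and adm: "admissible Om q \<tau> 1 \<epsilon>" "admissible Om (q + 1) \<tau> 1 \<mu>"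
  and S: "static_maxwell Om q \<epsilon> \<mu> d b0 b f F G g \<zeta> \<xi> E H" "static_maxwell Om q \<epsilon> \<mu> d b0 b f F G g \<zeta> \<xi> E' H'"
 shows "ae_eq Om E' E" "ae_eq Om H' H"
proof -
 have \<tau>0: "\<tau> > 0" using \<tau> N by linarith
 let ?e = "%x. E' x - E x" and ?h = "%x. H' x - H x"
 note s1 = S(1)[unfolded static_maxwell_def] and s2 = S(2)[unfolded static_maxwell_def]
 obtain t1 t2 where t: "t1 > - real CARD('n) / 2" "E \<in> L2w Om q t1" "t2 > - real CARD('n) / 2" "E' \<in> L2w Om q t2"
  using s1 s2 by blast
 obtain t3 t4 where t': "t3 > - real CARD('n) / 2" "H \<in> L2w Om (q + 1) t3" "t4 > - real CARD('n) / 2" "H' \<in> L2w Om (q + 1) t4"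
  using s1 s2 by blast
 define v w where "v = min t1 t2" and "w = min t3 t4"
 have E1: "E \<in> L2w Om q v" "E' \<in> L2w Om q v" by (rule L2w_mono[OF _ t(2)] L2w_mono[OF _ t(4)]; simp add: v_def)+
 have H1: "H \<in> L2w Om (q + 1) w" "H' \<in> L2w Om (q + 1) w" by (rule L2w_mono[OF _ t'(2)] L2w_mono[OF _ t'(4)]; simp add: w_def)+
 have vw: "- real CARD('n) / 2 < v" "- real CARD('n) / 2 < w" "0 \<le> v + \<tau>" "0 \<le> w + \<tau>" using t(1,3) t'(1,3) \<tau> by (auto simp: v_def w_def)
 note eL = L2w_diff[OF E1(2,1)] and hL = L2w_diff[OF H1(2,1)]
 have re: "has_rot Om q ?e (%x. 0)" and de: "has_div Om q (app \<epsilon> ?e) (%x. 0)" and dh: "has_div Om (q + 1) ?h (%x. 0)"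
  and rh: "has_rot Om (q + 1) (app \<mu> ?h) (%x. 0)"
  unfolding app_diff
  using has_rot_diff[OF Om, of q E' G E G] has_div_diff[OF Om, of q "app \<epsilon> E'" f "app \<epsilon> E" f]
   has_div_diff[OF Om, of "q + 1" H' F H F] has_rot_diff[OF Om, of "q + 1" "app \<mu> H'" g "app \<mu> H" g] s1 s2 by simp_all
 have e0: "?e \<in> L2w Om q 0"
 proof (rule far_field_L2[OF N Om a eL vw(1) L2w_zero])
  show "(%x. app \<epsilon> ?e x - ?e x) \<in> L2w Om q 0" by (rule L2w_mono[OF vw(3) pert_L2w[OF adm(1) \<tau>0 eL]])
 qed (use re de in simp_all)
 have h0: "?h \<in> L2w Om (q + 1) 0"
 proof (rule far_field_L2[OF N Om a hL vw(2) _ L2w_zero])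
  show "(%x. app \<mu> ?h x - ?h x) \<in> L2w Om (q + 1) 0" by (rule L2w_mono[OF vw(4) pert_L2w[OF adm(2) \<tau>0 hL]])
 qed (use rh dh in simp_all)
 have R: "?e \<in> R0_loc Om q" "app \<mu> ?h \<in> R0_loc Om (q + 1)"
  unfolding app_diff using s1 s2 by (simp_all add: R0_loc_diff[OF Om])
 note re1 = has_rot0_of_R0_loc[OF Om e0 R(1) re] and rh1 = has_rot0_of_R0_loc[OF Om app_L2w[OF adm(2) \<tau>0 h0] R(2) rh]
 have B0: "b0 q l \<in> ker_R0 Om q" "bounded_support Om (b0 q l)" if "l < d q" for l using SMP that by (auto simp: SMP_data_def)
 \<comment> \<open>As \<open>q \<ge> 1\<close>, the rank \<open>q + 1\<close> is not the exceptional
   rank 1 of the SMP.\<close>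
 have B: "b (q + 1) l \<in> ker_D Om (q + 1)" "bounded_support Om (b (q + 1) l)" if "l < d (q + 1)" for l
  using SMP that q by (auto simp: SMP_data_def)
 have "L2_pair Om (app \<epsilon> ?e) (b0 q l) = 0" if l: "l < d q" for l
  unfolding app_diff
  using s1 s2 l L2_pair_diff[OF app_L2w[OF adm(1) \<tau>0 E1(2)] app_L2w[OF adm(1) \<tau>0 E1(1)]
   bounded_support_L2w[OF B0(2)[OF l] has_rot0_L2w(1)[OF ker_R0D[OF Om B0(1)[OF l]]]]] by simp
 then have "ae_eq Om ?e (%_. 0)"
  using SMP by (intro unique_rot_free[OF Om adm(1) \<tau>0 B0(1) _ re1 de]) (auto simp: SMP_data_def)
 then show "ae_eq Om E' E" by (simp add: ae_eq_def)
 have "L2_pair Om (app \<mu> ?h) (b (q + 1) l) = 0" if l: "l < d (q + 1)" for l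
 proof -
  have "b (q + 1) l \<in> L2w Om (q + 1) 0" using B(1)[OF l] by (simp add: ker_D_def div_space_def)
  then show ?thesis
   unfolding app_diff using s1 s2 l
    L2_pair_diff[OF app_L2w[OF adm(2) \<tau>0 H1(2)] app_L2w[OF adm(2) \<tau>0 H1(1)] bounded_support_L2w[OF B(2)[OF l]]] by simp
 qed
 then have "ae_eq Om ?h (%_. 0)"
  using SMP[unfolded SMP_data_def, THEN conjunct2, THEN conjunct2, THEN conjunct2, THEN spec, of "q + 1"] q
  by (intro unique_div_free[OF Om adm(2) \<tau>0 B(1) _ h0 dh rh1]) auto
 then show "ae_eq Om H' H" by (simp add: ae_eq_def)
qed

section \<open>Passage to the limit\<close>

lemma tendsto_0_of_subseq:
 fixes a :: "nat => real"
 assumes "\<And>r :: nat => nat. strict_mono r ==> \<exists>\<sigma>. strict_mono \<sigma> \<and> (%k. a (r (\<sigma> k))) \<longlonglongrightarrow> 0"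
 shows "a \<longlonglongrightarrow> 0"
proof (rule ccontr)
 assume "\<not> a \<longlonglongrightarrow> 0"
 then obtain e where e: "e > 0" "\<And>K. \<exists>n\<ge>K. \<not> norm (a n - 0) < e" unfolding LIMSEQ_iff by blast
 have "infinite {n. \<not> norm (a n) < e}" unfolding infinite_nat_iff_unbounded_le using e(2) by auto
 then obtain r :: "nat => nat" where r: "strict_mono r" "\<And>n. r n \<in> {n. \<not> norm (a n) < e}" using infinite_enumerate by blast
 obtain \<sigma> where \<sigma>: "(%k. a (r (\<sigma> k))) \<longlonglongrightarrow> 0" using assms[OF r(1)] by blast
 then obtain K where "norm (a (r (\<sigma> K)) - 0) < e" using e(1) unfolding LIMSEQ_iff by blast
 then show False using r(2) by simp
qed

lemma L2w_norm_tendsto_mono: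
 assumes "\<And>n. u n \<in> L2w Om q s" "t \<le> s" "(%n. L2w_norm Om s (u n)) \<longlonglongrightarrow> 0" shows "(%n. L2w_norm Om t (u n)) \<longlonglongrightarrow> 0"
 by (rule Lim_null_comparison[OF always_eventually[OF allI] assms(3)]) (use L2w_norm_mono[OF assms(2,1)] in simp)

text \<open>The situation after the time-harmonic equations have been used: \<open>X\<close>,
  \<open>U\<close>, \<open>V\<close>, \<open>Y\<close> are the rotation of \<open>E\<close>, the
  divergence of \<open>\<epsilon> E\<close>, the rotation of \<open>\<mu> H\<close> and the
  divergence of \<open>H\<close>, all with one bound \<open>C\<close> and with limits in weight
  \<open>t\<close>. The frequency no longer occurs.\<close>

locale static_limit =
 fixes Om :: "(real ^ 'n::{finite,linorder}) set" and q :: int and \<epsilon> \<mu> :: "'n transf" and a \<tau> t C :: real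
  and d :: "int => nat" and b0 b :: "int => nat => 'n form" and E H X Y U V :: "nat => 'n form" and f F G g :: "'n form" and \<zeta> \<xi> :: "nat => complex"
 assumes N: "CARD('n) \<ge> 3" and q: "q \<ge> 1" and Om: "open Om" and a: "- Om \<subseteq> ball 0 a" "a > 0" and SMP: "SMP_data Om d b0 b"
  and \<tau>: "\<tau> > real CARD('n) / 2" and adm: "admissible Om q \<tau> 1 \<epsilon>" "admissible Om (q + 1) \<tau> 1 \<mu>" and t: "t > - real CARD('n) / 2"
  and rE: "\<And>n. has_rot0 Om q t t (E n) (X n)" and dE: "\<And>n. has_div Om q (app \<epsilon> (E n)) (U n)" "\<And>n. U n \<in> L2w Om (q - 1) t"
  and rH: "\<And>n. has_rot0 Om (q + 1) t t (app \<mu> (H n)) (V n)" and dH: "\<And>n. has_div Om (q + 1) (H n) (Y n)" "\<And>n. Y n \<in> L2w Om q t"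
  and HL: "\<And>n. H n \<in> L2w Om (q + 1) t"
  and C: "\<And>n. L2w_norm Om t (E n) \<le> C" "\<And>n. L2w_norm Om t (X n) \<le> C" "\<And>n. L2w_norm Om t (U n) \<le> C"
   "\<And>n. L2w_norm Om t (H n) \<le> C" "\<And>n. L2w_norm Om t (Y n) \<le> C" "\<And>n. L2w_norm Om t (V n) \<le> C"
  and L: "G \<in> L2w Om (q + 1) t" "f \<in> L2w Om (q - 1) t" "F \<in> L2w Om q t" "g \<in> L2w Om (q + 1 + 1) t"
  and l: "(%n. L2w_norm Om t (%x. X n x - G x)) \<longlonglongrightarrow> 0" "(%n. L2w_norm Om t (%x. U n x - f x)) \<longlonglongrightarrow> 0"
   "(%n. L2w_norm Om t (%x. Y n x - F x)) \<longlonglongrightarrow> 0" "(%n. L2w_norm Om t (%x. V n x - g x)) \<longlonglongrightarrow> 0"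
  and z: "\<And>l. l < d q ==> (%n. L2_pair Om (app \<epsilon> (E n)) (b0 q l)) \<longlonglongrightarrow> \<zeta> l"
   "\<And>k. k < d (q + 1) ==> (%n. L2_pair Om (app \<mu> (H n)) (b (q + 1) k)) \<longlonglongrightarrow> \<xi> k"
begin

lemma \<tau>0: "\<tau> > 0" using \<tau> N by linarith

abbreviation lim_E :: "real => (nat => nat) => 'n form => bool" where
 "lim_E v r u \<equiv> (%n. L2w_norm Om v (%x. E (r n) x - u x)) \<longlonglongrightarrow> 0"
abbreviation lim_H :: "real => (nat => nat) => 'n form => bool" where
 "lim_H v r u \<equiv> (%n. L2w_norm Om v (%x. H (r n) x - u x)) \<longlonglongrightarrow> 0"

lemma app_tendsto:
 assumes a: "admissible Om p \<tau> 1 \<nu>" and u: "\<And>n. u n \<in> L2w Om p v" "u' \<in> L2w Om p v" "(%n. L2w_norm Om v (%x. u n x - u' x)) \<longlonglongrightarrow> 0"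
 shows "(%n. L2w_norm Om v (%x. app \<nu> (u n) x - app \<nu> u' x)) \<longlonglongrightarrow> 0"
proof -
 obtain K where K: "\<And>s w. w \<in> L2w Om p s ==> L2w_norm Om s (app \<nu> w) \<le> K * L2w_norm Om s w" using app_L2w_norm[OF a \<tau>0] by blast
 show ?thesis
  by (rule Lim_null_comparison[OF always_eventually[OF allI] tendsto_mult_right_zero[OF u(3), of K]])
   (use K[OF L2w_diff[OF u(1,2)]] in \<open>simp add: app_diff\<close>)
qed

text \<open>Two successive extractions, the second along the first. For the magnetic field the two
  factors of the product are interchanged, because the boundary condition sits on
  \<open>\<mu> H\<close>.\<close>

lemma subsequence:
 fixes r :: "nat => nat"
 assumes r: "strict_mono r"
 obtains \<sigma> E' H' where "strict_mono \<sigma>"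
  "\<And>v. v < t ==> E' \<in> L2w Om q v" "\<And>v. v < t ==> lim_E v (%k. r (\<sigma> k)) E'"
  "\<And>v. v < t ==> H' \<in> L2w Om (q + 1) v" "\<And>v. v < t ==> lim_H v (%k. r (\<sigma> k)) H'"
proof -
 have M: "MLCP Om" using SMP by (simp add: SMP_data_def)
 obtain K1 where K1: "K1 \<ge> 0" "\<And>s w. w \<in> L2w Om q s ==> L2w_norm Om s (app \<epsilon> w) \<le> K1 * L2w_norm Om s w" using app_L2w_norm[OF adm(1) \<tau>0] by blast
 obtain K2 where K2: "K2 \<ge> 0" "\<And>s w. w \<in> L2w Om (q + 1) s ==> L2w_norm Om s (app \<mu> w) \<le> K2 * L2w_norm Om s w" using app_L2w_norm[OF adm(2) \<tau>0] by blast
 \<comment> \<open>A bound that also covers \<open>\<epsilon> E\<close> and \<open>\<mu> H\<close>,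
   whose norms are not among the assumed ones.\<close>
 define C' where "C' = (1 + K1 + K2) * C"
 have c: "C \<ge> 0" using C(1)[of 0] L2w_norm_nonneg[of Om t "E 0"] by linarith
 have C': "x \<le> C'" if "x \<le> C" for x using that K1(1) K2(1) c mult_right_mono[of 1 "1 + K1 + K2" C] by (simp add: C'_def)
 have CE: "L2w_norm Om t (app \<epsilon> (E n)) \<le> C'" for n
  using K1(2)[OF has_rot0_L2w(1)[OF rE], of n] mult_mono[of K1 "1 + K1 + K2" "L2w_norm Om t (E n)" C] C(1)[of n] K1(1) K2(1) by (simp add: C'_def)
 have CH: "L2w_norm Om t (app \<mu> (H n)) \<le> C'" for n
  using K2(2)[OF HL, of n] mult_mono[of K2 "1 + K1 + K2" "L2w_norm Om t (H n)" C] C(4)[of n] K1(1) K2(1) by (simp add: C'_def)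
 obtain \<sigma>1 where 1: "strict_mono \<sigma>1" "divrot_Cauchy Om (%k. wt t (E (r (\<sigma>1 k)))) (%k. wt t (app \<epsilon> (E (r (\<sigma>1 k)))))"
  using divrot_weighted_subseq[where X="%k. E (r k)" and G="%k. X (r k)" and Y="%k. app \<epsilon> (E (r k))" and D="%k. U (r k)" and C=C',
   OF Om M rE dE(1) app_L2w[OF adm(1) \<tau>0 has_rot0_L2w(1)[OF rE]] dE(2) C'[OF C(1)] C'[OF C(2)] CE C'[OF C(3)]] by blast
 obtain \<sigma>2 where 2: "strict_mono \<sigma>2" "divrot_Cauchy Om (%k. wt t (app \<mu> (H (r (\<sigma>1 (\<sigma>2 k)))))) (%k. wt t (H (r (\<sigma>1 (\<sigma>2 k)))))"
  using divrot_weighted_subseq[where X="%k. app \<mu> (H (r (\<sigma>1 k)))" and G="%k. V (r (\<sigma>1 k))" and Y="%k. H (r (\<sigma>1 k))" and D="%k. Y (r (\<sigma>1 k))" and C=C',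
   OF Om M rH dH(1) HL _ CH C'[OF C(6)] C'[OF C(4)] C'[OF C(5)]] dH(2) by auto
 have lE: "locally_Cauchy Om (%k. wt t (E (r (\<sigma>1 (\<sigma>2 k)))))"
  using locally_Cauchy_subseq[OF locally_Cauchy_of_divrot_Cauchy[OF Om adm(1) \<tau>0 has_rot0_L2w(1)[OF rE] disjI1[OF 1(2)]] 2(1)] .
 have lH: "locally_Cauchy Om (%k. wt t (H (r (\<sigma>1 (\<sigma>2 k)))))"
  using locally_Cauchy_of_divrot_Cauchy[OF Om adm(2) \<tau>0 HL disjI2[OF 2(2)]] .
 obtain E' where E': "\<And>v. v < t ==> E' \<in> L2w Om q v" "\<And>v. v < t ==> lim_E v (%k. r (\<sigma>1 (\<sigma>2 k))) E'"
  by (rule L2w_limit_of_locally_Cauchy[where u="%k. E (r (\<sigma>1 (\<sigma>2 k)))", OF Om has_rot0_L2w(1)[OF rE] C(1) lE]) blast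
 obtain H' where H': "\<And>v. v < t ==> H' \<in> L2w Om (q + 1) v" "\<And>v. v < t ==> lim_H v (%k. r (\<sigma>1 (\<sigma>2 k))) H'"
  by (rule L2w_limit_of_locally_Cauchy[where u="%k. H (r (\<sigma>1 (\<sigma>2 k)))", OF Om HL C(4) lH]) blast
 show ?thesis
  by (rule that[where \<sigma>="%k. \<sigma>1 (\<sigma>2 k)", OF _ E' H']) (use strict_mono_o[OF 1(1) 2(1)] in \<open>simp_all add: o_def\<close>)
qed

text \<open>All equations are closed under convergence in a single weight \<open>v < t\<close>; the
  forms of the SMP have bounded support and so define continuous functionals in that weight.\<close>

lemma limit_spaces:
 assumes r: "strict_mono r" and v: "v < t" and E': "E' \<in> L2w Om q v" "lim_E v r E'" and H': "H' \<in> L2w Om (q + 1) v" "lim_H v r H'"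
 shows "has_rot0 Om q v v E' G" "has_div Om q (app \<epsilon> E') f" "has_rot0 Om (q + 1) v v (app \<mu> H') g" "has_div Om (q + 1) H' F"
  "l < d q ==> L2_pair Om (app \<epsilon> E') (b0 q l) = \<zeta> l" "k < d (q + 1) ==> L2_pair Om (app \<mu> H') (b (q + 1) k) = \<xi> k"
proof -
 have v': "v \<le> t" using v by simp
 have sub: "(%n. L2w_norm Om v (%x. u (r n) x - u' x)) \<longlonglongrightarrow> 0"
  if "\<And>n. u n \<in> L2w Om p t" "u' \<in> L2w Om p t" "(%n. L2w_norm Om t (%x. u n x - u' x)) \<longlonglongrightarrow> 0" for u u' p
  using L2w_norm_tendsto_mono[OF L2w_diff[OF that(1,2)] v' LIMSEQ_subseq_LIMSEQ[OF that(3) r, unfolded o_def]] .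
 have Ev: "E (r n) \<in> L2w Om q v" and Hv: "H (r n) \<in> L2w Om (q + 1) v" for n using L2w_mono[OF v'] has_rot0_L2w(1)[OF rE] HL by blast+
 note aE = app_tendsto[OF adm(1) Ev E'] and aH = app_tendsto[OF adm(2) Hv H']
 note A = app_L2w[OF adm(1) \<tau>0] app_L2w[OF adm(2) \<tau>0]
 show "has_rot0 Om q v v E' G"
  by (rule has_rot0_closed[OF Om has_rot0_mono[OF Om rE v' v'] E' L2w_mono[OF v' L(1)] sub[OF has_rot0_L2w(2)[OF rE] L(1) l(1)]])
 show "has_rot0 Om (q + 1) v v (app \<mu> H') g"
  by (rule has_rot0_closed[OF Om has_rot0_mono[OF Om rH v' v'] A(2)[OF H'(1)] aH L2w_mono[OF v' L(4)] sub[OF has_rot0_L2w(2)[OF rH] L(4) l(4)]])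
 show "has_div Om q (app \<epsilon> E') f"
  by (rule has_div_limit[OF Om dE(1) A(1)[OF Ev] A(1)[OF E'(1)] aE L2w_mono[OF v' dE(2)] L2w_mono[OF v' L(2)] sub[OF dE(2) L(2) l(2)]])
 have dY: "Y n \<in> L2w Om (q + 1 - 1) t" for n using dH(2) by simp
 have dF: "F \<in> L2w Om (q + 1 - 1) t" using L(3) by simp
 show "has_div Om (q + 1) H' F"
  by (rule has_div_limit[OF Om dH(1) Hv H' L2w_mono[OF v' dY] L2w_mono[OF v' dF] sub[OF dY dF l(3)]])
 show "L2_pair Om (app \<epsilon> E') (b0 q l) = \<zeta> l" if l: "l < d q"
 proof (rule LIMSEQ_unique)
  have "b0 q l \<in> ker_R0 Om q" "bounded_support Om (b0 q l)" using SMP l by (auto simp: SMP_data_def)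
  then have "b0 q l \<in> L2w Om q (- v)" using bounded_support_L2w has_rot0_L2w(1)[OF ker_R0D[OF Om]] by blast
  then show "(%n. L2_pair Om (app \<epsilon> (E (r n))) (b0 q l)) \<longlonglongrightarrow> L2_pair Om (app \<epsilon> E') (b0 q l)"
   by (rule L2_pair_tendsto[OF A(1)[OF Ev] A(1)[OF E'(1)] _ aE])
  show "(%n. L2_pair Om (app \<epsilon> (E (r n))) (b0 q l)) \<longlonglongrightarrow> \<zeta> l"
   using LIMSEQ_subseq_LIMSEQ[OF z(1)[OF l] r] by (simp add: o_def)
 qed
 show "L2_pair Om (app \<mu> H') (b (q + 1) k) = \<xi> k" if k: "k < d (q + 1)"
 proof (rule LIMSEQ_unique)
  have "b (q + 1) k \<in> ker_D Om (q + 1)" "bounded_support Om (b (q + 1) k)" using SMP k q by (auto simp: SMP_data_def)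
  then have "b (q + 1) k \<in> L2w Om (q + 1) (- v)" using bounded_support_L2w by (auto simp: ker_D_def div_space_def)
  then show "(%n. L2_pair Om (app \<mu> (H (r n))) (b (q + 1) k)) \<longlonglongrightarrow> L2_pair Om (app \<mu> H') (b (q + 1) k)"
   by (rule L2_pair_tendsto[OF A(2)[OF Hv] A(2)[OF H'(1)] _ aH])
  show "(%n. L2_pair Om (app \<mu> (H (r n))) (b (q + 1) k)) \<longlonglongrightarrow> \<xi> k"
   using LIMSEQ_subseq_LIMSEQ[OF z(2)[OF k] r] by (simp add: o_def)
 qed
qed

lemma limit_static:
 assumes r: "strict_mono r" and E': "\<And>v. v < t ==> E' \<in> L2w Om q v" "\<And>v. v < t ==> lim_E v r E'"
  and H': "\<And>v. v < t ==> H' \<in> L2w Om (q + 1) v" "\<And>v. v < t ==> lim_H v r H'"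
 shows "static_maxwell Om q \<epsilon> \<mu> d b0 b f F G g \<zeta> \<xi> E' H'"
proof -
 \<comment> \<open>The static problem demands some weight above - N / 2, while the limits are
   available only in weights below \<open>t\<close>; the gap between the two is used here.\<close>
 obtain v where v: "- real CARD('n) / 2 < v" "v < t" using dense[OF t] by blast
 note s = limit_spaces[OF r v(2) E'(1)[OF v(2)] E'(2)[OF v(2)] H'(1)[OF v(2)] H'(2)[OF v(2)]]
 show ?thesis unfolding static_maxwell_def
  using v E'(1)[OF v(2)] H'(1)[OF v(2)] s R0_loc_of_has_rot0[OF Om s(1)] R0_loc_of_has_rot0[OF Om s(3)] has_rot0_has_rot[OF Om s(1)] has_rot0_has_rot[OF Om s(3)]
  by (auto simp: D_loc_def)
qed

lemma sol_norm_tendsto: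
 assumes v: "v < t" and E': "E' \<in> L2w Om q v" "lim_E v id E'" and H': "H' \<in> L2w Om (q + 1) v" "lim_H v id H'"
 shows "(E n, H n) \<in> sol_space Om q \<epsilon> \<mu> v" "(E', H') \<in> sol_space Om q \<epsilon> \<mu> v"
  "(%n. sol_norm Om q \<epsilon> \<mu> v (%x. E n x - E' x) (%x. H n x - H' x)) \<longlonglongrightarrow> 0"
proof -
 have v': "v \<le> t" using v by simp
 note s = limit_spaces[OF strict_mono_id v E' H']
 note A = app_L2w[OF adm(1) \<tau>0] app_L2w[OF adm(2) \<tau>0]
 have Ev: "E n \<in> L2w Om q v" and Hv: "H n \<in> L2w Om (q + 1) v" for n using L2w_mono[OF v'] has_rot0_L2w(1)[OF rE] HL by blast+
 have D: "U n \<in> L2w Om (q - 1) v" "f \<in> L2w Om (q - 1) v" "Y n \<in> L2w Om (q + 1 - 1) v" "F \<in> L2w Om (q + 1 - 1) v" for n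
  using L2w_mono[OF v' dE(2)] L2w_mono[OF v' dH(2)] L2w_mono[OF v' L(2)] L2w_mono[OF v' L(3)] by simp_all
 show "(E n, H n) \<in> sol_space Om q \<epsilon> \<mu> v"
  unfolding sol_space_def div_space_def
  using has_rot0_mono[OF Om rE v' v'] has_rot0_mono[OF Om rH v' v'] rot0_iff[OF Om] A(1)[OF Ev] Hv D(1,3) dE(1) dH(1) by blast
 show "(E', H') \<in> sol_space Om q \<epsilon> \<mu> v"
  unfolding sol_space_def div_space_def
  using s(1-4) rot0_iff[OF Om] A(1)[OF E'(1)] H'(1) D(2,4) by blast
 have sub: "(%n. L2w_norm Om v (%x. u n x - u' x)) \<longlonglongrightarrow> 0"
  if "\<And>n. u n \<in> L2w Om p t" "u' \<in> L2w Om p t" "(%n. L2w_norm Om t (%x. u n x - u' x)) \<longlonglongrightarrow> 0" for u u' p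
  using L2w_norm_tendsto_mono[OF L2w_diff[OF that(1,2)] v' that(3)] .
 have E2: "(%n. L2w_norm Om v (%x. E n x - E' x)) \<longlonglongrightarrow> 0" "(%n. L2w_norm Om v (%x. H n x - H' x)) \<longlonglongrightarrow> 0" using E'(2) H'(2) by simp_all
 note aE = app_tendsto[OF adm(1) Ev E'(1) E2(1)] and aH = app_tendsto[OF adm(2) Hv H'(1) E2(2)]
 note r1 = has_rot0_diff[OF Om has_rot0_mono[OF Om rE v' v'] s(1)] and r2 = has_rot0_diff[OF Om has_rot0_mono[OF Om rH v' v'] s(3)]
 have "rot_norm Om q v v (%x. E n x - E' x) = sqrt ((L2w_norm Om v (%x. E n x - E' x))\<^sup>2 + (L2w_norm Om v (%x. X n x - G x))\<^sup>2)"
  "div_norm Om q v v (app \<epsilon> (%x. E n x - E' x)) = sqrt ((L2w_norm Om v (%x. app \<epsilon> (E n) x - app \<epsilon> E' x))\<^sup>2 + (L2w_norm Om v (%x. U n x - f x))\<^sup>2)"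
  "rot_norm Om (q + 1) v v (app \<mu> (%x. H n x - H' x)) = sqrt ((L2w_norm Om v (%x. app \<mu> (H n) x - app \<mu> H' x))\<^sup>2 + (L2w_norm Om v (%x. V n x - g x))\<^sup>2)"
  "div_norm Om (q + 1) v v (%x. H n x - H' x) = sqrt ((L2w_norm Om v (%x. H n x - H' x))\<^sup>2 + (L2w_norm Om v (%x. Y n x - F x))\<^sup>2)" for n
  unfolding app_diff
  by (rule rot_norm_eq(1)[OF Om has_rot0_has_rot[OF Om r1] has_rot0_L2w(2)[OF r1]] rot_norm_eq(1)[OF Om has_rot0_has_rot[OF Om r2] has_rot0_L2w(2)[OF r2]]
    div_norm_eq(1)[OF Om has_div_diff[OF Om dE(1) s(2)] L2w_diff[OF D(1,2)]] div_norm_eq(1)[OF Om has_div_diff[OF Om dH(1) s(4)] L2w_diff[OF D(3,4)]])+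
 then show "(%n. sol_norm Om q \<epsilon> \<mu> v (%x. E n x - E' x) (%x. H n x - H' x)) \<longlonglongrightarrow> 0"
  unfolding sol_norm_def
  by (auto intro!: tendsto_add_zero sqrt_sum_sq_tendsto_0 E2 aE aH sub[OF has_rot0_L2w(2)[OF rE] L(1) l(1)] sub[OF dE(2) L(2) l(2)]
    sub[OF dH(2) L(3) l(3)] sub[OF has_rot0_L2w(2)[OF rH] L(4) l(4)])
qed

text \<open>One extraction from the full sequence supplies the candidate. Limits of extractions from
  arbitrary subsequences solve the same static problem and agree with it almost everywhere, so every
  subsequence has a further one converging to the candidate.\<close>

theorem convergence:
 "\<exists>E' H'. static_maxwell Om q \<epsilon> \<mu> d b0 b f F G g \<zeta> \<xi> E' H' \<and>
  (\<forall>E'' H''. static_maxwell Om q \<epsilon> \<mu> d b0 b f F G g \<zeta> \<xi> E'' H'' \<longrightarrow> ae_eq Om E'' E' \<and> ae_eq Om H'' H') \<and>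
  (\<forall>v<t. (\<forall>n. (E n, H n) \<in> sol_space Om q \<epsilon> \<mu> v) \<and> (E', H') \<in> sol_space Om q \<epsilon> \<mu> v \<and>
   (%n. sol_norm Om q \<epsilon> \<mu> v (%x. E n x - E' x) (%x. H n x - H' x)) \<longlonglongrightarrow> 0)"
proof -
 obtain \<sigma> E' H' where S: "strict_mono \<sigma>" "\<And>v. v < t ==> E' \<in> L2w Om q v" "\<And>v. v < t ==> lim_E v \<sigma> E'"
  "\<And>v. v < t ==> H' \<in> L2w Om (q + 1) v" "\<And>v. v < t ==> lim_H v \<sigma> H'"
  by (rule subsequence[OF strict_mono_id, unfolded id_apply]) blast
 have SM: "static_maxwell Om q \<epsilon> \<mu> d b0 b f F G g \<zeta> \<xi> E' H'" by (rule limit_static[OF S])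
 note U = static_unique[OF N q Om a SMP \<tau> adm SM]
 have same: "\<exists>\<rho>. strict_mono \<rho> \<and> lim_E v (%k. r (\<rho> k)) E' \<and> lim_H v (%k. r (\<rho> k)) H'" if v: "v < t" and r: "strict_mono r" for v and r :: "nat => nat"
 proof -
  obtain \<rho> E'' H'' where T: "strict_mono \<rho>" "\<And>v. v < t ==> E'' \<in> L2w Om q v" "\<And>v. v < t ==> lim_E v (%k. r (\<rho> k)) E''"
   "\<And>v. v < t ==> H'' \<in> L2w Om (q + 1) v" "\<And>v. v < t ==> lim_H v (%k. r (\<rho> k)) H''" by (rule subsequence[OF r]) blast
  have rr: "strict_mono (%k. r (\<rho> k))" using strict_mono_o[OF r T(1)] by (simp add: o_def)
  have "static_maxwell Om q \<epsilon> \<mu> d b0 b f F G g \<zeta> \<xi> E'' H''" by (rule limit_static[OF rr T(2-5)])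
  note ae = U[OF this]
  \<comment> \<open>The distance to a limit does not change when the limit is replaced by an almost
    everywhere equal form.\<close>
  have eq: "L2w_norm Om v (%x. u x - p x) = L2w_norm Om v (%x. u x - p' x)"
   if "u \<in> L2w Om m v" "p \<in> L2w Om m v" "p' \<in> L2w Om m v" "ae_eq Om p p'" for u p p' m
   by (rule L2w_AE(2)[OF L2w_diff[OF that(1,2)] L2w_measurable[OF L2w_diff[OF that(1,3)]] L2w_alt[OF L2w_diff[OF that(1,3)]]])
    (use that(4) in \<open>auto simp: ae_eq_def\<close>)
  have Ev: "E n \<in> L2w Om q v" and Hv: "H n \<in> L2w Om (q + 1) v" for n using L2w_mono[OF less_imp_le[OF v]] has_rot0_L2w(1)[OF rE] HL by blast+
  show ?thesis
   using T(1) T(3)[OF v] T(5)[OF v] eq[OF Ev T(2)[OF v] S(2)[OF v] ae(1)] eq[OF Hv T(4)[OF v] S(4)[OF v] ae(2)] by auto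
 qed
 have lE: "lim_E v id E'" and lH: "lim_H v id H'" if "v < t" for v
  unfolding id_apply by (rule tendsto_0_of_subseq, use same[OF that] in blast)+
 show ?thesis
  using SM U sol_norm_tendsto[OF _ S(2) lE S(4) lH] by (intro exI[of _ E'] exI[of _ H'] conjI allI impI) auto
qed

end

section \<open>Application to the time-harmonic solutions\<close>

lemma L2w_norm_bounded:
 assumes "\<And>n::nat. u n \<in> L2w Om q s" "v \<in> L2w Om q s" "(%n. L2w_norm Om s (%x. u n x - v x)) \<longlonglongrightarrow> 0"
 shows "\<exists>K. \<forall>n. L2w_norm Om s (u n) \<le> K"
proof -
 obtain K where K: "\<And>n. norm (L2w_norm Om s (%x. u n x - v x)) \<le> K"
  using convergent_imp_Bseq[OF convergentI[OF assms(3)]] by (auto simp: Bseq_def)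
 have "L2w_norm Om s (u n) \<le> K + L2w_norm Om s v" for n
  using L2w_norm_add[OF L2w_diff[OF assms(1,2)] assms(2), of n] K[of n] by simp
 then show ?thesis by blast
qed

lemma sqrt_sum_sq_le: "sqrt (x\<^sup>2 + y\<^sup>2) \<le> c ==> x \<le> c \<and> y \<le> (c :: real)"
 using real_sqrt_sum_squares_ge1[of x y] real_sqrt_sum_squares_ge2[of y x] by linarith

theorem theorem5p3:
  fixes \<Omega> :: "(real ^ 'n::{finite,linorder}) set"
    and q :: int
    and \<epsilon> \<mu> :: "'n transf"
    and r0 \<tau> s t \<gamma> :: real
    and d :: "int \<Rightarrow> nat"
    and b0 b :: "int \<Rightarrow> nat \<Rightarrow> 'n form"
    and \<omega> :: "nat \<Rightarrow> complex"
    and Fn Gn En Hn :: "nat \<Rightarrow> 'n form"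
    and f F G g :: "'n form"
    and \<zeta> \<xi> :: "nat \<Rightarrow> complex"
  assumes "CARD('n) \<ge> 3" and "odd CARD('n)" and "1 \<le> q" and "q \<le> int CARD('n)"
    and "exterior_domain \<Omega>" and "r0 > 0" and "- \<Omega> \<subseteq> ball 0 r0"
    and "SMP_data \<Omega> d b0 b"
    and "\<tau> > (real CARD('n) + 1) / 2"
    and "C1_admissible \<Omega> r0 q \<tau> 1 \<epsilon>" and "C1_admissible \<Omega> r0 (q + 1) \<tau> 1 \<mu>"
    and "1 / 2 < s" and "s < real CARD('n) / 2" and "t = s - (real CARD('n) + 1) / 2"
    and "admissible_frequency_bound \<Omega> q \<epsilon> \<mu> d b0 b s \<gamma>"
    and "\<And>n. \<omega> n \<in> upper_disc \<gamma> - {0}" and "\<omega> \<longlonglongrightarrow> 0"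
    and "\<And>n. Fn n \<in> bold_D \<Omega> q s" and "\<And>n. Gn n \<in> bold_R0 \<Omega> (q + 1) s"
    and "F \<in> L2w \<Omega> q s" and "(\<lambda>n. L2w_norm \<Omega> s (\<lambda>x. Fn n x - F x)) \<longlonglongrightarrow> 0"
    and "G \<in> L2w \<Omega> (q + 1) s" and "(\<lambda>n. L2w_norm \<Omega> s (\<lambda>x. Gn n x - G x)) \<longlonglongrightarrow> 0"
    and "f \<in> L2w \<Omega> (q - 1) s"
    and "(\<lambda>n. L2w_norm \<Omega> s (\<lambda>x. (- \<i> / \<omega> n) *s wdiv \<Omega> q (Fn n) x - f x)) \<longlonglongrightarrow> 0"
    and "g \<in> L2w \<Omega> (q + 2) s"
    and "(\<lambda>n. L2w_norm \<Omega> s (\<lambda>x. (- \<i> / \<omega> n) *s wrot \<Omega> (q + 1) (Gn n) x - g x)) \<longlonglongrightarrow> 0"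
    and "\<And>l. l < d q \<Longrightarrow> (\<lambda>n. - \<i> / \<omega> n * L2_pair \<Omega> (Fn n) (b0 q l)) \<longlonglongrightarrow> \<zeta> l"
    and "\<And>k. k < d (q + 1) \<Longrightarrow> (\<lambda>n. - \<i> / \<omega> n * L2_pair \<Omega> (Gn n) (b (q + 1) k)) \<longlonglongrightarrow> \<xi> k"
    and "\<And>n. is_sol_op \<Omega> q \<epsilon> \<mu> (\<omega> n) (Fn n) (Gn n) (En n) (Hn n)"
  shows "\<exists>E H. static_maxwell \<Omega> q \<epsilon> \<mu> d b0 b f F G g \<zeta> \<xi> E H \<and>
    (\<forall>E' H'. static_maxwell \<Omega> q \<epsilon> \<mu> d b0 b f F G g \<zeta> \<xi> E' H' \<longrightarrow> ae_eq \<Omega> E' E \<and> ae_eq \<Omega> H' H) \<and>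
    (\<forall>t'<t. (\<forall>n. (En n, Hn n) \<in> sol_space \<Omega> q \<epsilon> \<mu> t') \<and> (E, H) \<in> sol_space \<Omega> q \<epsilon> \<mu> t' \<and>
       (\<lambda>n. sol_norm \<Omega> q \<epsilon> \<mu> t' (\<lambda>x. En n x - E x) (\<lambda>x. Hn n x - H x)) \<longlonglongrightarrow> 0)"
proof -
 note N = assms(1) and q = assms(3) and \<Omega>B = assms(7) and SMP = assms(8) and \<tau> = assms(9) and \<omega> = assms(16,17)
  and FnD = assms(18) and GnR = assms(19) and F = assms(20,21) and G = assms(22,23) and f = assms(24,25) and g = assms(26,27)
  and \<zeta> = assms(28) and \<xi> = assms(29) and sol = assms(30)
 have \<Omega>: "open \<Omega>" using assms(5) by (simp add: exterior_domain_def)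
 have a1: "admissible \<Omega> q \<tau> 1 \<epsilon>" and a2: "admissible \<Omega> (q + 1) \<tau> 1 \<mu>" using assms(10,11) by (auto simp: C1_admissible_def)
 have \<tau>0: "\<tau> > 0" "\<tau> > real CARD('n) / 2" using \<tau> N by (simp_all add: field_simps)
 \<comment> \<open>Here \<open>s > 1 / 2\<close> yields a weight above - N / 2, and
   \<open>t \<le> s\<close> lets all data be measured in weight \<open>t\<close>.\<close>
 have ts: "t \<le> s" "t > - real CARD('n) / 2" using assms(12,14) by (simp_all add: field_simps)
 have \<omega>0: "\<omega> n \<noteq> 0" for n using \<omega>(1)[of n] by simp
 obtain c where c: "c > 0" and bound: "\<And>n. (En n, Hn n) \<in> sol_space \<Omega> q \<epsilon> \<mu> t \<and> sol_norm \<Omega> q \<epsilon> \<mu> t (En n) (Hn n) \<le>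
   c * (L2w_norm \<Omega> s (Fn n) + L2w_norm \<Omega> s (Gn n)
   + (L2w_norm \<Omega> s (wdiv \<Omega> q (Fn n)) + L2w_norm \<Omega> s (wrot \<Omega> (q + 1) (Gn n))) / cmod (\<omega> n)
   + (\<Sum>l<d q. cmod (L2_pair \<Omega> (Fn n) (b0 q l))) / cmod (\<omega> n)
   + (\<Sum>k<d (q + 1). cmod (L2_pair \<Omega> (Gn n) (b (q + 1) k))) / cmod (\<omega> n))"
  using assms(15) \<omega>(1) FnD GnR sol unfolding admissible_frequency_bound_def assms(14)[symmetric] by blast
 let ?k = "\<lambda>n. - \<i> / \<omega> n"
 have kn: "cmod (?k n) = 1 / cmod (\<omega> n)" for n by (simp add: norm_divide)
 have FL: "Fn n \<in> L2w \<Omega> q s" and Fd: "has_div \<Omega> q (Fn n) (wdiv \<Omega> q (Fn n))" and FdL: "wdiv \<Omega> q (Fn n) \<in> L2w \<Omega> (q - 1) s" for n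
 proof -
  obtain D where D: "Fn n \<in> L2w \<Omega> q s" "D \<in> L2w \<Omega> (q - 1) s" "has_div \<Omega> q (Fn n) D" using FnD[of n] by (auto simp: div_space_def)
  show "Fn n \<in> L2w \<Omega> q s" "has_div \<Omega> q (Fn n) (wdiv \<Omega> q (Fn n))" "wdiv \<Omega> q (Fn n) \<in> L2w \<Omega> (q - 1) s"
   using D(1) div_norm_eq(2,3)[OF \<Omega> D(3,2)] by auto
 qed
 note Gr = rot0_has_rot0[OF \<Omega> GnR]
 note GL = has_rot0_L2w(1)[OF Gr] and GdL = has_rot0_L2w(2)[OF Gr]
 have sp: "En n \<in> bold_R0 \<Omega> q t" "app \<mu> (Hn n) \<in> bold_R0 \<Omega> (q + 1) t" "Hn n \<in> bold_D \<Omega> (q + 1) t" for n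
  using bound[of n] by (auto simp: sol_space_def)
 note Er = rot0_has_rot0[OF \<Omega> sp(1)] and mHr = rot0_has_rot0[OF \<Omega> sp(2)]
 note EL = has_rot0_L2w(1)[OF Er] and eEL = app_L2w[OF a1 \<tau>0(1) has_rot0_L2w(1)[OF Er]]
 have HL: "Hn n \<in> L2w \<Omega> (q + 1) t" and Hd: "has_div \<Omega> (q + 1) (Hn n) (wdiv \<Omega> (q + 1) (Hn n))" for n
 proof -
  obtain D where D: "Hn n \<in> L2w \<Omega> (q + 1) t" "D \<in> L2w \<Omega> (q + 1 - 1) t" "has_div \<Omega> (q + 1) (Hn n) D" using sp(3)[of n] by (auto simp: div_space_def)
  show "Hn n \<in> L2w \<Omega> (q + 1) t" "has_div \<Omega> (q + 1) (Hn n) (wdiv \<Omega> (q + 1) (Hn n))"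
   using D(1) div_norm_eq(2)[OF \<Omega> D(3,2)] by auto
 qed
 note mHL = app_L2w[OF a2 \<tau>0(1) HL]
 \<comment> \<open>The derivatives prescribed by the time-harmonic system and by the scaled data, as
   explicit representatives in place of the chosen \<open>wrot\<close> and
   \<open>wdiv\<close>.\<close>
 define X where "X n x = Gn n x - (\<i> * \<omega> n) *s app \<mu> (Hn n) x" for n x
 define Y where "Y n x = Fn n x - (\<i> * \<omega> n) *s app \<epsilon> (En n) x" for n x
 define U where "U n x = ?k n *s wdiv \<Omega> q (Fn n) x" for n x
 define V where "V n x = ?k n *s wrot \<Omega> (q + 1) (Gn n) x" for n x
 have XL: "X n \<in> L2w \<Omega> (q + 1) t" and YL: "Y n \<in> L2w \<Omega> q t" for n
  unfolding X_def[abs_def] Y_def[abs_def] by (intro L2w_diff L2w_smult L2w_mono[OF ts(1)] GL FL mHL eEL)+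
 have UL: "U n \<in> L2w \<Omega> (q - 1) s" and VL: "V n \<in> L2w \<Omega> (q + 1 + 1) s" for n
  unfolding U_def[abs_def] V_def[abs_def] by (intro L2w_smult FdL GdL)+
 have ae: "AE x in lebesgue_on \<Omega>. wdiv \<Omega> (q + 1) (Hn n) x = Y n x" "AE x in lebesgue_on \<Omega>. wrot \<Omega> q (En n) x = X n x" for n
 proof -
  have m: "ae_eq \<Omega> (\<lambda>x. wdiv \<Omega> (q + 1) (Hn n) x + (\<i> * \<omega> n) *s app \<epsilon> (En n) x) (Fn n)"
   "ae_eq \<Omega> (\<lambda>x. wrot \<Omega> q (En n) x + (\<i> * \<omega> n) *s app \<mu> (Hn n) x) (Gn n)"
   using sol[of n] by (auto simp: is_sol_op_def maxwell_def)
  show "AE x in lebesgue_on \<Omega>. wdiv \<Omega> (q + 1) (Hn n) x = Y n x" "AE x in lebesgue_on \<Omega>. wrot \<Omega> q (En n) x = X n x"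
   using m unfolding ae_eq_def X_def Y_def by (auto elim!: eventually_mono simp: algebra_simps)
 qed
 have rE: "has_rot0 \<Omega> q t t (En n) (X n)" for n by (rule has_rot0_AE[OF \<Omega> Er EL _ XL ae(2)]) simp
 have dH: "has_div \<Omega> (q + 1) (Hn n) (Y n)" for n
  using has_div_AE[OF \<Omega> Hd L2w_imp_L2loc[OF \<Omega> HL] _ _ ae(1)] L2w_imp_L2loc[OF \<Omega> YL] by simp
 \<comment> \<open>The system solved for \<open>\<epsilon> E\<close> and \<open>\<mu> H\<close>;
   division by the frequency is the origin of the scaled data in the hypotheses.\<close>
 have eY: "?k n *s (Fn n x - Y n x) = app \<epsilon> (En n) x" and eX: "?k n *s (Gn n x - X n x) = app \<mu> (Hn n) x" for n x
  by (simp_all add: X_def Y_def \<omega>0)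
 \<comment> \<open>\<open>Y n\<close> is a divergence, so its own divergence vanishes and only the
   scaled data remain.\<close>
 have dE: "has_div \<Omega> q (app \<epsilon> (En n)) (U n)" for n
  using has_div_smult[OF \<Omega> has_div_diff[OF \<Omega> Fd has_div_div[OF \<Omega> dH, simplified]], of "?k n" n n] unfolding eY U_def[abs_def] by simp
 have mHrot: "has_rot \<Omega> (q + 1) (app \<mu> (Hn n)) (V n)" for n
  using has_rot_smult[OF \<Omega> has_rot_diff[OF \<Omega> has_rot0_has_rot[OF \<Omega> Gr] has_rot_rot[OF \<Omega> has_rot0_has_rot[OF \<Omega> rE]]], of "?k n" n n] unfolding eX V_def[abs_def] by simp
 \<comment> \<open>The boundary condition for \<open>\<mu> H\<close> comes from the solution space
   in the a priori estimate; the rotation is replaced by the representative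
   \<open>V n\<close>.\<close>
 have rH: "has_rot0 \<Omega> (q + 1) t t (app \<mu> (Hn n)) (V n)" for n by (rule has_rot0_change_rot[OF \<Omega> mHr mHrot VL])
 have B0: "b0 q l \<in> ker_R0 \<Omega> q" "bounded_support \<Omega> (b0 q l)" if "l < d q" for l using SMP that by (auto simp: SMP_data_def)
 have B: "b (q + 1) l \<in> ker_D \<Omega> (q + 1)" "bounded_support \<Omega> (b (q + 1) l)" if "l < d (q + 1)" for l
  using SMP that q by (auto simp: SMP_data_def)
 \<comment> \<open>\<open>b0 q l\<close> is a rotation-free limit of test forms, hence orthogonal to
   the divergence \<open>Y n\<close>; its bounded support permits the weight
   \<open>- t\<close>.\<close>
 have pE: "L2_pair \<Omega> (app \<epsilon> (En n)) (b0 q l) = ?k n * L2_pair \<Omega> (Fn n) (b0 q l)" if l: "l < d q" for n l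
 proof -
  note r = bounded_support_has_rot0[OF \<Omega> B0(2)[OF l] ker_R0D[OF \<Omega> B0(1)[OF l]], of "- t" "- t"]
  note bL = has_rot0_L2w(1)[OF r]
  have "ip (lebesgue_on \<Omega>) v (Y n) = 0" if "has_rot0 \<Omega> q (- t) (- t) v (\<lambda>x. 0)" for v
   using has_rot0_pair[OF \<Omega> that dH] HL YL by (simp add: ip_def)
  from this[OF r] this[OF has_rot0_smult[OF \<Omega> r, of \<i>, simplified]]
  have "L2_pair \<Omega> (Y n) (b0 q l) = 0" unfolding L2_pair_w[OF YL bL] by (simp add: ip_commute[of _ "Y n"] complex_eq_iff)
  then have "L2_pair \<Omega> (\<lambda>x. ?k n *s (Fn n x - Y n x)) (b0 q l) = ?k n * L2_pair \<Omega> (Fn n) (b0 q l)"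
   unfolding L2_pair_smult L2_pair_diff[OF L2w_mono[OF ts(1) FL] YL bL] by simp
  then show ?thesis unfolding eY .
 qed
 \<comment> \<open>Dually, \<open>X n\<close> is the rotation of a limit of test forms, and
   \<open>b (q + 1) l\<close> is divergence-free.\<close>
 have pH: "L2_pair \<Omega> (app \<mu> (Hn n)) (b (q + 1) l) = ?k n * L2_pair \<Omega> (Gn n) (b (q + 1) l)" if l: "l < d (q + 1)" for n l
 proof -
  have bD: "b (q + 1) l \<in> L2w \<Omega> (q + 1) 0" "has_div \<Omega> (q + 1) (b (q + 1) l) (\<lambda>x. 0)" using B(1)[OF l] by (auto simp: ker_D_def div_space_def)
  note bL = bounded_support_L2w[OF B(2)[OF l] bD(1), of "- t"]
  have "ip (lebesgue_on \<Omega>) (X n) v = 0" if "has_div \<Omega> (q + 1) v (\<lambda>x. 0)" "v \<in> L2w \<Omega> (q + 1) (- t)" for v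
   using has_rot0_pair[OF \<Omega> rE that L2w_zero] by (simp add: ip_def)
  from this[OF bD(2) bL] this[OF has_div_smult[OF \<Omega> bD(2), of \<i>, simplified] L2w_smult[OF bL]]
  have "L2_pair \<Omega> (X n) (b (q + 1) l) = 0" unfolding L2_pair_w[OF XL bL] by (simp add: complex_eq_iff)
  then have "L2_pair \<Omega> (\<lambda>x. ?k n *s (Gn n x - X n x)) (b (q + 1) l) = ?k n * L2_pair \<Omega> (Gn n) (b (q + 1) l)"
   unfolding L2_pair_smult L2_pair_diff[OF L2w_mono[OF ts(1) GL] XL bL] by simp
  then show ?thesis unfolding eX .
 qed
 have g2: "g \<in> L2w \<Omega> (q + 1 + 1) s" using g(1) by (simp add: add.commute)
 have lU: "(\<lambda>n. L2w_norm \<Omega> s (\<lambda>x. U n x - f x)) \<longlonglongrightarrow> 0" and lV: "(\<lambda>n. L2w_norm \<Omega> s (\<lambda>x. V n x - g x)) \<longlonglongrightarrow> 0"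
  unfolding U_def V_def by (rule f(2) g(2))+
 obtain K1 K2 K3 K4 where K: "\<And>n. L2w_norm \<Omega> s (Fn n) \<le> K1" "\<And>n. L2w_norm \<Omega> s (Gn n) \<le> K2" "\<And>n. L2w_norm \<Omega> s (U n) \<le> K3" "\<And>n. L2w_norm \<Omega> s (V n) \<le> K4"
  using L2w_norm_bounded[OF FL F] L2w_norm_bounded[OF GL G] L2w_norm_bounded[OF UL f(1) lU] L2w_norm_bounded[OF VL g2 lV] by auto
 \<comment> \<open>Convergence of the scaled pairings bounds the corresponding quotients by the
   modulus of the frequency in the a priori estimate.\<close>
 have bs: "\<exists>K. \<forall>n. (\<Sum>l<m. cmod (a n l)) / cmod (\<omega> n) \<le> K" if "\<And>l. l < m \<Longrightarrow> (\<lambda>n. ?k n * a n l) \<longlonglongrightarrow> z l" for m and a :: "nat \<Rightarrow> nat \<Rightarrow> complex" and z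
 proof -
  have "(\<lambda>n. \<Sum>l<m. cmod (?k n * a n l)) \<longlonglongrightarrow> (\<Sum>l<m. cmod (z l))" by (intro tendsto_sum tendsto_norm that) simp
  from convergent_imp_Bseq[OF convergentI[OF this]] obtain K where "\<And>n. norm (\<Sum>l<m. cmod (?k n * a n l)) \<le> K" by (auto simp: Bseq_def)
  moreover have "(\<Sum>l<m. cmod (?k n * a n l)) = (\<Sum>l<m. cmod (a n l)) / cmod (\<omega> n)" for n
   by (simp add: norm_mult norm_divide sum_divide_distrib)
  ultimately have "(\<Sum>l<m. cmod (a n l)) / cmod (\<omega> n) \<le> K" for n using abs_le_D1 unfolding real_norm_def by metis
  then show ?thesis by blast
 qed
 obtain K5 where K5: "\<And>n. (\<Sum>l<d q. cmod (L2_pair \<Omega> (Fn n) (b0 q l))) / cmod (\<omega> n) \<le> K5"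
  using bs[where a="\<lambda>n l. L2_pair \<Omega> (Fn n) (b0 q l)" and z=\<zeta>, OF \<zeta>] by auto
 obtain K6 where K6: "\<And>n. (\<Sum>l<d (q + 1). cmod (L2_pair \<Omega> (Gn n) (b (q + 1) l))) / cmod (\<omega> n) \<le> K6"
  using bs[where a="\<lambda>n l. L2_pair \<Omega> (Gn n) (b (q + 1) l)" and z=\<xi>, OF \<xi>] by auto
 define C where "C = c * (K1 + K2 + (K3 + K4) + K5 + K6)"
 have sn: "sol_norm \<Omega> q \<epsilon> \<mu> t (En n) (Hn n) \<le> C" for n
 proof -
  have "(L2w_norm \<Omega> s (wdiv \<Omega> q (Fn n)) + L2w_norm \<Omega> s (wrot \<Omega> (q + 1) (Gn n))) / cmod (\<omega> n) = L2w_norm \<Omega> s (U n) + L2w_norm \<Omega> s (V n)"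
   unfolding U_def[abs_def] V_def[abs_def] L2w_norm_smult kn by (simp add: add_divide_distrib)
  then show ?thesis unfolding C_def using K(1,2)[of n] K(3,4)[of n] K5[of n] K6[of n] c
   by (intro order_trans[OF conjunct2[OF bound]] mult_left_mono add_mono) auto
 qed
 have parts: "L2w_norm \<Omega> t (En n) \<le> C" "L2w_norm \<Omega> t (X n) \<le> C" "L2w_norm \<Omega> t (app \<epsilon> (En n)) \<le> C" "L2w_norm \<Omega> t (U n) \<le> C"
  "L2w_norm \<Omega> t (app \<mu> (Hn n)) \<le> C" "L2w_norm \<Omega> t (V n) \<le> C" "L2w_norm \<Omega> t (Hn n) \<le> C" "L2w_norm \<Omega> t (Y n) \<le> C" for n
 proof -
  have YL': "Y n \<in> L2w \<Omega> (q + 1 - 1) t" using YL by simp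
  note e = rot_norm_eq(1)[OF \<Omega> has_rot0_has_rot[OF \<Omega> rE[of n]] XL[of n], of t] div_norm_eq(1)[OF \<Omega> dE[of n] L2w_mono[OF ts(1) UL[of n]], of t]
   rot_norm_eq(1)[OF \<Omega> has_rot0_has_rot[OF \<Omega> rH[of n]] L2w_mono[OF ts(1) VL[of n]], of t] div_norm_eq(1)[OF \<Omega> dH[of n] YL', of t]
  have p: "0 \<le> rot_norm \<Omega> q t t (En n)" "0 \<le> div_norm \<Omega> q t t (app \<epsilon> (En n))"
   "0 \<le> rot_norm \<Omega> (q + 1) t t (app \<mu> (Hn n))" "0 \<le> div_norm \<Omega> (q + 1) t t (Hn n)"
   by (simp_all add: rot_norm_def div_norm_def)
  have le: "rot_norm \<Omega> q t t (En n) \<le> C" "div_norm \<Omega> q t t (app \<epsilon> (En n)) \<le> C"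
   "rot_norm \<Omega> (q + 1) t t (app \<mu> (Hn n)) \<le> C" "div_norm \<Omega> (q + 1) t t (Hn n) \<le> C"
   using sn[of n] p unfolding sol_norm_def by linarith+
  show "L2w_norm \<Omega> t (En n) \<le> C" "L2w_norm \<Omega> t (X n) \<le> C" "L2w_norm \<Omega> t (app \<epsilon> (En n)) \<le> C" "L2w_norm \<Omega> t (U n) \<le> C"
   "L2w_norm \<Omega> t (app \<mu> (Hn n)) \<le> C" "L2w_norm \<Omega> t (V n) \<le> C" "L2w_norm \<Omega> t (Hn n) \<le> C" "L2w_norm \<Omega> t (Y n) \<le> C"
   using sqrt_sum_sq_le[OF le(1)[unfolded e(1)]] sqrt_sum_sq_le[OF le(2)[unfolded e(2)]]
    sqrt_sum_sq_le[OF le(3)[unfolded e(3)]] sqrt_sum_sq_le[OF le(4)[unfolded e(4)]] by auto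
 qed
 \<comment> \<open>The second term is \<open>\<omega> n\<close> times a bounded sequence; this is
   where the frequencies tending to 0 enter.\<close>
 have lXY: "(\<lambda>n. L2w_norm \<Omega> t (\<lambda>x. (P n x - (\<i> * \<omega> n) *s Q n x) - p x)) \<longlonglongrightarrow> 0"
  if "\<And>n. P n \<in> L2w \<Omega> m s" "\<And>n. Q n \<in> L2w \<Omega> m t" "p \<in> L2w \<Omega> m s" "(\<lambda>n. L2w_norm \<Omega> s (\<lambda>x. P n x - p x)) \<longlonglongrightarrow> 0" "\<And>n. L2w_norm \<Omega> t (Q n) \<le> C"
  for P Q p m
 proof (rule Lim_null_comparison[OF always_eventually[OF allI]])
  have w: "(\<lambda>n. cmod (\<omega> n) * C) \<longlonglongrightarrow> 0" using tendsto_mult_left_zero[OF tendsto_norm_zero[OF \<omega>(2)]] .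
  show "(\<lambda>n. L2w_norm \<Omega> s (\<lambda>x. P n x - p x) + cmod (\<omega> n) * C) \<longlonglongrightarrow> 0" using tendsto_add[OF that(4) w] by simp
  fix n
  note d = L2w_diff[OF that(1)[of n] that(3)]
  have "L2w_norm \<Omega> t (\<lambda>x. (P n x - p x) - (\<i> * \<omega> n) *s Q n x) \<le> L2w_norm \<Omega> t (\<lambda>x. P n x - p x) + L2w_norm \<Omega> t (\<lambda>x. (\<i> * \<omega> n) *s Q n x)"
   by (rule L2w_norm_diff[OF L2w_mono[OF ts(1) d] L2w_smult[OF that(2)]])
  also have "\<dots> \<le> L2w_norm \<Omega> s (\<lambda>x. P n x - p x) + cmod (\<omega> n) * C"
   unfolding L2w_norm_smult using mult_left_mono[OF that(5)[of n] norm_ge_zero[of "\<omega> n"]]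
   by (intro add_mono L2w_norm_mono[OF ts(1) d]) (simp add: norm_mult)
  finally show "norm (L2w_norm \<Omega> t (\<lambda>x. (P n x - (\<i> * \<omega> n) *s Q n x) - p x)) \<le> L2w_norm \<Omega> s (\<lambda>x. P n x - p x) + cmod (\<omega> n) * C"
   by (simp add: algebra_simps)
 qed
 interpret S: static_limit \<Omega> q \<epsilon> \<mu> r0 \<tau> t C d b0 b En Hn X Y U V f F G g \<zeta> \<xi>
 proof
  show "L2w_norm \<Omega> t (En n) \<le> C" "L2w_norm \<Omega> t (X n) \<le> C" "L2w_norm \<Omega> t (U n) \<le> C" "L2w_norm \<Omega> t (V n) \<le> C" "L2w_norm \<Omega> t (Hn n) \<le> C" "L2w_norm \<Omega> t (Y n) \<le> C" for n
   by (rule parts)+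
  show "U n \<in> L2w \<Omega> (q - 1) t" for n by (rule L2w_mono[OF ts(1) UL])
  show "G \<in> L2w \<Omega> (q + 1) t" "f \<in> L2w \<Omega> (q - 1) t" "F \<in> L2w \<Omega> q t" "g \<in> L2w \<Omega> (q + 1 + 1) t"
   by (rule L2w_mono[OF ts(1)], fact)+
  show "(\<lambda>n. L2w_norm \<Omega> t (\<lambda>x. X n x - G x)) \<longlonglongrightarrow> 0" unfolding X_def by (rule lXY[OF GL mHL G parts(5)])
  show "(\<lambda>n. L2w_norm \<Omega> t (\<lambda>x. Y n x - F x)) \<longlonglongrightarrow> 0" unfolding Y_def by (rule lXY[OF FL eEL F parts(3)])
  show "(\<lambda>n. L2w_norm \<Omega> t (\<lambda>x. U n x - f x)) \<longlonglongrightarrow> 0" by (rule L2w_norm_tendsto_mono[OF L2w_diff[OF UL f(1)] ts(1) lU])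
  show "(\<lambda>n. L2w_norm \<Omega> t (\<lambda>x. V n x - g x)) \<longlonglongrightarrow> 0" by (rule L2w_norm_tendsto_mono[OF L2w_diff[OF VL g2] ts(1) lV])
  show "(\<lambda>n. L2_pair \<Omega> (app \<epsilon> (En n)) (b0 q l)) \<longlonglongrightarrow> \<zeta> l" if "l < d q" for l unfolding pE[OF that] by (rule \<zeta>[OF that])
  show "(\<lambda>n. L2_pair \<Omega> (app \<mu> (Hn n)) (b (q + 1) k)) \<longlonglongrightarrow> \<xi> k" if "k < d (q + 1)" for k unfolding pH[OF that] by (rule \<xi>[OF that])
 qed (fact N q \<Omega> \<Omega>B assms(6) SMP \<tau>0(2) a1 a2 ts(2) rE dE rH dH YL HL)+
 show ?thesis by (rule S.convergence)
qed

end
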